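(* Assume the legislative body acts according to the policy $\overline\eta\equiv0$. Let $\delta_2$ be the negative root of $\frac12\sigma^2\delta(\delta-1)+(r-g)\delta-\rho=0$ and set $$\overline D_1(a):=-\frac{1}{(\rho-2(r-g)-\sigma^2)\,\delta_2(\delta_2-1)\,a^{\delta_2-2}},\qquad \overline a:=\frac{(1-\delta_2)c_2(\rho-2(r-g)-\sigma^2)}{2-\delta_2}.$$ Then the value function $$\overline V_1(x):=\inf_{\xi\in\mathcal A_{\overline\eta}}\mathsf E_x\Big[\int_0^\infty e^{-\rho t}\tfrac12(X_t^{\xi,\overline\eta})^2dt-c_2\int_0^\infty e^{-\rho t}X_t^{\xi,\overline\eta}\circ_u d\xi_t\Big],\qquad x>0,$$ is given by $$\overline V_1(x)=\begin{cases}\overline V_1(\overline a)-c_2(\overline a-x),&0<x\le\overline a,\\[1mm]\overline D_1(\overline a)x^{\delta_2}+\dfrac{x^2}{2(\rho-2(r-g)-\sigma^2)},&x>\overline a,\end{cases}$$ (with $\overline V_1(\overline a)$ given by the value of the second expression at $x=\overline a$). Moreover, the policy $\xi^{\overline a}$ reflecting the debt ratio upwards at $\overline a$ is admissible and optimal for $\overline V_1(x)$.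
   Context: Model. $(\Omega,\mathcal F,\mathsf P)$ is a complete probability space carrying a standard one-dimensional Brownian motion $W$, with $\mathbb F$ the $\mathsf P$-augmented filtration of $W$. Parameters: $r,g\in\mathbb R$, $\sigma,\rho,\lambda,c_1,c_2,\alpha,\kappa,m>0$, with standing assumptions $c_1>c_2$, $\rho>(2(r-g)+\sigma^2)^+$, $\lambda>r-g$. Controls. $\mathcal U$ is the set of $\mathbb F$-adapted, nondecreasing, càdlàg processes $\upsilon\ge0$ with $\upsilon_{0-}=0$. For $(\xi,\eta)\in\mathcal U\times\mathcal U$ and $x>0$: $X^{\xi,\eta}_{0-}=x$, $X_t^{\xi,\eta}=x\exp\big((r-g-\frac12\sigma^2)t+\sigma W_t+\xi_t-\eta_t\big)$, $t\ge0$; $\mathsf E_x,\mathsf P_x$ indicate the starting value $x$. With $\xi^c,\eta^c$ the continuous parts and $\Delta$ denoting jumps, $$X_t^{\xi,\eta}\circ_u d\xi_t=X_t^{\xi,\eta}d\xi^c_t+X_{t-}^{\xi,\eta}(e^{\Delta\xi_t}-1),\qquad X_t^{\xi,\eta}\circ_d d\eta_t=X_t^{\xi,\eta}d\eta^c_t+X_{t-}^{\xi,\eta}(1-e^{-\Delta\eta_t}),$$ where integrals include sums over all jump times, including a jump at time $0$. Admissibility. $\mathcal A$ is the set of $(\xi,\eta)\in\mathcal U\times\mathcal U$ such that $\mathsf E_x[\int_0^\infty e^{-\rho t}\frac12(X^{\xi,\eta}_t)^2dt+c_1\int_0^\infty e^{-\rho t}X^{\xi,\eta}_t\circ_d d\eta_t+c_2\int_0^\infty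 e^{-\rho t}X^{\xi,\eta}_t\circ_u d\xi_t]<\infty$, $\mathsf E_x[\int_0^\infty e^{-\lambda t}\alpha(X^{\xi,\eta}_t-m)^+dt+\kappa\int_0^\infty e^{-\lambda t}X^{\xi,\eta}_t\circ_d d\eta_t]<\infty$, and $\mathsf P_x(\Delta\xi_t\cdot\Delta\eta_t>0)=0$ for all $t\ge0$, $x>0$. $\mathcal A_\eta=\{\xi\in\mathcal U:(\xi,\eta)\in\mathcal A\}$. Reflection policy. For $a>0$, $\xi^a_t=(\ln(a/x))^++\xi_t(a)$, $t\ge0$ ($\xi^a_{0-}=0$), where $\xi(a)$ is the unique $\xi\in\mathcal A_{\overline\eta}$ such that, for the process $X^{\xi,\overline\eta}$ started at $x\vee a$, a.s. $X^{\xi,\overline\eta}_t\ge a$ for $t>0$ and $\int_0^T\mathbf 1_{\{X^{\xi,\overline\eta}_t>a\}}d\xi_t=0$ for all $T>0$. *)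

theory Defs
  imports "HOL-Probability.Probability"
begin

text \<open>
  A process is a function \<open>real \<Rightarrow> 'a \<Rightarrow> real\<close> (time, then scenario); only times \<open>t \<ge> 0\<close> are
  relevant, and values at negative times are never used. The discount rate usually called lambda
  is named \<open>lam\<close>.
\<close>

type_synonym 'a process = "real \<Rightarrow> 'a \<Rightarrow> real"

subsection \<open>Brownian motion and its augmented filtration\<close>

definition brownian_motion :: "'a measure \<Rightarrow> 'a process \<Rightarrow> bool" where
  "brownian_motion M W \<longleftrightarrow>
     (\<forall>t\<ge>0. W t \<in> borel_measurable M) \<and>
     (AE \<omega> in M. W 0 \<omega> = 0) \<and>
     (\<forall>s t. 0 \<le> s \<and> s < t \<longrightarrow>
        distributed M lborel (\<lambda>\<omega>. W t \<omega> - W s \<omega>) (normal_density 0 (sqrt (t - s)))) \<and>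
     (\<forall>(n::nat) \<tau>. 0 \<le> \<tau> 0 \<and> (\<forall>i<n. \<tau> i \<le> \<tau> (Suc i)) \<longrightarrow>
        prob_space.indep_vars M (\<lambda>_. borel) (\<lambda>i \<omega>. W (\<tau> (Suc i)) \<omega> - W (\<tau> i) \<omega>) {..<n}) \<and>
     (AE \<omega> in M. continuous_on {0..} (\<lambda>t. W t \<omega>))"

definition augmented_filtration :: "'a measure \<Rightarrow> 'a process \<Rightarrow> real \<Rightarrow> 'a measure" where
  "augmented_filtration M W t =
     sigma (space M)
       ({W s -` B \<inter> space M | s B. 0 \<le> s \<and> s \<le> t \<and> B \<in> sets borel} \<union> null_sets M)"

subsection \<open>Controls and the debt ratio\<close>

definition cadlag :: "(real \<Rightarrow> real) \<Rightarrow> bool" where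
  "cadlag f \<longleftrightarrow>
     (\<forall>t\<ge>0. continuous (at_right t) f) \<and> (\<forall>t>0. \<exists>l. (f \<longlongrightarrow> l) (at_left t))"

definition controls :: "'a measure \<Rightarrow> 'a process \<Rightarrow> 'a process set" where
  "controls M W =
     {\<upsilon>. (\<forall>t\<ge>0. \<upsilon> t \<in> borel_measurable (augmented_filtration M W t)) \<and>
         (\<forall>\<omega>\<in>space M. (\<forall>t\<ge>0. 0 \<le> \<upsilon> t \<omega>) \<and> mono_on {0..} (\<lambda>t. \<upsilon> t \<omega>) \<and> cadlag (\<lambda>t. \<upsilon> t \<omega>))}"

definition debt_ratio ::
  "real \<Rightarrow> real \<Rightarrow> real \<Rightarrow> 'a process \<Rightarrow> real \<Rightarrow> 'a process \<Rightarrow> 'a process \<Rightarrow> 'a process" where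
  "debt_ratio r g \<sigma> W x \<xi> \<eta> t \<omega> =
     x * exp ((r - g - \<sigma>\<^sup>2 / 2) * t + \<sigma> * W t \<omega> + \<xi> t \<omega> - \<eta> t \<omega>)"

subsection \<open>Pathwise integrals against controls\<close>

text \<open>The value \<open>v\<close> is the one prescribed at \<open>0-\<close>: it is \<open>0\<close> for a control and the starting
  point for the debt ratio.\<close>

definition left_lim :: "real \<Rightarrow> (real \<Rightarrow> real) \<Rightarrow> real \<Rightarrow> real" where
  "left_lim v f t = (if t = 0 then v else Lim (at_left t) f)"

definition jump :: "(real \<Rightarrow> real) \<Rightarrow> real \<Rightarrow> real" where
  "jump f t = f t - left_lim 0 f t"

definition cont_part :: "(real \<Rightarrow> real) \<Rightarrow> real \<Rightarrow> real" where
  "cont_part f t = f t - (\<Sum>\<^sub>\<infinity>s\<in>{0..t}. jump f s)"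

text \<open>Extending the path by \<open>0\<close> to the left gives the measure an atom of mass \<open>f 0\<close> at time
  \<open>0\<close>, i.e. the jump from \<open>f\<close> at \<open>0-\<close>.\<close>

definition control_measure :: "(real \<Rightarrow> real) \<Rightarrow> real measure" where
  "control_measure f = interval_measure (\<lambda>t. if t < 0 then 0 else f t)"

text \<open>Integrals over \<open>[0,\<infinity>)\<close> of \<open>exp (- q * t)\<close> against \<open>X \<circ>\<^sub>u d\<xi>\<close> and \<open>X \<circ>\<^sub>d d\<eta>\<close>, for a path
  \<open>X\<close> with value \<open>x\<close> at \<open>0-\<close>; the integral over the counting measure is the sum over all jump
  times.\<close>

definition up_integral ::
  "real \<Rightarrow> real \<Rightarrow> (real \<Rightarrow> real) \<Rightarrow> (real \<Rightarrow> real) \<Rightarrow> ennreal" where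
  "up_integral q x X f =
     (\<integral>\<^sup>+t\<in>{0..}. ennreal (exp (- q * t) * X t) \<partial>control_measure (cont_part f)) +
     (\<integral>\<^sup>+t. ennreal (exp (- q * t) * (left_lim x X t * (exp (jump f t) - 1))) \<partial>count_space {0..})"

definition down_integral ::
  "real \<Rightarrow> real \<Rightarrow> (real \<Rightarrow> real) \<Rightarrow> (real \<Rightarrow> real) \<Rightarrow> ennreal" where
  "down_integral q x X f =
     (\<integral>\<^sup>+t\<in>{0..}. ennreal (exp (- q * t) * X t) \<partial>control_measure (cont_part f)) +
     (\<integral>\<^sup>+t. ennreal (exp (- q * t) * (left_lim x X t * (1 - exp (- jump f t)))) \<partial>count_space {0..})"

definition running_integral :: "real \<Rightarrow> (real \<Rightarrow> real) \<Rightarrow> (real \<Rightarrow> real) \<Rightarrow> ennreal" where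
  "running_integral q h X = (\<integral>\<^sup>+t\<in>{0..}. ennreal (exp (- q * t) * h (X t)) \<partial>lborel)"

subsection \<open>Admissibility\<close>

definition admissible ::
  "'a measure \<Rightarrow> 'a process \<Rightarrow> real \<Rightarrow> real \<Rightarrow> real \<Rightarrow> real \<Rightarrow> real \<Rightarrow> real \<Rightarrow> real \<Rightarrow> real \<Rightarrow> real \<Rightarrow> real \<Rightarrow>
   ('a process \<times> 'a process) set" where
  "admissible M W r g \<sigma> \<rho> lam c1 c2 \<alpha> \<kappa> m =
     {(\<xi>, \<eta>). \<xi> \<in> controls M W \<and> \<eta> \<in> controls M W \<and>
        (\<forall>x>0.
           (\<integral>\<^sup>+\<omega>. (let X = (\<lambda>t. debt_ratio r g \<sigma> W x \<xi> \<eta> t \<omega>) in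
               running_integral \<rho> (\<lambda>y. 1 / 2 * y\<^sup>2) X
               + ennreal c1 * down_integral \<rho> x X (\<lambda>t. \<eta> t \<omega>)
               + ennreal c2 * up_integral \<rho> x X (\<lambda>t. \<xi> t \<omega>)) \<partial>M) < \<infinity> \<and>
           (\<integral>\<^sup>+\<omega>. (let X = (\<lambda>t. debt_ratio r g \<sigma> W x \<xi> \<eta> t \<omega>) in
               running_integral lam (\<lambda>y. \<alpha> * max 0 (y - m)) X
               + ennreal \<kappa> * down_integral lam x X (\<lambda>t. \<eta> t \<omega>)) \<partial>M) < \<infinity>) \<and>
        (\<forall>t\<ge>0. AE \<omega> in M. \<not> jump (\<lambda>s. \<xi> s \<omega>) t * jump (\<lambda>s. \<eta> s \<omega>) t > 0)}"

definition admissible_for ::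
  "'a measure \<Rightarrow> 'a process \<Rightarrow> real \<Rightarrow> real \<Rightarrow> real \<Rightarrow> real \<Rightarrow> real \<Rightarrow> real \<Rightarrow> real \<Rightarrow> real \<Rightarrow> real \<Rightarrow> real \<Rightarrow>
   'a process \<Rightarrow> 'a process set" where
  "admissible_for M W r g \<sigma> \<rho> lam c1 c2 \<alpha> \<kappa> m \<eta> =
     {\<xi> \<in> controls M W. (\<xi>, \<eta>) \<in> admissible M W r g \<sigma> \<rho> lam c1 c2 \<alpha> \<kappa> m}"

definition no_intervention :: "'a process" where
  "no_intervention t \<omega> = 0"

subsection \<open>The control problem without legislative intervention\<close>

text \<open>For admissible controls both path integrals are almost surely finite with finite
  expectation, so that \<open>enn2real\<close> loses nothing.\<close>

definition objective1 ::
  "'a measure \<Rightarrow> 'a process \<Rightarrow> real \<Rightarrow> real \<Rightarrow> real \<Rightarrow> real \<Rightarrow> real \<Rightarrow> real \<Rightarrow> 'a process \<Rightarrow> real" where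
  "objective1 M W r g \<sigma> \<rho> c2 x \<xi> =
     (\<integral>\<omega>. (let X = (\<lambda>t. debt_ratio r g \<sigma> W x \<xi> no_intervention t \<omega>) in
         enn2real (running_integral \<rho> (\<lambda>y. 1 / 2 * y\<^sup>2) X)
         - c2 * enn2real (up_integral \<rho> x X (\<lambda>t. \<xi> t \<omega>))) \<partial>M)"

text \<open>The infimum is taken in the extended reals, as \<open>Inf\<close> on the reals is unspecified for sets
  that are unbounded below.\<close>

definition value1 ::
  "'a measure \<Rightarrow> 'a process \<Rightarrow> real \<Rightarrow> real \<Rightarrow> real \<Rightarrow> real \<Rightarrow> real \<Rightarrow> real \<Rightarrow> real \<Rightarrow> real \<Rightarrow> real \<Rightarrow> real \<Rightarrow>
   real \<Rightarrow> ereal" where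
  "value1 M W r g \<sigma> \<rho> lam c1 c2 \<alpha> \<kappa> m x =
     (INF \<xi>\<in>admissible_for M W r g \<sigma> \<rho> lam c1 c2 \<alpha> \<kappa> m no_intervention.
        ereal (objective1 M W r g \<sigma> \<rho> c2 x \<xi>))"

subsection \<open>Reflection policies\<close>

definition reflects_at ::
  "'a measure \<Rightarrow> 'a process \<Rightarrow> real \<Rightarrow> real \<Rightarrow> real \<Rightarrow> real \<Rightarrow> real \<Rightarrow> real \<Rightarrow> real \<Rightarrow> real \<Rightarrow> real \<Rightarrow> real \<Rightarrow>
   real \<Rightarrow> real \<Rightarrow> 'a process \<Rightarrow> bool" where
  "reflects_at M W r g \<sigma> \<rho> lam c1 c2 \<alpha> \<kappa> m a x \<zeta> \<longleftrightarrow>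
     \<zeta> \<in> admissible_for M W r g \<sigma> \<rho> lam c1 c2 \<alpha> \<kappa> m no_intervention \<and>
     (AE \<omega> in M. let X = (\<lambda>t. debt_ratio r g \<sigma> W (max x a) \<zeta> no_intervention t \<omega>) in
        (\<forall>t>0. a \<le> X t) \<and>
        (\<forall>T>0. (\<integral>\<^sup>+t\<in>{0..T}. indicator {s. a < X s} t \<partial>control_measure (\<lambda>t. \<zeta> t \<omega>)) = 0))"

text \<open>Uniqueness of a process is up to indistinguishability.\<close>

definition is_reflection ::
  "'a measure \<Rightarrow> 'a process \<Rightarrow> real \<Rightarrow> real \<Rightarrow> real \<Rightarrow> real \<Rightarrow> real \<Rightarrow> real \<Rightarrow> real \<Rightarrow> real \<Rightarrow> real \<Rightarrow> real \<Rightarrow>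
   real \<Rightarrow> real \<Rightarrow> 'a process \<Rightarrow> bool" where
  "is_reflection M W r g \<sigma> \<rho> lam c1 c2 \<alpha> \<kappa> m a x \<zeta> \<longleftrightarrow>
     reflects_at M W r g \<sigma> \<rho> lam c1 c2 \<alpha> \<kappa> m a x \<zeta> \<and>
     (\<forall>\<zeta>'. reflects_at M W r g \<sigma> \<rho> lam c1 c2 \<alpha> \<kappa> m a x \<zeta>' \<longrightarrow>
        (AE \<omega> in M. \<forall>t\<ge>0. \<zeta>' t \<omega> = \<zeta> t \<omega>))"

definition reflection_policy :: "real \<Rightarrow> real \<Rightarrow> 'a process \<Rightarrow> 'a process" where
  "reflection_policy a x \<zeta> t \<omega> = max 0 (ln (a / x)) + \<zeta> t \<omega>"

subsection \<open>The explicit solution\<close>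

definition D1_bar :: "real \<Rightarrow> real \<Rightarrow> real \<Rightarrow> real \<Rightarrow> real \<Rightarrow> real \<Rightarrow> real" where
  "D1_bar r g \<sigma> \<rho> \<delta>2 a =
     - (1 / ((\<rho> - 2 * (r - g) - \<sigma>\<^sup>2) * \<delta>2 * (\<delta>2 - 1) * a powr (\<delta>2 - 2)))"

definition a_bar :: "real \<Rightarrow> real \<Rightarrow> real \<Rightarrow> real \<Rightarrow> real \<Rightarrow> real \<Rightarrow> real" where
  "a_bar r g \<sigma> \<rho> c2 \<delta>2 = (1 - \<delta>2) * c2 * (\<rho> - 2 * (r - g) - \<sigma>\<^sup>2) / (2 - \<delta>2)"

end

theory Submission
  imports Defs "HOL-Real_Asymp.Real_Asymp"
begin

text \<open>Let \<open>Y\<close> be the uncontrolled debt ratio started at the maximum of \<open>x\<close> and \<open>a\<close>,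
  and \<open>B\<close> the exponential of the running supremum that keeps \<open>Y * B\<close> above \<open>a\<close>. A policy
  multiplies the debt ratio by an increasing process, so up to a constant factor \<open>X = Y * A\<close>,
  and the chain rule at jumps turns the upward control integral into the discounted integral of \<open>Y\<close>
  against the Stieltjes measure of \<open>A\<close>. The objective is therefore convex in \<open>A\<close>.

  Powers of \<open>Y\<close> are exponential martingales up to a deterministic factor. Summation by parts over
  uniform partitions and dominated convergence, with Doob's inequality as the dominating bound, give the
  expectation of \<open>Y powr p * B powr s * A\<close> for every adapted bounded increasing \<open>A\<close>; no stochastic
  integral is needed. A combination of two exponents in which the \<open>B\<close>-integrals cancel shows that the
  expected discounted integral of \<open>(Y * B) * (Y * A)\<close> is the initial marginal value plus the integral
  of the marginal value of \<open>Y * B\<close> against the measure of \<open>A\<close>. The marginal value is at least \<open>c2\<close>,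
  with equality at \<open>a\<close>, where \<open>B\<close> increases. Together with \<open>2 u v \<le> u\<^sup>2 + v\<^sup>2\<close> this bounds every
  objective from below by the one of the reflected policy.\<close>

text \<open>The two exponents cancel because \<open>B\<close> grows only where
  \<open>Y * B = a\<close>: there the increment of \<open>B powr s\<close> is
  \<open>s * a powr (s - 1) * Y powr (1 - s)\<close> times that of \<open>B\<close>. For
  \<open>(p, s) = (d, d - 1)\<close> and for \<open>(2, 1)\<close> the weight
  \<open>Y powr (p + 1 - s)\<close> is \<open>Y\<^sup>2\<close>, so one linear combination removes
  the \<open>B\<close>-integral. The time integral of the first pair drops out by
  \<open>\<theta> d = \<rho>\<close>, that of the second keeps the factor
  \<open>\<theta> 2 - \<rho>\<close>, and what stands in front of the increments of \<open>A\<close>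
  is the marginal value. Two obstacles shape the proof. Dominated convergence wants \<open>A\<close>
  bounded, while admissibility bounds costs only in mean; hence the policy is truncated, and Fatou's
  lemma removes the truncation. The terminal term of the product rule has no evident limit; it is
  controlled through its finite time integral, along suitable late times. The second moment of the
  reflected process enters only through an upper bound. Inserted into the reflected objective, this
  bound yields the very number that bounds all objectives from below, so both estimates are
  equalities.\<close>

section \<open>The Stieltjes measure of an exponential path\<close>

text \<open>Continuous induction along \<open>f\<close>: to the right, \<open>D\<close> moves by a
  vanishing multiple of the increment of \<open>f\<close>, and from the left it is continuous, so
  \<open>\<bar>D t\<bar> \<le> e * (f t - f 0)\<close> spreads from 0 to \<open>T\<close> for every
  \<open>e > 0\<close>. This compares functions with jumps without derivatives.\<close>

lemma interval_induct_zero: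
  fixes D f :: "real \<Rightarrow> real"
  assumes mono: "mono_on {0..} f" and D0: "D 0 = 0"
    and right: "\<And>u e. 0 \<le> u \<Longrightarrow> 0 < e \<Longrightarrow> \<exists>d>0. \<forall>t. u < t \<and> t < u + d \<longrightarrow> \<bar>D t - D u\<bar> \<le> e * (f t - f u)"
    and left: "\<And>u e. 0 < u \<Longrightarrow> 0 < e \<Longrightarrow> \<exists>d>0. \<forall>s\<ge>0. u - d < s \<and> s < u \<longrightarrow> \<bar>D u - D s\<bar> \<le> e"
    and T: "0 \<le> T"
  shows "D T = 0"
proof -
  have main: "\<bar>D T\<bar> \<le> e * (f T - f 0)" if e: "0 < e" for e
  proof -
    define S where "S = {t\<in>{0..T}. \<bar>D t\<bar> \<le> e * (f t - f 0)}"
    have S0: "0 \<in> S" using T D0 by (simp add: S_def)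
    have bdd: "bdd_above S" by (rule bdd_aboveI[of _ T]) (simp add: S_def)
    define u where "u = Sup S"
    have u0: "0 \<le> u" unfolding u_def by (rule cSup_upper[OF S0 bdd])
    have uT: "u \<le> T" unfolding u_def by (rule cSup_least) (use S0 in \<open>auto simp: S_def\<close>)
    \<comment> \<open>The hypothesis on left neighbourhoods closes the set at its supremum; the one
      on right neighbourhoods then leads past the supremum unless it is \<open>T\<close>.\<close>
    have uS: "u \<in> S"
    proof (rule ccontr)
      assume nu: "u \<notin> S"
      then have upos: "0 < u" using S0 u0 by (cases "u = 0") auto
      have "\<bar>D u\<bar> \<le> e * (f u - f 0) + \<eta>" if \<eta>: "0 < \<eta>" for \<eta>
      proof -
        obtain d where d: "d > 0" "\<And>s. 0 \<le> s \<Longrightarrow> u - d < s \<Longrightarrow> s < u \<Longrightarrow> \<bar>D u - D s\<bar> \<le> \<eta>"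
          using left[OF upos \<eta>] by blast
        have "\<exists>s\<in>S. u - d < s"
          using less_cSup_iff[OF _ bdd, of "u - d"] S0 d(1) unfolding u_def by auto
        then obtain s where s: "s \<in> S" "u - d < s" by blast
        have "s \<le> u" unfolding u_def by (rule cSup_upper[OF s(1) bdd])
        then have su: "s < u" using s(1) nu by (cases "s = u") auto
        have "\<bar>D u - D s\<bar> \<le> \<eta>" using d(2)[of s] s su by (auto simp: S_def)
        moreover have "\<bar>D s\<bar> \<le> e * (f s - f 0)" using s by (auto simp: S_def)
        moreover have "f s \<le> f u" using su s mono by (auto simp: S_def mono_on_def)
        then have "e * (f s - f 0) \<le> e * (f u - f 0)" using e by simp
        ultimately show ?thesis by linarith
      qed
      then have "\<bar>D u\<bar> \<le> e * (f u - f 0)" by (rule field_le_epsilon)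
      then show False using nu u0 uT by (simp add: S_def)
    qed
    have "u = T"
    proof (rule ccontr)
      assume "u \<noteq> T"
      then have uT': "u < T" using uT by simp
      obtain d where d: "d > 0" "\<And>t. u < t \<Longrightarrow> t < u + d \<Longrightarrow> \<bar>D t - D u\<bar> \<le> e * (f t - f u)"
        using right[OF u0 e] by blast
      define t where "t = min T (u + d/2)"
      have t: "u < t" "t < u + d" "t \<le> T" using d(1) uT' by (auto simp: t_def)
      have "\<bar>D t - D u\<bar> \<le> e * (f t - f u)" using d(2) t by simp
      moreover have "\<bar>D u\<bar> \<le> e * (f u - f 0)" using uS by (simp add: S_def)
      ultimately have "\<bar>D t\<bar> \<le> e * (f t - f 0)" unfolding right_diff_distrib by linarith
      then have "t \<in> S" using t u0 by (simp add: S_def)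
      then have "t \<le> u" unfolding u_def by (rule cSup_upper[OF _ bdd])
      then show False using t by simp
    qed
    then show ?thesis using uS by (simp add: S_def)
  qed
  define c where "c = f T - f 0"
  have c: "0 \<le> c" using mono T by (auto simp: c_def mono_on_def)
  have "\<bar>D T\<bar> \<le> 0 + \<eta>" if "0 < \<eta>" for \<eta>
  proof -
    \<comment> \<open>The denominator is \<open>c + 1\<close> because \<open>c\<close> vanishes when
      \<open>f\<close> is constant.\<close>
    have "\<bar>D T\<bar> \<le> \<eta> / (c + 1) * c" using main[of "\<eta> / (c+1)"] that c by (simp add: c_def)
    also have "\<dots> \<le> \<eta>" using c that by (simp add: field_simps)
    finally show ?thesis by simp
  qed
  then have "\<bar>D T\<bar> \<le> 0" by (rule field_le_epsilon)
  then show ?thesis by simp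
qed

lemma measure_eq_if_eq_Ioc:
  fixes N N' :: "real measure" and F :: "real \<Rightarrow> real"
  assumes sets: "sets N = sets borel" "sets N' = sets borel"
    and N: "\<And>a b. a \<le> b \<Longrightarrow> emeasure N {a<..b} = ennreal (F b - F a)"
    and N': "\<And>a b. a \<le> b \<Longrightarrow> emeasure N' {a<..b} = ennreal (F b - F a)"
  shows "N = N'"
proof (rule measure_eqI_generator_eq[where \<Omega>=UNIV and E="range (\<lambda>(a, b). {a<..b})" and A="\<lambda>i::nat. {- real i<..real i}"])
  show "Int_stable (range (\<lambda>(a, b). {a<..b::real}))"
  proof (rule Int_stableI)
    fix X Y assume "X \<in> range (\<lambda>(a, b). {a<..b::real})" "Y \<in> range (\<lambda>(a, b). {a<..b::real})"
    then obtain a b c d where "X = {a<..b}" "Y = {c<..d}" by auto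
    then have "X \<inter> Y = (\<lambda>(a, b). {a<..b}) (max a c, min b d)" by auto
    then show "X \<inter> Y \<in> range (\<lambda>(a, b). {a<..b})" by blast
  qed
  show "emeasure N X = emeasure N' X" if X_in: "X \<in> range (\<lambda>(a, b). {a<..b})" for X
  proof -
    obtain p where "X = (\<lambda>(a, b). {a<..b}) p" using X_in by blast
    then obtain a b where X: "X = {a<..b}" by (cases p) simp
    show ?thesis by (cases "a \<le> b") (auto simp: X N N')
  qed
  show "(\<Union>i. {- real i<..real i}) = UNIV"
  proof (intro equalityI subsetI UNIV_I)
    fix x :: real
    obtain n where "\<bar>x\<bar> < real n" using reals_Archimedean2 by blast
    then show "x \<in> (\<Union>i. {- real i<..real i})" by (intro UN_I[of n]) auto
  qed
qed (auto simp: sets borel_sigma_sets_Ioc N)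

locale control_path =
  fixes f :: "real \<Rightarrow> real"
  assumes f_nonneg: "\<And>t. 0 \<le> t \<Longrightarrow> 0 \<le> f t"
    and f_mono: "mono_on {0..} f"
    and f_cadlag: "cadlag f"
begin

definition F where "F t = (if t < 0 then 0 else f t)"

lemma control_measure_eq: "control_measure f = interval_measure F"
  unfolding control_measure_def F_def ..

lemma f_le: "0 \<le> s \<Longrightarrow> s \<le> t \<Longrightarrow> f s \<le> f t"
  using f_mono by (auto simp: mono_on_def)

lemma F_mono: "s \<le> t \<Longrightarrow> F s \<le> F t"
  by (auto simp: F_def f_nonneg f_le)

lemma f_right: "0 \<le> t \<Longrightarrow> (f \<longlongrightarrow> f t) (at_right t)"
  using f_cadlag by (auto simp: cadlag_def continuous_within)

lemma F_right: "continuous (at_right t) F"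
proof (cases "t < 0")
  case True
  have "eventually (\<lambda>s. F s = 0) (at_right t)"
    using True by (auto simp: eventually_at_right F_def intro!: exI[of _ 0])
  then show ?thesis using True
    by (auto simp: continuous_within F_def intro!: tendsto_eventually)
next
  case False
  then have "eventually (\<lambda>s. f s = F s) (at_right t)"
    by (intro eventually_at_rightI[of t "t+1"]) (auto simp: F_def)
  then show ?thesis using False f_right[of t]
    by (auto simp: continuous_within F_def intro: Lim_transform_eventually)
qed

abbreviation "\<mu> \<equiv> interval_measure F"

lemma emeasure_Ioc: "a \<le> b \<Longrightarrow> emeasure \<mu> {a<..b} = ennreal (F b - F a)"
  by (rule emeasure_interval_measure_Ioc[OF _ F_mono F_right])

lemma emeasure_Icc0: "0 \<le> b \<Longrightarrow> emeasure \<mu> {0..b} = ennreal (f b)"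
proof -
  assume b: "0 \<le> b"
  have "emeasure \<mu> {-1<..<0} \<le> 0"
  proof -
    \<comment> \<open>The open interval is exhausted by half-open ones, on which the mass is an
      increment of \<open>F\<close>.\<close>
    have "{-1<..<0::real} = (\<Union>n. {-1<..- 1 / real (Suc n)})"
    proof (intro equalityI subsetI)
      fix x :: real assume x: "x \<in> {-1<..<0}"
      then obtain n where "1 / real (Suc n) < - x" using nat_approx_posE[of "-x"] by auto
      then show "x \<in> (\<Union>n. {-1<..- 1 / real (Suc n)})" using x by (intro UN_I[of n]) auto
    next
      fix x :: real assume "x \<in> (\<Union>n. {-1<..- 1 / real (Suc n)})"
      then obtain n where "-1 < x" "x \<le> - 1 / real (Suc n)" by auto
      moreover have "- 1 / real (Suc n) < 0" by (rule divide_neg_pos) auto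
      ultimately have "-1 < x" "x < 0" by linarith+
      then show "x \<in> {-1<..<0}" by simp
    qed
    moreover have "emeasure \<mu> {-1<..- 1 / real (Suc n)} = 0" for n
      by (subst emeasure_Ioc) (auto simp: F_def field_simps)
    then have "(\<Union>n. {-1<..- 1 / real (Suc n)}) \<in> null_sets \<mu>"
      by (intro null_sets_UN) (auto simp: null_sets_def)
    ultimately show ?thesis by (auto simp: null_sets_def)
  qed
  moreover have "emeasure \<mu> {-1<..b} = emeasure \<mu> {-1<..<0} + emeasure \<mu> {0..b}"
    using b by (subst plus_emeasure) (auto intro!: arg_cong[where f="emeasure \<mu>"])
  moreover have "emeasure \<mu> {-1<..b} = ennreal (f b)"
    using b by (subst emeasure_Ioc) (auto simp: F_def)
  ultimately show ?thesis by simp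
qed

lemma left_lim_tendsto: "0 < t \<Longrightarrow> (f \<longlongrightarrow> left_lim 0 f t) (at_left t)"
  using f_cadlag unfolding cadlag_def left_lim_def
  by (auto intro: tendsto_Lim simp: trivial_limit_at_left_real dest!: spec[of _ t])
     (metis tendsto_Lim trivial_limit_at_left_real)

lemma left_lim_ge: "0 \<le> s \<Longrightarrow> s < t \<Longrightarrow> f s \<le> left_lim 0 f t"
  by (rule tendsto_lowerbound[OF left_lim_tendsto])
     (auto simp: eventually_at_left trivial_limit_at_left_real intro!: exI[of _ s] f_le)

lemma left_lim_le: "0 \<le> t \<Longrightarrow> left_lim 0 f t \<le> f t"
proof (cases "t = 0")
  case True then show ?thesis using f_nonneg by (simp add: left_lim_def)
next
  case False
  assume "0 \<le> t" then have t: "0 < t" using False by simp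
  show ?thesis
    by (rule tendsto_upperbound[OF left_lim_tendsto[OF t]])
       (use t in \<open>auto simp: eventually_at_left trivial_limit_at_left_real intro!: exI[of _ 0] f_le\<close>)
qed

lemma left_lim_nonneg: "0 \<le> t \<Longrightarrow> 0 \<le> left_lim 0 f t"
  using left_lim_ge[of 0 t] f_nonneg[of 0] by (cases "t = 0") (auto simp: left_lim_def)

lemma jump_nonneg: "0 \<le> t \<Longrightarrow> 0 \<le> jump f t"
  using left_lim_le by (simp add: jump_def)

lemma emeasure_singleton: "0 \<le> t \<Longrightarrow> emeasure \<mu> {t} = ennreal (jump f t)"
proof (cases "t = 0")
  case True
  then show ?thesis using emeasure_Icc0[of 0] by (simp add: jump_def left_lim_def)
next
  case False
  assume "0 \<le> t" then have t: "0 < t" using False by simp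
  define s where "s n = t - t / real (Suc n)" for n
  have s: "0 \<le> s n" "s n < t" for n
  proof -
    have "t / real (Suc n) \<le> t / 1" using t by (intro divide_left_mono) auto
    then show "0 \<le> s n" by (simp add: s_def)
    show "s n < t" using t by (simp add: s_def)
  qed
  have slim: "s \<longlonglongrightarrow> t"
  proof -
    have "(\<lambda>n. t - t * inverse (real (Suc n))) \<longlonglongrightarrow> t - t * 0"
      by (intro tendsto_intros LIMSEQ_inverse_real_of_nat)
    then show ?thesis by (simp add: s_def[abs_def] divide_inverse)
  qed
  have sdec: "t / real (Suc m) \<ge> t / real (Suc n)" if "m \<le> n" for m n
    using t that by (intro divide_left_mono) auto
  have "(\<lambda>n. emeasure \<mu> {s n<..t}) \<longlonglongrightarrow> emeasure \<mu> (\<Inter>n. {s n<..t})"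
  proof (rule Lim_emeasure_decseq)
    show "decseq (\<lambda>n. {s n<..t})" using sdec by (force simp: decseq_def s_def)
    show "emeasure \<mu> {s n<..t} \<noteq> \<infinity>" for n using s(2)[of n] by (simp add: emeasure_Ioc)
  qed auto
  moreover have "(\<Inter>n. {s n<..t}) = {t}"
  proof (intro equalityI subsetI)
    fix x assume "x \<in> (\<Inter>n. {s n<..t})"
    then have x: "\<And>n. s n < x" "x \<le> t" by auto
    have "t \<le> x" by (rule LIMSEQ_le_const2[OF slim]) (auto intro!: exI[of _ 0] less_imp_le x(1))
    then show "x \<in> {t}" using x by auto
  qed (use s in auto)
  moreover have "(\<lambda>n. emeasure \<mu> {s n<..t}) = (\<lambda>n. ennreal (f t - f (s n)))"
  proof
    fix n show "emeasure \<mu> {s n<..t} = ennreal (f t - f (s n))"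
      using s[of n] t by (subst emeasure_Ioc) (auto simp: F_def)
  qed
  moreover have "(\<lambda>n. f (s n)) \<longlonglongrightarrow> left_lim 0 f t"
    by (rule filterlim_compose[OF left_lim_tendsto[OF t]])
       (use s slim in \<open>auto simp: filterlim_at intro!: always_eventually\<close>)
  then have "(\<lambda>n. ennreal (f t - f (s n))) \<longlonglongrightarrow> ennreal (jump f t)"
    unfolding jump_def by (intro tendsto_intros)
  ultimately show ?thesis using LIMSEQ_unique by fastforce
qed

lemma emeasure_Ioo: "0 \<le> s \<Longrightarrow> s < t \<Longrightarrow> emeasure \<mu> {s<..<t} = ennreal (left_lim 0 f t - f s)"
proof -
  assume st: "0 \<le> s" "s < t"
  have "emeasure \<mu> {s<..t} = emeasure \<mu> {s<..<t} + emeasure \<mu> {t}"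
    using st by (subst plus_emeasure) (auto intro!: arg_cong[where f="emeasure \<mu>"])
  then have "emeasure \<mu> {s<..<t} + ennreal (jump f t) = ennreal (f t - f s)"
    using st by (simp add: emeasure_singleton emeasure_Ioc F_def)
  also have "\<dots> = ennreal (left_lim 0 f t - f s) + ennreal (jump f t)"
    using st left_lim_ge[OF st] jump_nonneg[of t]
    by (subst ennreal_plus[symmetric]) (auto simp: jump_def)
  finally show ?thesis by (simp add: ennreal_add_left_cancel add.commute)
qed

definition "C = {t. 0 \<le> t \<and> jump f t \<noteq> 0}"

lemma countable_C: "countable C"
proof -
  have "C \<subseteq> insert 0 {a \<in> {0..}. \<not> continuous (at a within {0..}) f}"
  proof
    fix t assume t: "t \<in> C"
    show "t \<in> insert 0 {a \<in> {0..}. \<not> continuous (at a within {0..}) f}"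
    proof (cases "t = 0")
      case False
      then have t0: "0 < t" using t by (auto simp: C_def)
      have "\<not> continuous (at t within {0..}) f"
      proof
        assume "continuous (at t within {0..}) f"
        then have "(f \<longlongrightarrow> f t) (at t within {0..})" by (simp only: continuous_within)
        then have "(f \<longlongrightarrow> f t) (at t)" using t0 at_within_interior[of t "{0..}"] by simp
        then have "(f \<longlongrightarrow> f t) (at_left t)" by (simp only: filterlim_at_split)
        then have "left_lim 0 f t = f t"
          by (rule tendsto_unique[OF trivial_limit_at_left_real left_lim_tendsto[OF t0]])
        then show False using t by (simp add: C_def jump_def)
      qed
      then show ?thesis using t0 by simp
    qed simp
  qed
  then show ?thesis
    by (rule countable_subset) (intro countable_insert mono_on_ctble_discont[OF f_mono])
qed

lemma C_measurable [measurable]: "C \<in> sets borel"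
  using countable_C by (rule sets.countable[rotated]) simp

lemma F_measurable [measurable]: "F \<in> borel_measurable borel"
  by (rule borel_measurable_mono) (simp add: mono_def F_mono)

text \<open>The density of \<open>d(e\<^sup>f)\<close> with respect to \<open>df\<close>.\<close>

definition "\<phi> t = (if t \<in> C then exp (left_lim 0 f t) * ((exp (jump f t) - 1) / jump f t) else exp (F t))"

lemma phi_measurable [measurable]: "\<phi> \<in> borel_measurable borel"
  by (rule measurable_discrete_difference[where f="\<lambda>t. exp (F t)" and X=C])
     (auto simp: \<phi>_def countable_C)

text \<open>For a jump of size \<open>j\<close>, \<open>(exp j - 1) / j\<close> is a mean of
  \<open>exp\<close> over the jump and lies between 1 and \<open>exp j\<close>. The later comparison
  of masses rests on these two bounds and on the exact value at atoms.\<close>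

lemma phi_bounds:
  assumes "0 \<le> s" shows "exp (left_lim 0 f s) \<le> \<phi> s" "\<phi> s \<le> exp (f s)"
proof -
  have J: "0 \<le> jump f s" using jump_nonneg assms .
  have "exp (left_lim 0 f s) \<le> \<phi> s \<and> \<phi> s \<le> exp (f s)"
  proof (cases "s \<in> C")
    case True
    then have Jp: "0 < jump f s" using J by (auto simp: C_def)
    have 1: "1 \<le> (exp (jump f s) - 1) / jump f s"
      using exp_ge_add_one_self[of "jump f s"] Jp by (simp add: field_simps)
    have "exp (jump f s) * (1 - jump f s) \<le> exp (jump f s) * exp (- jump f s)"
      using exp_ge_add_one_self[of "- jump f s"] by (intro mult_left_mono) auto
    then have "exp (jump f s) * (1 - jump f s) \<le> 1" by (simp add: exp_minus)
    then have 2: "(exp (jump f s) - 1) / jump f s \<le> exp (jump f s)"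
      using Jp by (simp add: field_simps)
    have "f s = left_lim 0 f s + jump f s" by (simp add: jump_def)
    then have e: "exp (f s) = exp (left_lim 0 f s) * exp (jump f s)" by (simp add: exp_add)
    have "exp (left_lim 0 f s) * 1 \<le> \<phi> s" "\<phi> s \<le> exp (f s)"
      unfolding e using 1 2 True unfolding \<phi>_def by (auto simp only: if_True intro!: mult_left_mono exp_ge_zero)
    then show ?thesis by simp
  next
    case False
    then show ?thesis using assms left_lim_le[OF assms] by (simp add: \<phi>_def F_def)
  qed
  then show "exp (left_lim 0 f s) \<le> \<phi> s" "\<phi> s \<le> exp (f s)" by auto
qed

lemma phi_nonneg: "0 \<le> \<phi> s"
proof (cases "0 \<le> s")
  case True then show ?thesis using phi_bounds(1)[of s] by (smt (verit) exp_gt_zero)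
qed (auto simp: \<phi>_def C_def)

lemma phi_jump: "0 \<le> t \<Longrightarrow> \<phi> t * jump f t = exp (f t) - exp (left_lim 0 f t)"
proof (cases "t \<in> C")
  case True
  then have "jump f t \<noteq> 0" by (simp add: C_def)
  have "f t = left_lim 0 f t + jump f t" by (simp add: jump_def)
  then have "exp (f t) = exp (left_lim 0 f t) * exp (jump f t)" by (simp add: exp_add)
  then show ?thesis using True \<open>jump f t \<noteq> 0\<close> by (simp add: \<phi>_def right_diff_distrib)
next
  case False
  assume "0 \<le> t"
  then show ?thesis using False by (auto simp: C_def jump_def)
qed

section \<open>The measure of the exponential path and the chain rule with jumps\<close>

definition "exp_measure = density \<mu> (\<lambda>t. ennreal (\<phi> t))"

lemma sets_exp_measure [simp, measurable_cong]: "sets exp_measure = sets borel" by (simp add: exp_measure_def)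

lemma exp_measure_upper:
  assumes "S \<in> sets borel" "S \<subseteq> {0..t}"
  shows "emeasure exp_measure S \<le> ennreal (exp (f t)) * emeasure \<mu> S"
proof -
  have "emeasure exp_measure S = (\<integral>\<^sup>+s. ennreal (\<phi> s) * indicator S s \<partial>\<mu>)"
    unfolding exp_measure_def using assms by (intro emeasure_density) auto
  also have "\<dots> \<le> (\<integral>\<^sup>+s. ennreal (exp (f t)) * indicator S s \<partial>\<mu>)"
  proof (intro nn_integral_mono)
    fix s
    show "ennreal (\<phi> s) * indicator S s \<le> ennreal (exp (f t)) * indicator S s"
    proof (cases "s \<in> S")
      case True
      then have s: "0 \<le> s" "s \<le> t" using assms(2) by auto
      have "\<phi> s \<le> exp (f t)" using phi_bounds(2)[OF s(1)] f_le[OF s] by (meson exp_le_cancel_iff order_trans)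
      then show ?thesis using True by (simp add: ennreal_leI)
    qed simp
  qed
  also have "\<dots> = ennreal (exp (f t)) * emeasure \<mu> S"
    using assms by (intro nn_integral_cmult_indicator) simp
  finally show ?thesis .
qed

lemma exp_measure_lower:
  assumes "0 \<le> u" "u \<le> t"
  shows "ennreal (exp (f u)) * emeasure \<mu> {u<..t} \<le> emeasure exp_measure {u<..t}"
proof -
  have "ennreal (exp (f u)) * emeasure \<mu> {u<..t} = (\<integral>\<^sup>+s. ennreal (exp (f u)) * indicator {u<..t} s \<partial>\<mu>)"
    by (intro nn_integral_cmult_indicator[symmetric]) simp
  also have "\<dots> \<le> (\<integral>\<^sup>+s. ennreal (\<phi> s) * indicator {u<..t} s \<partial>\<mu>)"
  proof (intro nn_integral_mono)
    fix s
    show "ennreal (exp (f u)) * indicator {u<..t} s \<le> ennreal (\<phi> s) * indicator {u<..t} s"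
    proof (cases "s \<in> {u<..t}")
      case True
      then have "exp (f u) \<le> \<phi> s" using assms phi_bounds(1)[of s] left_lim_ge[of u s]
        by (auto intro: order_trans)
      then show ?thesis using True by (simp add: ennreal_leI)
    qed simp
  qed
  also have "\<dots> = emeasure exp_measure {u<..t}"
    unfolding exp_measure_def by (intro emeasure_density[symmetric]) auto
  finally show ?thesis .
qed

lemma exp_measure_singleton: "0 \<le> t \<Longrightarrow> emeasure exp_measure {t} = ennreal (exp (f t) - exp (left_lim 0 f t))"
proof -
  assume t: "0 \<le> t"
  have "emeasure exp_measure {t} = (\<integral>\<^sup>+s. ennreal (\<phi> t) * indicator {t} s \<partial>\<mu>)"
    unfolding exp_measure_def by (subst emeasure_density) (auto intro!: nn_integral_cong simp: indicator_def)
  also have "\<dots> = ennreal (\<phi> t) * ennreal (jump f t)"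
    using t by (subst nn_integral_cmult_indicator) (auto simp: emeasure_singleton)
  also have "\<dots> = ennreal (exp (f t) - exp (left_lim 0 f t))"
    using t phi_jump[OF t] jump_nonneg[OF t] phi_nonneg by (simp add: ennreal_mult[symmetric])
  finally show ?thesis .
qed

definition "G t = measure exp_measure {0..t}"

lemma exp_measure_Icc: "0 \<le> t \<Longrightarrow> emeasure exp_measure {0..t} = ennreal (G t)"
proof -
  assume t: "0 \<le> t"
  have "emeasure exp_measure {0..t} \<le> ennreal (exp (f t)) * ennreal (f t)"
    using exp_measure_upper[of "{0..t}" t] t by (simp add: emeasure_Icc0)
  then have "emeasure exp_measure {0..t} < \<infinity>" by (simp add: ennreal_mult[symmetric] f_nonneg t order_le_less_trans)
  then show ?thesis unfolding G_def by (simp add: emeasure_eq_ennreal_measure)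
qed

lemma G_mono_add:
  assumes "0 \<le> u" "u \<le> t"
  shows "emeasure exp_measure {u<..t} = ennreal (G t - G u)" "G u \<le> G t"
proof -
  have "emeasure exp_measure {0..t} = emeasure exp_measure {0..u} + emeasure exp_measure {u<..t}"
    using assms by (subst plus_emeasure) (auto intro!: arg_cong[where f="emeasure exp_measure"])
  then have *: "ennreal (G t) = ennreal (G u) + emeasure exp_measure {u<..t}" using assms by (simp add: exp_measure_Icc)
  then have "ennreal (G u) \<le> ennreal (G t)" by simp
  then show le: "G u \<le> G t" using assms by (simp add: G_def ennreal_le_iff)
  have "ennreal (G t) = ennreal (G u) + ennreal (G t - G u)"
    using le by (subst ennreal_plus[symmetric]) (auto simp: G_def)
  with * show "emeasure exp_measure {u<..t} = ennreal (G t - G u)"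
    by (simp add: ennreal_add_left_cancel)
qed

lemma G_bounds:
  assumes "0 \<le> u" "u \<le> t"
  shows "exp (f u) * (f t - f u) \<le> G t - G u" "G t - G u \<le> exp (f t) * (f t - f u)"
proof -
  have d: "emeasure \<mu> {u<..t} = ennreal (f t - f u)" "0 \<le> f t - f u" using assms
    by (auto simp: emeasure_Ioc F_def f_le)
  show "exp (f u) * (f t - f u) \<le> G t - G u"
    using exp_measure_lower[OF assms] d G_mono_add[OF assms] by (simp add: ennreal_mult[symmetric] ennreal_le_iff)
  show "G t - G u \<le> exp (f t) * (f t - f u)"
  proof -
    have "{u<..t} \<subseteq> {0..t}" using assms by auto
    from exp_measure_upper[OF _ this] show ?thesis
      using d G_mono_add[OF assms] by (auto simp: ennreal_mult[symmetric] ennreal_le_iff)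
  qed
qed

lemma exp_diff_bounds:
  fixes x y :: real assumes "x \<le> y"
  shows "exp x * (y - x) \<le> exp y - exp x" "exp y - exp x \<le> exp y * (y - x)"
proof -
  have "exp x * (1 + (y - x)) \<le> exp x * exp (y - x)"
    using exp_ge_add_one_self[of "y-x"] by (intro mult_left_mono) auto
  also have "\<dots> = exp y" by (simp add: exp_add[symmetric])
  finally show "exp x * (y - x) \<le> exp y - exp x" by (simp add: algebra_simps)
  have "exp y * (1 + (x - y)) \<le> exp y * exp (x - y)"
    using exp_ge_add_one_self[of "x-y"] by (intro mult_left_mono) auto
  also have "\<dots> = exp x" by (simp add: exp_add[symmetric])
  finally show "exp y - exp x \<le> exp y * (y - x)" by (simp add: algebra_simps)
qed

text \<open>Both \<open>G\<close> and \<open>exp (f t) - 1\<close> have increments between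
  \<open>exp (f u) * (f t - f u)\<close> and \<open>exp (f t) * (f t - f u)\<close>. Their
  difference therefore moves by at most \<open>(exp (f t) - exp (f u)) * (f t - f u)\<close>, and
  the first factor is small to the right of \<open>u\<close>. From the left the difference is
  continuous, because the atom of \<open>exp_measure\<close> at \<open>u\<close> is exactly the jump
  of the exponential path.\<close>

lemma G_eq: "0 \<le> t \<Longrightarrow> G t = exp (f t) - 1"
proof -
  assume t: "0 \<le> t"
  define D where "D t = G t - (exp (f t) - 1)" for t
  have "D t = 0"
  proof (rule interval_induct_zero[OF f_mono _ _ _ t])
    have "ennreal (G 0) = ennreal (exp (f 0) - 1)"
      using exp_measure_Icc[of 0] exp_measure_singleton[of 0] by (simp add: left_lim_def)
    then show "D 0 = 0" using f_nonneg[of 0] by (simp add: D_def G_def)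
  next
    fix u e :: real assume u: "0 \<le> u" and e: "0 < e"
    have "((\<lambda>t. exp (f t)) \<longlongrightarrow> exp (f u)) (at_right u)"
      by (intro tendsto_exp f_right u)
    then have "eventually (\<lambda>t. exp (f t) < exp (f u) + e) (at_right u)"
      by (rule order_tendstoD) (use e in simp)
    then obtain b where b: "b > u" "\<And>t. u < t \<Longrightarrow> t < b \<Longrightarrow> exp (f t) < exp (f u) + e"
      by (auto simp: eventually_at_right_field)
    show "\<exists>d>0. \<forall>t. u < t \<and> t < u + d \<longrightarrow> \<bar>D t - D u\<bar> \<le> e * (f t - f u)"
    proof (intro exI[of _ "b-u"] conjI allI impI)
      fix t assume t: "u < t \<and> t < u + (b - u)"
      then have ft: "f u \<le> f t" using u by (intro f_le) auto
      have "\<bar>(G t - G u) - (exp (f t) - exp (f u))\<bar> \<le> exp (f t) * (f t - f u) - exp (f u) * (f t - f u)"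
        using G_bounds[of u t] exp_diff_bounds[OF ft] u t by linarith
      also have "\<dots> = (exp (f t) - exp (f u)) * (f t - f u)" by (simp add: algebra_simps)
      also have "\<dots> \<le> e * (f t - f u)" using b(2)[of t] t ft by (intro mult_right_mono) auto
      finally show "\<bar>D t - D u\<bar> \<le> e * (f t - f u)" by (simp add: D_def)
    qed (use b in simp)
  next
    fix u e :: real assume u: "0 < u" and e: "0 < e"
    let ?L = "left_lim 0 f u"
    have "((\<lambda>s. exp (f u) * (?L - f s) + (exp ?L - exp (f s))) \<longlongrightarrow> exp (f u) * (?L - ?L) + (exp ?L - exp ?L)) (at_left u)"
      by (intro tendsto_intros left_lim_tendsto u)
    then have "eventually (\<lambda>s. exp (f u) * (?L - f s) + (exp ?L - exp (f s)) < e) (at_left u)"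
      by (rule order_tendstoD) (use e in simp)
    then obtain b where b: "b < u" "\<And>s. b < s \<Longrightarrow> s < u \<Longrightarrow> exp (f u) * (?L - f s) + (exp ?L - exp (f s)) < e"
      by (auto simp: eventually_at_left_field)
    show "\<exists>d>0. \<forall>s\<ge>0. u - d < s \<and> s < u \<longrightarrow> \<bar>D u - D s\<bar> \<le> e"
    proof (intro exI[of _ "u-b"] conjI allI impI)
      fix s assume s0: "0 \<le> s" and s: "u - (u - b) < s \<and> s < u"
      have L: "f s \<le> ?L" "?L \<le> f u" using left_lim_ge[of s u] left_lim_le[of u] s0 s u by auto
      have "emeasure exp_measure {s<..u} = emeasure exp_measure {s<..<u} + emeasure exp_measure {u}"
        using s by (subst plus_emeasure) (auto intro!: arg_cong[where f="emeasure exp_measure"])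
      also have "\<dots> \<le> ennreal (exp (f u)) * ennreal (?L - f s) + ennreal (exp (f u) - exp ?L)"
      proof (intro add_mono)
        have "{s<..<u} \<subseteq> {0..u}" using s0 by auto
        from exp_measure_upper[OF _ this] show "emeasure exp_measure {s<..<u} \<le> ennreal (exp (f u)) * ennreal (?L - f s)"
          using s s0 by (simp add: emeasure_Ioo)
      qed (use u in \<open>simp add: exp_measure_singleton\<close>)
      also have "\<dots> = ennreal (exp (f u) * (?L - f s) + (exp (f u) - exp ?L))"
        using L by (simp add: ennreal_mult[symmetric] ennreal_plus[symmetric] del: ennreal_plus)
      finally have 1: "G u - G s \<le> exp (f u) * (?L - f s) + (exp (f u) - exp ?L)"
        using G_mono_add[of s u] s s0 L by (simp add: ennreal_le_iff del: ennreal_plus)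
      have "emeasure exp_measure {u} \<le> emeasure exp_measure {s<..u}" using s by (intro emeasure_mono) auto
      then have 2: "exp (f u) - exp ?L \<le> G u - G s"
        using G_mono_add[of s u] s s0 u by (simp add: exp_measure_singleton ennreal_le_iff)
      have 3: "0 \<le> exp (f u) * (?L - f s)" "exp (f s) \<le> exp ?L" using L by auto
      have "\<bar>D u - D s\<bar> \<le> exp (f u) * (?L - f s) + (exp ?L - exp (f s))"
        unfolding D_def using 1 2 3 by linarith
      then show "\<bar>D u - D s\<bar> \<le> e" using b(2)[of s] s by linarith
    qed (use b in simp)
  qed
  then show ?thesis by (simp add: D_def)
qed

lemma exp_path: "control_path (\<lambda>t. exp (f t) - 1)"
proof
  show "0 \<le> exp (f t) - 1" if "0 \<le> t" for t using f_nonneg[OF that] by simp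
  show "mono_on {0..} (\<lambda>t. exp (f t) - 1)" by (auto simp: mono_on_def f_le)
  show "cadlag (\<lambda>t. exp (f t) - 1)"
    unfolding cadlag_def
  proof (intro conjI allI impI)
    show "continuous (at_right t) (\<lambda>t. exp (f t) - 1)" if "0 \<le> t" for t
      using f_right[OF that] by (auto simp: continuous_within intro!: tendsto_intros)
    show "\<exists>l. ((\<lambda>t. exp (f t) - 1) \<longlongrightarrow> l) (at_left t)" if "0 < t" for t
      using tendsto_diff[OF tendsto_exp[OF left_lim_tendsto[OF that]] tendsto_const[of 1]] by blast
  qed
qed

lemma null_neg: "{..<0} \<in> null_sets \<mu>"
proof -
  have "{..<0::real} = (\<Union>n. {- real n - 1<..- 1 / real (Suc n)})"
  proof (intro equalityI subsetI)
    fix x :: real assume x: "x \<in> {..<0}"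
    then obtain n where n: "1 / real (Suc n) < - x" using nat_approx_posE[of "-x"] by auto
    obtain k where k: "- x < real k" using reals_Archimedean2 by blast
    have "1 / real (Suc (max n k)) \<le> 1 / real (Suc n)" by (intro divide_left_mono) auto
    then have "x \<le> - 1 / real (Suc (max n k))" using n unfolding minus_divide_left[symmetric] by linarith
    moreover have "- real (max n k) - 1 < x" using k by linarith
    ultimately have "x \<in> {- real (max n k) - 1<..- 1 / real (Suc (max n k))}" by (simp only: greaterThanAtMost_iff)
    then show "x \<in> (\<Union>n. {- real n - 1<..- 1 / real (Suc n)})" by (rule UN_I[OF UNIV_I])
  next
    fix x :: real assume "x \<in> (\<Union>n. {- real n - 1<..- 1 / real (Suc n)})"
    then obtain n where "x \<le> - 1 / real (Suc n)" by auto
    moreover have "- 1 / real (Suc n) < 0" by (rule divide_neg_pos) auto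
    ultimately have "x < 0" by linarith
    then show "x \<in> {..<0}" by simp
  qed
  moreover have "emeasure \<mu> {- real n - 1<..- 1 / real (Suc n)} = 0" for n
  proof -
    have "- 1 / real (Suc n) < 0" by (rule divide_neg_pos) auto
    moreover have "- real n - 1 \<le> - 1 / real (Suc n)" by (simp add: field_simps)
    ultimately show ?thesis by (subst emeasure_Ioc) (auto simp: F_def)
  qed
  then have "(\<Union>n. {- real n - 1<..- 1 / real (Suc n)}) \<in> null_sets \<mu>"
    by (intro null_sets_UN) (auto simp: null_sets_def)
  ultimately show ?thesis by simp
qed

text \<open>Absolute continuity excludes mass before time 0, so the masses of \<open>{0..t}\<close>
  determine all others. The form with \<open>if\<close> is the extension by zero that
  \<open>control_measure\<close> uses.\<close>

lemma Ioc_if_abs_cont: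
  assumes N: "sets N = sets borel" and abs: "null_sets \<mu> \<subseteq> null_sets N"
    and Icc: "\<And>t. 0 \<le> t \<Longrightarrow> emeasure N {0..t} = ennreal (H t)"
    and H: "\<And>t. 0 \<le> t \<Longrightarrow> 0 \<le> H t"
    and ab: "a \<le> b"
  shows "emeasure N {a<..b} = ennreal ((if b < 0 then 0 else H b) - (if a < 0 then 0 else H a))"
proof -
  have neg: "S \<subseteq> {..<0} \<Longrightarrow> S \<in> sets borel \<Longrightarrow> emeasure N S = 0" for S
    using null_neg abs N null_sets_subset[of "{..<0}" N S] by (auto simp del: lessThan_subset_iff)
  consider "b < 0" | "a < 0" "0 \<le> b" | "0 \<le> a" using ab by linarith
  then show ?thesis
  proof cases
    case 1
    then have "{a<..b} \<subseteq> {..<0}" by auto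
    from neg[OF this] show ?thesis using 1 ab by simp
  next
    case 2
    have "emeasure N {a<..b} = emeasure N {a<..<0} + emeasure N {0..b}"
      using 2 N by (subst plus_emeasure) (auto intro!: arg_cong[where f="emeasure N"])
    moreover have "{a<..<0} \<subseteq> {..<0}" by auto
    from neg[OF this] have "emeasure N {a<..<0} = 0" by simp
    ultimately show ?thesis using 2 Icc[of b] by simp
  next
    case 3
    have "emeasure N {0..b} = emeasure N {0..a} + emeasure N {a<..b}"
      using 3 ab N by (subst plus_emeasure) (auto intro!: arg_cong[where f="emeasure N"])
    then have *: "ennreal (H b) = ennreal (H a) + emeasure N {a<..b}" using 3 ab by (simp add: Icc)
    then have "ennreal (H a) \<le> ennreal (H b)" by simp
    then have le: "H a \<le> H b" using H 3 ab by (simp add: ennreal_le_iff)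
    have "ennreal (H b) = ennreal (H a) + ennreal (H b - H a)"
      using le 3 H by (subst ennreal_plus[symmetric]) auto
    with * show ?thesis using 3 ab by (simp add: ennreal_add_left_cancel)
  qed
qed

text \<open>Promotes the identity for initial intervals to an identity of measures, the form in
  which control integrals are rewritten.\<close>

lemma density_phi: "exp_measure = control_measure (\<lambda>t. exp (f t) - 1)"
proof -
  interpret E: control_path "\<lambda>t. exp (f t) - 1" by (rule exp_path)
  show ?thesis unfolding E.control_measure_eq
  proof (rule measure_eq_if_eq_Ioc[where F=E.F])
    fix a b :: real assume ab: "a \<le> b"
    show "emeasure exp_measure {a<..b} = ennreal (E.F b - E.F a)" unfolding E.F_def
    proof (rule Ioc_if_abs_cont[OF sets_exp_measure _ _ _ ab])
      show "null_sets \<mu> \<subseteq> null_sets exp_measure" unfolding exp_measure_def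
        using absolutely_continuousI_density[of "\<lambda>t. ennreal (\<phi> t)" \<mu>] by (simp add: absolutely_continuous_def)
    qed (auto simp: exp_measure_Icc G_eq f_nonneg)
    show "emeasure E.\<mu> {a<..b} = ennreal (E.F b - E.F a)" using ab by (rule E.emeasure_Ioc)
  qed simp_all
qed

text \<open>The unordered sum of jumps over \<open>{0..t}\<close> sees only the countable set
  \<open>C\<close>, where it is the total mass of the atoms; what remains of \<open>f t\<close> is
  the mass off \<open>C\<close>.\<close>

lemma cont_part_eq: "0 \<le> t \<Longrightarrow> ennreal (cont_part f t) = emeasure \<mu> ({0..t} - C)" "0 \<le> t \<Longrightarrow> 0 \<le> cont_part f t"
proof -
  assume t: "0 \<le> t"
  let ?S = "C \<inter> {0..t}"
  have fin: "emeasure \<mu> ?S < \<infinity>" "emeasure \<mu> ?S \<le> ennreal (f t)"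
  proof -
    have "emeasure \<mu> ?S \<le> emeasure \<mu> {0..t}" by (intro emeasure_mono) auto
    then show "emeasure \<mu> ?S \<le> ennreal (f t)" using t by (simp add: emeasure_Icc0)
    then show "emeasure \<mu> ?S < \<infinity>" using order_le_less_trans by fastforce
  qed
  have cS: "countable ?S" using countable_C by blast
  have *: "emeasure \<mu> ?S = (\<integral>\<^sup>+s. ennreal (jump f s) \<partial>count_space ?S)"
    using cS by (subst emeasure_countable_singleton) (auto intro!: nn_integral_cong simp: emeasure_singleton)
  have int: "integrable (count_space ?S) (jump f)"
  proof (rule integrableI_bounded)
    have "(\<integral>\<^sup>+s. ennreal (norm (jump f s)) \<partial>count_space ?S) = (\<integral>\<^sup>+s. ennreal (jump f s) \<partial>count_space ?S)"
      by (intro nn_integral_cong) (simp add: jump_nonneg)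
    then show "(\<integral>\<^sup>+s. ennreal (norm (jump f s)) \<partial>count_space ?S) < \<infinity>" using fin(1) unfolding * by simp
  qed simp
  have "ennreal (infsetsum (jump f) ?S) = emeasure \<mu> ?S"
    unfolding * infsetsum_def using int
    by (subst nn_integral_eq_integral[OF int]) (auto intro!: AE_I2 jump_nonneg)
  moreover have "infsetsum (jump f) ?S = infsum (jump f) ?S"
    using int by (intro infsetsum_infsum) (simp add: abs_summable_on_def)
  moreover have "infsum (jump f) ?S = infsum (jump f) {0..t}"
    by (rule infsum_cong_neutral) (auto simp: C_def)
  ultimately have J: "ennreal (infsum (jump f) {0..t}) = emeasure \<mu> ?S" by simp
  have J0: "0 \<le> infsum (jump f) {0..t}" by (intro infsum_nonneg) (simp add: jump_nonneg)
  have "emeasure \<mu> {0..t} = emeasure \<mu> ({0..t} - C) + emeasure \<mu> ?S"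
    by (subst plus_emeasure) (auto intro!: arg_cong[where f="emeasure \<mu>"])
  then have sum: "ennreal (f t) = emeasure \<mu> ({0..t} - C) + ennreal (infsum (jump f) {0..t})"
    using t by (simp add: emeasure_Icc0 J)
  have le: "infsum (jump f) {0..t} \<le> f t"
    using fin(2) f_nonneg[OF t] unfolding J[symmetric] by (simp add: ennreal_le_iff)
  then show "0 \<le> cont_part f t" by (simp add: cont_part_def)
  have "ennreal (f t) = ennreal (cont_part f t) + ennreal (infsum (jump f) {0..t})"
    using le J0 by (subst ennreal_plus[symmetric]) (auto simp: cont_part_def)
  with sum have "ennreal (infsum (jump f) {0..t}) + ennreal (cont_part f t)
      = ennreal (infsum (jump f) {0..t}) + emeasure \<mu> ({0..t} - C)"
    by (simp only: add.commute)
  then show "ennreal (cont_part f t) = emeasure \<mu> ({0..t} - C)"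
    by (simp only: ennreal_add_left_cancel ennreal_neq_top)  simp
qed

lemma density_cont: "density \<mu> (indicator (- C)) = control_measure (cont_part f)"
proof -
  let ?N = "density \<mu> (indicator (- C))"
  let ?H = "\<lambda>t. if t < 0 then 0 else cont_part f t"
  have emN: "emeasure ?N S = emeasure \<mu> (S - C)" if "S \<in> sets borel" for S
    using that by (subst emeasure_density) (auto intro!: arg_cong[where f="emeasure \<mu>"]
      simp: nn_integral_indicator[symmetric] indicator_inter_arith[symmetric] Diff_eq Int_commute simp del: nn_integral_indicator)
  have Ioc: "emeasure ?N {a<..b} = ennreal (?H b - ?H a)" if ab: "a \<le> b" for a b
    by (rule Ioc_if_abs_cont[OF _ _ _ _ ab])
       (use absolutely_continuousI_density[of "indicator (- C)" \<mu>]
        in \<open>auto simp: absolutely_continuous_def emN cont_part_eq\<close>)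
  \<comment> \<open>Domination by the increments of \<open>F\<close> hands right continuity over to
    the continuous part, which is what identifies its interval measure.\<close>
  have incr: "0 \<le> ?H b - ?H a \<and> ?H b - ?H a \<le> F b - F a" if ab: "a \<le> b" for a b
  proof -
    have H0: "0 \<le> ?H c" for c by (simp add: cont_part_eq)
    have le: "?H a \<le> ?H b"
    proof (cases "a < 0")
      case False
      then have "emeasure \<mu> ({0..a} - C) \<le> emeasure \<mu> ({0..b} - C)" using ab by (intro emeasure_mono) auto
      then show ?thesis using False ab by (simp add: cont_part_eq(1)[symmetric] cont_part_eq(2) ennreal_le_iff)
    qed (use H0 in auto)
    have "emeasure ?N {a<..b} \<le> emeasure \<mu> {a<..b}" by (auto simp: emN intro!: emeasure_mono)
    then have "ennreal (?H b - ?H a) \<le> ennreal (F b - F a)" using ab Ioc[OF ab] by (simp only: emeasure_Ioc)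
    then show ?thesis using le F_mono[OF ab] by (simp only: ennreal_le_iff diff_ge_0_iff_ge)
  qed
  have right: "continuous (at_right a) ?H" for a
  proof -
    have "((\<lambda>b. ?H b - ?H a) \<longlongrightarrow> 0) (at_right a)"
    proof (rule tendsto_sandwich[of "\<lambda>_. 0" _ _ "\<lambda>b. F b - F a"])
      show "((\<lambda>b. F b - F a) \<longlongrightarrow> 0) (at_right a)"
        using F_right[of a] by (simp add: continuous_within LIM_zero)
      have ev: "eventually (\<lambda>b. 0 \<le> ?H b - ?H a \<and> ?H b - ?H a \<le> F b - F a) (at_right a)"
      proof (rule eventually_at_rightI[of a "a+1"])
        fix b assume "b \<in> {a<..<a+1}"
        then show "0 \<le> ?H b - ?H a \<and> ?H b - ?H a \<le> F b - F a" by (intro incr) simp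
      qed simp
      show "eventually (\<lambda>b. 0 \<le> ?H b - ?H a) (at_right a)"
        using ev by (rule eventually_mono) (rule conjunct1)
      show "eventually (\<lambda>b. ?H b - ?H a \<le> F b - F a) (at_right a)"
        using ev by (rule eventually_mono) (rule conjunct2)
    qed simp
    then show ?thesis unfolding continuous_within by (rule LIM_zero_cancel)
  qed
  show ?thesis unfolding control_measure_def
  proof (rule measure_eq_if_eq_Ioc[where F="?H"])
    fix a b :: real assume ab: "a \<le> b"
    show "emeasure ?N {a<..b} = ennreal (?H b - ?H a)" by (rule Ioc[OF ab])
    show "emeasure (interval_measure ?H) {a<..b} = ennreal (?H b - ?H a)"
      by (rule emeasure_interval_measure_Ioc[OF ab _ right]) (use incr in auto)
  qed simp_all
qed

text \<open>Off \<open>C\<close> the density \<open>\<phi>\<close> is \<open>exp f\<close>, so the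
  continuous part integrates \<open>y * \<phi>\<close>. A jump of size \<open>j\<close> contributes
  \<open>y\<close> times the left limit of \<open>exp f\<close> times \<open>exp j - 1\<close>,
  which is \<open>y * \<phi> * j\<close>. Together they form one integral of \<open>y\<close>
  against the measure of the exponential path.\<close>

lemma up_integral_eq:
  assumes y: "continuous_on {0..} y" "\<And>t. 0 \<le> t \<Longrightarrow> 0 \<le> y t" and x: "x = y 0"
  shows "up_integral q x (\<lambda>t. y t * exp (f t)) f
    = (\<integral>\<^sup>+t\<in>{0..}. ennreal (exp (- q * t) * y t) \<partial>control_measure (\<lambda>t. exp (f t) - 1))"
proof -
  define g where "g t = (if 0 \<le> t then exp (- q * t) * y t else 0)" for t
  have g0: "0 \<le> g t" for t using y(2) by (simp add: g_def)
  have gm [measurable]: "g \<in> borel_measurable borel"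
  proof -
    have "(\<lambda>t. if t \<in> {0..} then exp (- q * t) * y t else 0) \<in> borel_measurable borel"
      by (rule borel_measurable_continuous_on_if) (auto intro!: continuous_intros y)
    then show ?thesis by (simp add: g_def[abs_def])
  qed
  \<comment> \<open>At time 0 the values prescribed at \<open>0-\<close> are used:
    \<open>x = y 0\<close> for the product and 0 for the control.\<close>
  have ll: "left_lim x (\<lambda>t. y t * exp (f t)) t = y t * exp (left_lim 0 f t)" if t: "0 \<le> t" for t
  proof (cases "t = 0")
    case True then show ?thesis by (simp add: left_lim_def x)
  next
    case False
    then have t0: "0 < t" using t by simp
    have "(y \<longlongrightarrow> y t) (at t)"
      using y(1) t0 by (metis atLeast_iff at_within_interior continuous_on_def interior_real_atLeast greaterThan_iff t)
    then have "(y \<longlongrightarrow> y t) (at_left t)" by (simp only: filterlim_at_split)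
    then have "((\<lambda>t. y t * exp (f t)) \<longlongrightarrow> y t * exp (left_lim 0 f t)) (at_left t)"
      by (intro tendsto_intros left_lim_tendsto t0)
    then show ?thesis using t0 by (simp add: left_lim_def[of x] tendsto_Lim trivial_limit_at_left_real)
  qed
  have A: "(\<integral>\<^sup>+t\<in>{0..}. ennreal (exp (- q * t) * (y t * exp (f t))) \<partial>control_measure (cont_part f))
      = (\<integral>\<^sup>+t. ennreal (g t * \<phi> t) * indicator (- C) t \<partial>\<mu>)"
  proof -
    have "(\<integral>\<^sup>+t\<in>{0..}. ennreal (exp (- q * t) * (y t * exp (f t))) \<partial>control_measure (cont_part f))
      = (\<integral>\<^sup>+t. ennreal (g t * exp (F t)) \<partial>density \<mu> (indicator (- C)))"
      unfolding density_cont by (intro nn_integral_cong) (auto simp: g_def F_def indicator_def mult_ac)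
    also have "\<dots> = (\<integral>\<^sup>+t. indicator (- C) t * ennreal (g t * exp (F t)) \<partial>\<mu>)"
      by (rule nn_integral_density) auto
    also have "\<dots> = (\<integral>\<^sup>+t. ennreal (g t * \<phi> t) * indicator (- C) t \<partial>\<mu>)"
      by (intro nn_integral_cong) (auto simp: \<phi>_def indicator_def)
    finally show ?thesis .
  qed
  have B: "(\<integral>\<^sup>+t. ennreal (exp (- q * t) * (left_lim x (\<lambda>t. y t * exp (f t)) t * (exp (jump f t) - 1))) \<partial>count_space {0..})
     = (\<integral>\<^sup>+t. ennreal (g t * \<phi> t) * indicator C t \<partial>\<mu>)"
  proof -
    have "(\<integral>\<^sup>+t. ennreal (exp (- q * t) * (left_lim x (\<lambda>t. y t * exp (f t)) t * (exp (jump f t) - 1))) \<partial>count_space {0..})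
      = (\<integral>\<^sup>+t. ennreal (g t * \<phi> t * jump f t) \<partial>count_space {0..})"
    proof (intro nn_integral_cong)
      fix t :: real assume "t \<in> space (count_space {0..})"
      then have t: "0 \<le> t" by simp
      have "f t = left_lim 0 f t + jump f t" by (simp add: jump_def)
      then have "exp (f t) = exp (left_lim 0 f t) * exp (jump f t)" by (simp add: exp_add)
      then have "\<phi> t * jump f t = exp (left_lim 0 f t) * (exp (jump f t) - 1)"
        using phi_jump[OF t] by (simp add: algebra_simps)
      then show "ennreal (exp (- q * t) * (left_lim x (\<lambda>t. y t * exp (f t)) t * (exp (jump f t) - 1)))
         = ennreal (g t * \<phi> t * jump f t)" using t by (simp add: g_def ll mult.assoc)
    qed
    also have "\<dots> = (\<integral>\<^sup>+t. ennreal (g t * \<phi> t * jump f t) \<partial>count_space C)"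
      by (rule nn_integral_count_space_eq) (auto simp: C_def)
    also have "\<dots> = (\<integral>\<^sup>+t. (\<integral>\<^sup>+s. ennreal (g t * \<phi> t) * indicator {t} s \<partial>\<mu>) \<partial>count_space C)"
    proof (intro nn_integral_cong)
      fix t assume "t \<in> space (count_space C)"
      then have t: "0 \<le> t" by (simp add: C_def)
      show "ennreal (g t * \<phi> t * jump f t) = (\<integral>\<^sup>+s. ennreal (g t * \<phi> t) * indicator {t} s \<partial>\<mu>)"
        using t by (subst nn_integral_cmult_indicator)
          (auto simp: emeasure_singleton ennreal_mult[symmetric] g0 phi_nonneg jump_nonneg)
    qed
    \<comment> \<open>Countability of \<open>C\<close> allows the exchange of sum and integral; the
      inner sum then retains only the atom at \<open>s\<close>.\<close>
    also have "\<dots> = (\<integral>\<^sup>+s. (\<integral>\<^sup>+t. ennreal (g t * \<phi> t) * indicator {t} s \<partial>count_space C) \<partial>\<mu>)"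
      by (rule nn_integral_count_space_nn_integral[symmetric]) (auto simp: countable_C)
    also have "\<dots> = (\<integral>\<^sup>+s. ennreal (g s * \<phi> s) * indicator C s \<partial>\<mu>)"
    proof (intro nn_integral_cong)
      fix s
      have "(\<integral>\<^sup>+t. ennreal (g t * \<phi> t) * indicator {t} s \<partial>count_space C)
        = (\<integral>\<^sup>+t. ennreal (g s * \<phi> s) * indicator C s * indicator {s} t \<partial>count_space UNIV)"
        by (subst nn_integral_count_space_indicator, simp, intro nn_integral_cong) (auto simp: indicator_def)
      then show "(\<integral>\<^sup>+t. ennreal (g t * \<phi> t) * indicator {t} s \<partial>count_space C) = ennreal (g s * \<phi> s) * indicator C s"
        by (simp add: nn_integral_cmult_indicator)
    qed
    finally show ?thesis .
  qed
  have "(\<integral>\<^sup>+t\<in>{0..}. ennreal (exp (- q * t) * y t) \<partial>control_measure (\<lambda>t. exp (f t) - 1))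
     = (\<integral>\<^sup>+t. ennreal (g t) \<partial>density \<mu> (\<lambda>t. ennreal (\<phi> t)))"
    unfolding density_phi[symmetric] exp_measure_def by (intro nn_integral_cong) (auto simp: g_def indicator_def)
  also have "\<dots> = (\<integral>\<^sup>+t. ennreal (g t * \<phi> t) \<partial>\<mu>)"
    by (subst nn_integral_density) (auto intro!: nn_integral_cong simp: ennreal_mult'' g0 phi_nonneg mult.commute)
  also have "\<dots> = (\<integral>\<^sup>+t. ennreal (g t * \<phi> t) * indicator (- C) t + ennreal (g t * \<phi> t) * indicator C t \<partial>\<mu>)"
    by (intro nn_integral_cong) (auto simp: indicator_def)
  also have "\<dots> = (\<integral>\<^sup>+t. ennreal (g t * \<phi> t) * indicator (- C) t \<partial>\<mu>) + (\<integral>\<^sup>+t. ennreal (g t * \<phi> t) * indicator C t \<partial>\<mu>)"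
    by (rule nn_integral_add) auto
  finally show ?thesis unfolding up_integral_def A B by simp
qed

end

section \<open>Exponential martingales and their maximal inequality\<close>

text \<open>\<open>W_incr\<close> is all that is kept of the Gaussian law: exponential moments of an
  increment, unaffected by the past. It is stated for nonnegative extended \<open>H\<close>, so that
  no integrability has to be checked on the way. Paths start at 0 and are continuous in every
  scenario, which keeps later pathwise arguments free of null sets.\<close>

locale exp_martingale = prob_space M for M :: "'a measure" +
  fixes Fl :: "real \<Rightarrow> 'a measure" and W :: "real \<Rightarrow> 'a \<Rightarrow> real"
  assumes subalg: "\<And>s. 0 \<le> s \<Longrightarrow> subalgebra M (Fl s)"
    and filt_mono: "\<And>s t. 0 \<le> s \<Longrightarrow> s \<le> t \<Longrightarrow> sets (Fl s) \<subseteq> sets (Fl t)"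
    and W_adapted: "\<And>t. 0 \<le> t \<Longrightarrow> W t \<in> borel_measurable (Fl t)"
    and W_zero: "\<And>\<omega>. \<omega> \<in> space M \<Longrightarrow> W 0 \<omega> = 0"
    and W_cont: "\<And>\<omega>. \<omega> \<in> space M \<Longrightarrow> continuous_on {0..} (\<lambda>t. W t \<omega>)"
    and W_incr: "\<And>s t c H. 0 \<le> s \<Longrightarrow> s < t \<Longrightarrow> H \<in> borel_measurable (Fl s) \<Longrightarrow>
      (\<integral>\<^sup>+\<omega>. ennreal (exp (c * (W t \<omega> - W s \<omega>))) * H \<omega> \<partial>M) = ennreal (exp (c\<^sup>2 * (t - s) / 2)) * (\<integral>\<^sup>+\<omega>. H \<omega> \<partial>M)"
begin

lemma Fl_space: "0 \<le> s \<Longrightarrow> space (Fl s) = space M"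
  using subalg by (auto simp: subalgebra_def)

lemma Fl_measurable_M: "0 \<le> s \<Longrightarrow> f \<in> measurable (Fl s) N \<Longrightarrow> f \<in> measurable M N"
  using subalg measurable_from_subalg by blast

lemma Fl_measurable_mono: "0 \<le> s \<Longrightarrow> s \<le> t \<Longrightarrow> f \<in> measurable (Fl s) N \<Longrightarrow> f \<in> measurable (Fl t) N"
  by (rule measurable_from_subalg[of "Fl t" "Fl s"]) (auto simp: subalgebra_def Fl_space filt_mono)

lemma W_adapted_mono: "0 \<le> s \<Longrightarrow> s \<le> t \<Longrightarrow> W s \<in> borel_measurable (Fl t)"
  using W_adapted Fl_measurable_mono by blast

lemma W_measurable: "0 \<le> t \<Longrightarrow> W t \<in> borel_measurable M"
  using W_adapted Fl_measurable_M by blast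

text \<open>The past factor \<open>exp (c * W s \<omega>)\<close> is absorbed into
  \<open>H\<close>.\<close>

lemma exp_W_mult:
  assumes "0 \<le> s" "s \<le> t" and H: "H \<in> borel_measurable (Fl s)"
  shows "(\<integral>\<^sup>+\<omega>. ennreal (exp (c * W t \<omega>)) * H \<omega> \<partial>M)
    = ennreal (exp (c\<^sup>2 * (t - s) / 2)) * (\<integral>\<^sup>+\<omega>. ennreal (exp (c * W s \<omega>)) * H \<omega> \<partial>M)"
proof (cases "s = t")
  case False
  have [measurable]: "W s \<in> borel_measurable (Fl s)" "H \<in> borel_measurable (Fl s)" using assms W_adapted by auto
  have "(\<integral>\<^sup>+\<omega>. ennreal (exp (c * W t \<omega>)) * H \<omega> \<partial>M)
    = (\<integral>\<^sup>+\<omega>. ennreal (exp (c * (W t \<omega> - W s \<omega>))) * (ennreal (exp (c * W s \<omega>)) * H \<omega>) \<partial>M)"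
    by (intro nn_integral_cong)
       (auto simp: mult.assoc[symmetric] ennreal_mult[symmetric] exp_add[symmetric] algebra_simps)
  also have "\<dots> = ennreal (exp (c\<^sup>2 * (t - s) / 2)) * (\<integral>\<^sup>+\<omega>. ennreal (exp (c * W s \<omega>)) * H \<omega> \<partial>M)"
    using assms False by (intro W_incr) auto
  finally show ?thesis .
qed simp

lemma exp_W_moment: "0 \<le> t \<Longrightarrow> (\<integral>\<^sup>+\<omega>. ennreal (exp (c * W t \<omega>)) \<partial>M) = ennreal (exp (c\<^sup>2 * t / 2))"
  using exp_W_mult[of 0 t "\<lambda>_. 1" c] W_zero
  by (simp add: emeasure_space_1 cong: nn_integral_cong)

text \<open>Doob's inequality for squares, proved pathwise. The running maximum \<open>R\<close>
  grows only where it meets \<open>N\<close>, so \<open>R\<^sup>2\<close> grows by at most twice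
  \<open>N\<close> times the growth of \<open>R\<close>. The submartingale property moves
  \<open>N\<close> to the final time, the sum telescopes, and Young's inequality leaves half of the
  mean of \<open>R\<^sup>2\<close> on the right.\<close>

lemma discrete_doob:
  fixes N R :: "nat \<Rightarrow> 'a \<Rightarrow> real" and \<tau> :: "nat \<Rightarrow> real" and c :: real
  assumes \<tau>: "\<And>i. 0 \<le> \<tau> i" "\<And>i. \<tau> i \<le> \<tau> (Suc i)"
  defines "N \<equiv> \<lambda>i \<omega>. exp (c * W (\<tau> i) \<omega>)"
  defines "R \<equiv> rec_nat (N 0) (\<lambda>k r \<omega>. max (r \<omega>) (N (Suc k) \<omega>))"
  shows "(\<integral>\<^sup>+\<omega>. ennreal ((R n \<omega>)\<^sup>2) \<partial>M) \<le> ennreal (6 * exp (2 * c\<^sup>2 * \<tau> n))"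
proof -
  have R0: "R 0 = N 0" and RS: "R (Suc k) = (\<lambda>\<omega>. max (R k \<omega>) (N (Suc k) \<omega>))" for k
    by (simp_all add: R_def)
  have Npos: "0 < N i \<omega>" for i \<omega> by (simp add: N_def)
  have Rpos: "0 < R i \<omega>" for i \<omega> by (induction i) (auto simp: R0 RS Npos max_def)
  have Rmono: "R i \<omega> \<le> R (Suc i) \<omega>" for i \<omega> by (simp add: RS)
  have \<tau>mono: "i \<le> j \<Longrightarrow> \<tau> i \<le> \<tau> j" for i j by (rule lift_Suc_mono_le[of \<tau>]) (auto simp: \<tau>)
  have Nmeas: "N i \<in> borel_measurable (Fl (\<tau> j))" if "i \<le> j" for i j
    using W_adapted_mono[of "\<tau> i" "\<tau> j"] \<tau> \<tau>mono that unfolding N_def by measurable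
  have Rmeas: "i \<le> j \<Longrightarrow> R i \<in> borel_measurable (Fl (\<tau> j))" for i j
  proof (induction i)
    case (Suc i)
    have [measurable]: "R i \<in> borel_measurable (Fl (\<tau> j))" "N (Suc i) \<in> borel_measurable (Fl (\<tau> j))"
      using Suc Nmeas by auto
    show ?case unfolding RS by measurable
  qed (simp add: R0 Nmeas)
  have [measurable]: "N i \<in> borel_measurable M" "R i \<in> borel_measurable M" for i
    using Nmeas[of i i] Rmeas[of i i] Fl_measurable_M \<tau> by auto
  have N2: "(\<integral>\<^sup>+\<omega>. ennreal ((N i \<omega>)\<^sup>2) \<partial>M) = ennreal (exp (2 * c\<^sup>2 * \<tau> i))" for i
    using exp_W_moment[of "\<tau> i" "2 * c"] \<tau>
    by (simp add: N_def power2_eq_square exp_add[symmetric] algebra_simps)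
  have path: "(R n \<omega>)\<^sup>2 \<le> (N 0 \<omega>)\<^sup>2 + 2 * (\<Sum>i<n. N (Suc i) \<omega> * (R (Suc i) \<omega> - R i \<omega>))" for \<omega>
  proof (induction n)
    case (Suc n)
    have "(R (Suc n) \<omega>)\<^sup>2 - (R n \<omega>)\<^sup>2 \<le> 2 * (N (Suc n) \<omega> * (R (Suc n) \<omega> - R n \<omega>))"
    proof (cases "N (Suc n) \<omega> \<le> R n \<omega>")
      case False
      then have e: "R (Suc n) \<omega> = N (Suc n) \<omega>" by (simp add: RS)
      have "0 \<le> (N (Suc n) \<omega> - R n \<omega>)\<^sup>2" by simp
      then show ?thesis unfolding e by (simp add: power2_eq_square algebra_simps)
    qed (simp add: RS)
    then show ?case using Suc by (simp add: algebra_simps)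
  qed (simp add: R0)
  \<comment> \<open>The increment of \<open>R\<close> is known at time
    \<open>\<tau> (Suc i)\<close>; replacing \<open>N (Suc i)\<close> by \<open>N n\<close>
    therefore multiplies the integral by a factor at least 1.\<close>
  have step: "(\<integral>\<^sup>+\<omega>. ennreal (N (Suc i) \<omega> * (R (Suc i) \<omega> - R i \<omega>)) \<partial>M)
     \<le> (\<integral>\<^sup>+\<omega>. ennreal (N n \<omega> * (R (Suc i) \<omega> - R i \<omega>)) \<partial>M)" if i: "i < n" for i
  proof -
    have [measurable]: "R (Suc i) \<in> borel_measurable (Fl (\<tau> (Suc i)))" "R i \<in> borel_measurable (Fl (\<tau> (Suc i)))"
      using Rmeas by auto
    have "(\<integral>\<^sup>+\<omega>. ennreal (N n \<omega> * (R (Suc i) \<omega> - R i \<omega>)) \<partial>M)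
      = (\<integral>\<^sup>+\<omega>. ennreal (exp (c * W (\<tau> n) \<omega>)) * ennreal (R (Suc i) \<omega> - R i \<omega>) \<partial>M)"
      by (intro nn_integral_cong) (auto simp: N_def ennreal_mult Rmono)
    also have "\<dots> = ennreal (exp (c\<^sup>2 * (\<tau> n - \<tau> (Suc i)) / 2)) *
       (\<integral>\<^sup>+\<omega>. ennreal (exp (c * W (\<tau> (Suc i)) \<omega>)) * ennreal (R (Suc i) \<omega> - R i \<omega>) \<partial>M)"
      using \<tau> \<tau>mono[of "Suc i" n] i by (intro exp_W_mult) auto
    also have "\<dots> \<ge> 1 * (\<integral>\<^sup>+\<omega>. ennreal (exp (c * W (\<tau> (Suc i)) \<omega>)) * ennreal (R (Suc i) \<omega> - R i \<omega>) \<partial>M)"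
      using \<tau>mono[of "Suc i" n] i by (intro mult_right_mono) auto
    also have "(\<integral>\<^sup>+\<omega>. ennreal (exp (c * W (\<tau> (Suc i)) \<omega>)) * ennreal (R (Suc i) \<omega> - R i \<omega>) \<partial>M)
      = (\<integral>\<^sup>+\<omega>. ennreal (N (Suc i) \<omega> * (R (Suc i) \<omega> - R i \<omega>)) \<partial>M)"
      by (intro nn_integral_cong) (auto simp: N_def ennreal_mult Rmono)
    finally show ?thesis by simp
  qed
  let ?x = "\<integral>\<^sup>+\<omega>. ennreal ((R n \<omega>)\<^sup>2) \<partial>M"
  let ?e = "exp (2 * c\<^sup>2 * \<tau> n)"
  \<comment> \<open>Finiteness is settled beforehand, since half of this quantity is absorbed into
    the left side at the end.\<close>
  have fin: "?x < \<infinity>"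
  proof -
    have "(R k \<omega>)\<^sup>2 \<le> (\<Sum>i\<le>k. (N i \<omega>)\<^sup>2)" for k \<omega>
    proof (induction k)
      case (Suc k)
      have "(R (Suc k) \<omega>)\<^sup>2 \<le> (R k \<omega>)\<^sup>2 + (N (Suc k) \<omega>)\<^sup>2" by (auto simp: RS max_def)
      then show ?case using Suc by simp
    qed (simp add: R0)
    then have "?x \<le> (\<integral>\<^sup>+\<omega>. (\<Sum>i\<le>n. ennreal ((N i \<omega>)\<^sup>2)) \<partial>M)"
      by (intro nn_integral_mono) (simp add: ennreal_leI)
    also have "\<dots> = (\<Sum>i\<le>n. ennreal (exp (2 * c\<^sup>2 * \<tau> i)))" by (subst nn_integral_sum) (auto simp: N2)
    also have "\<dots> < \<infinity>" by simp
    finally show ?thesis .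
  qed
  have "?x \<le> (\<integral>\<^sup>+\<omega>. ennreal ((N 0 \<omega>)\<^sup>2) + 2 * (\<Sum>i<n. ennreal (N (Suc i) \<omega> * (R (Suc i) \<omega> - R i \<omega>))) \<partial>M)"
  proof (intro nn_integral_mono)
    fix \<omega>
    have "ennreal ((R n \<omega>)\<^sup>2) \<le> ennreal ((N 0 \<omega>)\<^sup>2 + 2 * (\<Sum>i<n. N (Suc i) \<omega> * (R (Suc i) \<omega> - R i \<omega>)))"
      using path by (rule ennreal_leI)
    also have "\<dots> = ennreal ((N 0 \<omega>)\<^sup>2) + 2 * (\<Sum>i<n. ennreal (N (Suc i) \<omega> * (R (Suc i) \<omega> - R i \<omega>)))"
    proof -
      have nn: "0 \<le> N (Suc i) \<omega> * (R (Suc i) \<omega> - R i \<omega>)" for i using Npos Rmono by (simp add: less_imp_le)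
      then have "(\<Sum>i<n. ennreal (N (Suc i) \<omega> * (R (Suc i) \<omega> - R i \<omega>))) = ennreal (\<Sum>i<n. N (Suc i) \<omega> * (R (Suc i) \<omega> - R i \<omega>))"
        by (intro sum_ennreal)
      then show ?thesis using nn by (subst ennreal_plus) (auto intro!: sum_nonneg simp del: sum_ennreal zero_le_mult_iff simp add: ennreal_mult' less_imp_le[OF Npos] Rmono)
    qed
    finally show "ennreal ((R n \<omega>)\<^sup>2) \<le> ennreal ((N 0 \<omega>)\<^sup>2) + 2 * (\<Sum>i<n. ennreal (N (Suc i) \<omega> * (R (Suc i) \<omega> - R i \<omega>)))" .
  qed
  also have "\<dots> = ennreal (exp (2 * c\<^sup>2 * \<tau> 0)) + 2 * (\<Sum>i<n. (\<integral>\<^sup>+\<omega>. ennreal (N (Suc i) \<omega> * (R (Suc i) \<omega> - R i \<omega>)) \<partial>M))"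
    by (simp add: nn_integral_add nn_integral_cmult nn_integral_sum N2)
  also have "\<dots> \<le> ennreal ?e + 2 * (\<Sum>i<n. (\<integral>\<^sup>+\<omega>. ennreal (N n \<omega> * (R (Suc i) \<omega> - R i \<omega>)) \<partial>M))"
    using \<tau>mono[of 0 n] by (intro add_mono mult_left_mono sum_mono step) (auto intro!: ennreal_leI mult_left_mono)
  also have "\<dots> = ennreal ?e + (\<integral>\<^sup>+\<omega>. 2 * (\<Sum>i<n. ennreal (N n \<omega> * (R (Suc i) \<omega> - R i \<omega>))) \<partial>M)"
    by (simp add: nn_integral_cmult nn_integral_sum)
  also have "\<dots> \<le> ennreal ?e + (\<integral>\<^sup>+\<omega>. ennreal ((R n \<omega>)\<^sup>2 / 2) + ennreal (2 * (N n \<omega>)\<^sup>2) \<partial>M)"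
  proof (intro add_mono nn_integral_mono order_refl)
    fix \<omega>
    have "(\<Sum>i<n. R (Suc i) \<omega> - R i \<omega>) = R n \<omega> - R 0 \<omega>" by (rule sum_lessThan_telescope)
    then have s: "(\<Sum>i<n. N n \<omega> * (R (Suc i) \<omega> - R i \<omega>)) = N n \<omega> * (R n \<omega> - R 0 \<omega>)"
      by (simp only: sum_distrib_left[symmetric])
    have "0 \<le> (R n \<omega> - 2 * N n \<omega>)\<^sup>2" by simp
    then have "2 * (N n \<omega> * R n \<omega>) \<le> (R n \<omega>)\<^sup>2 / 2 + 2 * (N n \<omega>)\<^sup>2"
      by (simp add: power2_eq_square algebra_simps)
    moreover have "0 \<le> N n \<omega> * R 0 \<omega>" using Npos Rpos by (simp add: less_imp_le)
    moreover have "2 * (\<Sum>i<n. N n \<omega> * (R (Suc i) \<omega> - R i \<omega>)) = 2 * (N n \<omega> * R n \<omega>) - 2 * (N n \<omega> * R 0 \<omega>)"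
      unfolding s by (simp only: right_diff_distrib)
    ultimately have "2 * (\<Sum>i<n. N n \<omega> * (R (Suc i) \<omega> - R i \<omega>)) \<le> (R n \<omega>)\<^sup>2 / 2 + 2 * (N n \<omega>)\<^sup>2"
      by linarith
    then have "ennreal (2 * (\<Sum>i<n. N n \<omega> * (R (Suc i) \<omega> - R i \<omega>))) \<le> ennreal ((R n \<omega>)\<^sup>2 / 2 + 2 * (N n \<omega>)\<^sup>2)"
      by (rule ennreal_leI)
    also have "\<dots> = ennreal ((R n \<omega>)\<^sup>2 / 2) + ennreal (2 * (N n \<omega>)\<^sup>2)" by (rule ennreal_plus) auto
    finally have *: "ennreal (2 * (\<Sum>i<n. N n \<omega> * (R (Suc i) \<omega> - R i \<omega>))) \<le> ennreal ((R n \<omega>)\<^sup>2 / 2) + ennreal (2 * (N n \<omega>)\<^sup>2)" .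
    then show "2 * (\<Sum>i<n. ennreal (N n \<omega> * (R (Suc i) \<omega> - R i \<omega>))) \<le> ennreal ((R n \<omega>)\<^sup>2 / 2) + ennreal (2 * (N n \<omega>)\<^sup>2)"
    proof -
      have nn: "0 \<le> N n \<omega> * (R (Suc i) \<omega> - R i \<omega>)" for i using Npos Rmono by (simp add: less_imp_le)
      then have "(\<Sum>i<n. ennreal (N n \<omega> * (R (Suc i) \<omega> - R i \<omega>))) = ennreal (\<Sum>i<n. N n \<omega> * (R (Suc i) \<omega> - R i \<omega>))"
        by (intro sum_ennreal)
      moreover have "2 * ennreal (\<Sum>i<n. N n \<omega> * (R (Suc i) \<omega> - R i \<omega>)) = ennreal (2 * (\<Sum>i<n. N n \<omega> * (R (Suc i) \<omega> - R i \<omega>)))"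
        by (simp add: ennreal_mult')
      ultimately show ?thesis using * by (simp only:)
    qed
  qed
  also have "\<dots> = ennreal ?e + ((\<integral>\<^sup>+\<omega>. ennreal (1/2) * ennreal ((R n \<omega>)\<^sup>2) \<partial>M) + (\<integral>\<^sup>+\<omega>. 2 * ennreal ((N n \<omega>)\<^sup>2) \<partial>M))"
  proof -
    have "ennreal ((R n \<omega>)\<^sup>2 / 2) = ennreal (1/2) * ennreal ((R n \<omega>)\<^sup>2)" "ennreal (2 * (N n \<omega>)\<^sup>2) = 2 * ennreal ((N n \<omega>)\<^sup>2)" for \<omega>
      by (subst ennreal_mult[symmetric]; simp) (simp add: ennreal_mult)
    then show ?thesis by (simp only:) (subst nn_integral_add; simp)
  qed
  also have "\<dots> = ennreal ?e + (ennreal (1/2) * ?x + 2 * ennreal ?e)"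
    by (simp add: nn_integral_cmult N2)
  finally have ineq: "?x \<le> ennreal ?e + (ennreal (1/2) * ?x + 2 * ennreal ?e)" .
  obtain r where r: "?x = ennreal r" "0 \<le> r" using fin by (cases ?x) auto
  have a: "ennreal (1/2) * ennreal r = ennreal (1/2 * r)" using r(2) by (intro ennreal_mult[symmetric]) auto
  have b: "2 * ennreal ?e = ennreal (2 * ?e)" by (simp add: ennreal_mult)
  have "ennreal ?e + (ennreal (1/2 * r) + ennreal (2 * ?e)) = ennreal (?e + (1/2 * r + 2 * ?e))"
    using r(2) by (simp add: ennreal_plus[symmetric] del: ennreal_plus)
  then have "ennreal r \<le> ennreal (?e + (1/2 * r + 2 * ?e))"
    using ineq unfolding r(1) a b by simp
  then have "r \<le> ?e + (1/2 * r + 2 * ?e)" using r(2) by (subst (asm) ennreal_le_iff) (auto intro!: add_nonneg_nonneg)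
  \<comment> \<open>Solving \<open>r \<le> ?e + r / 2 + 2 * ?e\<close> for \<open>r\<close> is the
    origin of the factor 6.\<close>
  then show ?thesis unfolding r(1) by (intro ennreal_leI) simp
qed

text \<open>Doob's bound is uniform over partitions. Dyadic partitions are nested, so the maxima
  over them increase to a limit of finite mean, and path continuity extends the domination from
  dyadic times to all times. Squaring \<open>exp (c * W)\<close> produces the 2 in the
  exponent.\<close>

lemma exp_sup_dominated:
  assumes T: "0 \<le> T"
  shows "\<exists>H. integrable M H \<and> (\<forall>\<omega>\<in>space M. \<forall>t\<in>{0..T}. exp (2 * c * W t \<omega>) \<le> H \<omega>)"
proof -
  \<comment> \<open>Capping \<open>i\<close> at \<open>2^k\<close> keeps the times monotone for
    every index, as the discrete inequality demands, and inside \<open>{0..T}\<close>.\<close>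
  define tt where "tt k i = real (min i (2^k)) * T / 2^k" for k i :: nat
  define R where "R k = rec_nat (\<lambda>\<omega>. exp (c * W (tt k 0) \<omega>)) (\<lambda>j r \<omega>. max (r \<omega>) (exp (c * W (tt k (Suc j)) \<omega>)))" for k
  have tt: "0 \<le> tt k i" "tt k i \<le> tt k (Suc i)" "tt k i \<le> T" for k i
  proof -
    show "0 \<le> tt k i" using T by (simp add: tt_def)
    show "tt k i \<le> tt k (Suc i)" unfolding tt_def using T
      by (intro divide_right_mono mult_right_mono) auto
    have "real (min i (2^k)) * T \<le> 2^k * T" using T by (intro mult_right_mono) (auto simp: of_nat_min)
    then show "tt k i \<le> T" by (simp add: tt_def field_simps)
  qed
  have R0: "R k 0 = (\<lambda>\<omega>. exp (c * W (tt k 0) \<omega>))"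
    and RS: "R k (Suc n) = (\<lambda>\<omega>. max (R k n \<omega>) (exp (c * W (tt k (Suc n)) \<omega>)))" for k n
    by (simp_all add: R_def)
  have Rge: "i \<le> n \<Longrightarrow> exp (c * W (tt k i) \<omega>) \<le> R k n \<omega>" for i n k \<omega>
    by (induction n) (auto simp: R0 RS le_Suc_eq)
  have Rex: "\<exists>i\<le>n. R k n \<omega> = exp (c * W (tt k i) \<omega>)" for n k \<omega>
  proof (induction n)
    case (Suc n)
    then obtain i where "i \<le> n" "R k n \<omega> = exp (c * W (tt k i) \<omega>)" by blast
    then show ?case by (cases "R k n \<omega> \<le> exp (c * W (tt k (Suc n)) \<omega>)") (auto simp: RS max_def intro: exI[of _ "Suc n"] exI[of _ i])
  qed (auto simp: R0)
  have Rpos: "0 < R k n \<omega>" for k n \<omega> using Rex[of n k \<omega>] by auto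
  have [measurable]: "R k n \<in> borel_measurable M" for k n
  proof (induction n)
    case 0 show ?case unfolding R0 using W_measurable[OF tt(1)] by measurable
  next
    case (Suc n) then show ?case unfolding RS using W_measurable[OF tt(1)] by measurable
  qed
  define X where "X k \<omega> = ennreal ((R k (2^k) \<omega>)\<^sup>2)" for k \<omega>
  have [measurable]: "X k \<in> borel_measurable M" for k unfolding X_def by measurable
  have incX: "incseq X"
  proof (rule incseq_SucI, rule le_funI)
    fix k \<omega>
    obtain i where i: "i \<le> 2^k" "R k (2^k) \<omega> = exp (c * W (tt k i) \<omega>)" using Rex by blast
    \<comment> \<open>Nestedness: a point of level \<open>k\<close> reappears at level
      \<open>Suc k\<close> with twice the index.\<close>
    have "tt k i = tt (Suc k) (2 * i)" using i(1) by (simp add: tt_def min_def)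
    then have "R k (2^k) \<omega> \<le> R (Suc k) (2^(Suc k)) \<omega>" using Rge[of "2*i" "2^(Suc k)" "Suc k" \<omega>] i by simp
    then show "X k \<omega> \<le> X (Suc k) \<omega>" unfolding X_def using Rpos[of k "2^k" \<omega>]
      by (intro ennreal_leI power_mono) auto
  qed
  define H where "H \<omega> = (SUP k. X k \<omega>)" for \<omega>
  have "(\<integral>\<^sup>+\<omega>. H \<omega> \<partial>M) = (SUP k. \<integral>\<^sup>+\<omega>. X k \<omega> \<partial>M)"
    unfolding H_def using incX by (intro nn_integral_monotone_convergence_SUP) auto
  also have "\<dots> \<le> ennreal (6 * exp (2 * c\<^sup>2 * T))"
  proof (rule SUP_least)
    fix k
    have "(\<integral>\<^sup>+\<omega>. X k \<omega> \<partial>M) \<le> ennreal (6 * exp (2 * c\<^sup>2 * tt k (2^k)))"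
      unfolding X_def R_def by (rule discrete_doob) (rule tt)+
    also have "\<dots> \<le> ennreal (6 * exp (2 * c\<^sup>2 * T))" using tt(3)[of k "2^k"] by (auto intro!: ennreal_leI mult_left_mono)
    finally show "(\<integral>\<^sup>+\<omega>. X k \<omega> \<partial>M) \<le> ennreal (6 * exp (2 * c\<^sup>2 * T))" .
  qed
  finally have EH: "(\<integral>\<^sup>+\<omega>. H \<omega> \<partial>M) < \<infinity>" by (simp add: order_le_less_trans)
  have [measurable]: "H \<in> borel_measurable M" unfolding H_def by measurable
  have sq: "(exp (c * w))\<^sup>2 = exp (2 * c * w)" for w by (simp add: power2_eq_square exp_add[symmetric])
  have Hfin: "H \<omega> < \<infinity>" if \<omega>: "\<omega> \<in> space M" for \<omega>
  proof -
    have "continuous_on {0..T} (\<lambda>t. exp (2 * c * W t \<omega>))"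
      by (intro continuous_intros continuous_on_subset[OF W_cont[OF \<omega>]]) auto
    then have "bounded ((\<lambda>t. exp (2 * c * W t \<omega>)) ` {0..T})" by (intro compact_imp_bounded compact_continuous_image) auto
    then obtain B where "\<forall>x\<in>(\<lambda>t. exp (2 * c * W t \<omega>)) ` {0..T}. norm x \<le> B"
      unfolding bounded_iff ..
    then have B: "\<And>t. t \<in> {0..T} \<Longrightarrow> exp (2 * c * W t \<omega>) \<le> B" by simp
    have "X k \<omega> \<le> ennreal B" for k
    proof -
      obtain i where "R k (2^k) \<omega> = exp (c * W (tt k i) \<omega>)" using Rex by blast
      then show ?thesis unfolding X_def using B[of "tt k i"] tt by (intro ennreal_leI) (simp add: sq)
    qed
    then have "H \<omega> \<le> ennreal B" unfolding H_def by (rule SUP_least)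
    then show ?thesis by (simp add: order_le_less_trans)
  qed
  have Hge: "ennreal (exp (2 * c * W t \<omega>)) \<le> H \<omega>" if \<omega>: "\<omega> \<in> space M" and t: "t \<in> {0..T}" for \<omega> t
  proof (cases "T = 0")
    case True
    have "ennreal (exp (2 * c * W t \<omega>)) = X 0 \<omega>"
    proof -
      obtain i where "R 0 (2^0) \<omega> = exp (c * W (tt 0 i) \<omega>)" using Rex by blast
      then show ?thesis using True t by (simp add: X_def sq tt_def)
    qed
    then show ?thesis unfolding H_def by (metis SUP_upper UNIV_I)
  next
    case False
    then have T0: "0 < T" using T by simp
    \<comment> \<open>Index of the last dyadic point not exceeding \<open>t\<close>; the division by
      \<open>T\<close> is why \<open>T = 0\<close> was treated apart.\<close>
    define j where "j k = nat \<lfloor>t * 2^k / T\<rfloor>" for k :: nat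
    have j: "real (j k) \<le> t * 2^k / T" "t * 2^k / T - 1 < real (j k)" for k
      using t T0 by (auto simp: j_def)
    have jle: "j k \<le> 2^k" for k
    proof -
      have "t * 2^k / T \<le> 2^k" using t T0 by (simp add: field_simps)
      from order_trans[OF j(1) this] show ?thesis by simp
    qed
    have ttj: "tt k (j k) = real (j k) * T / 2^k" for k using jle[of k] by (simp add: tt_def min_def)
    have lim: "(\<lambda>k. tt k (j k)) \<longlonglongrightarrow> t"
    proof (rule tendsto_sandwich[of "\<lambda>k. t - T * (1/2)^k" _ _ "\<lambda>_. t"])
      show "eventually (\<lambda>k. t - T * (1/2)^k \<le> tt k (j k)) sequentially"
      proof (rule always_eventually, rule allI)
        fix k
        have "(t * 2^k / T - 1) * (T / 2^k) \<le> real (j k) * (T / 2^k)"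
          using j(2)[of k] T0 by (intro mult_right_mono) auto
        moreover have "(t * 2^k / T - 1) * (T / 2^k) = t - T * (1/2)^k" using T0 by (simp add: field_simps power_divide)
        ultimately show "t - T * (1/2)^k \<le> tt k (j k)" by (simp add: ttj)
      qed
      show "eventually (\<lambda>k. tt k (j k) \<le> t) sequentially"
        using j(1) T0 by (intro always_eventually allI) (simp add: ttj field_simps)
      have "(\<lambda>k. t - T * (1/2)^k) \<longlonglongrightarrow> t - T * 0"
        by (intro tendsto_intros LIMSEQ_power_zero) auto
      then show "(\<lambda>k. t - T * (1/2)^k) \<longlonglongrightarrow> t" by simp
    qed simp
    have "(\<lambda>k. W (tt k (j k)) \<omega>) \<longlonglongrightarrow> W t \<omega>"
      by (rule continuous_on_tendsto_compose[OF W_cont[OF \<omega>] lim]) (use t tt in auto)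
    then have "(\<lambda>k. ennreal (exp (2 * c * W (tt k (j k)) \<omega>))) \<longlonglongrightarrow> ennreal (exp (2 * c * W t \<omega>))"
      by (intro tendsto_intros)
    moreover have "ennreal (exp (2 * c * W (tt k (j k)) \<omega>)) \<le> H \<omega>" for k
    proof -
      have "ennreal (exp (2 * c * W (tt k (j k)) \<omega>)) \<le> X k \<omega>"
        unfolding X_def sq[symmetric] using Rge[OF jle[of k], of k \<omega>] by (intro ennreal_leI power_mono) auto
      also have "\<dots> \<le> H \<omega>" unfolding H_def by (rule SUP_upper) simp
      finally show ?thesis .
    qed
    ultimately show ?thesis by (rule LIMSEQ_le_const2[OF _ exI, OF _ allI, OF _ impI])
  qed
  have en: "ennreal (enn2real (H \<omega>)) = H \<omega>" if "\<omega> \<in> space M" for \<omega> using Hfin[OF that] by simp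
  have "integrable M (\<lambda>\<omega>. enn2real (H \<omega>))"
    using EH by (intro integrableI_bounded) (auto simp: en cong: nn_integral_cong)
  moreover have "\<forall>\<omega>\<in>space M. \<forall>t\<in>{0..T}. exp (2 * c * W t \<omega>) \<le> enn2real (H \<omega>)"
    using Hge en by (metis enn2real_nonneg ennreal_le_iff)
  ultimately show ?thesis by blast
qed

text \<open>\<open>exp (c * \<bar>w\<bar>)\<close> is at most
  \<open>exp (c * w) + exp (- (c * w))\<close>; the halved constants below compensate the factor 2
  of the one-sided bound.\<close>

lemma exp_abs_dominated:
  assumes T: "0 \<le> T"
  obtains H where "integrable M H" "\<And>\<omega> t. \<omega> \<in> space M \<Longrightarrow> 0 \<le> t \<Longrightarrow> t \<le> T \<Longrightarrow> exp (c * \<bar>W t \<omega>\<bar>) \<le> H \<omega>"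
proof -
  obtain H1 where H1: "integrable M H1" "\<forall>\<omega>\<in>space M. \<forall>t\<in>{0..T}. exp (2 * (c/2) * W t \<omega>) \<le> H1 \<omega>"
    using exp_sup_dominated[OF T] by blast
  obtain H2 where H2: "integrable M H2" "\<forall>\<omega>\<in>space M. \<forall>t\<in>{0..T}. exp (2 * (- c/2) * W t \<omega>) \<le> H2 \<omega>"
    using exp_sup_dominated[OF T] by blast
  show ?thesis
  proof (rule that[of "\<lambda>\<omega>. H1 \<omega> + H2 \<omega>"])
    fix \<omega> t assume \<omega>: "\<omega> \<in> space M" and t: "0 \<le> t" "t \<le> T"
    have a: "exp (c * W t \<omega>) \<le> H1 \<omega>" "exp (- (c * W t \<omega>)) \<le> H2 \<omega>" using H1 H2 \<omega> t by auto
    have p: "0 < exp (c * W t \<omega>)" "0 < exp (- (c * W t \<omega>))" by auto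
    show "exp (c * \<bar>W t \<omega>\<bar>) \<le> H1 \<omega> + H2 \<omega>"
    proof (cases "0 \<le> W t \<omega>")
      case True
      then have "exp (c * \<bar>W t \<omega>\<bar>) = exp (c * W t \<omega>)" by simp
      then show ?thesis using a p by linarith
    next
      case False
      then have "exp (c * \<bar>W t \<omega>\<bar>) = exp (- (c * W t \<omega>))" by simp
      then show ?thesis using a p by linarith
    qed
  qed (use H1 H2 in auto)
qed

end

section \<open>Gaussian increments and the augmented filtration\<close>

lemma normal_exp_moment:
  assumes v: "0 < v"
  shows "(\<integral>\<^sup>+x. ennreal (normal_density 0 (sqrt v) x) * ennreal (exp (c * x)) \<partial>lborel) = ennreal (exp (c\<^sup>2 * v / 2))"
proof -
  have *: "normal_density 0 (sqrt v) x * exp (c * x) = exp (c\<^sup>2 * v / 2) * normal_density (c * v) (sqrt v) x" for x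
  proof -
    \<comment> \<open>Completing the square: the weight \<open>exp (c * x)\<close> shifts the
      Gaussian mean to \<open>c * v\<close>.\<close>
    have "- (x - 0)\<^sup>2 / (2 * (sqrt v)\<^sup>2) + c * x = c\<^sup>2 * v / 2 + - (x - c * v)\<^sup>2 / (2 * (sqrt v)\<^sup>2)"
      using v by (simp add: field_simps power2_eq_square)
    then have "exp (- (x - 0)\<^sup>2 / (2 * (sqrt v)\<^sup>2)) * exp (c * x) = exp (c\<^sup>2 * v / 2) * exp (- (x - c * v)\<^sup>2 / (2 * (sqrt v)\<^sup>2))"
      by (simp only: exp_add[symmetric])
    then show ?thesis unfolding normal_density_def by simp
  qed
  have "(\<integral>\<^sup>+x. ennreal (normal_density 0 (sqrt v) x) * ennreal (exp (c * x)) \<partial>lborel)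
    = (\<integral>\<^sup>+x. ennreal (exp (c\<^sup>2 * v / 2)) * ennreal (normal_density (c * v) (sqrt v) x) \<partial>lborel)"
    by (intro nn_integral_cong) (simp add: ennreal_mult[symmetric] *)
  also have "\<dots> = ennreal (exp (c\<^sup>2 * v / 2)) * ennreal (\<integral>x. normal_density (c * v) (sqrt v) x \<partial>lborel)"
    using v by (simp add: nn_integral_cmult nn_integral_eq_integral)
  also have "\<dots> = ennreal (exp (c\<^sup>2 * v / 2))" using v by simp
  finally show ?thesis .
qed

text \<open>The whole path is replaced by 0 on the exceptional null set, so that starting at 0 and
  continuity hold in every scenario.\<close>

definition regular_version :: "'a process \<Rightarrow> 'a process" where
  "regular_version W t \<omega> = (if W 0 \<omega> = 0 \<and> continuous_on {0..} (\<lambda>t. W t \<omega>) then W t \<omega> else 0)"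

locale brownian = prob_space M for M :: "'a measure" +
  fixes W :: "'a process"
  assumes M_complete: "complete_measure M" and BM: "brownian_motion M W"
begin

lemma W_measurable: "0 \<le> t \<Longrightarrow> W t \<in> borel_measurable M"
  using BM by (simp add: brownian_motion_def)

lemma AE_regular: "AE \<omega> in M. W 0 \<omega> = 0 \<and> continuous_on {0..} (\<lambda>t. W t \<omega>)"
  using BM by (auto simp: brownian_motion_def)

lemma AE_regular_version: "AE \<omega> in M. \<forall>t. regular_version W t \<omega> = W t \<omega>"
  using AE_regular by eventually_elim (auto simp: regular_version_def)

abbreviation "Fl \<equiv> augmented_filtration M W"

lemma Fl_gen: "{W s -` B \<inter> space M | s B. 0 \<le> s \<and> s \<le> t \<and> B \<in> sets borel} \<union> null_sets M \<subseteq> sets M"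
  using W_measurable by (auto intro: measurable_sets)

lemma sets_Fl: "sets (Fl t) = sigma_sets (space M)
       ({W s -` B \<inter> space M | s B. 0 \<le> s \<and> s \<le> t \<and> B \<in> sets borel} \<union> null_sets M)"
  unfolding augmented_filtration_def using Fl_gen[of t] sets.space_closed[of M]
  by (intro sets_measure_of) auto

lemma space_Fl [simp]: "space (Fl t) = space M"
  unfolding augmented_filtration_def using Fl_gen[of t] sets.space_closed[of M]
  by (intro space_measure_of) auto

lemma subalg_Fl: "subalgebra M (Fl t)"
  unfolding subalgebra_def sets_Fl using sets.sigma_sets_subset[OF Fl_gen] by simp

lemma Fl_mono: "s \<le> t \<Longrightarrow> sets (Fl s) \<subseteq> sets (Fl t)"
  unfolding sets_Fl by (intro sigma_sets_subseteq) fastforce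

lemma null_in_Fl: "N \<in> null_sets M \<Longrightarrow> N \<in> sets (Fl t)"
  unfolding sets_Fl by (rule sigma_sets.Basic) simp

lemma W_Fl: "0 \<le> t \<Longrightarrow> W t \<in> borel_measurable (Fl t)"
  by (rule measurableI) (auto simp: sets_Fl intro!: sigma_sets.Basic)

text \<open>Completeness makes every subset of the exceptional set a null set, and each member of
  the augmented filtration contains all null sets. Hence the regular version remains
  adapted.\<close>

lemma Fl_AE_eq:
  assumes X: "X \<in> borel_measurable (Fl t)" and ae: "AE \<omega> in M. X \<omega> = Y \<omega>"
  shows "Y \<in> borel_measurable (Fl t)"
proof (rule measurableI)
  interpret C: complete_measure M by (rule M_complete)
  fix B :: "'b set" assume B: "B \<in> sets borel"
  have N: "{\<omega> \<in> space M. \<not> X \<omega> = Y \<omega>} \<in> null_sets M" using ae unfolding C.AE_iff_null_sets .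
  let ?N = "{\<omega> \<in> space M. \<not> X \<omega> = Y \<omega>}"
  have 1: "Y -` B \<inter> space (Fl t) = (X -` B \<inter> space (Fl t) - ?N) \<union> (Y -` B \<inter> ?N)" by auto
  have "Y -` B \<inter> ?N \<in> null_sets M" by (rule C.complete2[OF _ N]) auto
  then show "Y -` B \<inter> space (Fl t) \<in> sets (Fl t)"
    unfolding 1 using measurable_sets[OF X B] N by (intro sets.Un sets.Diff) (auto intro: null_in_Fl)
qed simp

text \<open>Finite-dimensional events up to time \<open>s\<close>: stable under intersection and,
  with the null sets, containing the generators of the filtration.\<close>

definition "cyl s = {(\<Inter>u\<in>U. W u -` B u \<inter> space M) | U B. finite U \<and> U \<noteq> {} \<and> U \<subseteq> {0..s} \<and> (\<forall>u\<in>U. B u \<in> sets (borel :: real measure))}"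

text \<open>On a grid through 0, the times of the cylinder, \<open>s\<close> and \<open>t\<close>,
  the positions are partial sums of all increments but the last, and the last increment is
  \<open>W t - W s\<close>. Independence of two disjoint blocks of increments then suffices, up to
  the fact that \<open>W 0 = 0\<close> holds only almost surely.\<close>

lemma cyl_indep:
  assumes s: "0 \<le> s" "s < t" and D: "D \<in> cyl s" and E: "E \<in> sets borel"
  shows "prob (D \<inter> ((\<lambda>\<omega>. W t \<omega> - W s \<omega>) -` E \<inter> space M)) = prob D * prob ((\<lambda>\<omega>. W t \<omega> - W s \<omega>) -` E \<inter> space M)"
proof -
  obtain U B where U: "finite U" "U \<noteq> {}" "U \<subseteq> {0..s}" "\<forall>u\<in>U. B u \<in> sets (borel :: real measure)"
    and D: "D = (\<Inter>u\<in>U. W u -` B u \<inter> space M)" using D unfolding cyl_def by (elim CollectE exE conjE) (rule that)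
  \<comment> \<open>Repeated grid points, such as 0 or \<open>s\<close> in \<open>U\<close>, are
    harmless: the definition of Brownian motion admits increments over degenerate intervals.\<close>
  define l where "l = 0 # sorted_list_of_set U @ [s, t]"
  have sl: "sorted l" using U s by (auto simp: l_def sorted_append)
  have len: "length l = card U + 3" by (simp add: l_def)
  define n where "n = card U + 2"
  \<comment> \<open>The grid is frozen at its last point so that it is monotone for every
    index.\<close>
  define \<tau> where "\<tau> i = l ! (min i n)" for i
  have \<tau>0: "\<tau> 0 = 0" by (simp add: \<tau>_def l_def)
  have \<tau>s: "\<tau> (n - 1) = s" "\<tau> n = t" by (auto simp: \<tau>_def l_def n_def nth_append)
  have \<tau>mono: "\<tau> i \<le> \<tau> (Suc i)" for i
    unfolding \<tau>_def using sl by (intro sorted_nth_mono) (auto simp: len n_def)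
  have \<tau>m: "i \<le> j \<Longrightarrow> \<tau> i \<le> \<tau> j" for i j by (rule lift_Suc_mono_le[of \<tau>]) (auto simp: \<tau>mono)
  then have \<tau>nn: "0 \<le> \<tau> i" for i using \<tau>m[of 0 i] \<tau>0 by simp
  have \<tau>U: "\<exists>i<n. \<tau> i = u" if "u \<in> U" for u
  proof -
    have "u \<in> set (sorted_list_of_set U)" using that U by simp
    then obtain i where i: "i < length (sorted_list_of_set U)" "sorted_list_of_set U ! i = u"
      by (auto simp: in_set_conv_nth)
    then have "\<tau> (Suc i) = u" by (simp add: \<tau>_def l_def n_def nth_append)
    then show ?thesis using i U by (intro exI[of _ "Suc i"]) (simp add: n_def)
  qed
  define X where "X i \<omega> = W (\<tau> (Suc i)) \<omega> - W (\<tau> i) \<omega>" for i \<omega>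
  have X_meas: "X i \<in> borel_measurable M" for i
    unfolding X_def using W_measurable[OF \<tau>nn] by measurable
  have "indep_vars (\<lambda>_. borel) X {..<n}"
    using BM \<tau>mono \<tau>0 unfolding brownian_motion_def X_def by auto
  then have ind: "indep_var (PiM {..<n-1} (\<lambda>_. borel)) (\<lambda>\<omega>. restrict (\<lambda>i. X i \<omega>) {..<n-1})
      (PiM {n-1} (\<lambda>_. borel)) (\<lambda>\<omega>. restrict (\<lambda>i. X i \<omega>) {n-1})"
    by (rule indep_var_restrict) (auto simp: n_def)
  obtain k where k: "\<And>u. u \<in> U \<Longrightarrow> k u < n \<and> \<tau> (k u) = u" using \<tau>U by metis
  have tele: "(\<Sum>j<i. X j \<omega>) = W (\<tau> i) \<omega> - W 0 \<omega>" for i \<omega>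
    by (induction i) (auto simp: X_def \<tau>0)
  define A1 where "A1 = {x \<in> space (PiM {..<n-1} (\<lambda>_. borel :: real measure)). \<forall>u\<in>U. (\<Sum>j<k u. x j) \<in> B u}"
  define A2 where "A2 = {x \<in> space (PiM {n-1} (\<lambda>_. borel :: real measure)). x (n-1) \<in> E}"
  have A1: "A1 \<in> sets (PiM {..<n-1} (\<lambda>_. borel))"
    unfolding A1_def
  proof (intro sets.sets_Collect_finite_All' U(1,2))
    fix u assume u: "u \<in> U"
    have "(\<lambda>x. \<Sum>j<k u. x j) \<in> borel_measurable (PiM {..<n-1} (\<lambda>_. borel :: real measure))"
    proof (rule borel_measurable_sum)
      fix j assume "j \<in> {..<k u}"
      then have "j \<in> {..<n-1}" using k[OF u] by auto
      then show "(\<lambda>x. x j) \<in> borel_measurable (PiM {..<n-1} (\<lambda>_. borel :: real measure))" by measurable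
    qed
    from measurable_sets[OF this, of "B u"] show "{x \<in> space (PiM {..<n-1} (\<lambda>_. borel)). (\<Sum>j<k u. x j) \<in> B u} \<in> sets (PiM {..<n-1} (\<lambda>_. borel))"
      using U u by (simp add: vimage_def Int_def conj_commute)
  qed
  have A2: "A2 \<in> sets (PiM {n-1} (\<lambda>_. borel))"
  proof -
    have "(\<lambda>x. x (n-1)) \<in> borel_measurable (PiM {n-1} (\<lambda>_. borel :: real measure))" by measurable
    from measurable_sets[OF this E] show ?thesis by (simp add: A2_def vimage_def Int_def conj_commute)
  qed
  have n1: "Suc (n - 1) = n" by (simp add: n_def)
  have E2: "(\<lambda>\<omega>. restrict (\<lambda>i. X i \<omega>) {n-1}) -` A2 \<inter> space M = (\<lambda>\<omega>. W t \<omega> - W s \<omega>) -` E \<inter> space M"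
  proof -
    have "X (n-1) \<omega> = W t \<omega> - W s \<omega>" for \<omega> unfolding X_def n1 \<tau>s ..
    then show ?thesis by (auto simp: A2_def space_PiM)
  qed
  let ?D' = "(\<lambda>\<omega>. restrict (\<lambda>i. X i \<omega>) {..<n-1}) -` A1 \<inter> space M"
  \<comment> \<open>The block of increments only sees displacements from \<open>W 0\<close>; this
    event differs from \<open>D\<close> by a null set.\<close>
  have D'eq: "?D' = {\<omega>\<in>space M. \<forall>u\<in>U. W u \<omega> - W 0 \<omega> \<in> B u}"
  proof -
    have "(\<Sum>j<k u. restrict (\<lambda>i. X i \<omega>) {..<n-1} j) = W u \<omega> - W 0 \<omega>" if "u \<in> U" for u \<omega>
    proof -
      have "(\<Sum>j<k u. restrict (\<lambda>i. X i \<omega>) {..<n-1} j) = (\<Sum>j<k u. X j \<omega>)"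
        using k[OF that] by (intro sum.cong) auto
      then show ?thesis using k[OF that] by (simp add: tele)
    qed
    then show ?thesis by (auto simp: A1_def space_PiM)
  qed
  have D'meas: "?D' \<in> sets M"
    using indep_var_rv1[OF ind] A1 by (rule measurable_sets)
  have Dmeas: "D \<in> sets M" unfolding D using U W_measurable
    by (intro sets.finite_INT) (auto intro: measurable_sets)
  have Emeas: "(\<lambda>\<omega>. W t \<omega> - W s \<omega>) -` E \<inter> space M \<in> sets M"
    using W_measurable[of s] W_measurable[of t] s E by (intro measurable_sets[OF _ E]) auto
  have ae: "AE \<omega> in M. \<omega> \<in> D \<longleftrightarrow> \<omega> \<in> ?D'"
    unfolding D'eq using AE_regular AE_space by eventually_elim (use U in \<open>auto simp: D\<close>)
  have p1: "prob D = prob ?D'"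
    by (rule measure_eq_AE[OF ae Dmeas D'meas])
  have p2: "prob (D \<inter> ((\<lambda>\<omega>. W t \<omega> - W s \<omega>) -` E \<inter> space M)) = prob (?D' \<inter> ((\<lambda>\<omega>. W t \<omega> - W s \<omega>) -` E \<inter> space M))"
    by (rule measure_eq_AE) (use ae Dmeas D'meas Emeas in \<open>auto intro!: sets.Int\<close>)
  have "prob (?D' \<inter> ((\<lambda>\<omega>. W t \<omega> - W s \<omega>) -` E \<inter> space M))
     = prob ((\<lambda>\<omega>. (restrict (\<lambda>i. X i \<omega>) {..<n-1}, restrict (\<lambda>i. X i \<omega>) {n-1})) -` (A1 \<times> A2) \<inter> space M)"
    unfolding E2[symmetric] by (rule arg_cong[where f=prob]) auto
  also have "\<dots> = prob ?D' * prob ((\<lambda>\<omega>. W t \<omega> - W s \<omega>) -` E \<inter> space M)"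
    unfolding indep_varD[OF ind A1 A2] E2 ..
  finally show ?thesis using p1 p2 by simp
qed

text \<open>Independence passes from intersection-stable generators, cylinders with null sets on one
  side and events of the increment on the other, to the generated sigma-algebras. The expectation
  then factorises, and the increment contributes its Gaussian exponential moment.\<close>

lemma W_incr_mult:
  assumes s: "0 \<le> s" "s < t" and H: "H \<in> borel_measurable (Fl s)"
  shows "(\<integral>\<^sup>+\<omega>. ennreal (exp (c * (W t \<omega> - W s \<omega>))) * H \<omega> \<partial>M) = ennreal (exp (c\<^sup>2 * (t - s) / 2)) * (\<integral>\<^sup>+\<omega>. H \<omega> \<partial>M)"
proof -
  let ?P = "cyl s \<union> null_sets M"
  let ?D = "\<lambda>\<omega>. W t \<omega> - W s \<omega>"
  let ?Q = "{?D -` E \<inter> space M | E. E \<in> sets borel}"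
  have dist: "distributed M lborel ?D (normal_density 0 (sqrt (t - s)))"
    using BM s by (simp add: brownian_motion_def)
  have Dm [measurable]: "?D \<in> borel_measurable M" using W_measurable[of s] W_measurable[of t] s by auto
  have Psub: "?P \<subseteq> events"
  proof (intro Un_least subsetI)
    fix D assume "D \<in> cyl s"
    then obtain U B where U: "finite U" "U \<noteq> {}" "U \<subseteq> {0..s}" "\<forall>u\<in>U. B u \<in> sets (borel :: real measure)"
      and D: "D = (\<Inter>u\<in>U. W u -` B u \<inter> space M)" unfolding cyl_def by (elim CollectE exE conjE) (rule that)
    show "D \<in> events" unfolding D using U W_measurable
      by (intro sets.finite_INT) (auto intro: measurable_sets)
  qed auto
  have Qsub: "?Q \<subseteq> events" by (auto intro: measurable_sets)
  have ind: "indep_set ?P ?Q"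
    unfolding indep_sets2_eq
  proof (intro conjI Psub Qsub ballI)
    fix D E' assume D: "D \<in> ?P" and "E' \<in> ?Q"
    then obtain E where E: "E \<in> sets borel" "E' = ?D -` E \<inter> space M" by auto
    show "prob (D \<inter> E') = prob D * prob E'"
    proof (cases "D \<in> cyl s")
      case True then show ?thesis unfolding E(2) by (rule cyl_indep[OF s _ E(1)])
    next
      case False
      then have D: "D \<in> null_sets M" using D by simp
      then have "D \<inter> E' \<in> null_sets M" using Qsub \<open>E' \<in> ?Q\<close> by (intro null_set_Int2) auto
      with D show ?thesis by (simp add: measure_eq_0_null_sets)
    qed
  qed
  \<comment> \<open>Intersections with a null set stay null; two genuine cylinders merge over the
    union of their time sets.\<close>
  have PI: "Int_stable ?P"
  proof (rule Int_stableI)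
    fix a b assume a: "a \<in> ?P" and b: "b \<in> ?P"
    show "a \<inter> b \<in> ?P"
    proof (cases "a \<in> null_sets M \<or> b \<in> null_sets M")
      case True
      then have "a \<inter> b \<in> null_sets M" using a b Psub by (auto intro: null_set_Int1 null_set_Int2)
      then show ?thesis by simp
    next
      case False
      then have "a \<in> cyl s" "b \<in> cyl s" using a b by auto
      from this(1) obtain U B where 1: "finite U" "U \<noteq> {}" "U \<subseteq> {0..s}" "\<forall>u\<in>U. B u \<in> sets (borel :: real measure)" "a = (\<Inter>u\<in>U. W u -` B u \<inter> space M)"
        unfolding cyl_def by (elim CollectE exE conjE) (rule that)
      from \<open>b \<in> cyl s\<close> obtain U' B' where 2: "finite U'" "U' \<noteq> {}" "U' \<subseteq> {0..s}" "\<forall>u\<in>U'. B' u \<in> sets (borel :: real measure)" "b = (\<Inter>u\<in>U'. W u -` B' u \<inter> space M)"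
        unfolding cyl_def by (elim CollectE exE conjE) (rule that)
      define C where "C u = (if u \<in> U then B u else UNIV) \<inter> (if u \<in> U' then B' u else UNIV)" for u
      have "a \<inter> b = (\<Inter>u\<in>U\<union>U'. W u -` C u \<inter> space M)"
        unfolding 1 2 C_def using 1(2) 2(2) by (auto split: if_splits)
      moreover have "\<forall>u\<in>U\<union>U'. C u \<in> sets borel" using 1 2 by (auto simp: C_def)
      ultimately have "a \<inter> b \<in> cyl s" unfolding cyl_def using 1 2
        by (intro CollectI exI[of _ "U \<union> U'"] exI[of _ C]) auto
      then show ?thesis by simp
    qed
  qed
  have QI: "Int_stable ?Q"
  proof (rule Int_stableI)
    fix a b assume "a \<in> ?Q" "b \<in> ?Q"
    then obtain E E' where "E \<in> sets borel" "E' \<in> sets borel" "a = ?D -` E \<inter> space M" "b = ?D -` E' \<inter> space M" by auto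
    then show "a \<inter> b \<in> ?Q" by (intro CollectI exI[of _ "E \<inter> E'"]) auto
  qed
  have ind': "indep_set (sigma_sets (space M) ?P) (sigma_sets (space M) ?Q)"
    by (rule indep_set_sigma_sets[OF ind PI QI])
  have FlP: "sets (Fl s) \<subseteq> sigma_sets (space M) ?P"
    unfolding sets_Fl
  proof (rule sigma_sets_subseteq, intro Un_mono subsetI)
    fix x assume "x \<in> {W u -` B \<inter> space M |u B. 0 \<le> u \<and> u \<le> s \<and> B \<in> sets borel}"
    then obtain u B where "x = W u -` B \<inter> space M" "0 \<le> u" "u \<le> s" "B \<in> sets borel" by auto
    then show "x \<in> cyl s" unfolding cyl_def by (intro CollectI exI[of _ "{u}"] exI[of _ "\<lambda>_. B"]) auto
  qed simp
  let ?K = "\<lambda>\<omega>. ennreal (exp (c * ?D \<omega>))"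
  have Hm [measurable]: "H \<in> borel_measurable M" using subalg_Fl H measurable_from_subalg by blast
  have iv: "indep_var borel H borel ?K"
    unfolding indep_var_eq
  proof (intro conjI)
    show "indep_set (sigma_sets (space M) {H -` A \<inter> space M |A. A \<in> sets borel}) (sigma_sets (space M) {?K -` A \<inter> space M |A. A \<in> sets borel})"
    proof -
      have 1: "sigma_sets (space M) {H -` A \<inter> space M |A. A \<in> sets borel} \<subseteq> sigma_sets (space M) ?P"
      proof (rule sigma_sets_mono, rule subsetI)
        fix x assume "x \<in> {H -` A \<inter> space M |A. A \<in> sets borel}"
        then obtain A where "A \<in> sets borel" "x = H -` A \<inter> space (Fl s)" by auto
        then have "x \<in> sets (Fl s)" using measurable_sets[OF H] by simp
        then show "x \<in> sigma_sets (space M) ?P" using FlP by auto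
      qed
      have 2: "sigma_sets (space M) {?K -` A \<inter> space M |A. A \<in> sets borel} \<subseteq> sigma_sets (space M) ?Q"
      proof (rule sigma_sets_subseteq, rule subsetI)
        fix x assume "x \<in> {?K -` A \<inter> space M |A. A \<in> sets borel}"
        then obtain A where A: "A \<in> sets borel" "x = ?K -` A \<inter> space M" by auto
        have "(\<lambda>d. ennreal (exp (c * d))) -` A \<in> sets borel"
          using measurable_sets[of "\<lambda>d. ennreal (exp (c * d))" borel borel A] A by simp
        then show "x \<in> ?Q" using A(2) by (intro CollectI exI[of _ "(\<lambda>d. ennreal (exp (c * d))) -` A"]) auto
      qed
      show ?thesis using ind' 1 2 unfolding indep_sets2_eq by blast
    qed
  qed measurable
  have "indep_vars (\<lambda>_. borel) (case_bool H ?K) UNIV"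
  proof -
    have "case_bool borel borel = (\<lambda>_::bool. borel :: ennreal measure)" by (auto simp: fun_eq_iff split: bool.split)
    then show ?thesis using iv unfolding indep_var_def by simp
  qed
  from indep_vars_nn_integral[OF _ this]
  have "(\<integral>\<^sup>+\<omega>. H \<omega> * ?K \<omega> \<partial>M) = (\<integral>\<^sup>+\<omega>. H \<omega> \<partial>M) * (\<integral>\<^sup>+\<omega>. ?K \<omega> \<partial>M)"
    by (simp add: UNIV_bool mult.commute)
  moreover have "(\<integral>\<^sup>+\<omega>. ?K \<omega> \<partial>M) = ennreal (exp (c\<^sup>2 * (t - s) / 2))"
    using distributed_nn_integral[OF dist, of "\<lambda>x. ennreal (exp (c * x))"] normal_exp_moment[of "t-s" c] s by simp
  ultimately show ?thesis by (simp add: mult.commute)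
qed

lemma exp_martingale_regular: "exp_martingale M Fl (regular_version W)"
proof
  show "subalgebra M (Fl s)" for s by (rule subalg_Fl)
  show "s \<le> t \<Longrightarrow> sets (Fl s) \<subseteq> sets (Fl t)" for s t by (rule Fl_mono)
  show "0 \<le> t \<Longrightarrow> regular_version W t \<in> borel_measurable (Fl t)" for t
    by (rule Fl_AE_eq[OF W_Fl]) (use AE_regular_version in auto)
  show "regular_version W 0 \<omega> = 0" for \<omega> by (simp add: regular_version_def)
  show "continuous_on {0..} (\<lambda>t. regular_version W t \<omega>)" for \<omega>
    by (cases "W 0 \<omega> = 0 \<and> continuous_on {0..} (\<lambda>t. W t \<omega>)") (auto simp: regular_version_def)
  fix s t c :: real and H :: "'a \<Rightarrow> ennreal"
  assume st: "0 \<le> s" "s < t" "H \<in> borel_measurable (Fl s)"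
  have "(\<integral>\<^sup>+\<omega>. ennreal (exp (c * (regular_version W t \<omega> - regular_version W s \<omega>))) * H \<omega> \<partial>M)
     = (\<integral>\<^sup>+\<omega>. ennreal (exp (c * (W t \<omega> - W s \<omega>))) * H \<omega> \<partial>M)"
    by (rule nn_integral_cong_AE) (use AE_regular_version in eventually_elim, simp)
  then show "(\<integral>\<^sup>+\<omega>. ennreal (exp (c * (regular_version W t \<omega> - regular_version W s \<omega>))) * H \<omega> \<partial>M)
     = ennreal (exp (c\<^sup>2 * (t - s) / 2)) * (\<integral>\<^sup>+\<omega>. H \<omega> \<partial>M)"
    using W_incr_mult[OF st] by simp
qed

end

section \<open>Reflection of a continuous path\<close>

definition node :: "real \<Rightarrow> nat \<Rightarrow> nat \<Rightarrow> real" where "node T n i = real i * T / real n"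

text \<open>Index of the cell containing \<open>t\<close>. It is a ceiling minus one because cells
  are open on the left and closed on the right, like the intervals whose Stieltjes mass is an
  increment.\<close>

definition idx :: "real \<Rightarrow> nat \<Rightarrow> real \<Rightarrow> nat" where "idx T n t = nat (\<lceil>t * real n / T\<rceil> - 1)"

lemma node_0 [simp]: "node T n 0 = 0" by (simp add: node_def)
lemma node_n: "0 < n \<Longrightarrow> node T n n = T" by (simp add: node_def)
lemma node_mono: "0 \<le> T \<Longrightarrow> i \<le> j \<Longrightarrow> node T n i \<le> node T n j"
  unfolding node_def by (intro divide_right_mono mult_right_mono) auto
lemma node_nonneg: "0 \<le> T \<Longrightarrow> 0 \<le> node T n i" by (simp add: node_def)
lemma node_Suc: "node T n (Suc i) = node T n i + T / real n" by (simp add: node_def add_divide_distrib distrib_right)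
lemma node_le: "0 \<le> T \<Longrightarrow> i \<le> n \<Longrightarrow> node T n i \<le> T"
  using node_mono[of T i n n] by (cases "n = 0") (auto simp: node_n)

lemma idx_props:
  assumes t: "0 < t" "t \<le> T" and n: "0 < n"
  shows "node T n (idx T n t) < t" "t \<le> node T n (Suc (idx T n t))" "idx T n t < n"
proof -
  have T: "0 < T" using t by simp
  have p: "0 < t * real n / T" using t n T by simp
  then have c: "1 \<le> \<lceil>t * real n / T\<rceil>" by linarith
  then have i: "real (idx T n t) = real_of_int \<lceil>t * real n / T\<rceil> - 1" by (simp add: idx_def)
  have "real_of_int \<lceil>t * real n / T\<rceil> - 1 < t * real n / T" "t * real n / T \<le> real_of_int \<lceil>t * real n / T\<rceil>" by linarith+
  then have "real (idx T n t) < t * real n / T" "t * real n / T \<le> real (Suc (idx T n t))" using i by auto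
  then show 1: "node T n (idx T n t) < t" and 2: "t \<le> node T n (Suc (idx T n t))"
    using T n by (auto simp: node_def field_simps)
  have "real (idx T n t) * T / real n < T" using 1 t unfolding node_def by linarith
  then have "real (idx T n t) < real n" using T n by (simp add: field_simps)
  then show "idx T n t < n" by simp
qed

lemma idx_unique:
  assumes t: "node T n i < t" "t \<le> node T n (Suc i)" and n: "0 < n" and T: "0 < T"
  shows "idx T n t = i"
proof -
  have "real i < t * real n / T" "t * real n / T \<le> real i + 1"
    using t n T by (auto simp: node_def field_simps)
  then have "\<lceil>t * real n / T\<rceil> = int i + 1" by (intro ceiling_unique) auto
  then show ?thesis by (simp add: idx_def)
qed

lemma node_idx_tendsto:
  assumes t: "0 < t" "t \<le> T"
  shows "(\<lambda>n. node T (Suc n) (idx T (Suc n) t)) \<longlonglongrightarrow> t" "(\<lambda>n. node T (Suc n) (Suc (idx T (Suc n) t))) \<longlonglongrightarrow> t"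
proof -
  have lim: "(\<lambda>n. T / real (Suc n)) \<longlonglongrightarrow> 0"
    using tendsto_mult[OF tendsto_const[of T] LIMSEQ_inverse_real_of_nat] by (simp add: divide_inverse)
  have 1: "(\<lambda>n. t - T / real (Suc n)) \<longlonglongrightarrow> t" "(\<lambda>n. t + T / real (Suc n)) \<longlonglongrightarrow> t"
    using tendsto_diff[OF tendsto_const[of t] lim] tendsto_add[OF tendsto_const[of t] lim] by simp_all
  have p: "node T (Suc n) (idx T (Suc n) t) < t" "t \<le> node T (Suc n) (idx T (Suc n) t) + T / real (Suc n)" for n
    using idx_props[OF t, of "Suc n"] by (auto simp: node_Suc)
  show "(\<lambda>n. node T (Suc n) (idx T (Suc n) t)) \<longlonglongrightarrow> t"
  proof (rule tendsto_sandwich[OF _ _ 1(1) tendsto_const[of t]])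
    show "\<forall>\<^sub>F n in sequentially. t - T / real (Suc n) \<le> node T (Suc n) (idx T (Suc n) t)"
      using p(2) by (intro always_eventually allI) (simp add: algebra_simps)
    show "\<forall>\<^sub>F n in sequentially. node T (Suc n) (idx T (Suc n) t) \<le> t"
      using p(1) by (intro always_eventually allI less_imp_le)
  qed
  show "(\<lambda>n. node T (Suc n) (Suc (idx T (Suc n) t))) \<longlonglongrightarrow> t"
  proof (rule tendsto_sandwich[OF _ _ tendsto_const[of t] 1(2)])
    show "\<forall>\<^sub>F n in sequentially. node T (Suc n) (Suc (idx T (Suc n) t)) \<le> t + T / real (Suc n)"
      using p(1) by (intro always_eventually allI) (simp add: node_Suc less_imp_le)
    show "\<forall>\<^sub>F n in sequentially. t \<le> node T (Suc n) (Suc (idx T (Suc n) t))"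
      using p(2) by (intro always_eventually allI) (simp add: node_Suc)
  qed
qed

text \<open>The sum is the integral of the step function \<open>c n (idx T (Suc n) t)\<close>, so
  dominated convergence applies with a constant bound on a set of finite mass. Convergence is asked
  only almost everywhere, which allows coefficients that fail to converge at the jumps of a path
  when \<open>N\<close> is Lebesgue measure.\<close>

lemma riemann_stieltjes_limit:
  fixes N :: "real measure" and F g :: "real \<Rightarrow> real" and c :: "nat \<Rightarrow> nat \<Rightarrow> real"
  assumes N: "sets N = sets borel" and T: "0 < T"
    and F: "\<And>a b. 0 \<le> a \<Longrightarrow> a \<le> b \<Longrightarrow> F a \<le> F b"
    and Ioc: "\<And>a b. 0 \<le> a \<Longrightarrow> a \<le> b \<Longrightarrow> emeasure N {a<..b} = ennreal (F b - F a)"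
    and bd: "\<And>n i. i < Suc n \<Longrightarrow> \<bar>c n i\<bar> \<le> K"
    and lim: "AE t in N. 0 < t \<and> t \<le> T \<longrightarrow> (\<lambda>n. c n (idx T (Suc n) t)) \<longlonglongrightarrow> g t"
    and g: "set_borel_measurable N {0<..T} g"
  shows "(\<lambda>n. \<Sum>i<Suc n. c n i * (F (node T (Suc n) (Suc i)) - F (node T (Suc n) i))) \<longlonglongrightarrow> (LINT t:{0<..T}|N. g t)"
    "set_integrable N {0<..T} g"
proof -
  let ?s = "\<lambda>n t. \<Sum>i<Suc n. c n i * indicator {node T (Suc n) i<..node T (Suc n) (Suc i)} t"
  have step: "?s n t = indicator {0<..T} t * c n (idx T (Suc n) t)" for n t
  proof (cases "t \<in> {0<..T}")
    case True
    then have p: "node T (Suc n) (idx T (Suc n) t) < t" "t \<le> node T (Suc n) (Suc (idx T (Suc n) t))" "idx T (Suc n) t < Suc n"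
      using idx_props[of t T "Suc n"] by auto
    have "?s n t = (\<Sum>i<Suc n. if i = idx T (Suc n) t then c n i else 0)"
    proof (intro sum.cong refl)
      fix i
      have "t \<in> {node T (Suc n) i<..node T (Suc n) (Suc i)} \<longleftrightarrow> i = idx T (Suc n) t"
        using p idx_unique[of T "Suc n" i t] T by auto
      then show "c n i * indicator {node T (Suc n) i<..node T (Suc n) (Suc i)} t = (if i = idx T (Suc n) t then c n i else 0)"
        by (simp add: indicator_def)
    qed
    also have "\<dots> = c n (idx T (Suc n) t)" using p(3) by simp
    finally show ?thesis using True by simp
  next
    case False
    have "t \<notin> {node T (Suc n) i<..node T (Suc n) (Suc i)}" if "i < Suc n" for i
      using False that node_nonneg[of T "Suc n" i] node_le[of T "Suc i" "Suc n"] T by auto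
    then have "?s n t = 0" by (intro sum.neutral ballI) simp
    then show ?thesis using False by simp
  qed
  have integ: "integrable N (indicator {node T (Suc n) i<..node T (Suc n) (Suc i)} :: real \<Rightarrow> real)"
    and intval: "integral\<^sup>L N (indicator {node T (Suc n) i<..node T (Suc n) (Suc i)}) = F (node T (Suc n) (Suc i)) - F (node T (Suc n) i)" for n i
  proof -
    have *: "0 \<le> node T (Suc n) i" "node T (Suc n) i \<le> node T (Suc n) (Suc i)"
      using T by (auto intro: node_mono node_nonneg)
    show "integrable N (indicator {node T (Suc n) i<..node T (Suc n) (Suc i)} :: real \<Rightarrow> real)"
      using N Ioc[OF *] by (intro integrable_real_indicator) auto
    show "integral\<^sup>L N (indicator {node T (Suc n) i<..node T (Suc n) (Suc i)}) = F (node T (Suc n) (Suc i)) - F (node T (Suc n) i)"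
      using N Ioc[OF *] F[OF *] sets_eq_imp_space_eq[OF N] by (simp add: measure_def)
  qed
  have S: "(\<Sum>i<Suc n. c n i * (F (node T (Suc n) (Suc i)) - F (node T (Suc n) i))) = (LINT t|N. indicator {0<..T} t * c n (idx T (Suc n) t))" for n
    unfolding step[symmetric]
    by (subst Bochner_Integration.integral_sum) (simp_all only: integral_mult_right_zero intval integrable_mult_right integ)
  have int_step: "integrable N (\<lambda>t. indicator {0<..T} t * c n (idx T (Suc n) t))" for n
    unfolding step[symmetric] by (intro Bochner_Integration.integrable_sum integrable_mult_right integ)
  have K: "0 \<le> K" using bd[of 0 0] by simp
  have w: "integrable N (\<lambda>t. K * indicator {0<..T} t :: real)"
    using N Ioc[of 0 T] T by (intro integrable_mult_right integrable_real_indicator) auto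
  have dom: "norm (indicator {0<..T} t * c n (idx T (Suc n) t)) \<le> K * indicator {0<..T} t" for n t
  proof (cases "t \<in> {0<..T}")
    case True
    then show ?thesis using bd[of "idx T (Suc n) t" n] idx_props(3)[of t T "Suc n"] by simp
  qed simp
  have ae: "AE t in N. (\<lambda>n. indicator {0<..T} t * c n (idx T (Suc n) t)) \<longlonglongrightarrow> indicator {0<..T} t * g t"
    using lim by eventually_elim (auto simp: indicator_def)
  have gm: "(\<lambda>t. indicator {0<..T} t * g t) \<in> borel_measurable N"
    using g by (simp add: set_borel_measurable_def)
  have sm: "\<And>n. (\<lambda>t. indicator {0<..T} t * c n (idx T (Suc n) t)) \<in> borel_measurable N"
    using int_step by blast
  from integral_dominated_convergence[OF gm sm w ae] dom
  show "(\<lambda>n. \<Sum>i<Suc n. c n i * (F (node T (Suc n) (Suc i)) - F (node T (Suc n) i))) \<longlonglongrightarrow> (LINT t:{0<..T}|N. g t)"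
    unfolding S set_lebesgue_integral_def by simp
  from integrable_dominated_convergence[OF gm sm w ae] dom
  show "set_integrable N {0<..T} g" unfolding set_integrable_def by simp
qed

section \<open>The Skorokhod map: continuity, support and uniqueness\<close>

definition refl :: "real \<Rightarrow> (real \<Rightarrow> real) \<Rightarrow> real \<Rightarrow> real" where
  "refl b y t = (SUP s\<in>{0..t}. max 0 (b - y s))"

locale reflection =
  fixes b :: real and y :: "real \<Rightarrow> real"
  assumes y_cont: "continuous_on {0..} y" and y0: "b \<le> y 0"
begin

abbreviation "k s \<equiv> max 0 (b - y s)"
abbreviation "l \<equiv> refl b y"

lemma k_cont: "continuous_on {0..} (\<lambda>s. k s)"
  by (intro continuous_intros y_cont)

lemma l_attained: assumes "0 \<le> t" shows "\<exists>s\<in>{0..t}. l t = k s \<and> (\<forall>u\<in>{0..t}. k u \<le> k s)"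
proof -
  have "\<exists>s\<in>{0..t}. \<forall>u\<in>{0..t}. k u \<le> k s"
    using assms by (intro continuous_attains_sup continuous_on_subset[OF k_cont]) auto
  then obtain s where s: "s \<in> {0..t}" "\<forall>u\<in>{0..t}. k u \<le> k s" by blast
  have "l t = k s" unfolding refl_def by (rule cSup_eq_maximum) (use s in auto)
  then show ?thesis using s by blast
qed

lemma l_upper: "0 \<le> s \<Longrightarrow> s \<le> t \<Longrightarrow> k s \<le> l t"
  using l_attained[of t] by (metis atLeastAtMost_iff order_trans)

lemma l_ge: "0 \<le> t \<Longrightarrow> b - y t \<le> l t" using l_upper[of t t] by simp

lemma l_nonneg: "0 \<le> t \<Longrightarrow> 0 \<le> l t" using l_upper[of t t] by simp

lemma l_mono: "0 \<le> s \<Longrightarrow> s \<le> t \<Longrightarrow> l s \<le> l t"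
  using l_attained[of s] l_upper[of _ t] by force

lemma l_0: "l 0 = 0" using l_attained[of 0] y0 by auto

text \<open>A new maximum of the deficit is reached inside the interval on which \<open>l\<close>
  grows. All statements about where \<open>l\<close> increases come from this.\<close>

lemma l_increase:
  assumes "0 \<le> s" "s \<le> t" "l s < l t"
  shows "\<exists>u\<in>{s..t}. l t = b - y u"
proof -
  obtain u where u: "u \<in> {0..t}" "l t = k u" using l_attained[of t] assms by auto
  have "s \<le> u" using l_upper[of u s] u assms by (cases "s \<le> u") auto
  moreover have "l t = b - y u" using u assms l_nonneg[of s] by (auto simp: max_def split: if_splits)
  ultimately show ?thesis using u by auto
qed

lemma l_cont: "continuous_on {0..} l"
  unfolding continuous_on_iff
proof (intro ballI allI impI)
  fix t e :: real assume t: "t \<in> {0..}" and e: "0 < e"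
  obtain d where d: "0 < d" "\<And>s. s \<in> {0..} \<Longrightarrow> dist s t < d \<Longrightarrow> dist (k s) (k t) < e / 2"
    using k_cont t e unfolding continuous_on_iff by (meson half_gt_zero)
  \<comment> \<open>The inequality and the disequality together say \<open>l v < l u + e\<close>. If
    \<open>l\<close> grows between \<open>u\<close> and \<open>v\<close>, its new value is the
    deficit at a point that is still close to \<open>t\<close>.\<close>
  have *: "l v \<le> l u + e / 2 + e / 2 \<and> l v \<noteq> l u + e" if uv: "0 \<le> u" "u \<le> v" "\<bar>u - t\<bar> < d" "\<bar>v - t\<bar> < d" for u v
  proof (cases "l u < l v")
    case True
    then obtain w where w: "w \<in> {u..v}" "l v = b - y w" using l_increase[of u v] uv by auto
    have "0 \<le> l v" using l_nonneg uv by simp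
    then have "l v = k w" using w by simp
    have "\<bar>w - t\<bar> < d" using w uv by auto
    then have "\<bar>k w - k t\<bar> < e/2" using d(2)[of w] w uv by (auto simp: dist_real_def)
    moreover have "\<bar>k u - k t\<bar> < e/2" using d(2)[of u] uv by (auto simp: dist_real_def)
    moreover have "k u \<le> l u" using l_upper[of u u] uv by simp
    ultimately show ?thesis using \<open>l v = k w\<close> by linarith
  next
    case False then show ?thesis using e by auto
  qed
  show "\<exists>d>0. \<forall>x'\<in>{0..}. dist x' t < d \<longrightarrow> dist (l x') (l t) < e"
  proof (intro exI[of _ d] conjI ballI impI d(1))
    fix x assume x: "x \<in> {0..}" "dist x t < d"
    show "dist (l x) (l t) < e"
    proof (cases "x \<le> t")
      case True
      then show ?thesis using *[of x t] l_mono[of x t] x d(1) by (auto simp: dist_real_def)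
    next
      case False
      then show ?thesis using *[of t x] l_mono[of t x] x t d(1) by (auto simp: dist_real_def)
    qed
  qed
qed

text \<open>As a function of \<open>exp w\<close>, the quantity \<open>exp (s * w)\<close> has slope
  \<open>s * exp ((s - 1) * w)\<close>, which within distance \<open>\<epsilon>\<close> of
  \<open>b\<close> deviates from its value at \<open>b\<close> by the stated relative error. Adding
  or subtracting the difference to that multiple of \<open>exp w\<close> gives two nondecreasing
  functions.\<close>

lemma exp_increment_bound:
  fixes s \<epsilon> u v :: real
  assumes uv: "u \<le> v" "b - \<epsilon> \<le> u" "v \<le> b + \<epsilon>"
  shows "\<bar>exp (s * v) - exp (s * u) - s * exp ((s - 1) * b) * (exp v - exp u)\<bar>
     \<le> \<bar>s\<bar> * exp ((s - 1) * b) * (exp (\<bar>s - 1\<bar> * \<epsilon>) - 1) * (exp v - exp u)"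
proof -
  let ?C = "\<bar>s\<bar> * exp ((s - 1) * b) * (exp (\<bar>s - 1\<bar> * \<epsilon>) - 1)"
  let ?g = "\<lambda>w. exp (s * w) - s * exp ((s - 1) * b) * exp w"
  let ?g' = "\<lambda>w. s * exp w * (exp ((s - 1) * w) - exp ((s - 1) * b))"
  have D: "(?g has_real_derivative ?g' w) (at w)" for w
  proof -
    have "exp (s * w) = exp w * exp ((s - 1) * w)" by (simp add: exp_add[symmetric] algebra_simps)
    then show ?thesis by (auto intro!: derivative_eq_intros simp: algebra_simps)
  qed
  have b: "\<bar>?g' w\<bar> \<le> ?C * exp w" if w: "u \<le> w" "w \<le> v" for w
  proof -
    let ?\<theta> = "(s - 1) * (w - b)"
    have th: "\<bar>?\<theta>\<bar> \<le> \<bar>s - 1\<bar> * \<epsilon>" unfolding abs_mult using w uv by (intro mult_left_mono) auto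
    have "\<bar>exp ?\<theta> - 1\<bar> \<le> exp \<bar>?\<theta>\<bar> - 1"
    proof (cases "0 \<le> ?\<theta>")
      case False
      have "2 \<le> exp ?\<theta> + exp (- ?\<theta>)"
        using exp_ge_add_one_self[of ?\<theta>] exp_ge_add_one_self[of "- ?\<theta>"] by linarith
      moreover have "exp ?\<theta> < 1" using False by simp
      moreover have "\<bar>?\<theta>\<bar> = - ?\<theta>" using False by linarith
      ultimately show ?thesis by simp
    qed simp
    also have "\<dots> \<le> exp (\<bar>s - 1\<bar> * \<epsilon>) - 1" using th by simp
    finally have 1: "\<bar>exp ?\<theta> - 1\<bar> \<le> exp (\<bar>s - 1\<bar> * \<epsilon>) - 1" .
    have "exp ((s - 1) * w) - exp ((s - 1) * b) = exp ((s - 1) * b) * (exp ?\<theta> - 1)"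
      by (simp add: right_diff_distrib exp_add[symmetric])
    then have "\<bar>?g' w\<bar> = \<bar>s\<bar> * exp w * exp ((s - 1) * b) * \<bar>exp ?\<theta> - 1\<bar>" by (simp add: abs_mult)
    also have "\<dots> \<le> \<bar>s\<bar> * exp w * exp ((s - 1) * b) * (exp (\<bar>s - 1\<bar> * \<epsilon>) - 1)"
      using 1 by (intro mult_left_mono) auto
    finally show ?thesis by (simp add: mult_ac)
  qed
  have 1: "?C * exp u - ?g u \<le> ?C * exp v - ?g v"
  proof (rule DERIV_nonneg_imp_nondecreasing[OF uv(1)])
    fix w assume w: "u \<le> w" "w \<le> v"
    have "((\<lambda>w. ?C * exp w - ?g w) has_real_derivative ?C * exp w - ?g' w) (at w)"
      by (intro DERIV_diff D DERIV_cmult DERIV_exp)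
    then show "\<exists>y. ((\<lambda>w. ?C * exp w - ?g w) has_real_derivative y) (at w) \<and> 0 \<le> y"
      using b[OF w] by (intro exI[of _ "?C * exp w - ?g' w"] conjI) linarith+
  qed
  have 2: "?C * exp u + ?g u \<le> ?C * exp v + ?g v"
  proof (rule DERIV_nonneg_imp_nondecreasing[OF uv(1)])
    fix w assume w: "u \<le> w" "w \<le> v"
    have "((\<lambda>w. ?C * exp w + ?g w) has_real_derivative ?C * exp w + ?g' w) (at w)"
      by (intro DERIV_add D DERIV_cmult DERIV_exp)
    then show "\<exists>y. ((\<lambda>w. ?C * exp w + ?g w) has_real_derivative y) (at w) \<and> 0 \<le> y"
      using b[OF w] by (intro exI[of _ "?C * exp w + ?g' w"] conjI) linarith+
  qed
  have "\<bar>?g v - ?g u\<bar> \<le> ?C * exp v - ?C * exp u" using 1 2 by linarith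
  also have "?g v - ?g u = exp (s * v) - exp (s * u) - s * exp ((s - 1) * b) * (exp v - exp u)" by (simp add: algebra_simps)
  finally show ?thesis by (simp add: right_diff_distrib)
qed

lemma l_path: "control_path l"
proof
  show "0 \<le> l t" if "0 \<le> t" for t by (rule l_nonneg[OF that])
  show "mono_on {0..} l" by (auto simp: mono_on_def l_mono)
  have lim: "(l \<longlongrightarrow> l t) (at t within {0..})" if "0 \<le> t" for t
    using l_cont that by (simp add: continuous_on_def)
  show "cadlag l"
    unfolding cadlag_def
  proof (intro conjI allI impI)
    fix t :: real assume t: "0 \<le> t"
    have "(l \<longlongrightarrow> l t) (at_right t)" by (rule tendsto_within_subset[OF lim[OF t]]) (use t in auto)
    then show "continuous (at_right t) l" by (simp add: continuous_within)
  next
    fix t :: real assume t: "0 < t"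
    have "(l \<longlongrightarrow> l t) (at t)" using lim[of t] t at_within_interior[of t "{0..}"] by simp
    then have "(l \<longlongrightarrow> l t) (at_left t)" by (simp only: filterlim_at_split)
    then show "\<exists>c. (l \<longlongrightarrow> c) (at_left t)" by blast
  qed
qed

lemma exp_l_path: "control_path (\<lambda>t. exp (l t) - 1)"
proof -
  interpret L: control_path l by (rule l_path)
  show ?thesis by (rule L.exp_path)
qed

text \<open>Chain rule for powers of \<open>exp l\<close> on the support of its increase. A cell
  contributes only if \<open>l\<close> grows in it; then \<open>y + l\<close> is as close to
  \<open>b\<close> as \<open>y\<close> oscillates, and the increment of \<open>exp (s * l)\<close>
  is that of \<open>exp l\<close> times \<open>s * exp ((s - 1) * b) * exp ((1 - s) * y)\<close> up
  to a small relative error. The errors telescope to a multiple of \<open>exp (l T) - 1\<close>.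
  Evaluation at right endpoints is the reason for asking right continuity of
  \<open>G\<close>.\<close>

lemma stieltjes_exp_l_limit:
  assumes T: "0 < T" and K: "\<And>t. 0 \<le> t \<Longrightarrow> t \<le> T \<Longrightarrow> \<bar>G t\<bar> \<le> K"
    and right: "\<And>t. 0 \<le> t \<Longrightarrow> (G \<longlongrightarrow> G t) (at_right t)"
    and Gm: "set_borel_measurable borel {0<..T} G"
  shows "(\<lambda>n. \<Sum>i<Suc n. G (node T (Suc n) (Suc i)) * (exp (s * l (node T (Suc n) (Suc i))) - exp (s * l (node T (Suc n) i))))
    \<longlonglongrightarrow> s * exp ((s - 1) * b) * (LINT t:{0<..T}|control_measure (\<lambda>t. exp (l t) - 1). G t * exp ((1 - s) * y t))"
proof -
  interpret L: control_path "\<lambda>t. exp (l t) - 1" by (rule exp_l_path)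
  define nd where "nd n i = node T (Suc n) i" for n i
  have nd: "0 \<le> nd n i" "nd n i \<le> nd n (Suc i)" "i \<le> Suc n \<Longrightarrow> nd n i \<le> T" for n i
    using T by (auto simp: nd_def node_nonneg node_mono node_le)
  have "continuous_on {0..T} y" by (rule continuous_on_subset[OF y_cont]) auto
  then have uc: "uniformly_continuous_on {0..T} y" by (rule compact_uniformly_continuous) simp
  have "\<exists>Ky. \<forall>t\<in>{0..T}. exp ((1 - s) * y t) \<le> Ky"
  proof -
    have "continuous_on {0..T} (\<lambda>t. exp ((1 - s) * y t))"
      by (intro continuous_intros continuous_on_subset[OF y_cont]) auto
    from continuous_attains_sup[OF _ _ this] T show ?thesis by auto
  qed
  then obtain Ky where "\<forall>t\<in>{0..T}. exp ((1 - s) * y t) \<le> Ky" by blast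
  then have Ky: "\<And>t. 0 \<le> t \<Longrightarrow> t \<le> T \<Longrightarrow> exp ((1 - s) * y t) \<le> Ky" by simp
  have Kn: "0 \<le> K" "0 \<le> Ky" using K[of 0] Ky[of 0] T by (auto intro: order_trans[OF abs_ge_zero] order_trans[OF exp_ge_zero])
  define c where "c n i = G (nd n (Suc i)) * exp ((1 - s) * y (nd n (Suc i)))" for n i
  let ?\<mu> = "control_measure (\<lambda>t. exp (l t) - 1)"
  have R: "(\<lambda>n. \<Sum>i<Suc n. c n i * ((exp (l (node T (Suc n) (Suc i))) - 1) - (exp (l (node T (Suc n) i)) - 1)))
      \<longlonglongrightarrow> (LINT t:{0<..T}|?\<mu>. G t * exp ((1 - s) * y t))"
  proof (rule riemann_stieltjes_limit(1)[OF _ T, where K="K * Ky"])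
    show "sets ?\<mu> = sets borel" by (simp add: L.control_measure_eq)
    show "exp (l u) - 1 \<le> exp (l v) - 1" if "0 \<le> u" "u \<le> v" for u v using that by (simp add: l_mono)
    show "emeasure ?\<mu> {u<..v} = ennreal (exp (l v) - 1 - (exp (l u) - 1))" if "0 \<le> u" "u \<le> v" for u v
      using that by (simp add: L.control_measure_eq L.emeasure_Ioc L.F_def)
    show "\<bar>c n i\<bar> \<le> K * Ky" if "i < Suc n" for n i
      unfolding c_def abs_mult using nd(1)[of n "Suc i"] nd(3)[of "Suc i" n] that Kn by (intro mult_mono) (auto simp: K Ky)
    show "AE t in ?\<mu>. 0 < t \<and> t \<le> T \<longrightarrow> (\<lambda>n. c n (idx T (Suc n) t)) \<longlonglongrightarrow> G t * exp ((1 - s) * y t)"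
    proof (intro AE_I2 impI)
      fix t assume t: "0 < t \<and> t \<le> T"
      let ?v = "\<lambda>n. nd n (Suc (idx T (Suc n) t))"
      have v: "?v \<longlonglongrightarrow> t" using node_idx_tendsto(2)[of t T] t by (simp add: nd_def)
      have ge: "t \<le> ?v n" for n using idx_props(2)[of t T "Suc n"] t by (simp add: nd_def)
      have "(\<lambda>n. y (?v n)) \<longlonglongrightarrow> y t"
        by (rule continuous_on_tendsto_compose[OF y_cont v]) (use t nd in auto)
      moreover have "(\<lambda>n. G (?v n)) \<longlonglongrightarrow> G t"
      proof -
        have "(G \<longlongrightarrow> G t) (at t within {t..})"
        proof -
          have "at t within {t..} = at t within {t<..}"
          proof -
            have "{t..} - {t} = {t<..} - {t}" by auto
            then show ?thesis unfolding at_within_def by (simp only:)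
          qed
          then show ?thesis using right[of t] t by simp
        qed
        then have "continuous (at t within {t..}) G" by (simp add: continuous_within)
        then show ?thesis using continuous_within_sequentiallyI[of t "{t..}" G] v ge
          unfolding continuous_within_sequentially by (auto simp: comp_def)
      qed
      ultimately show "(\<lambda>n. c n (idx T (Suc n) t)) \<longlonglongrightarrow> G t * exp ((1 - s) * y t)"
        unfolding c_def by (intro tendsto_intros)
    qed
    have "(\<lambda>t. if t \<in> {0..} then exp ((1 - s) * y t) else 0) \<in> borel_measurable borel"
      by (rule borel_measurable_continuous_on_if) (auto intro!: continuous_intros y_cont)
    then have "(\<lambda>t. (indicator {0<..T} t *\<^sub>R G t) * (if t \<in> {0..} then exp ((1 - s) * y t) else 0)) \<in> borel_measurable borel"
      using Gm unfolding set_borel_measurable_def by measurable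
    also have "(\<lambda>t. (indicator {0<..T} t *\<^sub>R G t) * (if t \<in> {0..} then exp ((1 - s) * y t) else 0))
       = (\<lambda>t. indicator {0<..T} t *\<^sub>R (G t * exp ((1 - s) * y t)))" by (auto simp: indicator_def)
    finally show "set_borel_measurable ?\<mu> {0<..T} (\<lambda>t. G t * exp ((1 - s) * y t))"
      unfolding set_borel_measurable_def by (simp add: L.control_measure_eq)
  qed
  define S where "S n = (\<Sum>i<Suc n. G (nd n (Suc i)) * (exp (s * l (nd n (Suc i))) - exp (s * l (nd n i))))" for n
  define R' where "R' n = (\<Sum>i<Suc n. c n i * (exp (l (nd n (Suc i))) - exp (l (nd n i))))" for n
  let ?c = "s * exp ((s - 1) * b)"
  let ?L = "exp (l T) - 1"
  have bound: "\<bar>S n - ?c * R' n\<bar> \<le> K * Ky * (\<bar>s\<bar> * exp ((s - 1) * b) * (exp (\<bar>s - 1\<bar> * \<epsilon>) - 1)) * ?L"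
    if \<epsilon>: "0 \<le> \<epsilon>" "\<And>u v. u \<in> {0..T} \<Longrightarrow> v \<in> {0..T} \<Longrightarrow> \<bar>u - v\<bar> \<le> T / real (Suc n) \<Longrightarrow> \<bar>y u - y v\<bar> \<le> \<epsilon>" for n \<epsilon>
  proof -
    let ?C = "\<bar>s\<bar> * exp ((s - 1) * b) * (exp (\<bar>s - 1\<bar> * \<epsilon>) - 1)"
    have C: "0 \<le> ?C" using \<epsilon>(1) by auto
    have summand: "\<bar>G (nd n (Suc i)) * (exp (s * l (nd n (Suc i))) - exp (s * l (nd n i))) - ?c * (c n i * (exp (l (nd n (Suc i))) - exp (l (nd n i))))\<bar>
       \<le> K * Ky * ?C * (exp (l (nd n (Suc i))) - exp (l (nd n i)))" if i: "i < Suc n" for i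
    proof -
      define t1 t2 where "t1 = nd n i" and "t2 = nd n (Suc i)"
      have t: "0 \<le> t1" "t1 \<le> t2" "t2 \<le> T" "t2 - t1 = T / real (Suc n)"
        using nd[of n i] nd(3)[of "Suc i" n] i by (auto simp: t1_def t2_def) (simp add: nd_def node_Suc)
      \<comment> \<open>The same \<open>y t2\<close> enters both values, so between \<open>u\<close>
        and \<open>v\<close> only \<open>l\<close> changes.\<close>
      define u v where "u = y t2 + l t1" and "v = y t2 + l t2"
      have uv: "u \<le> v" using l_mono[of t1 t2] t by (simp add: u_def v_def)
      have key: "\<bar>exp (s * v) - exp (s * u) - ?c * (exp v - exp u)\<bar> \<le> ?C * (exp v - exp u)"
      proof (cases "u = v")
        case False
        then have "l t1 < l t2" using uv by (simp add: u_def v_def)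
        then obtain w where w: "w \<in> {t1..t2}" "l t2 = b - y w" using l_increase[of t1 t2] t by auto
        have "\<bar>y t2 - y w\<bar> \<le> \<epsilon>" using w t by (intro \<epsilon>(2)) auto
        then have v: "v \<le> b + \<epsilon>" using w by (simp add: v_def)
        have "\<bar>y t2 - y t1\<bar> \<le> \<epsilon>" using t by (intro \<epsilon>(2)) auto
        then have u: "b - \<epsilon> \<le> u" using l_ge[of t1] t by (simp add: u_def)
        show ?thesis by (rule exp_increment_bound[OF uv u v])
      qed simp
      have e1: "exp (s * l t2) - exp (s * l t1) = exp (- s * y t2) * (exp (s * v) - exp (s * u))"
        by (simp add: u_def v_def right_diff_distrib exp_add[symmetric] distrib_left)
      have e2: "exp ((1 - s) * y t2) * (exp (l t2) - exp (l t1)) = exp (- s * y t2) * (exp v - exp u)"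
        by (simp only: u_def v_def right_diff_distrib[of "exp _"] exp_add[symmetric]) (simp add: algebra_simps)
      have "G t2 * (exp (s * l t2) - exp (s * l t1)) - ?c * (G t2 * exp ((1 - s) * y t2) * (exp (l t2) - exp (l t1)))
        = G t2 * exp (- s * y t2) * (exp (s * v) - exp (s * u)) - ?c * (G t2 * (exp (- s * y t2) * (exp v - exp u)))"
        unfolding e1 e2[symmetric] by (simp only: mult.assoc)
      also have "\<dots> = G t2 * exp (- s * y t2) * (exp (s * v) - exp (s * u) - ?c * (exp v - exp u))"
        by (simp add: algebra_simps)
      also have "\<bar>\<dots>\<bar> \<le> \<bar>G t2\<bar> * exp (- s * y t2) * (?C * (exp v - exp u))"
        unfolding abs_mult[of "G t2 * exp (- s * y t2)"] abs_mult[of "G t2"] using key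
        by (intro mult_mono mult_left_mono) auto
      also have "\<dots> = \<bar>G t2\<bar> * exp ((1 - s) * y t2) * (?C * (exp (l t2) - exp (l t1)))"
      proof -
        have "\<bar>G t2\<bar> * exp (- s * y t2) * (?C * (exp v - exp u)) = \<bar>G t2\<bar> * ?C * (exp (- s * y t2) * (exp v - exp u))"
          by (simp only: mult_ac)
        also have "\<dots> = \<bar>G t2\<bar> * ?C * (exp ((1 - s) * y t2) * (exp (l t2) - exp (l t1)))" by (simp only: e2)
        finally show ?thesis by (simp only: mult_ac)
      qed
      also have "\<dots> \<le> K * Ky * (?C * (exp (l t2) - exp (l t1)))"
      proof (rule mult_right_mono)
        show "\<bar>G t2\<bar> * exp ((1 - s) * y t2) \<le> K * Ky" using t Kn by (intro mult_mono) (auto simp: K Ky)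
        show "0 \<le> ?C * (exp (l t2) - exp (l t1))" using t by (intro mult_nonneg_nonneg[OF C]) (simp add: l_mono)
      qed
      finally show ?thesis unfolding t1_def t2_def c_def by (simp only: mult_ac)
    qed
    have "\<bar>S n - ?c * R' n\<bar> \<le> (\<Sum>i<Suc n. \<bar>G (nd n (Suc i)) * (exp (s * l (nd n (Suc i))) - exp (s * l (nd n i))) - ?c * (c n i * (exp (l (nd n (Suc i))) - exp (l (nd n i))))\<bar>)"
      unfolding S_def R'_def sum_distrib_left sum_subtractf[symmetric] by (rule sum_abs)
    also have "\<dots> \<le> (\<Sum>i<Suc n. K * Ky * ?C * (exp (l (nd n (Suc i))) - exp (l (nd n i))))"
      by (rule sum_mono) (rule summand, simp)
    also have "\<dots> = K * Ky * ?C * (exp (l (nd n (Suc n))) - exp (l (nd n 0)))"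
      unfolding sum_distrib_left[symmetric] by (subst sum_lessThan_telescope) simp
    also have "\<dots> = K * Ky * ?C * ?L" by (simp add: nd_def node_n l_0)
    finally show ?thesis .
  qed
  \<comment> \<open>The tolerance \<open>\<epsilon>\<close> comes from continuity of the error bound
    at 0, and the mesh then comes from uniform continuity of \<open>y\<close>.\<close>
  have diff: "(\<lambda>n. S n - ?c * R' n) \<longlonglongrightarrow> 0"
  proof (rule LIMSEQ_I)
    fix \<eta> :: real assume \<eta>: "0 < \<eta>"
    have "((\<lambda>\<epsilon>. K * Ky * (\<bar>s\<bar> * exp ((s - 1) * b) * (exp (\<bar>s - 1\<bar> * \<epsilon>) - 1)) * ?L)
        \<longlongrightarrow> K * Ky * (\<bar>s\<bar> * exp ((s - 1) * b) * (exp (\<bar>s - 1\<bar> * 0) - 1)) * ?L) (at_right 0)"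
      by (intro tendsto_intros)
    then have "eventually (\<lambda>\<epsilon>. K * Ky * (\<bar>s\<bar> * exp ((s - 1) * b) * (exp (\<bar>s - 1\<bar> * \<epsilon>) - 1)) * ?L < \<eta>) (at_right 0)"
      by (rule order_tendstoD) (use \<eta> in simp)
    then obtain e where e: "e > 0" "\<And>\<epsilon>. 0 < \<epsilon> \<Longrightarrow> \<epsilon> < e \<Longrightarrow> K * Ky * (\<bar>s\<bar> * exp ((s - 1) * b) * (exp (\<bar>s - 1\<bar> * \<epsilon>) - 1)) * ?L < \<eta>"
      by (auto simp: eventually_at_right_field)
    define \<epsilon> where "\<epsilon> = e / 2"
    have \<epsilon>: "0 < \<epsilon>" "\<epsilon> < e" using e(1) by (auto simp: \<epsilon>_def)
    obtain d where d: "0 < d" "\<And>u v. u \<in> {0..T} \<Longrightarrow> v \<in> {0..T} \<Longrightarrow> dist v u < d \<Longrightarrow> dist (y v) (y u) < \<epsilon>"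
      using uc \<epsilon>(1) unfolding uniformly_continuous_on_def by metis
    have "(\<lambda>n. T / real (Suc n)) \<longlonglongrightarrow> 0"
      using tendsto_mult[OF tendsto_const[of T] LIMSEQ_inverse_real_of_nat] by (simp add: divide_inverse)
    then have "eventually (\<lambda>n. T / real (Suc n) < d) sequentially" by (rule order_tendstoD) (rule d(1))
    then obtain n0 where n0: "\<And>n. n0 \<le> n \<Longrightarrow> T / real (Suc n) < d" by (auto simp: eventually_sequentially)
    show "\<exists>n0. \<forall>n\<ge>n0. norm (S n - ?c * R' n - 0) < \<eta>"
    proof (intro exI[of _ n0] allI impI)
      fix n assume n: "n0 \<le> n"
      have "\<bar>S n - ?c * R' n\<bar> \<le> K * Ky * (\<bar>s\<bar> * exp ((s - 1) * b) * (exp (\<bar>s - 1\<bar> * \<epsilon>) - 1)) * ?L"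
      proof (rule bound)
        fix u v assume uv: "u \<in> {0..T}" "v \<in> {0..T}" "\<bar>u - v\<bar> \<le> T / real (Suc n)"
        then have "dist (y u) (y v) < \<epsilon>" using n0[OF n] by (intro d(2)) (auto simp: dist_real_def)
        then show "\<bar>y u - y v\<bar> \<le> \<epsilon>" by (simp add: dist_real_def)
      qed (use \<epsilon> in simp)
      also have "\<dots> < \<eta>" by (rule e(2)[OF \<epsilon>])
      finally show "norm (S n - ?c * R' n - 0) < \<eta>" by simp
    qed
  qed
  have "R' \<longlonglongrightarrow> (LINT t:{0<..T}|?\<mu>. G t * exp ((1 - s) * y t))"
    using R by (simp add: R'_def[abs_def] nd_def)
  then have "(\<lambda>n. (S n - ?c * R' n) + ?c * R' n) \<longlonglongrightarrow> 0 + ?c * (LINT t:{0<..T}|?\<mu>. G t * exp ((1 - s) * y t))"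
    by (intro tendsto_add diff tendsto_mult tendsto_const)
  then show ?thesis by (simp add: S_def[abs_def] nd_def)
qed

lemma y_measurable: "(\<lambda>t. if 0 \<le> t then y t else 0) \<in> borel_measurable borel"
proof -
  have "(\<lambda>t. if t \<in> {0..} then y t else 0) \<in> borel_measurable borel"
    by (rule borel_measurable_continuous_on_if) (auto intro!: continuous_intros y_cont)
  then show ?thesis by simp
qed

text \<open>Apart from 0, the set is covered by countably many rational intervals lying in it. On
  each of them \<open>l\<close> is constant, since growth would force \<open>y + l \<le> b\<close>
  somewhere in the interval. There is no atom at 0 because \<open>l 0 = 0\<close>.\<close>

lemma l_support: "emeasure (control_measure l) {t \<in> {0..}. b < y t + l t} = 0"
proof -
  interpret L: control_path l by (rule l_path)
  let ?O = "{t \<in> {0..}. b < y t + l t}"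
  let ?I = "{(p, q). p \<in> \<rat> \<and> q \<in> \<rat> \<and> 0 \<le> p \<and> p \<le> q \<and> {p..q} \<subseteq> ?O}"
  let ?U = "insert 0 (\<Union>(p,q)\<in>?I. {p<..q::real})"
  have "?O \<subseteq> ?U"
  proof
    fix t assume t: "t \<in> ?O"
    show "t \<in> ?U"
    proof (cases "t = 0")
      case False
      then have t0: "0 < t" using t by simp
      have "continuous_on {0..} (\<lambda>t. y t + l t)" by (intro continuous_intros y_cont l_cont)
      then have "((\<lambda>t. y t + l t) \<longlongrightarrow> y t + l t) (at t within {0..})" using t0 by (simp add: continuous_on_def)
      then have "((\<lambda>t. y t + l t) \<longlongrightarrow> y t + l t) (at t)" using t0 at_within_interior[of t "{0..}"] by simp
      then have "eventually (\<lambda>s. b < y s + l s) (at t)" by (rule order_tendstoD) (use t in simp)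
      then obtain d where d: "0 < d" "\<And>s. s \<noteq> t \<Longrightarrow> dist s t < d \<Longrightarrow> b < y s + l s"
        by (auto simp: eventually_at)
      have "max 0 (t - d) < t" using t0 d by auto
      then obtain p where p: "p \<in> \<rat>" "max 0 (t - d) < p" "p < t" using Rats_dense_in_real by blast
      have "t < t + d" using d by simp
      then obtain q where q: "q \<in> \<rat>" "t < q" "q < t + d" using Rats_dense_in_real by blast
      have "{p..q} \<subseteq> ?O"
      proof
        fix s assume s: "s \<in> {p..q}"
        then have "\<bar>s - t\<bar> < d" using p q by auto
        then have "b < y s + l s" using d(2)[of s] t by (cases "s = t") (auto simp: dist_real_def)
        then show "s \<in> ?O" using s p by auto
      qed
      then have "(p, q) \<in> ?I" using p q by auto
      moreover have "t \<in> {p<..q}" using p q by auto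
      ultimately show ?thesis by blast
    qed simp
  qed
  moreover have "?U \<in> null_sets (control_measure l)"
  proof -
    have 0: "{0} \<in> null_sets (control_measure l)"
      using L.emeasure_singleton[of 0] by (simp add: null_sets_def L.control_measure_eq jump_def left_lim_def l_0)
    have "(\<Union>(p,q)\<in>?I. {p<..q}) \<in> null_sets (control_measure l)"
    proof (rule null_sets_UN')
      have "?I \<subseteq> \<rat> \<times> \<rat>" by auto
      then show "countable ?I" by (rule countable_subset) (simp add: countable_rat)
      fix x assume "x \<in> ?I"
      then obtain p q where pq: "x = (p, q)" "0 \<le> p" "p \<le> q" "{p..q} \<subseteq> ?O" by auto
      have "l p = l q"
      proof (rule ccontr)
        assume "l p \<noteq> l q"
        then have "l p < l q" using l_mono[of p q] pq by simp
        then obtain u where u: "u \<in> {p..q}" "l q = b - y u" using l_increase[of p q] pq by auto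
        then have "b < y u + l u" using pq by auto
        moreover have "l u \<le> l q" using l_mono[of u q] u pq by auto
        ultimately show False using u by simp
      qed
      then show "(case x of (p, q) \<Rightarrow> {p<..q}) \<in> null_sets (control_measure l)"
        using pq by (simp add: null_sets_def L.control_measure_eq L.emeasure_Ioc L.F_def)
    qed
    with 0 have "{0} \<union> (\<Union>(p,q)\<in>?I. {p<..q}) \<in> null_sets (control_measure l)" by (rule null_sets.Un)
    then show ?thesis by simp
  qed
  ultimately have "emeasure (control_measure l) ?O \<le> emeasure (control_measure l) ?U"
    by (intro emeasure_mono null_setsD2)
  also have "\<dots> = 0" by (rule null_setsD1) fact
  finally show ?thesis by simp
qed

text \<open>A nondecreasing \<open>f\<close> that repairs the deficit dominates its running maximum.
  Conversely \<open>f t\<close> is the mass of \<open>{0..t}\<close>; up to a null set this mass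
  sits where \<open>y + f \<le> b\<close>, hence where \<open>f \<le> l t\<close>, and that set has
  mass at most \<open>l t\<close>. Jumps of \<open>f\<close> are not excluded in advance.\<close>

lemma skorokhod_unique:
  assumes f: "control_path f" and ge: "\<And>t. 0 < t \<Longrightarrow> b \<le> y t + f t"
    and flat: "\<And>T. 0 < T \<Longrightarrow> (\<integral>\<^sup>+t\<in>{0..T}. indicator {s. b < y s + f s} t \<partial>control_measure f) = 0"
    and t: "0 \<le> t"
  shows "f t = l t"
proof (rule antisym)
  interpret f: control_path f by (rule f)
  obtain s where s: "s \<in> {0..t}" "l t = k s" using l_attained[OF t] by blast
  \<comment> \<open>\<open>ge\<close> speaks of positive times only; at time 0 the deficit is
    nonpositive by \<open>y0\<close>.\<close>
  have "b - y s \<le> f s" using ge[of s] s y0 f.f_nonneg[of 0] by (cases "s = 0") auto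
  then have "k s \<le> f s" using f.f_nonneg[of s] s by auto
  also have "\<dots> \<le> f t" using s by (intro f.f_le) auto
  finally show "l t \<le> f t" using s by simp
next
  interpret f: control_path f by (rule f)
  \<comment> \<open>Monotonicity makes the set an initial interval. Its mass is \<open>f u\<close>,
    or the left limit of \<open>f\<close> at its supremum \<open>u\<close> if \<open>u\<close> is
    not a member.\<close>
  have small: "emeasure (control_measure f) {s\<in>{0..t}. f s \<le> l t} \<le> ennreal (l t)"
  proof (cases "{s\<in>{0..t}. f s \<le> l t} = {}")
    case True then show ?thesis by (simp only: emeasure_empty) simp
  next
    case False
    define S where "S = {s\<in>{0..t}. f s \<le> l t}"
    define u where "u = Sup S"
    have bdd: "bdd_above S" by (rule bdd_aboveI[of _ t]) (simp add: S_def)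
    have ne: "S \<noteq> {}" using False by (simp add: S_def)
    have up: "s \<in> S \<Longrightarrow> s \<le> u" for s unfolding u_def by (rule cSup_upper[OF _ bdd])
    have u0: "0 \<le> u" using ne up by (force simp: S_def)
    have below: "s \<in> S" if su: "0 \<le> s" "s < u" for s
    proof -
      obtain v where v: "v \<in> S" "s < v" using less_cSup_iff[OF ne bdd, of s] su(2) unfolding u_def by auto
      then have "f s \<le> f v" using su by (intro f.f_le) auto
      then show ?thesis using v su by (auto simp: S_def)
    qed
    show ?thesis
    proof (cases "u \<in> S")
      case True
      have "emeasure (control_measure f) S \<le> emeasure (control_measure f) {0..u}"
        using up by (intro emeasure_mono) (auto simp: S_def f.control_measure_eq)
      also have "\<dots> = ennreal (f u)" using u0 by (simp add: f.control_measure_eq f.emeasure_Icc0)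
      also have "\<dots> \<le> ennreal (l t)" using True by (intro ennreal_leI) (simp add: S_def)
      finally show ?thesis by (simp add: S_def)
    next
      case nu: False
      have S: "S = {0..<u}"
      proof (intro equalityI subsetI)
        fix s assume s: "s \<in> S"
        then have "s \<noteq> u" using nu by blast
        then show "s \<in> {0..<u}" using up[OF s] s by (simp add: S_def)
      next
        fix s assume "s \<in> {0..<u}"
        then show "s \<in> S" by (intro below) auto
      qed
      have u1: "0 < u" using ne S by auto
      have ll: "left_lim 0 f u \<le> l t"
      proof (rule tendsto_upperbound[OF f.left_lim_tendsto[OF u1]])
        show "\<forall>\<^sub>F s in at_left u. f s \<le> l t"
        proof (rule eventually_at_leftI[OF _ u1])
          fix s assume "s \<in> {0<..<u}"
          then have "s \<in> S" by (intro below) auto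
          then show "f s \<le> l t" by (simp add: S_def)
        qed
      qed (simp add: trivial_limit_at_left_real)
      have "emeasure f.\<mu> {0..u} = emeasure f.\<mu> {0..<u} + emeasure f.\<mu> {u}"
        using u1 by (subst plus_emeasure) (auto intro!: arg_cong[where f="emeasure f.\<mu>"])
      then have "ennreal (f u) = emeasure f.\<mu> {0..<u} + ennreal (jump f u)"
        using u1 by (simp add: f.emeasure_Icc0 f.emeasure_singleton)
      moreover have "ennreal (f u) = ennreal (left_lim 0 f u) + ennreal (jump f u)"
        using u0 by (subst ennreal_plus[symmetric]) (auto simp: f.left_lim_nonneg f.left_lim_le jump_def)
      ultimately have "emeasure f.\<mu> {0..<u} = ennreal (left_lim 0 f u)"
        by (simp add: ennreal_add_left_cancel add.commute)
      then have "emeasure (control_measure f) S \<le> ennreal (l t)"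
        unfolding S f.control_measure_eq using ll by (simp only: ennreal_leI)
      then show ?thesis unfolding S_def .
    qed
  qed
  \<comment> \<open>Flatness is given for positive horizons, and \<open>t\<close> may be 0.\<close>
  let ?T = "t + 1"
  let ?O = "{s \<in> {0..?T}. b < y s + f s}"
  have Om: "?O \<in> sets borel"
  proof -
    have "{s \<in> {0..?T}. b < y s + f s} = {s. 0 \<le> s \<and> s \<le> ?T \<and> b < (if 0 \<le> s then y s else 0) + f.F s}"
      by (auto simp: f.F_def)
    also have "\<dots> \<in> sets borel" using y_measurable f.F_measurable by measurable
    finally show ?thesis .
  qed
  have "emeasure (control_measure f) ?O = (\<integral>\<^sup>+t. indicator ?O t \<partial>control_measure f)"
    using Om by (subst nn_integral_indicator) (auto simp: f.control_measure_eq)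
  also have "\<dots> = (\<integral>\<^sup>+t\<in>{0..?T}. indicator {s. b < y s + f s} t \<partial>control_measure f)"
    by (intro nn_integral_cong) (auto simp: indicator_def)
  also have "\<dots> = 0" using t by (intro flat) simp
  finally have O0: "emeasure (control_measure f) ?O = 0" .
  have Sm: "{s\<in>{0..t}. f s \<le> l t} \<in> sets borel"
  proof -
    have "{s\<in>{0..t}. f s \<le> l t} = {s. 0 \<le> s \<and> s \<le> t \<and> f.F s \<le> l t}" by (auto simp: f.F_def)
    also have "\<dots> \<in> sets borel" using f.F_measurable by measurable
    finally show ?thesis .
  qed
  have "ennreal (f t) = emeasure (control_measure f) {0..t}" using t by (simp add: f.control_measure_eq f.emeasure_Icc0)
  also have "\<dots> \<le> emeasure (control_measure f) (?O \<union> {s\<in>{0..t}. f s \<le> l t})"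
  proof (intro emeasure_mono subsetI)
    fix s assume s: "s \<in> {0..t}"
    show "s \<in> ?O \<union> {s\<in>{0..t}. f s \<le> l t}"
    proof (cases "b < y s + f s")
      case False
      then have "f s \<le> l s" using l_ge[of s] s by auto
      also have "\<dots> \<le> l t" using l_mono[of s t] s by auto
      finally show ?thesis using s by auto
    qed (use s in auto)
  qed (use Om Sm in \<open>simp add: f.control_measure_eq\<close>)
  also have "\<dots> \<le> emeasure (control_measure f) ?O + emeasure (control_measure f) {s\<in>{0..t}. f s \<le> l t}"
    using Om Sm by (intro emeasure_subadditive) (auto simp: f.control_measure_eq)
  also have "\<dots> \<le> ennreal (l t)" using O0 small by simp
  finally show "f t \<le> l t" using l_nonneg[OF t] by (simp add: ennreal_le_iff)
qed

end

lemma (in prob_space) bounded_convergence_pathwise: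
  fixes X :: "nat \<Rightarrow> 'a \<Rightarrow> real"
  assumes X: "\<And>n. X n \<in> borel_measurable M" and H: "integrable M H"
    and lim: "\<And>\<omega>. \<omega> \<in> space M \<Longrightarrow> (\<lambda>n. X n \<omega>) \<longlonglongrightarrow> I \<omega>"
    and bd: "\<And>n \<omega>. \<omega> \<in> space M \<Longrightarrow> \<bar>X n \<omega>\<bar> \<le> H \<omega>"
  shows "integrable M I" "(\<lambda>n. expectation (X n)) \<longlonglongrightarrow> expectation I" "\<And>n. integrable M (X n)"
proof -
  have I: "I \<in> borel_measurable M"
    by (rule borel_measurable_LIMSEQ_real[OF lim X])
  have ae: "AE \<omega> in M. (\<lambda>n. X n \<omega>) \<longlonglongrightarrow> I \<omega>" by (rule AE_I2) (rule lim)
  have b: "AE \<omega> in M. norm (X n \<omega>) \<le> H \<omega>" for n by (rule AE_I2) (simp add: bd)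
  show "integrable M I" by (rule integrable_dominated_convergence[OF I X H ae b])
  show "(\<lambda>n. expectation (X n)) \<longlonglongrightarrow> expectation I" by (rule integral_dominated_convergence[OF I X H ae b])
  show "integrable M (X n)" for n by (rule integrable_dominated_convergence2[OF I X H ae b])
qed

lemma abs_exp_minus_one_le: "\<bar>exp x - 1\<bar> \<le> \<bar>x\<bar> * exp \<bar>x\<bar>" for x :: real
proof (cases "0 \<le> x")
  case True
  have "exp x * (1 + - x) \<le> exp x * exp (- x)"
    using exp_ge_add_one_self[of "- x"] by (intro mult_left_mono) auto
  then show ?thesis using True by (simp add: exp_minus algebra_simps)
next
  case False
  have "1 - exp x \<le> - x" using exp_ge_add_one_self[of x] by linarith
  also have "\<dots> \<le> - x * exp (- x)" using False by (simp add: mult_le_cancel_left1)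
  finally show ?thesis using False by simp
qed

section \<open>The product rule in expectation\<close>

text \<open>\<open>xh\<close> stands for the debt ratio after a possible initial jump to the barrier
  \<open>a\<close>; the uncontrolled process and its reflection start there.\<close>

locale debt_model = exp_martingale M Fl W
  for M :: "'a measure" and Fl :: "real \<Rightarrow> 'a measure" and W :: "real \<Rightarrow> 'a \<Rightarrow> real" +
  fixes r g \<sigma> a xh :: real
  assumes \<sigma>: "0 < \<sigma>" and a: "0 < a" and xh: "a \<le> xh"
begin

definition "ly t \<omega> = ln xh + (r - g - \<sigma>\<^sup>2 / 2) * t + \<sigma> * W t \<omega>"
definition "l t \<omega> = refl (ln a) (\<lambda>s. ly s \<omega>) t"
text \<open>Eigenvalue of the generator of the uncontrolled debt ratio on the power with exponent
  \<open>p\<close>: the discounted power is a martingale exactly at the rate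
  \<open>\<theta> p\<close>. The quadratic equation for the root reads
  \<open>\<theta> d = \<rho>\<close>.\<close>

definition "\<theta> p = \<sigma>\<^sup>2 / 2 * p * (p - 1) + (r - g) * p"

lemma ly_0: "\<omega> \<in> space M \<Longrightarrow> ly 0 \<omega> = ln xh" by (simp add: ly_def W_zero)

lemma reflection_ly: "\<omega> \<in> space M \<Longrightarrow> reflection (ln a) (\<lambda>s. ly s \<omega>)"
proof
  assume \<omega>: "\<omega> \<in> space M"
  show "continuous_on {0..} (\<lambda>s. ly s \<omega>)" unfolding ly_def by (intro continuous_intros W_cont \<omega>)
  show "ln a \<le> ly 0 \<omega>" using a xh \<omega> by (simp add: ly_0)
qed

lemma ly_adapted: "0 \<le> s \<Longrightarrow> s \<le> t \<Longrightarrow> ly s \<in> borel_measurable (Fl t)"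
  using W_adapted_mono[of s t] unfolding ly_def by measurable

text \<open>Continuity reduces the running supremum to the countably many partition points of
  \<open>{0..t}\<close>, all lying in the past of \<open>t\<close>.\<close>

lemma l_adapted: assumes t: "0 \<le> t" shows "l t \<in> borel_measurable (Fl t)"
  unfolding borel_measurable_iff_le
proof
  fix c
  let ?k = "\<lambda>n i \<omega>. max 0 (ln a - ly (node t (Suc n) i) \<omega>)"
  have "{\<omega> \<in> space (Fl t). l t \<omega> \<le> c} = {\<omega> \<in> space (Fl t). \<forall>n. \<forall>i\<in>{..Suc n}. ?k n i \<omega> \<le> c}"
  proof (intro Collect_cong conj_cong refl)
    fix \<omega> assume "\<omega> \<in> space (Fl t)"
    then have \<omega>: "\<omega> \<in> space M" using Fl_space t by simp
    interpret R: reflection "ln a" "\<lambda>s. ly s \<omega>" by (rule reflection_ly[OF \<omega>])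
    show "l t \<omega> \<le> c \<longleftrightarrow> (\<forall>n. \<forall>i\<in>{..Suc n}. ?k n i \<omega> \<le> c)"
    proof
      assume c: "l t \<omega> \<le> c"
      show "\<forall>n. \<forall>i\<in>{..Suc n}. ?k n i \<omega> \<le> c"
      proof (intro allI ballI)
        fix n i assume "i \<in> {..Suc n}"
        then have "?k n i \<omega> \<le> l t \<omega>" unfolding l_def using t by (intro R.l_upper node_nonneg node_le) auto
        then show "?k n i \<omega> \<le> c" using c by simp
      qed
    next
      assume c: "\<forall>n. \<forall>i\<in>{..Suc n}. ?k n i \<omega> \<le> c"
      obtain s where s: "s \<in> {0..t}" "l t \<omega> = R.k s" using R.l_attained[OF t] unfolding l_def by blast
      show "l t \<omega> \<le> c"
      proof (cases "s = 0")
        case True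
        have "?k 0 0 \<omega> \<le> c" using c by blast
        then show ?thesis using s True by simp
      next
        case False
        then have s0: "0 < s" "s \<le> t" using s by auto
        have "(\<lambda>n. R.k (node t (Suc n) (idx t (Suc n) s))) \<longlonglongrightarrow> R.k s"
          by (rule continuous_on_tendsto_compose[OF R.k_cont node_idx_tendsto(1)[OF s0]])
             (use s t in \<open>auto simp: node_nonneg\<close>)
        moreover have "R.k (node t (Suc n) (idx t (Suc n) s)) \<le> c" for n
        proof -
          have "idx t (Suc n) s \<in> {..Suc n}" using idx_props(3)[OF s0, of "Suc n"] by simp
          then show ?thesis using c by blast
        qed
        ultimately have "R.k s \<le> c" by (intro LIMSEQ_le_const2) auto
        then show ?thesis using s by simp
      qed
    qed
  qed
  also have "\<dots> \<in> sets (Fl t)"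
  proof -
    have "{\<omega> \<in> space (Fl t). ?k n i \<omega> \<le> c} \<in> sets (Fl t)" if "i \<in> {..Suc n}" for n i
    proof -
      have "ly (node t (Suc n) i) \<in> borel_measurable (Fl t)"
        using ly_adapted[of "node t (Suc n) i" t] t that by (simp add: node_nonneg node_le)
      then show ?thesis by measurable
    qed
    then have "{\<omega> \<in> space (Fl t). \<forall>i\<in>{..Suc n}. ?k n i \<omega> \<le> c} \<in> sets (Fl t)" for n
      by (rule sets.sets_Collect_finite_All') auto
    then show ?thesis by (rule sets.sets_Collect_countable_All)
  qed
  finally show "{\<omega> \<in> space (Fl t). l t \<omega> \<le> c} \<in> sets (Fl t)" .
qed

text \<open>Several powers of the path and of its reflection have to be dominated at once; hence the
  bound is stated through a common bound \<open>m\<close> of the logarithm.\<close>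

lemma path_dominated:
  assumes T: "0 \<le> T" and c: "0 \<le> c"
  obtains H where "integrable M H"
    "\<And>\<omega>. \<omega> \<in> space M \<Longrightarrow> \<exists>m\<ge>0. (\<forall>t\<in>{0..T}. \<bar>ly t \<omega>\<bar> \<le> m) \<and> exp (c * m) \<le> H \<omega>"
proof -
  obtain H where H: "integrable M H" "\<And>\<omega> t. \<omega> \<in> space M \<Longrightarrow> 0 \<le> t \<Longrightarrow> t \<le> T \<Longrightarrow> exp (c * \<sigma> * \<bar>W t \<omega>\<bar>) \<le> H \<omega>"
    using exp_abs_dominated[OF T] by blast
  let ?d = "\<bar>ln xh\<bar> + \<bar>r - g - \<sigma>\<^sup>2 / 2\<bar> * T"
  show ?thesis
  proof (rule that[of "\<lambda>\<omega>. exp (c * ?d) * H \<omega>"])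
    show "integrable M (\<lambda>\<omega>. exp (c * ?d) * H \<omega>)" using H by simp
    fix \<omega> assume \<omega>: "\<omega> \<in> space M"
    interpret R: reflection "ln a" "\<lambda>s. ly s \<omega>" by (rule reflection_ly[OF \<omega>])
    have "\<exists>t\<in>{0..T}. \<forall>s\<in>{0..T}. \<bar>ly s \<omega>\<bar> \<le> \<bar>ly t \<omega>\<bar>"
      using T by (intro continuous_attains_sup continuous_intros continuous_on_subset[OF R.y_cont]) auto
    then obtain t where t: "t \<in> {0..T}" "\<forall>s\<in>{0..T}. \<bar>ly s \<omega>\<bar> \<le> \<bar>ly t \<omega>\<bar>" by blast
    have "\<bar>ly t \<omega>\<bar> \<le> \<bar>ln xh\<bar> + \<bar>(r - g - \<sigma>\<^sup>2 / 2) * t\<bar> + \<bar>\<sigma> * W t \<omega>\<bar>" unfolding ly_def by linarith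
    also have "\<dots> \<le> ?d + \<sigma> * \<bar>W t \<omega>\<bar>"
      using t \<sigma> by (auto simp: abs_mult intro!: mult_left_mono)
    finally have "c * \<bar>ly t \<omega>\<bar> \<le> c * (?d + \<sigma> * \<bar>W t \<omega>\<bar>)" using c by (rule mult_left_mono)
    also have "\<dots> = c * ?d + c * \<sigma> * \<bar>W t \<omega>\<bar>" by (simp add: algebra_simps)
    finally have "exp (c * \<bar>ly t \<omega>\<bar>) \<le> exp (c * ?d) * exp (c * \<sigma> * \<bar>W t \<omega>\<bar>)" by (simp add: exp_add[symmetric])
    also have "\<dots> \<le> exp (c * ?d) * H \<omega>" using H(2)[OF \<omega>, of t] t by (intro mult_left_mono) auto
    finally show "\<exists>m\<ge>0. (\<forall>t\<in>{0..T}. \<bar>ly t \<omega>\<bar> \<le> m) \<and> exp (c * m) \<le> exp (c * ?d) * H \<omega>"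
      using t by (intro exI[of _ "\<bar>ly t \<omega>\<bar>"]) auto
  qed
qed

text \<open>The conditional mean of the power grows at the rate \<open>\<theta> p\<close>. For a
  nonnegative factor both expectations are real parts of nonnegative integrals, so infinite values
  cause no exception: they become 0 on both sides.\<close>

lemma expectation_power_step:
  assumes uv: "0 \<le> u" "u \<le> v" and C: "C \<in> borel_measurable (Fl u)" "\<And>\<omega>. \<omega> \<in> space M \<Longrightarrow> 0 \<le> C \<omega>"
  shows "expectation (\<lambda>\<omega>. exp (- q * v + p * ly v \<omega>) * C \<omega>)
    = exp ((\<theta> p - q) * (v - u)) * expectation (\<lambda>\<omega>. exp (- q * u + p * ly u \<omega>) * C \<omega>)"
proof -
  let ?e = "\<lambda>t. exp (- q * t + p * (ln xh + (r - g - \<sigma>\<^sup>2 / 2) * t))"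
  have CM: "C \<in> borel_measurable M" using C uv Fl_measurable_M by blast
  have Wm: "0 \<le> t \<Longrightarrow> W t \<in> borel_measurable M" for t by (rule W_measurable)
  have split: "exp (- q * t + p * ly t \<omega>) = ?e t * exp (p * \<sigma> * W t \<omega>)" for t \<omega>
    by (simp add: ly_def exp_add[symmetric] algebra_simps)
  have nn: "expectation (\<lambda>\<omega>. exp (- q * t + p * ly t \<omega>) * C \<omega>)
      = ?e t * enn2real (\<integral>\<^sup>+\<omega>. ennreal (exp (p * \<sigma> * W t \<omega>)) * ennreal (C \<omega>) \<partial>M)" if t: "0 \<le> t" for t
  proof -
    have "expectation (\<lambda>\<omega>. exp (- q * t + p * ly t \<omega>) * C \<omega>) = ?e t * expectation (\<lambda>\<omega>. exp (p * \<sigma> * W t \<omega>) * C \<omega>)"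
      unfolding split by (simp only: mult.assoc integral_mult_right_zero)
    also have "expectation (\<lambda>\<omega>. exp (p * \<sigma> * W t \<omega>) * C \<omega>) = enn2real (\<integral>\<^sup>+\<omega>. ennreal (exp (p * \<sigma> * W t \<omega>) * C \<omega>) \<partial>M)"
      using Wm[OF t] CM C(2) by (intro integral_eq_nn_integral) (auto intro!: AE_I2)
    also have "(\<integral>\<^sup>+\<omega>. ennreal (exp (p * \<sigma> * W t \<omega>) * C \<omega>) \<partial>M) = (\<integral>\<^sup>+\<omega>. ennreal (exp (p * \<sigma> * W t \<omega>)) * ennreal (C \<omega>) \<partial>M)"
      by (intro nn_integral_cong) (simp add: ennreal_mult C(2))
    finally show ?thesis .
  qed
  have "(\<integral>\<^sup>+\<omega>. ennreal (exp (p * \<sigma> * W v \<omega>)) * ennreal (C \<omega>) \<partial>M)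
    = ennreal (exp ((p * \<sigma>)\<^sup>2 * (v - u) / 2)) * (\<integral>\<^sup>+\<omega>. ennreal (exp (p * \<sigma> * W u \<omega>)) * ennreal (C \<omega>) \<partial>M)"
    using C(1) by (intro exp_W_mult uv) measurable
  then have "expectation (\<lambda>\<omega>. exp (- q * v + p * ly v \<omega>) * C \<omega>)
    = ?e v * exp ((p * \<sigma>)\<^sup>2 * (v - u) / 2) * enn2real (\<integral>\<^sup>+\<omega>. ennreal (exp (p * \<sigma> * W u \<omega>)) * ennreal (C \<omega>) \<partial>M)"
    using nn[of v] uv by (simp add: enn2real_mult)
  also have "?e v * exp ((p * \<sigma>)\<^sup>2 * (v - u) / 2) = exp ((\<theta> p - q) * (v - u)) * ?e u"
    by (simp add: exp_add[symmetric] \<theta>_def power2_eq_square field_simps)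
  also have "exp ((\<theta> p - q) * (v - u)) * ?e u * enn2real (\<integral>\<^sup>+\<omega>. ennreal (exp (p * \<sigma> * W u \<omega>)) * ennreal (C \<omega>) \<partial>M)
    = exp ((\<theta> p - q) * (v - u)) * expectation (\<lambda>\<omega>. exp (- q * u + p * ly u \<omega>) * C \<omega>)"
    unfolding nn[OF uv(1)] by (rule mult.assoc)
  finally show ?thesis .
qed

text \<open>The increments of \<open>A\<close> and of \<open>exp (s * l)\<close> lead to Stieltjes
  integrals path by path. The increments of the power of \<open>Y\<close> have no such limit; their
  cofactor is known at the left node, so in expectation each is exchanged for an exact growth
  factor, and the new sum is a Riemann sum for Lebesgue measure. Boundedness of \<open>A\<close>
  provides the dominating function. Integrability of \<open>I2\<close> and \<open>I3\<close> is read
  off limits carrying the factors \<open>s\<close> and \<open>\<theta> p - q\<close>, hence the two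
  side conditions.\<close>

lemma expectation_product_rule:
  fixes A :: "real \<Rightarrow> 'a \<Rightarrow> real" and p q s T Amax :: real
  assumes T: "0 < T" and path: "\<And>\<omega>. \<omega> \<in> space M \<Longrightarrow> control_path (\<lambda>t. A t \<omega>)"
    and adapted: "\<And>t. 0 \<le> t \<Longrightarrow> A t \<in> borel_measurable (Fl t)"
    and Amax: "\<And>t \<omega>. 0 \<le> t \<Longrightarrow> \<omega> \<in> space M \<Longrightarrow> A t \<omega> \<le> Amax"
  defines "I1 \<equiv> \<lambda>\<omega>. LINT t:{0<..T}|control_measure (\<lambda>t. A t \<omega>). exp (- q * t + p * ly t \<omega>) * exp (s * l t \<omega>)"
    and "I2 \<equiv> \<lambda>\<omega>. LINT t:{0<..T}|control_measure (\<lambda>t. exp (l t \<omega>) - 1). exp (- q * t + p * ly t \<omega>) * A t \<omega> * exp ((1 - s) * ly t \<omega>)"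
    and "I3 \<equiv> \<lambda>\<omega>. LINT t:{0<..T}|lborel. exp (- q * t + p * ly t \<omega>) * exp (s * l t \<omega>) * A t \<omega>"
  shows "integrable M I1" "s \<noteq> 0 \<Longrightarrow> integrable M I2" "\<theta> p \<noteq> q \<Longrightarrow> integrable M I3"
    "integrable M (\<lambda>\<omega>. exp (- q * T + p * ly T \<omega>) * exp (s * l T \<omega>) * A T \<omega>)"
    "expectation (\<lambda>\<omega>. exp (- q * T + p * ly T \<omega>) * exp (s * l T \<omega>) * A T \<omega>)
      = exp (p * ln xh) * expectation (A 0) + expectation I1 + s * exp ((s - 1) * ln a) * expectation I2
        + (\<theta> p - q) * expectation I3"
proof -
  let ?k = "\<theta> p - q"
  define nd where "nd n i = node T (Suc n) i" for n i
  have nd: "0 \<le> nd n i" "nd n i \<le> nd n (Suc i)" "i \<le> Suc n \<Longrightarrow> nd n i \<le> T" for n i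
    using T by (auto simp: nd_def node_nonneg node_mono node_le)
  have nd0: "nd n 0 = 0" and ndn: "nd n (Suc n) = T" for n by (simp_all add: nd_def node_n)
  define Q where "Q t \<omega> = exp (- q * t + p * ly t \<omega>)" for t \<omega>
  define B where "B t \<omega> = exp (s * l t \<omega>)" for t \<omega>
  have meas: "ly t \<in> borel_measurable M" "l t \<in> borel_measurable M" "A t \<in> borel_measurable M" if "0 \<le> t" for t
    using that Fl_measurable_M[OF that ly_adapted[of t t]] Fl_measurable_M[OF that l_adapted] Fl_measurable_M[OF that adapted] by auto
  have QBm: "Q t \<in> borel_measurable M" "B t \<in> borel_measurable M" if "0 \<le> t" for t
    using meas[OF that] unfolding Q_def B_def by measurable
  have A0: "0 \<le> A t \<omega>" if "0 \<le> t" "\<omega> \<in> space M" for t \<omega>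
    using control_path.f_nonneg[OF path] that by blast
  have Am: "A u \<omega> \<le> A v \<omega>" if "0 \<le> u" "u \<le> v" "\<omega> \<in> space M" for u v \<omega>
    using control_path.f_le[OF path] that by blast
  \<comment> \<open>The nodes are staggered so that the three sums add up exactly and the last one
    freezes \<open>B\<close> and \<open>A\<close> at the left node, where they belong to the
    past.\<close>
  define S1 where "S1 n \<omega> = (\<Sum>i<Suc n. Q (nd n (Suc i)) \<omega> * B (nd n i) \<omega> * (A (nd n (Suc i)) \<omega> - A (nd n i) \<omega>))" for n \<omega>
  define S2 where "S2 n \<omega> = (\<Sum>i<Suc n. Q (nd n (Suc i)) \<omega> * A (nd n (Suc i)) \<omega> * (B (nd n (Suc i)) \<omega> - B (nd n i) \<omega>))" for n \<omega>
  define C where "C n i \<omega> = B (nd n i) \<omega> * A (nd n i) \<omega>" for n i \<omega>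
  define S3 where "S3 n \<omega> = (\<Sum>i<Suc n. (Q (nd n (Suc i)) \<omega> - Q (nd n i) \<omega>) * C n i \<omega>)" for n \<omega>
  \<comment> \<open>Exact relative growth of the mean of \<open>Q\<close> over one step.\<close>
  define e where "e n = exp (?k * (T / real (Suc n))) - 1" for n
  define S3' where "S3' n \<omega> = e n * (\<Sum>i<Suc n. Q (nd n i) \<omega> * C n i \<omega>)" for n \<omega>
  have tele: "Q T \<omega> * B T \<omega> * A T \<omega> = Q 0 \<omega> * B 0 \<omega> * A 0 \<omega> + S1 n \<omega> + S2 n \<omega> + S3 n \<omega>" for n \<omega>
  proof -
    have "Q T \<omega> * B T \<omega> * A T \<omega> - Q 0 \<omega> * B 0 \<omega> * A 0 \<omega>
      = (\<Sum>i<Suc n. Q (nd n (Suc i)) \<omega> * B (nd n (Suc i)) \<omega> * A (nd n (Suc i)) \<omega> - Q (nd n i) \<omega> * B (nd n i) \<omega> * A (nd n i) \<omega>)"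
      by (subst sum_lessThan_telescope) (simp add: nd0 ndn)
    also have "\<dots> = S1 n \<omega> + S2 n \<omega> + S3 n \<omega>"
      unfolding S1_def S2_def S3_def C_def sum.distrib[symmetric] by (intro sum.cong refl) (simp add: algebra_simps)
    finally show ?thesis by simp
  qed
  have S_meas: "S1 n \<in> borel_measurable M" "S2 n \<in> borel_measurable M" "S3' n \<in> borel_measurable M" for n
    unfolding S1_def S2_def S3'_def C_def using QBm[OF nd(1)] meas(3)[OF nd(1)] by measurable
  obtain H where H: "integrable M H"
    "\<And>\<omega>. \<omega> \<in> space M \<Longrightarrow> \<exists>m\<ge>0. (\<forall>t\<in>{0..T}. \<bar>ly t \<omega>\<bar> \<le> m) \<and> exp ((\<bar>p\<bar> + \<bar>s\<bar>) * m) \<le> H \<omega>"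
    using path_dominated[of T "\<bar>p\<bar> + \<bar>s\<bar>"] T by (metis abs_ge_zero add_nonneg_nonneg less_imp_le)
  define E0 where "E0 = exp (\<bar>q\<bar> * T + \<bar>s\<bar> * \<bar>ln a\<bar>)"
  define D where "D \<omega> = E0 * H \<omega> * Amax" for \<omega>
  have D_int: "integrable M D" unfolding D_def using H(1) by simp
  have bounds: "\<exists>U V. 0 \<le> U \<and> 0 \<le> V \<and> 0 \<le> Amax \<and> U * V * Amax \<le> D \<omega> \<and>
       (\<forall>t\<in>{0..T}. 0 < Q t \<omega> \<and> Q t \<omega> \<le> U \<and> 0 < B t \<omega> \<and> B t \<omega> \<le> V)" if \<omega>: "\<omega> \<in> space M" for \<omega>
  proof -
    interpret R: reflection "ln a" "\<lambda>s. ly s \<omega>" by (rule reflection_ly[OF \<omega>])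
    obtain m where m: "0 \<le> m" "\<forall>t\<in>{0..T}. \<bar>ly t \<omega>\<bar> \<le> m" "exp ((\<bar>p\<bar> + \<bar>s\<bar>) * m) \<le> H \<omega>"
      using H(2)[OF \<omega>] by blast
    have "0 \<le> A 0 \<omega>" using A0[of 0] \<omega> by simp
    then have Am0: "0 \<le> Amax" using Amax[of 0 \<omega>] \<omega> by simp
    let ?U = "exp (\<bar>q\<bar> * T + \<bar>p\<bar> * m)" let ?V = "exp (\<bar>s\<bar> * (\<bar>ln a\<bar> + m))"
    have "?U * ?V = E0 * exp ((\<bar>p\<bar> + \<bar>s\<bar>) * m)" by (simp add: E0_def exp_add[symmetric] algebra_simps)
    also have "\<dots> \<le> E0 * H \<omega>" using m by (intro mult_left_mono) (auto simp: E0_def)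
    finally have UV: "?U * ?V * Amax \<le> D \<omega>" unfolding D_def using Am0 by (rule mult_right_mono)
    have "Q t \<omega> \<le> ?U \<and> B t \<omega> \<le> ?V" if t: "t \<in> {0..T}" for t
    proof
      have "- q * t \<le> \<bar>q\<bar> * T" using t by (intro mult_mono) auto
      moreover have "p * ly t \<omega> \<le> \<bar>p\<bar> * m"
      proof -
        have "p * ly t \<omega> \<le> \<bar>p\<bar> * \<bar>ly t \<omega>\<bar>" by (simp add: abs_mult[symmetric])
        also have "\<dots> \<le> \<bar>p\<bar> * m" using m t by (intro mult_left_mono) auto
        finally show ?thesis .
      qed
      ultimately show "Q t \<omega> \<le> ?U" unfolding Q_def by simp
      obtain v where v: "v \<in> {0..t}" "l t \<omega> = R.k v" using R.l_attained[of t] t unfolding l_def by auto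
      have "\<bar>ly v \<omega>\<bar> \<le> m" using m v t by auto
      then have "\<bar>l t \<omega>\<bar> \<le> \<bar>ln a\<bar> + m" unfolding v(2) using m(1) by linarith
      moreover have "s * l t \<omega> \<le> \<bar>s\<bar> * \<bar>l t \<omega>\<bar>" by (simp add: abs_mult[symmetric])
      ultimately have "s * l t \<omega> \<le> \<bar>s\<bar> * (\<bar>ln a\<bar> + m)" using mult_left_mono[of "\<bar>l t \<omega>\<bar>" "\<bar>ln a\<bar> + m" "\<bar>s\<bar>"] by linarith
      then show "B t \<omega> \<le> ?V" unfolding B_def by simp
    qed
    then show ?thesis using UV Am0 by (intro exI[of _ ?U] exI[of _ ?V]) (auto simp: Q_def B_def)
  qed
  have S1_bd: "\<bar>S1 n \<omega>\<bar> \<le> D \<omega>" if \<omega>: "\<omega> \<in> space M" for n \<omega>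
  proof -
    obtain U V where UV: "0 \<le> U" "0 \<le> V" "0 \<le> Amax" "U * V * Amax \<le> D \<omega>"
       "\<And>t. t \<in> {0..T} \<Longrightarrow> 0 < Q t \<omega> \<and> Q t \<omega> \<le> U \<and> 0 < B t \<omega> \<and> B t \<omega> \<le> V" using bounds[OF \<omega>] by blast
    have tm: "\<bar>Q (nd n (Suc i)) \<omega> * B (nd n i) \<omega> * (A (nd n (Suc i)) \<omega> - A (nd n i) \<omega>)\<bar> \<le> U * V * (A (nd n (Suc i)) \<omega> - A (nd n i) \<omega>)"
      if i: "i < Suc n" for i
    proof -
      have "nd n i \<in> {0..T}" "nd n (Suc i) \<in> {0..T}" using nd(1)[of n] nd(3)[of i n] nd(3)[of "Suc i" n] i by auto
      then have "\<bar>Q (nd n (Suc i)) \<omega> * B (nd n i) \<omega>\<bar> \<le> U * V"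
        unfolding abs_mult using UV(5)[of "nd n i"] UV(5)[of "nd n (Suc i)"] by (intro mult_mono) auto
      moreover have "0 \<le> A (nd n (Suc i)) \<omega> - A (nd n i) \<omega>" using Am[OF nd(1) nd(2) \<omega>] by simp
      ultimately show ?thesis unfolding abs_mult[of "Q (nd n (Suc i)) \<omega> * B (nd n i) \<omega>"] by (simp add: mult_right_mono)
    qed
    have "\<bar>S1 n \<omega>\<bar> \<le> (\<Sum>i<Suc n. U * V * (A (nd n (Suc i)) \<omega> - A (nd n i) \<omega>))"
      unfolding S1_def by (rule order_trans[OF sum_abs]) (rule sum_mono, rule tm, simp)
    also have "\<dots> = U * V * (A T \<omega> - A 0 \<omega>)"
      unfolding sum_distrib_left[symmetric] by (subst sum_lessThan_telescope) (simp only: nd0 ndn)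
    also have "\<dots> \<le> U * V * Amax"
      using Amax[of T \<omega>] A0[of 0 \<omega>] T \<omega> UV by (intro mult_left_mono) auto
    finally show ?thesis using UV by simp
  qed
  have S2_bd: "\<bar>S2 n \<omega>\<bar> \<le> D \<omega>" if \<omega>: "\<omega> \<in> space M" for n \<omega>
  proof -
    interpret R: reflection "ln a" "\<lambda>s. ly s \<omega>" by (rule reflection_ly[OF \<omega>])
    obtain U V where UV: "0 \<le> U" "0 \<le> V" "0 \<le> Amax" "U * V * Amax \<le> D \<omega>"
       "\<And>t. t \<in> {0..T} \<Longrightarrow> 0 < Q t \<omega> \<and> Q t \<omega> \<le> U \<and> 0 < B t \<omega> \<and> B t \<omega> \<le> V" using bounds[OF \<omega>] by blast
    \<comment> \<open>The sign of \<open>s\<close> decides whether \<open>B\<close> increases or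
      decreases; in both cases its increments have one sign and telescope.\<close>
    define sg where "sg = (if 0 \<le> s then 1 else -1 :: real)"
    have dB: "\<bar>B v \<omega> - B u \<omega>\<bar> = sg * (B v \<omega> - B u \<omega>)" if "0 \<le> u" "u \<le> v" for u v
    proof -
      have lm: "l u \<omega> \<le> l v \<omega>" unfolding l_def using that by (rule R.l_mono)
      show ?thesis
      proof (cases "0 \<le> s")
        case True then show ?thesis using mult_left_mono[OF lm, of s] by (simp add: B_def sg_def)
      next
        case False then show ?thesis using mult_left_mono_neg[OF lm, of s] by (simp add: B_def sg_def)
      qed
    qed
    have tm: "\<bar>Q (nd n (Suc i)) \<omega> * A (nd n (Suc i)) \<omega> * (B (nd n (Suc i)) \<omega> - B (nd n i) \<omega>)\<bar> \<le> U * Amax * (sg * (B (nd n (Suc i)) \<omega> - B (nd n i) \<omega>))"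
      if i: "i < Suc n" for i
    proof -
      have "nd n (Suc i) \<in> {0..T}" using nd(1)[of n] nd(3)[of "Suc i" n] i by auto
      then have "\<bar>Q (nd n (Suc i)) \<omega> * A (nd n (Suc i)) \<omega>\<bar> \<le> U * Amax"
        unfolding abs_mult using UV(5)[of "nd n (Suc i)"] UV(1) A0[OF nd(1) \<omega>] Amax[OF nd(1) \<omega>] by (intro mult_mono) auto
      then show ?thesis unfolding abs_mult[of "Q (nd n (Suc i)) \<omega> * A (nd n (Suc i)) \<omega>"] dB[OF nd(1) nd(2), symmetric]
        by (rule mult_right_mono) simp
    qed
    have "\<bar>S2 n \<omega>\<bar> \<le> (\<Sum>i<Suc n. U * Amax * (sg * (B (nd n (Suc i)) \<omega> - B (nd n i) \<omega>)))"
      unfolding S2_def by (rule order_trans[OF sum_abs]) (rule sum_mono, rule tm, simp)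
    also have "\<dots> = U * Amax * (sg * (B T \<omega> - B 0 \<omega>))"
      unfolding sum_distrib_left[symmetric] by (subst sum_lessThan_telescope) (simp only: nd0 ndn)
    also have "\<dots> \<le> U * Amax * V"
      using UV(5)[of T] UV(5)[of 0] T UV(1,3) by (intro mult_left_mono) (auto simp: sg_def)
    finally show ?thesis using UV by (simp add: mult_ac)
  qed
  have QC_bd: "\<bar>Q (nd n i) \<omega> * C n i \<omega>\<bar> \<le> D \<omega>" if \<omega>: "\<omega> \<in> space M" and i: "i < Suc n" for n i \<omega>
  proof -
    obtain U V where UV: "0 \<le> U" "0 \<le> V" "0 \<le> Amax" "U * V * Amax \<le> D \<omega>"
       "\<And>t. t \<in> {0..T} \<Longrightarrow> 0 < Q t \<omega> \<and> Q t \<omega> \<le> U \<and> 0 < B t \<omega> \<and> B t \<omega> \<le> V" using bounds[OF \<omega>] by blast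
    have "nd n i \<in> {0..T}" using nd(1)[of n] nd(3)[of i n] i by auto
    then have "\<bar>Q (nd n i) \<omega>\<bar> * \<bar>B (nd n i) \<omega>\<bar> * \<bar>A (nd n i) \<omega>\<bar> \<le> U * V * Amax"
      using UV(5)[of "nd n i"] UV(1-3) A0[OF nd(1) \<omega>, of n i] Amax[OF nd(1) \<omega>, of n i]
      by (intro mult_mono mult_nonneg_nonneg) auto
    then show ?thesis using UV(4) by (simp add: C_def abs_mult mult.assoc)
  qed
  \<comment> \<open>The sum in \<open>S3'\<close> has \<open>Suc n\<close> terms and
    \<open>e n\<close> is of order \<open>1 / Suc n\<close>; the product is bounded uniformly in
    \<open>n\<close>.\<close>
  have e_bd: "\<bar>e n\<bar> * real (Suc n) \<le> \<bar>?k\<bar> * T * exp (\<bar>?k\<bar> * T)" for n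
  proof -
    let ?h = "T / real (Suc n)"
    have h: "0 \<le> ?h" "?h * real (Suc n) = T" "?h \<le> T" using T by (auto simp: field_simps)
    have "\<bar>e n\<bar> \<le> \<bar>?k * ?h\<bar> * exp \<bar>?k * ?h\<bar>" unfolding e_def by (rule abs_exp_minus_one_le)
    also have "\<dots> = \<bar>?k\<bar> * ?h * exp (\<bar>?k\<bar> * ?h)" using h by (simp add: abs_mult)
    also have "\<dots> \<le> \<bar>?k\<bar> * ?h * exp (\<bar>?k\<bar> * T)"
    proof (rule mult_left_mono)
      show "exp (\<bar>?k\<bar> * ?h) \<le> exp (\<bar>?k\<bar> * T)" using mult_left_mono[OF h(3), of "\<bar>?k\<bar>"] by simp
      show "0 \<le> \<bar>?k\<bar> * ?h" using h(1) by (intro mult_nonneg_nonneg) auto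
    qed
    finally have "\<bar>e n\<bar> * real (Suc n) \<le> \<bar>?k\<bar> * ?h * exp (\<bar>?k\<bar> * T) * real (Suc n)" by (rule mult_right_mono) simp
    also have "\<dots> = \<bar>?k\<bar> * (?h * real (Suc n)) * exp (\<bar>?k\<bar> * T)" by (simp only: mult_ac)
    finally show ?thesis by (simp only: h(2))
  qed
  define K where "K = \<bar>?k\<bar> * T * exp (\<bar>?k\<bar> * T)"
  have S3_bd: "\<bar>S3' n \<omega>\<bar> \<le> K * D \<omega>" if \<omega>: "\<omega> \<in> space M" for n \<omega>
  proof -
    have D0: "0 \<le> D \<omega>" using S1_bd[OF \<omega>, of 0] by (rule order_trans[OF abs_ge_zero])
    have "\<bar>\<Sum>i<Suc n. Q (nd n i) \<omega> * C n i \<omega>\<bar> \<le> (\<Sum>i<Suc n. D \<omega>)"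
      by (rule order_trans[OF sum_abs]) (rule sum_mono, rule QC_bd[OF \<omega>], simp)
    then have "\<bar>S3' n \<omega>\<bar> \<le> \<bar>e n\<bar> * (real (Suc n) * D \<omega>)"
      unfolding S3'_def abs_mult by (intro mult_left_mono) auto
    also have "\<dots> = (\<bar>e n\<bar> * real (Suc n)) * D \<omega>" by (simp only: mult.assoc)
    also have "\<dots> \<le> K * D \<omega>" unfolding K_def using e_bd D0 by (rule mult_right_mono)
    finally show ?thesis .
  qed
  have QB_meas: "(\<lambda>t. if 0 \<le> t then Q t \<omega> * B t \<omega> else 0) \<in> borel_measurable borel"
    "(\<lambda>t. if 0 \<le> t then A t \<omega> else 0) \<in> borel_measurable borel"
    "(\<lambda>t. if 0 \<le> t then Q t \<omega> else 0) \<in> borel_measurable borel"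
    and QB_cont: "continuous_on {0..} (\<lambda>t. Q t \<omega>)" "continuous_on {0..} (\<lambda>t. B t \<omega>)" if \<omega>: "\<omega> \<in> space M" for \<omega>
  proof -
    interpret R: reflection "ln a" "\<lambda>s. ly s \<omega>" by (rule reflection_ly[OF \<omega>])
    interpret P: control_path "\<lambda>t. A t \<omega>" by (rule path[OF \<omega>])
    show c: "continuous_on {0..} (\<lambda>t. Q t \<omega>)" unfolding Q_def by (intro continuous_intros R.y_cont)
    show d: "continuous_on {0..} (\<lambda>t. B t \<omega>)" unfolding B_def l_def by (intro continuous_intros R.l_cont)
    have "(\<lambda>t. if t \<in> {0..} then Q t \<omega> * B t \<omega> else 0) \<in> borel_measurable borel"
      by (rule borel_measurable_continuous_on_if) (auto intro!: continuous_intros c d)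
    then show "(\<lambda>t. if 0 \<le> t then Q t \<omega> * B t \<omega> else 0) \<in> borel_measurable borel" by simp
    have "(\<lambda>t. if t \<in> {0..} then Q t \<omega> else 0) \<in> borel_measurable borel"
      by (rule borel_measurable_continuous_on_if) (auto intro!: continuous_intros c d)
    then show "(\<lambda>t. if 0 \<le> t then Q t \<omega> else 0) \<in> borel_measurable borel" by simp
    have "(\<lambda>t. if 0 \<le> t then A t \<omega> else 0) = P.F" by (auto simp: P.F_def fun_eq_iff)
    then show "(\<lambda>t. if 0 \<le> t then A t \<omega> else 0) \<in> borel_measurable borel" using P.F_measurable by simp
  qed
  have L1: "(\<lambda>n. S1 n \<omega>) \<longlonglongrightarrow> I1 \<omega>" if \<omega>: "\<omega> \<in> space M" for \<omega>
  proof -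
    interpret P: control_path "\<lambda>t. A t \<omega>" by (rule path[OF \<omega>])
    obtain U V where UV: "0 \<le> U" "0 \<le> V" "0 \<le> Amax" "U * V * Amax \<le> D \<omega>"
       "\<And>t. t \<in> {0..T} \<Longrightarrow> 0 < Q t \<omega> \<and> Q t \<omega> \<le> U \<and> 0 < B t \<omega> \<and> B t \<omega> \<le> V" using bounds[OF \<omega>] by blast
    have "(\<lambda>n. \<Sum>i<Suc n. (Q (nd n (Suc i)) \<omega> * B (nd n i) \<omega>) * (A (node T (Suc n) (Suc i)) \<omega> - A (node T (Suc n) i) \<omega>))
      \<longlonglongrightarrow> (LINT t:{0<..T}|control_measure (\<lambda>t. A t \<omega>). Q t \<omega> * B t \<omega>)"
    proof (rule riemann_stieltjes_limit(1)[OF _ T, where K="U * V"])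
      show "sets (control_measure (\<lambda>t. A t \<omega>)) = sets borel" by (simp add: P.control_measure_eq)
      show "A u \<omega> \<le> A v \<omega>" if "0 \<le> u" "u \<le> v" for u v by (rule Am[OF that \<omega>])
      show "emeasure (control_measure (\<lambda>t. A t \<omega>)) {u<..v} = ennreal (A v \<omega> - A u \<omega>)" if "0 \<le> u" "u \<le> v" for u v
        using that by (simp add: P.control_measure_eq P.emeasure_Ioc P.F_def)
      show "\<bar>Q (nd n (Suc i)) \<omega> * B (nd n i) \<omega>\<bar> \<le> U * V" if i: "i < Suc n" for n i
      proof -
        have "nd n i \<in> {0..T}" "nd n (Suc i) \<in> {0..T}" using nd(1)[of n] nd(3)[of i n] nd(3)[of "Suc i" n] i by auto
        then show ?thesis
          unfolding abs_mult using UV(5)[of "nd n i"] UV(5)[of "nd n (Suc i)"] by (intro mult_mono) auto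
      qed
      show "AE t in control_measure (\<lambda>t. A t \<omega>). 0 < t \<and> t \<le> T \<longrightarrow>
         (\<lambda>n. Q (nd n (Suc (idx T (Suc n) t))) \<omega> * B (nd n (idx T (Suc n) t)) \<omega>) \<longlonglongrightarrow> Q t \<omega> * B t \<omega>"
      proof (intro AE_I2 impI tendsto_mult)
        fix t assume t: "0 < t \<and> t \<le> T"
        show "(\<lambda>n. Q (nd n (Suc (idx T (Suc n) t))) \<omega>) \<longlonglongrightarrow> Q t \<omega>"
          by (rule continuous_on_tendsto_compose[OF QB_cont(1)[OF \<omega>]])
             (use t nd node_idx_tendsto(2)[of t T] in \<open>auto simp: nd_def node_nonneg\<close>)
        show "(\<lambda>n. B (nd n (idx T (Suc n) t)) \<omega>) \<longlonglongrightarrow> B t \<omega>"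
          by (rule continuous_on_tendsto_compose[OF QB_cont(2)[OF \<omega>]])
             (use t nd node_idx_tendsto(1)[of t T] in \<open>auto simp: nd_def node_nonneg\<close>)
      qed
      have "(\<lambda>t. indicator {0<..T} t * (if 0 \<le> t then Q t \<omega> * B t \<omega> else 0)) \<in> borel_measurable borel"
        using QB_meas(1)[OF \<omega>] by measurable
      also have "(\<lambda>t. indicator {0<..T} t * (if 0 \<le> t then Q t \<omega> * B t \<omega> else 0)) = (\<lambda>t. indicator {0<..T} t *\<^sub>R (Q t \<omega> * B t \<omega>))"
        by (auto simp: indicator_def)
      finally show "set_borel_measurable (control_measure (\<lambda>t. A t \<omega>)) {0<..T} (\<lambda>t. Q t \<omega> * B t \<omega>)"
        unfolding set_borel_measurable_def by (simp add: P.control_measure_eq)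
    qed
    then show ?thesis by (simp add: S1_def I1_def Q_def B_def nd_def)
  qed
  have L2: "(\<lambda>n. S2 n \<omega>) \<longlonglongrightarrow> s * exp ((s - 1) * ln a) * I2 \<omega>" if \<omega>: "\<omega> \<in> space M" for \<omega>
  proof -
    interpret P: control_path "\<lambda>t. A t \<omega>" by (rule path[OF \<omega>])
    interpret R: reflection "ln a" "\<lambda>s. ly s \<omega>" by (rule reflection_ly[OF \<omega>])
    obtain U V where UV: "0 \<le> U" "0 \<le> V" "0 \<le> Amax" "U * V * Amax \<le> D \<omega>"
       "\<And>t. t \<in> {0..T} \<Longrightarrow> 0 < Q t \<omega> \<and> Q t \<omega> \<le> U \<and> 0 < B t \<omega> \<and> B t \<omega> \<le> V" using bounds[OF \<omega>] by blast
    have "(\<lambda>n. \<Sum>i<Suc n. (Q (node T (Suc n) (Suc i)) \<omega> * A (node T (Suc n) (Suc i)) \<omega>) * (exp (s * R.l (node T (Suc n) (Suc i))) - exp (s * R.l (node T (Suc n) i))))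
      \<longlonglongrightarrow> s * exp ((s - 1) * ln a) * (LINT t:{0<..T}|control_measure (\<lambda>t. exp (R.l t) - 1). Q t \<omega> * A t \<omega> * exp ((1 - s) * ly t \<omega>))"
    proof (rule R.stieltjes_exp_l_limit[OF T, where K="U * Amax"])
      fix t assume t: "0 \<le> t" "t \<le> T"
      show "\<bar>Q t \<omega> * A t \<omega>\<bar> \<le> U * Amax"
        unfolding abs_mult using UV(5)[of t] t A0[OF t(1) \<omega>] Amax[OF t(1) \<omega>] UV(1) by (intro mult_mono) auto
    next
      fix t :: real assume t: "0 \<le> t"
      have "((\<lambda>t. Q t \<omega>) \<longlongrightarrow> Q t \<omega>) (at t within {0..})" using QB_cont(1)[OF \<omega>] t by (simp add: continuous_on_def)
      then have "((\<lambda>t. Q t \<omega>) \<longlongrightarrow> Q t \<omega>) (at_right t)" by (rule tendsto_within_subset) (use t in auto)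
      then show "((\<lambda>t. Q t \<omega> * A t \<omega>) \<longlongrightarrow> Q t \<omega> * A t \<omega>) (at_right t)"
        by (rule tendsto_mult) (rule P.f_right[OF t])
    next
      have "(\<lambda>t. indicator {0<..T} t * ((if 0 \<le> t then Q t \<omega> else 0) * (if 0 \<le> t then A t \<omega> else 0))) \<in> borel_measurable borel"
        using QB_meas(2,3)[OF \<omega>] by measurable
      also have "(\<lambda>t. indicator {0<..T} t * ((if 0 \<le> t then Q t \<omega> else 0) * (if 0 \<le> t then A t \<omega> else 0))) = (\<lambda>t. indicator {0<..T} t *\<^sub>R (Q t \<omega> * A t \<omega>))"
        by (auto simp: indicator_def)
      finally show "set_borel_measurable borel {0<..T} (\<lambda>t. Q t \<omega> * A t \<omega>)"
        unfolding set_borel_measurable_def .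
    qed
    then show ?thesis by (simp add: S2_def I2_def Q_def B_def nd_def l_def)
  qed
  have L3: "(\<lambda>n. S3' n \<omega>) \<longlonglongrightarrow> ?k * I3 \<omega>" if \<omega>: "\<omega> \<in> space M" for \<omega>
  proof -
    interpret P: control_path "\<lambda>t. A t \<omega>" by (rule path[OF \<omega>])
    \<comment> \<open>\<open>A\<close> is evaluated at left nodes, so convergence may fail at its
      jumps; these are countably many and null for Lebesgue measure.\<close>
    have disc: "countable {t \<in> {0..}. \<not> continuous (at t within {0..}) (\<lambda>t. A t \<omega>)}"
      by (rule mono_on_ctble_discont[OF P.f_mono])
    have "(\<lambda>n. \<Sum>i<Suc n. (Q (nd n i) \<omega> * C n i \<omega>) * (node T (Suc n) (Suc i) - node T (Suc n) i))
      \<longlonglongrightarrow> (LINT t:{0<..T}|lborel. Q t \<omega> * B t \<omega> * A t \<omega>)"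
    proof (rule riemann_stieltjes_limit(1)[OF _ T, where K="D \<omega>" and F="\<lambda>t. t"])
      show "\<bar>Q (nd n i) \<omega> * C n i \<omega>\<bar> \<le> D \<omega>" if "i < Suc n" for n i by (rule QC_bd[OF \<omega> that])
      have "AE t in lborel. t \<notin> {t \<in> {0..}. \<not> continuous (at t within {0..}) (\<lambda>t. A t \<omega>)}"
        by (rule AE_not_in) (rule countable_imp_null_set_lborel[OF disc])
      then show "AE t in lborel. 0 < t \<and> t \<le> T \<longrightarrow>
         (\<lambda>n. Q (nd n (idx T (Suc n) t)) \<omega> * C n (idx T (Suc n) t) \<omega>) \<longlonglongrightarrow> Q t \<omega> * B t \<omega> * A t \<omega>"
      proof eventually_elim
        fix t assume t': "t \<notin> {t \<in> {0..}. \<not> continuous (at t within {0..}) (\<lambda>t. A t \<omega>)}"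
        show "0 < t \<and> t \<le> T \<longrightarrow> (\<lambda>n. Q (nd n (idx T (Suc n) t)) \<omega> * C n (idx T (Suc n) t) \<omega>) \<longlonglongrightarrow> Q t \<omega> * B t \<omega> * A t \<omega>"
        proof
          assume t: "0 < t \<and> t \<le> T"
          then have ct: "continuous (at t within {0..}) (\<lambda>t. A t \<omega>)" using t' by auto
          have lim: "(\<lambda>n. nd n (idx T (Suc n) t)) \<longlonglongrightarrow> t" using node_idx_tendsto(1)[of t T] t by (simp add: nd_def)
          have "(\<lambda>n. A (nd n (idx T (Suc n) t)) \<omega>) \<longlonglongrightarrow> A t \<omega>"
            using ct lim nd(1) unfolding continuous_within_sequentially by (auto simp: comp_def)
          moreover have "(\<lambda>n. Q (nd n (idx T (Suc n) t)) \<omega>) \<longlonglongrightarrow> Q t \<omega>"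
            by (rule continuous_on_tendsto_compose[OF QB_cont(1)[OF \<omega>] lim]) (use t nd in auto)
          moreover have "(\<lambda>n. B (nd n (idx T (Suc n) t)) \<omega>) \<longlonglongrightarrow> B t \<omega>"
            by (rule continuous_on_tendsto_compose[OF QB_cont(2)[OF \<omega>] lim]) (use t nd in auto)
          ultimately show "(\<lambda>n. Q (nd n (idx T (Suc n) t)) \<omega> * C n (idx T (Suc n) t) \<omega>) \<longlonglongrightarrow> Q t \<omega> * B t \<omega> * A t \<omega>"
            unfolding C_def mult.assoc by (intro tendsto_mult)
        qed
      qed
      have "(\<lambda>t. indicator {0<..T} t * ((if 0 \<le> t then Q t \<omega> * B t \<omega> else 0) * (if 0 \<le> t then A t \<omega> else 0))) \<in> borel_measurable borel"
        using QB_meas(1,2)[OF \<omega>] by measurable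
      also have "(\<lambda>t. indicator {0<..T} t * ((if 0 \<le> t then Q t \<omega> * B t \<omega> else 0) * (if 0 \<le> t then A t \<omega> else 0))) = (\<lambda>t. indicator {0<..T} t *\<^sub>R (Q t \<omega> * B t \<omega> * A t \<omega>))"
        by (auto simp: indicator_def)
      finally show "set_borel_measurable lborel {0<..T} (\<lambda>t. Q t \<omega> * B t \<omega> * A t \<omega>)"
        unfolding set_borel_measurable_def by simp
    qed auto
    \<comment> \<open>Divided by the mesh, the growth factor is a difference quotient at 0 of an
      exponential with rate \<open>\<theta> p - q\<close>.\<close>
    moreover have "(\<lambda>n. e n / (T / real (Suc n))) \<longlonglongrightarrow> ?k"
    proof -
      have "((\<lambda>h. (exp (?k * h) - 1) / h) \<longlongrightarrow> ?k) (at 0)"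
      proof -
        have "((\<lambda>h. exp (?k * h)) has_real_derivative ?k) (at 0)"
          by (auto intro!: derivative_eq_intros)
        then show ?thesis unfolding DERIV_def by simp
      qed
      moreover have "filterlim (\<lambda>n. T / real (Suc n)) (at 0) sequentially"
      proof (rule filterlim_atI)
        show "(\<lambda>n. T / real (Suc n)) \<longlonglongrightarrow> 0"
          using tendsto_mult[OF tendsto_const[of T] LIMSEQ_inverse_real_of_nat] by (simp add: divide_inverse)
        show "\<forall>\<^sub>F n in sequentially. T / real (Suc n) \<noteq> 0" using T by (intro always_eventually) auto
      qed
      ultimately show ?thesis unfolding e_def by (rule filterlim_compose)
    qed
    ultimately have "(\<lambda>n. e n / (T / real (Suc n)) * (\<Sum>i<Suc n. (Q (nd n i) \<omega> * C n i \<omega>) * (node T (Suc n) (Suc i) - node T (Suc n) i)))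
      \<longlonglongrightarrow> ?k * (LINT t:{0<..T}|lborel. Q t \<omega> * B t \<omega> * A t \<omega>)" by (intro tendsto_mult)
    moreover have "e n / (T / real (Suc n)) * (\<Sum>i<Suc n. (Q (nd n i) \<omega> * C n i \<omega>) * (node T (Suc n) (Suc i) - node T (Suc n) i)) = S3' n \<omega>" for n
    proof -
      have "(\<Sum>i<Suc n. (Q (nd n i) \<omega> * C n i \<omega>) * (node T (Suc n) (Suc i) - node T (Suc n) i))
         = (\<Sum>i<Suc n. Q (nd n i) \<omega> * C n i \<omega>) * (T / real (Suc n))"
        unfolding sum_distrib_right by (intro sum.cong refl) (simp add: node_Suc)
      then show ?thesis using T unfolding S3'_def by simp
    qed
    ultimately show ?thesis by (simp add: I3_def Q_def B_def)
  qed
  note D1 = bounded_convergence_pathwise[OF S_meas(1) D_int L1 S1_bd]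
  note D2 = bounded_convergence_pathwise[OF S_meas(2) D_int L2 S2_bd]
  have KD: "integrable M (\<lambda>\<omega>. K * D \<omega>)" using D_int by simp
  note D3 = bounded_convergence_pathwise[OF S_meas(3) KD L3 S3_bd]
  show "integrable M I1" using D1(1) .
  have QTint: "integrable M (\<lambda>\<omega>. Q (nd n j) \<omega> * C n i \<omega>)" if "i < Suc n" "j \<le> Suc n" for n i j
  proof (rule Bochner_Integration.integrable_bound[OF D_int])
    show "(\<lambda>\<omega>. Q (nd n j) \<omega> * C n i \<omega>) \<in> borel_measurable M"
      unfolding C_def using QBm[OF nd(1)] meas(3)[OF nd(1)] by measurable
    show "AE \<omega> in M. norm (Q (nd n j) \<omega> * C n i \<omega>) \<le> norm (D \<omega>)"
    proof (rule AE_I2)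
      fix \<omega> assume \<omega>: "\<omega> \<in> space M"
      obtain U V where UV: "0 \<le> U" "0 \<le> V" "0 \<le> Amax" "U * V * Amax \<le> D \<omega>"
         "\<And>t. t \<in> {0..T} \<Longrightarrow> 0 < Q t \<omega> \<and> Q t \<omega> \<le> U \<and> 0 < B t \<omega> \<and> B t \<omega> \<le> V" using bounds[OF \<omega>] by blast
      have "nd n i \<in> {0..T}" "nd n j \<in> {0..T}" using nd(1)[of n] nd(3)[of i n] nd(3)[of j n] that by auto
      then have "\<bar>Q (nd n j) \<omega>\<bar> * \<bar>B (nd n i) \<omega>\<bar> * \<bar>A (nd n i) \<omega>\<bar> \<le> U * V * Amax"
        using UV(5)[of "nd n i"] UV(5)[of "nd n j"] UV(1-3) A0[OF nd(1) \<omega>, of n i] Amax[OF nd(1) \<omega>, of n i]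
        by (intro mult_mono mult_nonneg_nonneg) auto
      then show "norm (Q (nd n j) \<omega> * C n i \<omega>) \<le> norm (D \<omega>)" using UV(4) by (simp add: C_def abs_mult mult.assoc)
    qed
  qed
  have "integrable M (\<lambda>\<omega>. Q T \<omega> * B T \<omega> * A T \<omega>)"
  proof (rule Bochner_Integration.integrable_bound[OF D_int])
    show "(\<lambda>\<omega>. Q T \<omega> * B T \<omega> * A T \<omega>) \<in> borel_measurable M" using QBm[OF less_imp_le[OF T]] meas(3)[OF less_imp_le[OF T]] by measurable
    show "AE \<omega> in M. norm (Q T \<omega> * B T \<omega> * A T \<omega>) \<le> norm (D \<omega>)"
    proof (rule AE_I2)
      fix \<omega> assume \<omega>: "\<omega> \<in> space M"
      obtain U V where UV: "0 \<le> U" "0 \<le> V" "0 \<le> Amax" "U * V * Amax \<le> D \<omega>"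
         "\<And>t. t \<in> {0..T} \<Longrightarrow> 0 < Q t \<omega> \<and> Q t \<omega> \<le> U \<and> 0 < B t \<omega> \<and> B t \<omega> \<le> V" using bounds[OF \<omega>] by blast
      have "\<bar>Q T \<omega>\<bar> * \<bar>B T \<omega>\<bar> * \<bar>A T \<omega>\<bar> \<le> U * V * Amax"
        using UV(5)[of T] UV(1-3) A0[of T, OF _ \<omega>] Amax[of T, OF _ \<omega>] T
        by (intro mult_mono mult_nonneg_nonneg) auto
      then show "norm (Q T \<omega> * B T \<omega> * A T \<omega>) \<le> norm (D \<omega>)" using UV(4) by (simp add: abs_mult)
    qed
  qed
  then show QBA_int: "integrable M (\<lambda>\<omega>. exp (- q * T + p * ly T \<omega>) * exp (s * l T \<omega>) * A T \<omega>)"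
    by (simp only: Q_def B_def)
  \<comment> \<open>Conditioning at the left node: equality holds in expectation only, which is why
    \<open>S3'\<close> takes the place of \<open>S3\<close> before the limit.\<close>
  have S3E: "integrable M (S3 n)" "expectation (S3 n) = expectation (S3' n)" for n
  proof -
    have Ci: "C n i \<in> borel_measurable (Fl (nd n i))" for i
      unfolding C_def B_def using l_adapted[OF nd(1)] adapted[OF nd(1)] by measurable
    have Ci0: "0 \<le> C n i \<omega>" if "\<omega> \<in> space M" for i \<omega>
      unfolding C_def B_def using A0[OF nd(1) that] by simp
    have int: "integrable M (\<lambda>\<omega>. (Q (nd n (Suc i)) \<omega> - Q (nd n i) \<omega>) * C n i \<omega>)" if "i < Suc n" for i
      unfolding left_diff_distrib using that by (intro Bochner_Integration.integrable_diff QTint) auto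
    show "integrable M (S3 n)" unfolding S3_def using int by (intro Bochner_Integration.integrable_sum) auto
    have "expectation (S3 n) = (\<Sum>i<Suc n. expectation (\<lambda>\<omega>. (Q (nd n (Suc i)) \<omega> - Q (nd n i) \<omega>) * C n i \<omega>))"
      unfolding S3_def using int by (intro Bochner_Integration.integral_sum) auto
    also have "\<dots> = (\<Sum>i<Suc n. e n * expectation (\<lambda>\<omega>. Q (nd n i) \<omega> * C n i \<omega>))"
    proof (intro sum.cong refl)
      fix i assume i: "i \<in> {..<Suc n}"
      have "expectation (\<lambda>\<omega>. Q (nd n (Suc i)) \<omega> * C n i \<omega>) = exp (?k * (nd n (Suc i) - nd n i)) * expectation (\<lambda>\<omega>. Q (nd n i) \<omega> * C n i \<omega>)"
        unfolding Q_def by (rule expectation_power_step[OF nd(1) nd(2) Ci Ci0])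
      moreover have "nd n (Suc i) - nd n i = T / real (Suc n)" by (simp add: nd_def node_Suc)
      moreover have "expectation (\<lambda>\<omega>. (Q (nd n (Suc i)) \<omega> - Q (nd n i) \<omega>) * C n i \<omega>)
         = expectation (\<lambda>\<omega>. Q (nd n (Suc i)) \<omega> * C n i \<omega>) - expectation (\<lambda>\<omega>. Q (nd n i) \<omega> * C n i \<omega>)"
        unfolding left_diff_distrib using i by (intro Bochner_Integration.integral_diff QTint) auto
      ultimately show "expectation (\<lambda>\<omega>. (Q (nd n (Suc i)) \<omega> - Q (nd n i) \<omega>) * C n i \<omega>) = e n * expectation (\<lambda>\<omega>. Q (nd n i) \<omega> * C n i \<omega>)"
        by (simp add: e_def left_diff_distrib)
    qed
    also have "\<dots> = expectation (S3' n)"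
      unfolding S3'_def sum_distrib_left[symmetric] integral_mult_right_zero
      by (subst Bochner_Integration.integral_sum) (auto intro!: QTint)
    finally show "expectation (S3 n) = expectation (S3' n)" .
  qed
  have A0int: "integrable M (\<lambda>\<omega>. Q 0 \<omega> * B 0 \<omega> * A 0 \<omega>)"
    using QTint[of 0 0 0] by (simp add: C_def nd0 mult.assoc)
  have QB0: "Q 0 \<omega> * B 0 \<omega> * A 0 \<omega> = exp (p * ln xh) * A 0 \<omega>" if "\<omega> \<in> space M" for \<omega>
    using reflection.l_0[OF reflection_ly[OF that]] by (simp add: Q_def B_def ly_0[OF that] l_def)
  have ident: "expectation (\<lambda>\<omega>. Q T \<omega> * B T \<omega> * A T \<omega>) = exp (p * ln xh) * expectation (A 0) + expectation (S1 n) + expectation (S2 n) + expectation (S3' n)" for n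
  proof -
    have "expectation (\<lambda>\<omega>. Q T \<omega> * B T \<omega> * A T \<omega>) = expectation (\<lambda>\<omega>. Q 0 \<omega> * B 0 \<omega> * A 0 \<omega> + S1 n \<omega> + S2 n \<omega> + S3 n \<omega>)"
      by (simp only: tele[of _ n])
    also have "\<dots> = expectation (\<lambda>\<omega>. Q 0 \<omega> * B 0 \<omega> * A 0 \<omega>) + expectation (S1 n) + expectation (S2 n) + expectation (S3 n)"
      using A0int D1(3)[of n] D2(3)[of n] S3E(1)[of n] by simp
    also have "expectation (\<lambda>\<omega>. Q 0 \<omega> * B 0 \<omega> * A 0 \<omega>) = expectation (\<lambda>\<omega>. exp (p * ln xh) * A 0 \<omega>)"
      by (rule Bochner_Integration.integral_cong) (auto simp: QB0)
    finally show ?thesis by (simp only: S3E(2) integral_mult_right_zero)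
  qed
  have "(\<lambda>n. exp (p * ln xh) * expectation (A 0) + expectation (S1 n) + expectation (S2 n) + expectation (S3' n))
     \<longlonglongrightarrow> exp (p * ln xh) * expectation (A 0) + expectation I1 + expectation (\<lambda>\<omega>. s * exp ((s - 1) * ln a) * I2 \<omega>) + expectation (\<lambda>\<omega>. ?k * I3 \<omega>)"
    by (intro tendsto_intros D1(2) D2(2) D3(2))
  then have "(\<lambda>n. expectation (\<lambda>\<omega>. Q T \<omega> * B T \<omega> * A T \<omega>))
     \<longlonglongrightarrow> exp (p * ln xh) * expectation (A 0) + expectation I1 + expectation (\<lambda>\<omega>. s * exp ((s - 1) * ln a) * I2 \<omega>) + expectation (\<lambda>\<omega>. ?k * I3 \<omega>)"
    by (simp only: ident[symmetric])
  then have "expectation (\<lambda>\<omega>. Q T \<omega> * B T \<omega> * A T \<omega>)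
     = exp (p * ln xh) * expectation (A 0) + expectation I1 + expectation (\<lambda>\<omega>. s * exp ((s - 1) * ln a) * I2 \<omega>) + expectation (\<lambda>\<omega>. ?k * I3 \<omega>)"
    by (simp only: LIMSEQ_const_iff)
  then show "expectation (\<lambda>\<omega>. exp (- q * T + p * ly T \<omega>) * exp (s * l T \<omega>) * A T \<omega>)
      = exp (p * ln xh) * expectation (A 0) + expectation I1 + s * exp ((s - 1) * ln a) * expectation I2
        + (\<theta> p - q) * expectation I3"
    by (simp only: Q_def B_def integral_mult_right_zero)
  show "integrable M I2" if "s \<noteq> 0" using D2(1) that by (simp add: mult.assoc)
  show "integrable M I3" if "\<theta> p \<noteq> q" using D3(1) that by simp
qed

end

section \<open>Tails of integrals and joint measurability\<close>

lemma nn_integral_small_value: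
  fixes f :: "real \<Rightarrow> ennreal"
  assumes f: "(\<integral>\<^sup>+t\<in>{0..}. f t \<partial>lborel) < \<infinity>" and e: "0 < e" and T0: "0 \<le> T0"
  shows "\<exists>T\<ge>T0. f T \<le> ennreal e"
proof (rule ccontr)
  assume "\<not> ?thesis"
  then have gt: "ennreal e \<le> f T" if "T0 \<le> T" for T using that by (meson linear)
  \<comment> \<open>Otherwise the integrand stays above \<open>e\<close> on intervals of arbitrary
    length. Small values at arbitrarily late times thus exist even where no limit is known.\<close>
  have le: "ennreal (e * real n) \<le> (\<integral>\<^sup>+t\<in>{0..}. f t \<partial>lborel)" for n
  proof -
    have "ennreal (e * real n) = ennreal e * emeasure lborel {T0..T0 + real n}"
      using e by (simp add: ennreal_mult)
    also have "\<dots> = (\<integral>\<^sup>+t. ennreal e * indicator {T0..T0 + real n} t \<partial>lborel)"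
      by (subst nn_integral_cmult_indicator) auto
    also have "\<dots> \<le> (\<integral>\<^sup>+t\<in>{0..}. f t \<partial>lborel)"
      using gt T0 by (intro nn_integral_mono) (auto simp: indicator_def)
    finally show ?thesis .
  qed
  obtain b where b: "(\<integral>\<^sup>+t\<in>{0..}. f t \<partial>lborel) = ennreal b" "0 \<le> b" using f by (cases "\<integral>\<^sup>+t\<in>{0..}. f t \<partial>lborel") auto
  obtain n where "b / e < real n" using reals_Archimedean2 by blast
  then have "b < e * real n" using e by (simp add: field_simps)
  moreover have "e * real n \<le> b" using le[of n] b e by (simp add: ennreal_le_iff)
  ultimately show False by simp
qed

lemma nn_integral_Ioi_SUP:
  fixes N :: "real measure"
  assumes N: "sets N = sets borel" and f: "(\<lambda>t. f t * indicator {0<..} t) \<in> borel_measurable borel"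
  shows "(\<integral>\<^sup>+t\<in>{0<..}. f t \<partial>N) = (SUP n. \<integral>\<^sup>+t\<in>{0<..real (Suc n)}. f t \<partial>N)"
proof -
  have eq: "f t * indicator {0<..real (Suc n)} t = (f t * indicator {0<..} t) * indicator {..real (Suc n)} t" for n t
    by (auto simp: indicator_def)
  have m: "(\<lambda>t. f t * indicator {0<..real (Suc n)} t) \<in> borel_measurable N" for n
    unfolding eq measurable_cong_sets[OF N refl] using f by measurable
  have "(\<integral>\<^sup>+t\<in>{0<..}. f t \<partial>N) = (\<integral>\<^sup>+t. (SUP n. f t * indicator {0<..real (Suc n)} t) \<partial>N)"
  proof (intro nn_integral_cong)
    fix t
    obtain n where n: "t \<le> real (Suc n)" using real_arch_simple[of t] by (metis le_add_same_cancel1 of_nat_Suc order_trans zero_le_one add.commute)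
    show "f t * indicator {0<..} t = (SUP n. f t * indicator {0<..real (Suc n)} t)"
    proof (rule antisym)
      have "f t * indicator {0<..} t = f t * indicator {0<..real (Suc n)} t" using n by (auto simp: indicator_def)
      also have "\<dots> \<le> (SUP n. f t * indicator {0<..real (Suc n)} t)" by (rule SUP_upper) simp
      finally show "f t * indicator {0<..} t \<le> (SUP n. f t * indicator {0<..real (Suc n)} t)" .
      show "(SUP n. f t * indicator {0<..real (Suc n)} t) \<le> f t * indicator {0<..} t"
        by (rule SUP_least) (auto simp: indicator_def)
    qed
  qed
  also have "\<dots> = (SUP n. \<integral>\<^sup>+t\<in>{0<..real (Suc n)}. f t \<partial>N)"
    by (rule nn_integral_monotone_convergence_SUP[OF _ m]) (auto simp: incseq_def le_fun_def indicator_def)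
  finally show ?thesis .
qed

text \<open>Time is replaced by the next grid point, which takes countably many values and lies
  strictly to the right, so that right continuity yields the limit.\<close>

lemma jointly_measurable_right_continuous:
  fixes Y :: "real \<Rightarrow> 'a \<Rightarrow> real"
  assumes Y: "\<And>t. 0 \<le> t \<Longrightarrow> Y t \<in> borel_measurable M"
    and right: "\<And>t \<omega>. 0 \<le> t \<Longrightarrow> \<omega> \<in> space M \<Longrightarrow> ((\<lambda>t. Y t \<omega>) \<longlongrightarrow> Y t \<omega>) (at_right t)"
  shows "(\<lambda>(t, \<omega>). if 0 \<le> t then Y t \<omega> else 0) \<in> borel_measurable (borel \<Otimes>\<^sub>M M)"
proof (rule borel_measurable_LIMSEQ_real)
  define v where "v n t = (real (nat \<lfloor>t * real (Suc n)\<rfloor>) + 1) / real (Suc n)" for n :: nat and t :: real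
  let ?Z = "\<lambda>n (p :: real \<times> 'a). if 0 \<le> fst p then Y (v n (fst p)) (snd p) else 0"
  have v: "t < v n t" "v n t \<le> t + 1 / real (Suc n)" if t: "0 \<le> t" for n t
  proof -
    have "real (nat \<lfloor>t * real (Suc n)\<rfloor>) = real_of_int \<lfloor>t * real (Suc n)\<rfloor>" using t by simp
    then have "real (nat \<lfloor>t * real (Suc n)\<rfloor>) \<le> t * real (Suc n)" "t * real (Suc n) < real (nat \<lfloor>t * real (Suc n)\<rfloor>) + 1" by linarith+
    then have "real (nat \<lfloor>t * real (Suc n)\<rfloor>) / real (Suc n) \<le> t" "t < (real (nat \<lfloor>t * real (Suc n)\<rfloor>) + 1) / real (Suc n)"
      by (simp_all only: pos_divide_le_eq pos_less_divide_eq of_nat_0_less_iff zero_less_Suc)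
    then show "t < v n t" "v n t \<le> t + 1 / real (Suc n)" unfolding v_def by (simp_all add: add_divide_distrib)
  qed
  show "?Z n \<in> borel_measurable (borel \<Otimes>\<^sub>M M)" for n
  proof -
    have "(\<lambda>p. (\<lambda>i p. Y ((real i + 1) / real (Suc n)) (snd p)) (nat \<lfloor>fst p * real (Suc n)\<rfloor>) p) \<in> borel_measurable (borel \<Otimes>\<^sub>M M)"
    proof (rule measurable_compose_countable[where f="\<lambda>i p. Y ((real i + 1) / real (Suc n)) (snd p)" and g="\<lambda>p. nat \<lfloor>fst p * real (Suc n)\<rfloor>"])
      fix i :: nat
      have "Y ((real i + 1) / real (Suc n)) \<in> borel_measurable M" by (rule Y) simp
      then show "(\<lambda>p. Y ((real i + 1) / real (Suc n)) (snd p)) \<in> borel_measurable (borel \<Otimes>\<^sub>M M)" by measurable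
    qed measurable
    then have "(\<lambda>p. Y (v n (fst p)) (snd p)) \<in> borel_measurable (borel \<Otimes>\<^sub>M M)" by (simp add: v_def)
    then show ?thesis by measurable
  qed
  fix p :: "real \<times> 'a" assume "p \<in> space (borel \<Otimes>\<^sub>M M)"
  then have \<omega>: "snd p \<in> space M" by (auto simp: space_pair_measure)
  show "(\<lambda>n. ?Z n p) \<longlonglongrightarrow> (case p of (t, \<omega>) \<Rightarrow> if 0 \<le> t then Y t \<omega> else 0)"
  proof (cases "0 \<le> fst p")
    case True
    let ?t = "fst p"
    have "(\<lambda>n. v n ?t) \<longlonglongrightarrow> ?t"
    proof (rule tendsto_sandwich)
      show "\<forall>\<^sub>F n in sequentially. ?t \<le> v n ?t" using v(1)[OF True] by (intro always_eventually allI less_imp_le)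
      show "\<forall>\<^sub>F n in sequentially. v n ?t \<le> ?t + 1 / real (Suc n)" using v(2)[OF True] by (intro always_eventually allI)
      show "(\<lambda>n. ?t + 1 / real (Suc n)) \<longlonglongrightarrow> ?t"
        using tendsto_add[OF tendsto_const[of ?t] LIMSEQ_inverse_real_of_nat] by (simp add: divide_inverse)
    qed simp
    then have "filterlim (\<lambda>n. v n ?t) (at_right ?t) sequentially"
      using v(1)[OF True] by (auto simp: filterlim_at intro!: always_eventually less_imp_neq[symmetric])
    from filterlim_compose[OF right[OF True \<omega>] this] show ?thesis using True by (simp add: case_prod_beta)
  qed (auto simp: case_prod_beta)
qed

section \<open>Stieltjes integrals of continuous weights\<close>

context control_path
begin

lemma continuous_integral:
  assumes T: "0 < T" and w: "continuous_on {0..} w"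
  shows "set_integrable (control_measure f) {0<..T} w"
    "(\<lambda>n. \<Sum>i<Suc n. w (node T (Suc n) (Suc i)) * (f (node T (Suc n) (Suc i)) - f (node T (Suc n) i)))
      \<longlonglongrightarrow> (LINT t:{0<..T}|control_measure f. w t)"
proof -
  have "\<exists>x\<in>{0..T}. \<forall>y\<in>{0..T}. \<bar>w y\<bar> \<le> \<bar>w x\<bar>"
    using T by (intro continuous_attains_sup continuous_intros continuous_on_subset[OF w]) auto
  then obtain K where K: "\<forall>y\<in>{0..T}. \<bar>w y\<bar> \<le> K" by blast
  have wm: "(\<lambda>t. indicator {0<..T} t * (if t \<in> {0..} then w t else 0)) \<in> borel_measurable borel"
  proof -
    have "(\<lambda>t. if t \<in> {0..} then w t else 0) \<in> borel_measurable borel"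
      by (rule borel_measurable_continuous_on_if) (auto intro!: continuous_intros w)
    then show ?thesis by measurable
  qed
  also have "(\<lambda>t. indicator {0<..T} t * (if t \<in> {0..} then w t else 0)) = (\<lambda>t. indicator {0<..T} t *\<^sub>R w t)"
    by (auto simp: indicator_def)
  finally have sm: "set_borel_measurable (control_measure f) {0<..T} w"
    unfolding set_borel_measurable_def by (simp add: control_measure_eq)
  have lim: "AE t in control_measure f. 0 < t \<and> t \<le> T \<longrightarrow> (\<lambda>n. w (node T (Suc n) (Suc (idx T (Suc n) t)))) \<longlonglongrightarrow> w t"
  proof (intro AE_I2 impI)
    fix t assume t: "0 < t \<and> t \<le> T"
    show "(\<lambda>n. w (node T (Suc n) (Suc (idx T (Suc n) t)))) \<longlonglongrightarrow> w t"
      by (rule continuous_on_tendsto_compose[OF w node_idx_tendsto(2)]) (use t T in \<open>auto simp: node_nonneg\<close>)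
  qed
  have bd: "\<bar>w (node T (Suc n) (Suc i))\<bar> \<le> K" if "i < Suc n" for n i
    using K node_nonneg[of T "Suc n" "Suc i"] node_le[of T "Suc i" "Suc n"] T that by auto
  have Ioc: "emeasure (control_measure f) {u<..v} = ennreal (f v - f u)" if "0 \<le> u" "u \<le> v" for u v
    using that by (simp add: control_measure_eq emeasure_Ioc F_def)
  have s: "sets (control_measure f) = sets borel" by (simp add: control_measure_eq)
  note * = riemann_stieltjes_limit[OF s T f_le Ioc bd lim sm]
  show "set_integrable (control_measure f) {0<..T} w" by (rule *(2))
  show "(\<lambda>n. \<Sum>i<Suc n. w (node T (Suc n) (Suc i)) * (f (node T (Suc n) (Suc i)) - f (node T (Suc n) i)))
      \<longlonglongrightarrow> (LINT t:{0<..T}|control_measure f. w t)" by (rule *(1))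
qed

text \<open>Both integrals are limits of the same kind of partition sums, so the affine relation
  matters only on \<open>{0..T}\<close>. The constant \<open>k\<close> affects the atom at 0 alone,
  which lies outside the domain of integration.\<close>

lemma control_measure_affine:
  assumes T: "0 < T" and w: "continuous_on {0..} w" and f': "control_path f'"
    and eq: "\<And>t. 0 \<le> t \<Longrightarrow> t \<le> T \<Longrightarrow> f' t = c * f t + k"
  shows "(LINT t:{0<..T}|control_measure f'. w t) = c * (LINT t:{0<..T}|control_measure f. w t)"
proof (rule LIMSEQ_unique[OF control_path.continuous_integral(2)[OF f' T w]])
  have "(\<lambda>n. c * (\<Sum>i<Suc n. w (node T (Suc n) (Suc i)) * (f (node T (Suc n) (Suc i)) - f (node T (Suc n) i))))
     \<longlonglongrightarrow> c * (LINT t:{0<..T}|control_measure f. w t)"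
    by (intro tendsto_mult tendsto_const continuous_integral(2) T w)
  moreover have "c * (\<Sum>i<Suc n. w (node T (Suc n) (Suc i)) * (f (node T (Suc n) (Suc i)) - f (node T (Suc n) i)))
     = (\<Sum>i<Suc n. w (node T (Suc n) (Suc i)) * (f' (node T (Suc n) (Suc i)) - f' (node T (Suc n) i)))" for n
    unfolding sum_distrib_left
  proof (intro sum.cong refl)
    fix i assume "i \<in> {..<Suc n}"
    then have "f' (node T (Suc n) (Suc i)) = c * f (node T (Suc n) (Suc i)) + k" "f' (node T (Suc n) i) = c * f (node T (Suc n) i) + k"
      using T by (auto intro!: eq node_nonneg node_le)
    then show "c * (w (node T (Suc n) (Suc i)) * (f (node T (Suc n) (Suc i)) - f (node T (Suc n) i)))
      = w (node T (Suc n) (Suc i)) * (f' (node T (Suc n) (Suc i)) - f' (node T (Suc n) i))" by (simp add: algebra_simps)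
  qed
  ultimately show "(\<lambda>n. \<Sum>i<Suc n. w (node T (Suc n) (Suc i)) * (f' (node T (Suc n) (Suc i)) - f' (node T (Suc n) i)))
     \<longlonglongrightarrow> c * (LINT t:{0<..T}|control_measure f. w t)" by simp
qed

lemma nn_integral_eq_LINT:
  assumes T: "0 < T" and w: "continuous_on {0..} w" and w0: "\<And>t. 0 \<le> t \<Longrightarrow> 0 \<le> w t"
  shows "(\<integral>\<^sup>+t\<in>{0<..T}. ennreal (w t) \<partial>control_measure f) = ennreal (LINT t:{0<..T}|control_measure f. w t)"
    "0 \<le> (LINT t:{0<..T}|control_measure f. w t)"
proof -
  have i: "integrable (control_measure f) (\<lambda>t. indicator {0<..T} t *\<^sub>R w t)"
    using continuous_integral(1)[OF T w] by (simp add: set_integrable_def)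
  have n: "0 \<le> indicator {0<..T} t *\<^sub>R w t" for t using w0 by (auto simp: indicator_def)
  have "(\<integral>\<^sup>+t\<in>{0<..T}. ennreal (w t) \<partial>control_measure f) = (\<integral>\<^sup>+t. ennreal (indicator {0<..T} t *\<^sub>R w t) \<partial>control_measure f)"
    by (intro nn_integral_cong) (auto simp: indicator_def)
  then show "(\<integral>\<^sup>+t\<in>{0<..T}. ennreal (w t) \<partial>control_measure f) = ennreal (LINT t:{0<..T}|control_measure f. w t)"
    unfolding set_lebesgue_integral_def using nn_integral_eq_integral[OF i] n by simp
  show "0 \<le> (LINT t:{0<..T}|control_measure f. w t)"
    unfolding set_lebesgue_integral_def using n by (intro Bochner_Integration.integral_nonneg) auto
qed

text \<open>Separates the atom at 0 and links nonnegative integrals over the unbounded horizon to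
  real ones over bounded horizons, where the product rule is available.\<close>

lemma nn_integral_split_zero:
  assumes w: "continuous_on {0..} w" and w0: "\<And>t. 0 \<le> t \<Longrightarrow> 0 \<le> w t"
  shows "(\<integral>\<^sup>+t\<in>{0..}. ennreal (w t) \<partial>control_measure f)
    = ennreal (w 0 * f 0) + (SUP n. ennreal (LINT t:{0<..real (Suc n)}|control_measure f. w t))"
proof -
  have wm: "(\<lambda>t. ennreal (if t \<in> {0..} then w t else 0)) \<in> borel_measurable borel"
    by (intro measurable_compose[OF borel_measurable_continuous_on_if measurable_ennreal]) (auto intro!: continuous_intros w)
  have eq: "(\<lambda>t. ennreal (if t \<in> {0..} then w t else 0) * indicator {0<..} t) = (\<lambda>t. ennreal (w t) * indicator {0<..} t)"
    by (auto simp: indicator_def)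
  have wm': "(\<lambda>t. ennreal (w t) * indicator {0<..} t) \<in> borel_measurable borel"
    using wm unfolding eq[symmetric] by measurable
  have "(\<integral>\<^sup>+t\<in>{0..}. ennreal (w t) \<partial>control_measure f)
    = (\<integral>\<^sup>+t. ennreal (w 0) * indicator {0} t + ennreal (w t) * indicator {0<..} t \<partial>control_measure f)"
    by (intro nn_integral_cong) (auto simp: indicator_def)
  also have "\<dots> = (\<integral>\<^sup>+t. ennreal (w 0) * indicator {0} t \<partial>control_measure f) + (\<integral>\<^sup>+t\<in>{0<..}. ennreal (w t) \<partial>control_measure f)"
    using wm' by (intro nn_integral_add) (auto simp: control_measure_eq)
  also have "(\<integral>\<^sup>+t. ennreal (w 0) * indicator {0} t \<partial>control_measure f) = ennreal (w 0 * f 0)"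
    using w0[of 0] f_nonneg[of 0] emeasure_singleton[of 0]
    by (subst nn_integral_cmult_indicator) (auto simp: control_measure_eq jump_def left_lim_def ennreal_mult)
  also have "(\<integral>\<^sup>+t\<in>{0<..}. ennreal (w t) \<partial>control_measure f) = (SUP n. \<integral>\<^sup>+t\<in>{0<..real (Suc n)}. ennreal (w t) \<partial>control_measure f)"
    by (rule nn_integral_Ioi_SUP[OF _ wm']) (simp add: control_measure_eq)
  also have "\<dots> = (SUP n. ennreal (LINT t:{0<..real (Suc n)}|control_measure f. w t))"
    using nn_integral_eq_LINT(1)[OF _ w w0] by simp
  finally show ?thesis .
qed

end

lemma control_path_const: "0 \<le> c \<Longrightarrow> control_path (\<lambda>_. c)"
  by unfold_locales (auto simp: mono_on_def cadlag_def)

text \<open>A nonintegrable function has real integral 0, so no integrability has to be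
  known.\<close>

lemma ennreal_integral_le: "(\<And>x. x \<in> space M \<Longrightarrow> 0 \<le> f x) \<Longrightarrow> ennreal (integral\<^sup>L M f) \<le> (\<integral>\<^sup>+x. ennreal (f x) \<partial>M)"
  by (cases "integrable M f") (auto simp: nn_integral_eq_integral not_integrable_integral_eq intro!: AE_I2)

text \<open>Serves to cut a policy off at a constant while keeping it a control path.\<close>

lemma (in control_path) compose_path:
  assumes c: "continuous_on UNIV h" and m: "mono h" and n: "\<And>y. 0 \<le> y \<Longrightarrow> 0 \<le> h y"
  shows "control_path (\<lambda>t. h (f t))"
proof
  show "0 \<le> h (f t)" if "0 \<le> t" for t using f_nonneg[OF that] n by simp
  show "mono_on {0..} (\<lambda>t. h (f t))" using m f_le by (auto simp: mono_on_def mono_def)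
  have hc: "isCont h y" for y using c by (simp add: continuous_on_eq_continuous_at)
  show "cadlag (\<lambda>t. h (f t))"
    unfolding cadlag_def
  proof (intro conjI allI impI)
    show "continuous (at_right t) (\<lambda>t. h (f t))" if "0 \<le> t" for t
      unfolding continuous_within by (rule isCont_tendsto_compose[OF hc f_right[OF that]])
    fix t :: real assume t: "0 < t"
    show "\<exists>l. ((\<lambda>t. h (f t)) \<longlongrightarrow> l) (at_left t)"
      using isCont_tendsto_compose[OF hc left_lim_tendsto[OF t]] by (rule exI)
  qed
qed

section \<open>Moments of the reflected process and of its effort\<close>

context debt_model
begin

lemma weight_continuous: "\<omega> \<in> space M \<Longrightarrow> continuous_on {0..} (\<lambda>t. exp (- q * t + c * ly t \<omega> + s * l t \<omega>))"
proof -
  assume \<omega>: "\<omega> \<in> space M"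
  interpret R: reflection "ln a" "\<lambda>s. ly s \<omega>" by (rule reflection_ly[OF \<omega>])
  show ?thesis unfolding l_def by (intro continuous_intros R.y_cont R.l_cont)
qed

lemma exp_l_path: "\<omega> \<in> space M \<Longrightarrow> control_path (\<lambda>t. exp (l t \<omega>) - 1)"
  unfolding l_def using reflection.exp_l_path[OF reflection_ly] .

text \<open>The case \<open>A = 1\<close>, \<open>s = p\<close> of the product rule. A constant has
  no increments, and the weight in the reflection integral is
  \<open>Y powr p * Y powr (1 - p) = Y\<close> whatever \<open>p\<close> is. The same unknown, the
  mean discounted effort, therefore occurs for every exponent.\<close>

lemma expectation_power_rule:
  fixes T p q :: real
  assumes T: "0 < T" and p: "p \<noteq> 0"
  defines "U \<equiv> \<lambda>\<omega>. LINT t:{0<..T}|control_measure (\<lambda>t. exp (l t \<omega>) - 1). exp (- q * t + ly t \<omega>)"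
    and "I3 \<equiv> \<lambda>\<omega>. LINT t:{0<..T}|lborel. exp (- q * t + p * ly t \<omega> + p * l t \<omega>)"
  shows "integrable M U" "\<theta> p \<noteq> q \<Longrightarrow> integrable M I3"
    "integrable M (\<lambda>\<omega>. exp (- q * T + p * ly T \<omega> + p * l T \<omega>))"
    "expectation (\<lambda>\<omega>. exp (- q * T + p * ly T \<omega> + p * l T \<omega>))
      = exp (p * ln xh) + p * exp ((p - 1) * ln a) * expectation U + (\<theta> p - q) * expectation I3"
proof -
  have e: "exp (- q * t + p * ly t \<omega>) * exp (p * l t \<omega>) * 1 = exp (- q * t + p * ly t \<omega> + p * l t \<omega>)"
    "exp (- q * t + p * ly t \<omega>) * exp (p * l t \<omega>) = exp (- q * t + p * ly t \<omega> + p * l t \<omega>)"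
    "exp (- q * t + p * ly t \<omega>) * 1 * exp ((1 - p) * ly t \<omega>) = exp (- q * t + ly t \<omega>)" for t \<omega>
    by (simp_all add: exp_add[symmetric] algebra_simps)
  have z: "(LINT t:{0<..T}|control_measure (\<lambda>t. 1 :: real). exp (- q * t + p * ly t \<omega> + p * l t \<omega>)) = 0" if \<omega>: "\<omega> \<in> space M" for \<omega>
    using control_path.control_measure_affine[OF control_path_const[of 1] T weight_continuous[OF \<omega>, of q p p] control_path_const[of 1], of 0 1] by simp
  note K = expectation_product_rule[OF T, where A="\<lambda>_ _. 1" and Amax=1 and q=q and p=p and s=p, unfolded e]
  have K': "expectation (\<lambda>\<omega>. LINT t:{0<..T}|control_measure (\<lambda>t. 1 :: real). exp (- q * t + p * ly t \<omega> + p * l t \<omega>)) = 0"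
    using Bochner_Integration.integral_cong[of M M "\<lambda>\<omega>. LINT t:{0<..T}|control_measure (\<lambda>t. 1 :: real). exp (- q * t + p * ly t \<omega> + p * l t \<omega>)" "\<lambda>_. 0"] z by simp
  show "integrable M U" unfolding U_def using K(2) p by (simp add: control_path_const)
  show "integrable M I3" if "\<theta> p \<noteq> q" unfolding I3_def using K(3) that by (simp add: control_path_const)
  show "integrable M (\<lambda>\<omega>. exp (- q * T + p * ly T \<omega> + p * l T \<omega>))" using K(4) by (simp add: control_path_const)
  show "expectation (\<lambda>\<omega>. exp (- q * T + p * ly T \<omega> + p * l T \<omega>))
      = exp (p * ln xh) + p * exp ((p - 1) * ln a) * expectation U + (\<theta> p - q) * expectation I3"
    unfolding U_def I3_def using K(5) K' by (simp add: control_path_const prob_space)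
qed

text \<open>Total discounted amount that reflection adds, in units of the debt ratio: the integral
  of \<open>Y\<close> against the measure of \<open>exp l\<close>.\<close>

definition "up_reflection q \<omega> = (\<integral>\<^sup>+t\<in>{0..}. ennreal (exp (- q * t + ly t \<omega>)) \<partial>control_measure (\<lambda>t. exp (l t \<omega>) - 1))"

definition "up_truncated q T \<omega> = (LINT t:{0<..T}|control_measure (\<lambda>t. exp (l t \<omega>) - 1). exp (- q * t + ly t \<omega>))"

lemma up_reflection_SUP: "\<omega> \<in> space M \<Longrightarrow> up_reflection q \<omega> = (SUP n. ennreal (up_truncated q (real (Suc n)) \<omega>))"
  unfolding up_reflection_def up_truncated_def
  using control_path.nn_integral_split_zero[OF exp_l_path weight_continuous[of \<omega> q 1 0]] reflection.l_0[OF reflection_ly[of \<omega>]]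
  by (simp add: l_def)

lemma up_truncated_nonneg: "\<omega> \<in> space M \<Longrightarrow> 0 < T \<Longrightarrow> 0 \<le> up_truncated q T \<omega>"
  unfolding up_truncated_def using control_path.nn_integral_eq_LINT(2)[OF exp_l_path _ weight_continuous[of \<omega> q 1 0]] by simp

lemma up_truncated_mono:
  assumes \<omega>: "\<omega> \<in> space M" and T: "0 < T" "T \<le> T'"
  shows "up_truncated q T \<omega> \<le> up_truncated q T' \<omega>"
proof -
  have "ennreal (up_truncated q T \<omega>) \<le> ennreal (up_truncated q T' \<omega>)"
    unfolding up_truncated_def using control_path.nn_integral_eq_LINT(1)[OF exp_l_path[OF \<omega>] _ weight_continuous[OF \<omega>, of q 1 0], of T, symmetric]
      control_path.nn_integral_eq_LINT(1)[OF exp_l_path[OF \<omega>] _ weight_continuous[OF \<omega>, of q 1 0], of T', symmetric] T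
    by (simp, intro nn_integral_mono) (auto simp: indicator_def)
  then show ?thesis using up_truncated_nonneg[OF \<omega>, of T' q] T by (simp add: ennreal_le_iff)
qed

lemma up_truncated_integrable: "0 < T \<Longrightarrow> integrable M (up_truncated q T)"
  using expectation_power_rule(1)[of T 1 q] by (simp add: up_truncated_def[abs_def])

lemma up_reflection_expectation_SUP: "(\<integral>\<^sup>+\<omega>. up_reflection q \<omega> \<partial>M) = (SUP n. ennreal (expectation (up_truncated q (real (Suc n)))))"
proof -
  have "(\<integral>\<^sup>+\<omega>. up_reflection q \<omega> \<partial>M) = (\<integral>\<^sup>+\<omega>. (SUP n. ennreal (up_truncated q (real (Suc n)) \<omega>)) \<partial>M)"
    by (intro nn_integral_cong) (rule up_reflection_SUP)
  also have "\<dots> = (SUP n. \<integral>\<^sup>+\<omega>. ennreal (up_truncated q (real (Suc n)) \<omega>) \<partial>M)"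
  proof (rule nn_integral_monotone_convergence_SUP_AE)
    show "AE \<omega> in M. ennreal (up_truncated q (real (Suc i)) \<omega>) \<le> ennreal (up_truncated q (real (Suc (Suc i))) \<omega>)" for i
      by (intro AE_I2 ennreal_leI up_truncated_mono) auto
    have "up_truncated q (real (Suc i)) \<in> borel_measurable M" for i using up_truncated_integrable[of "real (Suc i)" q] by auto
    then show "(\<lambda>\<omega>. ennreal (up_truncated q (real (Suc i)) \<omega>)) \<in> borel_measurable M" for i by measurable
  qed
  also have "\<dots> = (SUP n. ennreal (expectation (up_truncated q (real (Suc n)))))"
    by (intro SUP_cong refl nn_integral_eq_integral up_truncated_integrable AE_I2 up_truncated_nonneg) auto
  finally show ?thesis .
qed

text \<open>With \<open>\<theta> d = q\<close> the time integral drops out. As \<open>d\<close> is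
  negative and the reflected process stays above \<open>a\<close>, its power is at most
  \<open>a powr d\<close>; discounting removes the terminal term, and the effort is the only unknown
  left.\<close>

lemma up_reflection_expectation:
  assumes d: "d < 0" "\<theta> d = q" and q: "0 < q"
  shows "(\<integral>\<^sup>+\<omega>. up_reflection q \<omega> \<partial>M) = ennreal (- exp (d * ln xh + (1 - d) * ln a) / d)"
proof -
  define E where "E n = expectation (up_truncated q (real (Suc n)))" for n
  define L where "L n = expectation (\<lambda>\<omega>. exp (- q * real (Suc n) + d * ly (real (Suc n)) \<omega> + d * l (real (Suc n)) \<omega>))" for n
  have id: "L n = exp (d * ln xh) + d * exp ((d - 1) * ln a) * E n" for n
    using expectation_power_rule(4)[of "real (Suc n)" d q] d by (simp add: E_def L_def up_truncated_def[abs_def])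
  have L0: "0 \<le> L n" "L n \<le> exp (- q * real (Suc n)) * exp (d * ln a)" for n
  proof -
    show "0 \<le> L n" unfolding L_def by (intro Bochner_Integration.integral_nonneg) simp
    have "L n \<le> expectation (\<lambda>_. exp (- q * real (Suc n)) * exp (d * ln a))"
      unfolding L_def
    proof (rule integral_mono)
      show "integrable M (\<lambda>\<omega>. exp (- q * real (Suc n) + d * ly (real (Suc n)) \<omega> + d * l (real (Suc n)) \<omega>))"
        using d by (intro expectation_power_rule(3)) auto
      fix \<omega> assume \<omega>: "\<omega> \<in> space M"
      interpret R: reflection "ln a" "\<lambda>s. ly s \<omega>" by (rule reflection_ly[OF \<omega>])
      have "ln a \<le> ly (real (Suc n)) \<omega> + l (real (Suc n)) \<omega>" using R.l_ge[of "real (Suc n)"] by (simp add: l_def)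
      then have "d * (ly (real (Suc n)) \<omega> + l (real (Suc n)) \<omega>) \<le> d * ln a" using d by (intro mult_left_mono_neg) auto
      then show "exp (- q * real (Suc n) + d * ly (real (Suc n)) \<omega> + d * l (real (Suc n)) \<omega>) \<le> exp (- q * real (Suc n)) * exp (d * ln a)"
        by (simp add: exp_add[symmetric] distrib_left)
    qed simp
    then show "L n \<le> exp (- q * real (Suc n)) * exp (d * ln a)" by (simp add: prob_space)
  qed
  have "L \<longlonglongrightarrow> 0"
  proof (rule tendsto_sandwich[of "\<lambda>_. 0"])
    show "(\<lambda>n. exp (- q * real (Suc n)) * exp (d * ln a)) \<longlonglongrightarrow> 0" using q by real_asymp
  qed (use L0 in \<open>auto intro!: always_eventually\<close>)
  then have "(\<lambda>n. (L n - exp (d * ln xh)) / (d * exp ((d - 1) * ln a))) \<longlonglongrightarrow> (0 - exp (d * ln xh)) / (d * exp ((d - 1) * ln a))"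
    using d by (intro tendsto_intros) auto
  moreover have "(L n - exp (d * ln xh)) / (d * exp ((d - 1) * ln a)) = E n" for n using d by (simp add: id)
  moreover have "(0 - exp (d * ln xh)) / (d * exp ((d - 1) * ln a)) = - exp (d * ln xh + (1 - d) * ln a) / d"
  proof -
    have "exp (d * ln xh + (1 - d) * ln a) = exp (d * ln xh) / exp ((d - 1) * ln a)"
      by (simp add: exp_diff[symmetric] algebra_simps)
    then show ?thesis using d by (simp add: field_simps)
  qed
  ultimately have lim: "E \<longlonglongrightarrow> - exp (d * ln xh + (1 - d) * ln a) / d" by simp
  have "incseq (\<lambda>n. ennreal (E n))"
  proof (rule incseq_SucI)
    fix n show "ennreal (E n) \<le> ennreal (E (Suc n))"
      unfolding E_def by (intro ennreal_leI integral_mono up_truncated_integrable up_truncated_mono) auto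
  qed
  then have "(\<lambda>n. ennreal (E n)) \<longlonglongrightarrow> (SUP n. ennreal (E n))" by (rule LIMSEQ_SUP)
  moreover have "(\<lambda>n. ennreal (E n)) \<longlonglongrightarrow> ennreal (- exp (d * ln xh + (1 - d) * ln a) / d)"
    by (intro tendsto_ennrealI lim)
  ultimately have "(SUP n. ennreal (E n)) = ennreal (- exp (d * ln xh + (1 - d) * ln a) / d)" by (rule LIMSEQ_unique)
  then show ?thesis unfolding up_reflection_expectation_SUP E_def .
qed

lemma up_truncated_le:
  assumes u: "(\<integral>\<^sup>+\<omega>. up_reflection q \<omega> \<partial>M) \<le> ennreal u" "0 \<le> u"
  shows "expectation (up_truncated q (real (Suc n))) \<le> u"
proof -
  have "ennreal (expectation (up_truncated q (real (Suc n)))) \<le> (SUP n. ennreal (expectation (up_truncated q (real (Suc n)))))"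
    by (rule SUP_upper) simp
  also have "\<dots> \<le> ennreal u" using u(1) by (simp only: up_reflection_expectation_SUP)
  finally show ?thesis using u(2) by (simp add: ennreal_le_iff)
qed

text \<open>The terminal term is nonnegative and is dropped. The upper bound that results is what
  finiteness of the costs and the optimality argument rely on.\<close>

lemma expectation_square_bound:
  assumes p: "0 < p" "\<theta> p < q" and u: "(\<integral>\<^sup>+\<omega>. up_reflection q \<omega> \<partial>M) \<le> ennreal u" "0 \<le> u"
  shows "(\<integral>\<^sup>+\<omega>. (\<integral>\<^sup>+t\<in>{0..}. ennreal (exp (- q * t + p * ly t \<omega> + p * l t \<omega>)) \<partial>lborel) \<partial>M)
    \<le> ennreal ((exp (p * ln xh) + p * exp ((p - 1) * ln a) * u) / (q - \<theta> p))"
proof -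
  let ?w = "\<lambda>\<omega> t. exp (- q * t + p * ly t \<omega> + p * l t \<omega>)"
  define I where "I n \<omega> = (LINT t:{0<..real (Suc n)}|lborel. ?w \<omega> t)" for n \<omega>
  have I_int: "integrable M (I n)" for n unfolding I_def using p by (intro expectation_power_rule(2)) auto
  have nn: "ennreal (I n \<omega>) = (\<integral>\<^sup>+t\<in>{0<..real (Suc n)}. ennreal (?w \<omega> t) \<partial>lborel)" "0 \<le> I n \<omega>" if \<omega>: "\<omega> \<in> space M" for n \<omega>
  proof -
    have "set_integrable lborel {0..real (Suc n)} (?w \<omega>)"
      by (rule borel_integrable_atLeastAtMost', rule continuous_on_subset[OF weight_continuous[OF \<omega>]]) auto
    then have "set_integrable lborel {0<..real (Suc n)} (?w \<omega>)" by (rule set_integrable_subset) auto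
    then have i: "integrable lborel (\<lambda>t. indicator {0<..real (Suc n)} t *\<^sub>R ?w \<omega> t)" by (simp add: set_integrable_def)
    have "(\<integral>\<^sup>+t\<in>{0<..real (Suc n)}. ennreal (?w \<omega> t) \<partial>lborel) = (\<integral>\<^sup>+t. ennreal (indicator {0<..real (Suc n)} t *\<^sub>R ?w \<omega> t) \<partial>lborel)"
      by (intro nn_integral_cong) (auto simp: indicator_def)
    then show "ennreal (I n \<omega>) = (\<integral>\<^sup>+t\<in>{0<..real (Suc n)}. ennreal (?w \<omega> t) \<partial>lborel)"
      unfolding I_def set_lebesgue_integral_def using nn_integral_eq_integral[OF i] by simp
    show "0 \<le> I n \<omega>" unfolding I_def set_lebesgue_integral_def by (intro Bochner_Integration.integral_nonneg) simp
  qed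
  have inner: "(\<integral>\<^sup>+t\<in>{0..}. ennreal (?w \<omega> t) \<partial>lborel) = (SUP n. ennreal (I n \<omega>))" if \<omega>: "\<omega> \<in> space M" for \<omega>
  proof -
    have "(\<lambda>t. if t \<in> {0..} then ?w \<omega> t else 0) \<in> borel_measurable borel"
      by (rule borel_measurable_continuous_on_if) (use weight_continuous[OF \<omega>, of q p p] in simp_all)
    then have "(\<lambda>t. ennreal (if t \<in> {0..} then ?w \<omega> t else 0) * indicator {0<..} t) \<in> borel_measurable borel" by measurable
    also have "(\<lambda>t. ennreal (if t \<in> {0..} then ?w \<omega> t else 0) * indicator {0<..} t) = (\<lambda>t. ennreal (?w \<omega> t) * indicator {0<..} t)"
      by (auto simp: indicator_def)
    finally have m: "(\<lambda>t. ennreal (?w \<omega> t) * indicator {0<..} t) \<in> borel_measurable borel" .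
    have "AE t in lborel. t \<noteq> (0::real)" by (rule AE_lborel_singleton)
    then have "(\<integral>\<^sup>+t\<in>{0..}. ennreal (?w \<omega> t) \<partial>lborel) = (\<integral>\<^sup>+t\<in>{0<..}. ennreal (?w \<omega> t) \<partial>lborel)"
      by (intro nn_integral_cong_AE) (auto simp: indicator_def elim!: eventually_mono)
    also have "\<dots> = (SUP n. ennreal (I n \<omega>))" using nn_integral_Ioi_SUP[OF _ m, of lborel] nn(1)[OF \<omega>] by simp
    finally show ?thesis .
  qed
  have bound: "expectation (I n) \<le> (exp (p * ln xh) + p * exp ((p - 1) * ln a) * u) / (q - \<theta> p)" for n
  proof -
    have id: "expectation (\<lambda>\<omega>. ?w \<omega> (real (Suc n))) = exp (p * ln xh) + p * exp ((p - 1) * ln a) * expectation (up_truncated q (real (Suc n))) + (\<theta> p - q) * expectation (I n)"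
      using expectation_power_rule(4)[of "real (Suc n)" p q] p by (simp add: up_truncated_def[abs_def] I_def[abs_def])
    have "0 \<le> expectation (\<lambda>\<omega>. ?w \<omega> (real (Suc n)))" by (intro Bochner_Integration.integral_nonneg) simp
    moreover have "p * exp ((p - 1) * ln a) * expectation (up_truncated q (real (Suc n))) \<le> p * exp ((p - 1) * ln a) * u"
      using p by (intro mult_left_mono up_truncated_le u) auto
    ultimately have "(q - \<theta> p) * expectation (I n) \<le> exp (p * ln xh) + p * exp ((p - 1) * ln a) * u"
      using id unfolding left_diff_distrib by linarith
    then show ?thesis using p by (simp add: pos_le_divide_eq mult.commute)
  qed
  have "(\<integral>\<^sup>+\<omega>. (\<integral>\<^sup>+t\<in>{0..}. ennreal (?w \<omega> t) \<partial>lborel) \<partial>M) = (\<integral>\<^sup>+\<omega>. (SUP n. ennreal (I n \<omega>)) \<partial>M)"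
    by (intro nn_integral_cong) (rule inner)
  also have "\<dots> = (SUP n. \<integral>\<^sup>+\<omega>. ennreal (I n \<omega>) \<partial>M)"
  proof (rule nn_integral_monotone_convergence_SUP_AE)
    show "AE \<omega> in M. ennreal (I i \<omega>) \<le> ennreal (I (Suc i) \<omega>)" for i
    proof (rule AE_I2)
      fix \<omega> assume "\<omega> \<in> space M"
      then show "ennreal (I i \<omega>) \<le> ennreal (I (Suc i) \<omega>)"
        by (simp add: nn del: of_nat_Suc) (intro nn_integral_mono, auto simp: indicator_def)
    qed
    have "I i \<in> borel_measurable M" for i using I_int by auto
    then show "(\<lambda>\<omega>. ennreal (I i \<omega>)) \<in> borel_measurable M" for i by measurable
  qed
  also have "\<dots> = (SUP n. ennreal (expectation (I n)))"
    by (intro SUP_cong refl nn_integral_eq_integral I_int AE_I2 nn(2)) auto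
  also have "\<dots> \<le> ennreal ((exp (p * ln xh) + p * exp ((p - 1) * ln a) * u) / (q - \<theta> p))"
    by (intro SUP_least ennreal_leI bound)
  finally show ?thesis .
qed

end

section \<open>The lower bound for arbitrary policies\<close>

text \<open>The equation for \<open>c2\<close> says that the marginal value at the barrier equals
  the price of control. \<open>x\<close> is the actual starting point, possibly below the point
  \<open>xh\<close> from which the reflected process starts.\<close>

locale verification = debt_model M Fl W r g \<sigma> a xh
  for M :: "'a measure" and Fl :: "real \<Rightarrow> 'a measure" and W :: "real \<Rightarrow> 'a \<Rightarrow> real" and r g \<sigma> a xh :: real +
  fixes \<rho> d x c2 :: real
  assumes K: "\<theta> 2 < \<rho>" and d: "d < 0" "\<theta> d = \<rho>" and x: "0 < x" "x \<le> xh"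
    and c2: "c2 = a / (\<rho> - \<theta> 2) * (1 + 1 / (1 - d))"
begin

abbreviation "K \<equiv> \<rho> - \<theta> 2"

text \<open>The derivative of the claimed value function at \<open>e\<^sup>y\<close>.\<close>

definition "marginal y = (exp y + exp ((2 - d) * ln a + (d - 1) * y) / (1 - d)) / K"

text \<open>This is \<open>c2 / a\<close>, the ratio of \<open>marginal y\<close> to
  \<open>exp y\<close> at the barrier.\<close>

definition "marginal_slope = (1 + 1 / (1 - d)) / K"

lemma K_pos: "0 < K" using K by simp

lemma c2_pos: "0 < c2" unfolding c2 using K_pos a d by (intro mult_pos_pos divide_pos_pos add_pos_pos) auto

text \<open>In terms of the distance of \<open>y\<close> from \<open>ln a\<close>, the marginal
  value is a sum of two exponentials whose tangents at 0 have opposite slopes. The two tangent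
  inequalities add up to the constant \<open>c2\<close>.\<close>

lemma marginal_lower: assumes y: "ln a \<le> y" shows "c2 \<le> marginal y"
proof -
  let ?u = "y - ln a"
  have e1: "exp y = a * exp ?u" using a by (simp add: exp_diff)
  have e2: "exp ((2 - d) * ln a + (d - 1) * y) = a * exp (- (1 - d) * ?u)"
  proof -
    have "(2 - d) * ln a + (d - 1) * y = ln a + - (1 - d) * ?u" by (simp add: algebra_simps)
    then show ?thesis using a by (simp only: exp_add exp_ln)
  qed
  have "1 + ?u \<le> exp ?u" by (rule exp_ge_add_one_self)
  moreover have "1 + - (1 - d) * ?u \<le> exp (- (1 - d) * ?u)" by (rule exp_ge_add_one_self)
  then have "(1 + - (1 - d) * ?u) / (1 - d) \<le> exp (- (1 - d) * ?u) / (1 - d)" using d by (intro divide_right_mono) auto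
  moreover have "(1 + - (1 - d) * ?u) / (1 - d) = 1 / (1 - d) - ?u" using d by (simp add: field_simps)
  ultimately have "1 + 1 / (1 - d) \<le> exp ?u + exp (- (1 - d) * ?u) / (1 - d)" by linarith
  then have "a / K * (1 + 1 / (1 - d)) \<le> a / K * (exp ?u + exp (- (1 - d) * ?u) / (1 - d))"
    using a K_pos by (intro mult_left_mono) auto
  also have "\<dots> = marginal y" unfolding marginal_def e1 e2 by (simp add: distrib_left add_divide_distrib)
  finally show ?thesis unfolding c2 .
qed

lemma marginal_upper: assumes y: "ln a \<le> y" shows "marginal y \<le> marginal_slope * exp y"
proof -
  have "(2 - d) * ln a + (d - 1) * y \<le> y"
  proof -
    have "(2 - d) * ln a \<le> (2 - d) * y" using y d by (intro mult_left_mono) auto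
    then show ?thesis by (simp add: algebra_simps)
  qed
  then have "exp ((2 - d) * ln a + (d - 1) * y) / (1 - d) \<le> exp y / (1 - d)" using d by (intro divide_right_mono) auto
  then have "marginal y \<le> (exp y + exp y / (1 - d)) / K" unfolding marginal_def using K_pos by (intro divide_right_mono) auto
  also have "\<dots> = marginal_slope * exp y" by (simp add: marginal_slope_def distrib_right add_divide_distrib)
  finally show ?thesis .
qed

lemma marginal_slope_pos: "0 < marginal_slope" unfolding marginal_slope_def using d K_pos by (intro divide_pos_pos add_pos_pos) auto

lemma reflected_above: "0 \<le> t \<Longrightarrow> \<omega> \<in> space M \<Longrightarrow> ln a \<le> ly t \<omega> + l t \<omega>"
  using reflection.l_ge[OF reflection_ly, of \<omega> t] by (simp add: l_def)

definition "V T A \<omega> = (LINT t:{0<..T}|control_measure (\<lambda>t. A t \<omega>). exp (- \<rho> * t + ly t \<omega>))"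

text \<open>The exponents \<open>(1, 0)\<close> supply integrability of the control cost. In the
  combination of the other two pairs, \<open>marginal_lower\<close> prices the increments of
  \<open>A\<close> from below, and \<open>marginal_upper\<close> replaces the terminal term by one
  whose time integral is the other term on the right. The estimate is stated with nonnegative
  integrals, ready for the passage to unbounded \<open>A\<close>.\<close>

lemma expectation_truncated_bound:
  assumes T: "0 < T" and path: "\<And>\<omega>. \<omega> \<in> space M \<Longrightarrow> control_path (\<lambda>t. A t \<omega>)"
    and adapted: "\<And>t. 0 \<le> t \<Longrightarrow> A t \<in> borel_measurable (Fl t)"
    and Amax: "\<And>t \<omega>. 0 \<le> t \<Longrightarrow> \<omega> \<in> space M \<Longrightarrow> A t \<omega> \<le> Amax"
  shows "integrable M (V T A)" "integrable M (A 0)"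
    "ennreal (xh * marginal (ln xh) * expectation (A 0) + c2 * expectation (V T A))
     \<le> (\<integral>\<^sup>+\<omega>. (\<integral>\<^sup>+t\<in>{0..}. ennreal (exp (- \<rho> * t + 2 * ly t \<omega> + l t \<omega>) * A t \<omega>) \<partial>lborel) \<partial>M)
      + ennreal marginal_slope * (\<integral>\<^sup>+\<omega>. ennreal (exp (- \<rho> * T + 2 * ly T \<omega> + l T \<omega>) * A T \<omega>) \<partial>M)"
proof -
  have A0: "0 \<le> A t \<omega>" if "0 \<le> t" "\<omega> \<in> space M" for t \<omega>
    using control_path.f_nonneg[OF path] that by blast
  have Am: "A 0 \<in> borel_measurable M" using Fl_measurable_M[OF _ adapted[of 0]] by simp
  show A0_int: "integrable M (A 0)"
  proof (rule integrable_const_bound[where B=Amax])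
    show "AE \<omega> in M. norm (A 0 \<omega>) \<le> Amax" using A0[of 0] Amax[of 0] by (intro AE_I2) simp
  qed (rule Am)
  \<comment> \<open>The last two equations exhibit the common weight
    \<open>exp (2 * ly t \<omega>)\<close> of the reflection integrals for \<open>(d, d - 1)\<close>
    and \<open>(2, 1)\<close>.\<close>
  have e: "exp (- \<rho> * t + 1 * ly t \<omega>) * exp (0 * l t \<omega>) = exp (- \<rho> * t + ly t \<omega>)"
    "exp (- \<rho> * t + d * ly t \<omega>) * exp ((d - 1) * l t \<omega>) = exp (- \<rho> * t + d * ly t \<omega> + (d - 1) * l t \<omega>)"
    "exp (- \<rho> * t + 2 * ly t \<omega>) * exp (1 * l t \<omega>) = exp (- \<rho> * t + 2 * ly t \<omega> + 1 * l t \<omega>)"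
    "exp (- \<rho> * t + d * ly t \<omega>) * A t \<omega> * exp ((1 - (d - 1)) * ly t \<omega>) = exp (- \<rho> * t + 2 * ly t \<omega>) * A t \<omega>"
    "exp (- \<rho> * t + 2 * ly t \<omega>) * A t \<omega> * exp ((1 - 1) * ly t \<omega>) = exp (- \<rho> * t + 2 * ly t \<omega>) * A t \<omega>" for t \<omega>
  proof -
    have "exp (- \<rho> * t + d * ly t \<omega>) * exp ((1 - (d - 1)) * ly t \<omega>) = exp (- \<rho> * t + 2 * ly t \<omega>)"
      unfolding exp_add[symmetric] by (simp add: algebra_simps)
    then show "exp (- \<rho> * t + d * ly t \<omega>) * A t \<omega> * exp ((1 - (d - 1)) * ly t \<omega>) = exp (- \<rho> * t + 2 * ly t \<omega>) * A t \<omega>"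
      by (simp only: mult_ac)
  qed (simp_all add: exp_add[symmetric])
  note k0 = expectation_product_rule[OF T path adapted Amax, where q=\<rho> and p=1 and s=0, unfolded e]
  note k1 = expectation_product_rule[OF T path adapted Amax, where q=\<rho> and p=d and s="d - 1", unfolded e]
  note k2 = expectation_product_rule[OF T path adapted Amax, where q=\<rho> and p=2 and s=1, unfolded e]
  show V_int: "integrable M (V T A)" unfolding V_def using k0(1) by simp
  define I1 where "I1 \<omega> = (LINT t:{0<..T}|control_measure (\<lambda>t. A t \<omega>). exp (- \<rho> * t + d * ly t \<omega> + (d - 1) * l t \<omega>))" for \<omega>
  define J1 where "J1 \<omega> = (LINT t:{0<..T}|control_measure (\<lambda>t. A t \<omega>). exp (- \<rho> * t + 2 * ly t \<omega> + 1 * l t \<omega>))" for \<omega>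
  define I2 where "I2 \<omega> = (LINT t:{0<..T}|control_measure (\<lambda>t. exp (l t \<omega>) - 1). exp (- \<rho> * t + 2 * ly t \<omega>) * A t \<omega>)" for \<omega>
  define J3 where "J3 \<omega> = (LINT t:{0<..T}|lborel. exp (- \<rho> * t + 2 * ly t \<omega> + 1 * l t \<omega>) * A t \<omega>)" for \<omega>
  define L1 where "L1 \<omega> = exp (- \<rho> * T + d * ly T \<omega> + (d - 1) * l T \<omega>) * A T \<omega>" for \<omega>
  define L2 where "L2 \<omega> = exp (- \<rho> * T + 2 * ly T \<omega> + 1 * l T \<omega>) * A T \<omega>" for \<omega>
  have int: "integrable M I1" "integrable M J1" "integrable M J3" "integrable M L1" "integrable M L2"
    using k1(1) k2(1) k2(3) k1(4) k2(4) K by (simp_all add: I1_def[abs_def] J1_def[abs_def] J3_def[abs_def] L1_def[abs_def] L2_def[abs_def])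
  \<comment> \<open>Coefficient of the decaying exponential in \<open>marginal\<close>. With weight
    \<open>1 / K\<close> on the square it is the multiple for which the \<open>I2\<close> terms
    cancel.\<close>
  define Dd where "Dd = exp ((2 - d) * ln a) / (K * (1 - d))"
  have Dd: "0 < Dd" unfolding Dd_def using K_pos d by simp
  have E1: "expectation L1 = exp (d * ln xh) * expectation (A 0) + expectation I1 + (d - 1) * exp ((d - 1 - 1) * ln a) * expectation I2"
    using k1(5) d by (simp add: I1_def[abs_def] I2_def[abs_def] L1_def[abs_def])
  have E2: "expectation L2 = exp (2 * ln xh) * expectation (A 0) + expectation J1 + expectation I2 - K * expectation J3"
    using k2(5) by (simp add: J1_def[abs_def] I2_def[abs_def] J3_def[abs_def] L2_def[abs_def] algebra_simps)
  have cancel: "Dd * ((d - 1) * exp ((d - 1 - 1) * ln a)) = - (1 / K)"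
  proof -
    have "exp ((2 - d) * ln a) * exp ((d - 1 - 1) * ln a) = 1" unfolding exp_add[symmetric] by (simp add: algebra_simps)
    then have "Dd * ((d - 1) * exp ((d - 1 - 1) * ln a)) = (d - 1) / (K * (1 - d))"
      unfolding Dd_def by (simp add: mult_ac)
    moreover have "- e / (k * e) = - (1 / k)" if "e \<noteq> 0" for k e :: real using that by simp
    from this[of "1 - d" K] have "(d - 1) / (K * (1 - d)) = - (1 / K)" using d by simp
    ultimately show ?thesis by simp
  qed
  \<comment> \<open>The weights that cancel \<open>I2\<close> rebuild the marginal value at the
    reflected point \<open>z + m\<close>, multiplied by the unreflected
    \<open>exp z\<close>.\<close>
  have hform: "Dd * exp (d * z + (d - 1) * m) + exp (2 * z + 1 * m) / K = exp z * marginal (z + m)" for z m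
  proof -
    have "exp ((2 - d) * ln a) * exp (d * z + (d - 1) * m) = exp z * exp ((2 - d) * ln a + (d - 1) * (z + m))"
      unfolding exp_add[symmetric] by (simp add: algebra_simps)
    moreover have "exp (2 * z + 1 * m) = exp z * exp (z + m)" unfolding exp_add[symmetric] by simp
    ultimately show ?thesis unfolding marginal_def Dd_def by (simp add: add_divide_distrib distrib_left divide_divide_eq_left mult.commute)
  qed
  have init: "Dd * exp (d * ln xh) + exp (2 * ln xh) / K = xh * marginal (ln xh)"
    using hform[of "ln xh" 0] a xh by simp
  have key: "expectation (\<lambda>\<omega>. Dd * L1 \<omega> + L2 \<omega> / K)
      = xh * marginal (ln xh) * expectation (A 0) + expectation (\<lambda>\<omega>. Dd * I1 \<omega> + J1 \<omega> / K) - expectation J3"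
  proof -
    have "expectation (\<lambda>\<omega>. Dd * L1 \<omega> + L2 \<omega> / K) = Dd * expectation L1 + expectation L2 / K" using int by simp
    also have "\<dots> = (Dd * exp (d * ln xh) + exp (2 * ln xh) / K) * expectation (A 0) + (Dd * expectation I1 + expectation J1 / K)
        + (Dd * ((d - 1) * exp ((d - 1 - 1) * ln a)) + 1 / K) * expectation I2 - expectation J3"
    proof -
      have "D * (e1 * A' + I + c * Y) + (e2 * A' + J + Y - k * j) / k = (D * e1 + e2 / k) * A' + (D * I + J / k) + (D * c + 1 / k) * Y - j"
        if "k \<noteq> 0" for D e1 A' I c Y e2 J k j :: real using that by (simp add: field_simps)
      from this[of K] show ?thesis unfolding E1 E2 using K_pos by simp
    qed
    also have "\<dots> = xh * marginal (ln xh) * expectation (A 0) + (Dd * expectation I1 + expectation J1 / K) - expectation J3"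
      unfolding cancel init by simp
    also have "Dd * expectation I1 + expectation J1 / K = expectation (\<lambda>\<omega>. Dd * I1 \<omega> + J1 \<omega> / K)" using int by simp
    finally show ?thesis .
  qed
  have "c2 * expectation (V T A) \<le> expectation (\<lambda>\<omega>. Dd * I1 \<omega> + J1 \<omega> / K)"
  proof -
    have "expectation (\<lambda>\<omega>. c2 * V T A \<omega>) \<le> expectation (\<lambda>\<omega>. Dd * I1 \<omega> + J1 \<omega> / K)"
    proof (rule integral_mono)
      show "integrable M (\<lambda>\<omega>. c2 * V T A \<omega>)" using V_int by simp
      show "integrable M (\<lambda>\<omega>. Dd * I1 \<omega> + J1 \<omega> / K)" using int by simp
      fix \<omega> assume \<omega>: "\<omega> \<in> space M"
      interpret P: control_path "\<lambda>t. A t \<omega>" by (rule path[OF \<omega>])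
      let ?N = "control_measure (\<lambda>t. A t \<omega>)"
      have i0: "set_integrable ?N {0<..T} (\<lambda>t. exp (- \<rho> * t + ly t \<omega>))"
        using P.continuous_integral(1)[OF T weight_continuous[OF \<omega>, of \<rho> 1 0]] by simp
      have i1: "set_integrable ?N {0<..T} (\<lambda>t. exp (- \<rho> * t + d * ly t \<omega> + (d - 1) * l t \<omega>))"
        by (rule P.continuous_integral(1)[OF T weight_continuous[OF \<omega>]])
      have i2: "set_integrable ?N {0<..T} (\<lambda>t. exp (- \<rho> * t + 2 * ly t \<omega> + 1 * l t \<omega>))"
        by (rule P.continuous_integral(1)[OF T weight_continuous[OF \<omega>]])
      have "c2 * V T A \<omega> = (LINT t:{0<..T}|?N. c2 * exp (- \<rho> * t + ly t \<omega>))" unfolding V_def by simp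
      also have "\<dots> \<le> (LINT t:{0<..T}|?N. Dd * exp (- \<rho> * t + d * ly t \<omega> + (d - 1) * l t \<omega>) + exp (- \<rho> * t + 2 * ly t \<omega> + 1 * l t \<omega>) / K)"
      proof (rule set_integral_mono)
        show "set_integrable ?N {0<..T} (\<lambda>t. c2 * exp (- \<rho> * t + ly t \<omega>))" using i0 by simp
        show "set_integrable ?N {0<..T} (\<lambda>t. Dd * exp (- \<rho> * t + d * ly t \<omega> + (d - 1) * l t \<omega>) + exp (- \<rho> * t + 2 * ly t \<omega> + 1 * l t \<omega>) / K)"
          using i1 i2 by simp
        fix t assume t: "t \<in> {0<..T}"
        have "Dd * exp (- \<rho> * t + d * ly t \<omega> + (d - 1) * l t \<omega>) + exp (- \<rho> * t + 2 * ly t \<omega> + 1 * l t \<omega>) / K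
          = exp (- \<rho> * t) * (Dd * exp (d * ly t \<omega> + (d - 1) * l t \<omega>) + exp (2 * ly t \<omega> + 1 * l t \<omega>) / K)"
          unfolding add.assoc exp_add[of "- \<rho> * t"] by (simp add: distrib_left)
        also have "\<dots> = exp (- \<rho> * t + ly t \<omega>) * marginal (ly t \<omega> + l t \<omega>)"
          unfolding hform exp_add[of "- \<rho> * t"] by (simp only: mult.assoc)
        also have "\<dots> \<ge> exp (- \<rho> * t + ly t \<omega>) * c2"
          using marginal_lower[OF reflected_above[of t \<omega>]] t \<omega> by (intro mult_left_mono) auto
        finally show "c2 * exp (- \<rho> * t + ly t \<omega>) \<le> Dd * exp (- \<rho> * t + d * ly t \<omega> + (d - 1) * l t \<omega>) + exp (- \<rho> * t + 2 * ly t \<omega> + 1 * l t \<omega>) / K"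
          by (simp only: mult.commute)
      qed
      also have "\<dots> = Dd * I1 \<omega> + J1 \<omega> / K" unfolding I1_def J1_def using i1 i2 by simp
      finally show "c2 * V T A \<omega> \<le> Dd * I1 \<omega> + J1 \<omega> / K" .
    qed
    then show ?thesis by simp
  qed
  moreover have "expectation (\<lambda>\<omega>. Dd * L1 \<omega> + L2 \<omega> / K) \<le> marginal_slope * expectation L2"
  proof -
    have "expectation (\<lambda>\<omega>. Dd * L1 \<omega> + L2 \<omega> / K) \<le> expectation (\<lambda>\<omega>. marginal_slope * L2 \<omega>)"
    proof (rule integral_mono)
      show "integrable M (\<lambda>\<omega>. Dd * L1 \<omega> + L2 \<omega> / K)" "integrable M (\<lambda>\<omega>. marginal_slope * L2 \<omega>)" using int by simp_all
      fix \<omega> assume \<omega>: "\<omega> \<in> space M"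
      have "Dd * L1 \<omega> + L2 \<omega> / K = exp (- \<rho> * T) * (Dd * exp (d * ly T \<omega> + (d - 1) * l T \<omega>) + exp (2 * ly T \<omega> + 1 * l T \<omega>) / K) * A T \<omega>"
        unfolding L1_def L2_def add.assoc exp_add[of "- \<rho> * T"] by (simp add: distrib_left distrib_right)
      also have "\<dots> = exp (- \<rho> * T + ly T \<omega>) * marginal (ly T \<omega> + l T \<omega>) * A T \<omega>"
        unfolding hform exp_add[of "- \<rho> * T"] by (simp only: mult.assoc)
      also have "\<dots> \<le> exp (- \<rho> * T + ly T \<omega>) * (marginal_slope * exp (ly T \<omega> + l T \<omega>)) * A T \<omega>"
        using marginal_upper[OF reflected_above[of T \<omega>]] T \<omega> A0[of T \<omega>] by (intro mult_right_mono mult_left_mono) auto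
      also have "\<dots> = marginal_slope * L2 \<omega>"
      proof -
        have "exp (- \<rho> * T + ly T \<omega>) * exp (ly T \<omega> + l T \<omega>) = exp (- \<rho> * T + 2 * ly T \<omega> + 1 * l T \<omega>)"
          unfolding exp_add[symmetric] by (simp add: algebra_simps)
        then show ?thesis unfolding L2_def by (simp only: mult_ac)
      qed
      finally show "Dd * L1 \<omega> + L2 \<omega> / K \<le> marginal_slope * L2 \<omega>" .
    qed
    then show ?thesis by simp
  qed
  ultimately have main: "xh * marginal (ln xh) * expectation (A 0) + c2 * expectation (V T A) \<le> expectation J3 + marginal_slope * expectation L2"
    using key by linarith
  have L2nn: "0 \<le> L2 \<omega>" if "\<omega> \<in> space M" for \<omega> unfolding L2_def using A0[of T \<omega>] T that by simp
  have J3nn: "0 \<le> indicator {0<..T} t *\<^sub>R (exp (- \<rho> * t + 2 * ly t \<omega> + 1 * l t \<omega>) * A t \<omega>)" if "\<omega> \<in> space M" for t \<omega>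
    using A0[of t \<omega>] that by (auto simp: indicator_def)
  have J3_le: "ennreal (J3 \<omega>) \<le> (\<integral>\<^sup>+t\<in>{0..}. ennreal (exp (- \<rho> * t + 2 * ly t \<omega> + l t \<omega>) * A t \<omega>) \<partial>lborel)" if \<omega>: "\<omega> \<in> space M" for \<omega>
  proof -
    have "ennreal (J3 \<omega>) \<le> (\<integral>\<^sup>+t. ennreal (indicator {0<..T} t *\<^sub>R (exp (- \<rho> * t + 2 * ly t \<omega> + 1 * l t \<omega>) * A t \<omega>)) \<partial>lborel)"
      unfolding J3_def set_lebesgue_integral_def using J3nn[OF \<omega>] by (intro ennreal_integral_le)
    also have "\<dots> \<le> (\<integral>\<^sup>+t\<in>{0..}. ennreal (exp (- \<rho> * t + 2 * ly t \<omega> + l t \<omega>) * A t \<omega>) \<partial>lborel)"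
      by (intro nn_integral_mono) (auto simp: indicator_def)
    finally show ?thesis .
  qed
  have "ennreal (xh * marginal (ln xh) * expectation (A 0) + c2 * expectation (V T A)) \<le> ennreal (expectation J3 + marginal_slope * expectation L2)"
    using main by (rule ennreal_leI)
  also have "\<dots> = ennreal (expectation J3) + ennreal marginal_slope * ennreal (expectation L2)"
  proof -
    have "0 \<le> expectation J3" unfolding J3_def set_lebesgue_integral_def
      using J3nn by (intro Bochner_Integration.integral_nonneg) blast+
    moreover have "0 \<le> expectation L2" using L2nn by (rule Bochner_Integration.integral_nonneg)
    ultimately show ?thesis using marginal_slope_pos by (subst ennreal_plus) (auto simp: ennreal_mult)
  qed
  also have "\<dots> \<le> (\<integral>\<^sup>+\<omega>. (\<integral>\<^sup>+t\<in>{0..}. ennreal (exp (- \<rho> * t + 2 * ly t \<omega> + l t \<omega>) * A t \<omega>) \<partial>lborel) \<partial>M)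
      + ennreal marginal_slope * (\<integral>\<^sup>+\<omega>. ennreal (exp (- \<rho> * T + 2 * ly T \<omega> + l T \<omega>) * A T \<omega>) \<partial>M)"
  proof (intro add_mono mult_left_mono)
    have "ennreal (expectation J3) \<le> (\<integral>\<^sup>+\<omega>. ennreal (J3 \<omega>) \<partial>M)"
      unfolding J3_def set_lebesgue_integral_def
      using J3nn by (intro ennreal_integral_le Bochner_Integration.integral_nonneg) blast+
    also have "\<dots> \<le> (\<integral>\<^sup>+\<omega>. (\<integral>\<^sup>+t\<in>{0..}. ennreal (exp (- \<rho> * t + 2 * ly t \<omega> + l t \<omega>) * A t \<omega>) \<partial>lborel) \<partial>M)"
      by (intro nn_integral_mono J3_le)
    finally show "ennreal (expectation J3) \<le> (\<integral>\<^sup>+\<omega>. (\<integral>\<^sup>+t\<in>{0..}. ennreal (exp (- \<rho> * t + 2 * ly t \<omega> + l t \<omega>) * A t \<omega>) \<partial>lborel) \<partial>M)" .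
    have "ennreal (expectation L2) \<le> (\<integral>\<^sup>+\<omega>. ennreal (L2 \<omega>) \<partial>M)" using L2nn by (rule ennreal_integral_le)
    then show "ennreal (expectation L2) \<le> (\<integral>\<^sup>+\<omega>. ennreal (exp (- \<rho> * T + 2 * ly T \<omega> + l T \<omega>) * A T \<omega>) \<partial>M)"
      by (simp add: L2_def)
  qed simp
  finally show "ennreal (xh * marginal (ln xh) * expectation (A 0) + c2 * expectation (V T A))
     \<le> (\<integral>\<^sup>+\<omega>. (\<integral>\<^sup>+t\<in>{0..}. ennreal (exp (- \<rho> * t + 2 * ly t \<omega> + l t \<omega>) * A t \<omega>) \<partial>lborel) \<partial>M)
      + ennreal marginal_slope * (\<integral>\<^sup>+\<omega>. ennreal (exp (- \<rho> * T + 2 * ly T \<omega> + l T \<omega>) * A T \<omega>) \<partial>M)" .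
qed

text \<open>Truncating \<open>exp \<xi>\<close> gives bounded processes for which the finite-horizon
  estimate holds, and Fatou's lemma undoes the truncation. Tonelli makes the terminal terms
  integrable over the horizon, hence small at suitable late times; since the left side increases
  with the horizon, every fixed horizon can be compared with such a time.\<close>

lemma expectation_lower_bound:
  fixes \<xi> :: "real \<Rightarrow> 'a \<Rightarrow> real"
  assumes path: "\<And>\<omega>. \<omega> \<in> space M \<Longrightarrow> control_path (\<lambda>t. \<xi> t \<omega>)"
    and adapted: "\<And>t. 0 \<le> t \<Longrightarrow> \<xi> t \<in> borel_measurable (Fl t)"
  defines "X \<equiv> \<lambda>t \<omega>. x / xh * exp (ly t \<omega> + \<xi> t \<omega>)"
  assumes fin: "(\<integral>\<^sup>+\<omega>. (\<integral>\<^sup>+t\<in>{0..}. ennreal (exp (- \<rho> * t + ly t \<omega> + l t \<omega>) * X t \<omega>) \<partial>lborel) \<partial>M) < \<infinity>"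
  shows "(\<integral>\<^sup>+\<omega>. ennreal (x * marginal (ln xh)) + ennreal c2 *
        (\<integral>\<^sup>+t\<in>{0..}. ennreal (x / xh * exp (- \<rho> * t + ly t \<omega>)) \<partial>control_measure (\<lambda>t. exp (\<xi> t \<omega>) - 1)) \<partial>M)
     \<le> (\<integral>\<^sup>+\<omega>. (\<integral>\<^sup>+t\<in>{0..}. ennreal (exp (- \<rho> * t + ly t \<omega> + l t \<omega>) * X t \<omega>) \<partial>lborel) \<partial>M)"
proof -
  have xh0: "0 < xh" using a xh by simp
  have c: "0 < x / xh" using x xh0 by simp
  define BB where "BB = (\<integral>\<^sup>+\<omega>. (\<integral>\<^sup>+t\<in>{0..}. ennreal (exp (- \<rho> * t + ly t \<omega> + l t \<omega>) * X t \<omega>) \<partial>lborel) \<partial>M)"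
  define \<Phi> where "\<Phi> T = (\<integral>\<^sup>+\<omega>. ennreal (exp (- \<rho> * T + ly T \<omega> + l T \<omega>) * X T \<omega>) \<partial>M)" for T
  define A where "A n t \<omega> = x / xh * min (exp (\<xi> t \<omega>)) (real (Suc n))" for n t \<omega>
  have A_path: "control_path (\<lambda>t. A n t \<omega>)" if \<omega>: "\<omega> \<in> space M" for n \<omega>
    unfolding A_def
  proof (rule control_path.compose_path[OF path[OF \<omega>], where h="\<lambda>y. x / xh * min (exp y) (real (Suc n))"])
    show "continuous_on UNIV (\<lambda>y. x / xh * min (exp y) (real (Suc n)))" using xh0 by (intro continuous_intros) auto
    show "mono (\<lambda>y. x / xh * min (exp y) (real (Suc n)))"
    proof (rule monoI)
      fix u v :: real assume "u \<le> v"
      then have "min (exp u) (real (Suc n)) \<le> min (exp v) (real (Suc n))" by (intro min.mono) auto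
      then show "x / xh * min (exp u) (real (Suc n)) \<le> x / xh * min (exp v) (real (Suc n))" using c by (intro mult_left_mono) auto
    qed
    show "0 \<le> x / xh * min (exp y) (real (Suc n))" for y using c by (intro mult_nonneg_nonneg) auto
  qed
  have A_adapted: "A n t \<in> borel_measurable (Fl t)" if "0 \<le> t" for n t
    unfolding A_def using adapted[OF that] by measurable
  have A_max: "A n t \<omega> \<le> x / xh * real (Suc n)" for n t \<omega>
    unfolding A_def using c by (intro mult_left_mono) auto
  have A_X: "exp (ly t \<omega>) * A n t \<omega> \<le> X t \<omega>" for n t \<omega>
  proof -
    have "exp (ly t \<omega>) * A n t \<omega> \<le> exp (ly t \<omega>) * (x / xh * exp (\<xi> t \<omega>))"
      unfolding A_def using c by (intro mult_left_mono) auto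
    then show ?thesis by (simp add: X_def exp_add mult_ac)
  qed
  have A_le: "exp (- \<rho> * t + 2 * ly t \<omega> + l t \<omega>) * A n t \<omega> \<le> exp (- \<rho> * t + ly t \<omega> + l t \<omega>) * X t \<omega>" for n t \<omega>
  proof -
    have "exp (- \<rho> * t + 2 * ly t \<omega> + l t \<omega>) * A n t \<omega> = exp (- \<rho> * t + ly t \<omega> + l t \<omega>) * (exp (ly t \<omega>) * A n t \<omega>)"
      unfolding mult.assoc[symmetric] exp_add[symmetric] by (simp add: algebra_simps)
    also have "\<dots> \<le> exp (- \<rho> * t + ly t \<omega> + l t \<omega>) * X t \<omega>" by (intro mult_left_mono A_X) simp
    finally show ?thesis .
  qed
  \<comment> \<open>The jump at time 0 is priced at \<open>c2\<close>, although the estimate grants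
    the rate \<open>marginal (ln xh)\<close>, which is at least \<open>c2\<close>. This is the form
    that matches the cost of the policy.\<close>
  define Y where "Y n T \<omega> = x * marginal (ln xh) + c2 * (x * (min (exp (\<xi> 0 \<omega>)) (real (Suc n)) - 1) + V T (A n) \<omega>)" for n T \<omega>
  have Y: "Y n T \<in> borel_measurable M" "(\<integral>\<^sup>+\<omega>. ennreal (Y n T \<omega>) \<partial>M) \<le> BB + ennreal marginal_slope * \<Phi> T" if T: "0 < T" for n T
  proof -
    note tb = expectation_truncated_bound[OF T A_path A_adapted A_max, of n]
    define \<alpha> where "\<alpha> \<omega> = min (exp (\<xi> 0 \<omega>)) (real (Suc n))" for \<omega>
    have A0: "A n 0 = (\<lambda>\<omega>. x / xh * \<alpha> \<omega>)" by (simp add: A_def \<alpha>_def fun_eq_iff)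
    have \<alpha>_int: "integrable M \<alpha>"
    proof -
      have "integrable M (\<lambda>\<omega>. xh / x * (x / xh * \<alpha> \<omega>))" using tb(2) unfolding A0 by (rule integrable_mult_right)
      then show ?thesis using x xh0 by simp
    qed
    have \<alpha>1: "1 \<le> \<alpha> \<omega>" if "\<omega> \<in> space M" for \<omega>
      using control_path.f_nonneg[OF path[OF that], of 0] by (simp add: \<alpha>_def)
    have E\<alpha>: "1 \<le> expectation \<alpha>"
    proof -
      have "expectation (\<lambda>_. 1) \<le> expectation \<alpha>" by (rule integral_mono) (use \<alpha>_int \<alpha>1 in auto)
      then show ?thesis by (simp add: prob_space)
    qed
    have V0: "0 \<le> V T (A n) \<omega>" if "\<omega> \<in> space M" for \<omega>
      unfolding V_def using control_path.nn_integral_eq_LINT(2)[OF A_path[OF that] T weight_continuous[OF that, of \<rho> 1 0], of n] by simp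
    have Y_eq: "Y n T = (\<lambda>\<omega>. x * marginal (ln xh) + c2 * (x * (\<alpha> \<omega> - 1) + V T (A n) \<omega>))" by (simp add: Y_def \<alpha>_def fun_eq_iff)
    have Y_int: "integrable M (Y n T)" unfolding Y_eq using \<alpha>_int tb(1) by simp
    then show "Y n T \<in> borel_measurable M" by auto
    have hc: "c2 \<le> marginal (ln xh)" using a xh by (intro marginal_lower) simp
    have Y0: "0 \<le> Y n T \<omega>" if "\<omega> \<in> space M" for \<omega>
      unfolding Y_eq using hc c2_pos x \<alpha>1[OF that] V0[OF that] by (intro add_nonneg_nonneg mult_nonneg_nonneg) auto
    have "(\<integral>\<^sup>+\<omega>. ennreal (Y n T \<omega>) \<partial>M) = ennreal (expectation (Y n T))"
      using Y0 by (intro nn_integral_eq_integral Y_int AE_I2)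
    also have "\<dots> \<le> ennreal (xh * marginal (ln xh) * expectation (A n 0) + c2 * expectation (V T (A n)))"
    proof (rule ennreal_leI)
      have "expectation (Y n T) = x * marginal (ln xh) + c2 * (x * (expectation \<alpha> - 1) + expectation (V T (A n)))"
        unfolding Y_eq using \<alpha>_int tb(1) by (simp add: prob_space)
      also have "\<dots> \<le> x * marginal (ln xh) + marginal (ln xh) * (x * (expectation \<alpha> - 1)) + c2 * expectation (V T (A n))"
        using mult_right_mono[OF hc, of "x * (expectation \<alpha> - 1)"] E\<alpha> x by (simp add: distrib_left)
      also have "\<dots> = xh * marginal (ln xh) * expectation (A n 0) + c2 * expectation (V T (A n))"
        unfolding A0 using xh0 by (simp add: algebra_simps)
      finally show "expectation (Y n T) \<le> xh * marginal (ln xh) * expectation (A n 0) + c2 * expectation (V T (A n))" .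
    qed
    also have "\<dots> \<le> (\<integral>\<^sup>+\<omega>. (\<integral>\<^sup>+t\<in>{0..}. ennreal (exp (- \<rho> * t + 2 * ly t \<omega> + l t \<omega>) * A n t \<omega>) \<partial>lborel) \<partial>M)
      + ennreal marginal_slope * (\<integral>\<^sup>+\<omega>. ennreal (exp (- \<rho> * T + 2 * ly T \<omega> + l T \<omega>) * A n T \<omega>) \<partial>M)"
      by (rule tb(3))
    also have "\<dots> \<le> BB + ennreal marginal_slope * \<Phi> T"
      unfolding BB_def \<Phi>_def
      by (intro add_mono mult_left_mono nn_integral_mono mult_right_mono ennreal_leI A_le) auto
    finally show "(\<integral>\<^sup>+\<omega>. ennreal (Y n T \<omega>) \<partial>M) \<le> BB + ennreal marginal_slope * \<Phi> T" .
  qed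
  define v where "v T \<omega> = (LINT t:{0<..T}|control_measure (\<lambda>t. exp (\<xi> t \<omega>) - 1). x / xh * exp (- \<rho> * t + ly t \<omega>))" for T \<omega>
  define YT where "YT T \<omega> = x * marginal (ln xh) + c2 * (x * (exp (\<xi> 0 \<omega>) - 1) + v T \<omega>)" for T \<omega>
  have e_path: "control_path (\<lambda>t. exp (\<xi> t \<omega>) - 1)" if "\<omega> \<in> space M" for \<omega>
    using path[OF that] by (rule control_path.exp_path)
  have wc: "continuous_on {0..} (\<lambda>t. exp (- \<rho> * t + ly t \<omega>))" "continuous_on {0..} (\<lambda>t. x / xh * exp (- \<rho> * t + ly t \<omega>))" if "\<omega> \<in> space M" for \<omega>
    using weight_continuous[OF that, of \<rho> 1 0] continuous_on_mult_left[OF weight_continuous[OF that, of \<rho> 1 0], of "x / xh"] by simp_all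
  have Ylim: "(\<lambda>n. Y n T \<omega>) \<longlonglongrightarrow> YT T \<omega>" if T: "0 < T" and \<omega>: "\<omega> \<in> space M" for T \<omega>
  proof -
    interpret P: control_path "\<lambda>t. \<xi> t \<omega>" by (rule path[OF \<omega>])
    obtain N where N: "exp (\<xi> T \<omega>) \<le> real N" using real_arch_simple by blast
    \<comment> \<open>As \<open>\<xi>\<close> is nondecreasing, a truncation level above
      \<open>exp (\<xi> T \<omega>)\<close> is inactive on all of \<open>{0..T}\<close>.\<close>
    have "Y n T \<omega> = YT T \<omega>" if n: "N \<le> n" for n
    proof -
      have le: "exp (\<xi> t \<omega>) \<le> real (Suc n)" if "0 \<le> t" "t \<le> T" for t
      proof -
        have "exp (\<xi> t \<omega>) \<le> exp (\<xi> T \<omega>)" using P.f_le[OF that] by simp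
        also have "\<dots> \<le> real (Suc n)" using N n by simp
        finally show ?thesis .
      qed
      have "V T (A n) \<omega> = x / xh * (LINT t:{0<..T}|control_measure (\<lambda>t. exp (\<xi> t \<omega>) - 1). exp (- \<rho> * t + ly t \<omega>))"
        unfolding V_def
      proof (rule control_path.control_measure_affine[OF e_path[OF \<omega>] T wc(1)[OF \<omega>] A_path[OF \<omega>], where k="x / xh"])
        fix t assume "0 \<le> t" "t \<le> T"
        then have "min (exp (\<xi> t \<omega>)) (real (Suc n)) = exp (\<xi> t \<omega>)" using le by (simp only: min_absorb1)
        then show "A n t \<omega> = x / xh * (exp (\<xi> t \<omega>) - 1) + x / xh" unfolding A_def by (simp add: algebra_simps)
      qed
      also have "\<dots> = v T \<omega>" unfolding v_def by (rule set_integral_mult_right[symmetric])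
      finally have 1: "V T (A n) \<omega> = v T \<omega>" .
      have "min (exp (\<xi> 0 \<omega>)) (real (Suc n)) = exp (\<xi> 0 \<omega>)" using le[of 0] T by (simp only: min_absorb1)
      then show ?thesis unfolding Y_def YT_def 1 by simp
    qed
    then show ?thesis by (intro tendsto_eventually) (auto simp: eventually_sequentially)
  qed
  have YT_meas: "YT T \<in> borel_measurable M" if T: "0 < T" for T
    by (rule borel_measurable_LIMSEQ_real[OF Ylim[OF T] Y(1)[OF T]])
  have YT_bd: "(\<integral>\<^sup>+\<omega>. ennreal (YT T \<omega>) \<partial>M) \<le> BB + ennreal marginal_slope * \<Phi> T" if T: "0 < T" for T
  proof -
    have "(\<integral>\<^sup>+\<omega>. ennreal (YT T \<omega>) \<partial>M) = (\<integral>\<^sup>+\<omega>. liminf (\<lambda>n. ennreal (Y n T \<omega>)) \<partial>M)"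
    proof (rule nn_integral_cong)
      fix \<omega> assume \<omega>: "\<omega> \<in> space M"
      have "(\<lambda>n. ennreal (Y n T \<omega>)) \<longlonglongrightarrow> ennreal (YT T \<omega>)" by (intro tendsto_ennrealI Ylim T \<omega>)
      then show "ennreal (YT T \<omega>) = liminf (\<lambda>n. ennreal (Y n T \<omega>))" by (rule lim_imp_Liminf[OF trivial_limit_sequentially, symmetric])
    qed
    also have "\<dots> \<le> liminf (\<lambda>n. \<integral>\<^sup>+\<omega>. ennreal (Y n T \<omega>) \<partial>M)"
      using Y(1)[OF T] by (intro nn_integral_liminf) measurable
    also have "\<dots> \<le> BB + ennreal marginal_slope * \<Phi> T"
    proof -
      have "liminf (\<lambda>n. \<integral>\<^sup>+\<omega>. ennreal (Y n T \<omega>) \<partial>M) \<le> liminf (\<lambda>n::nat. BB + ennreal marginal_slope * \<Phi> T)"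
        by (intro Liminf_mono always_eventually allI Y(2) T)
      also have "\<dots> = BB + ennreal marginal_slope * \<Phi> T" by (rule Liminf_const) simp
      finally show ?thesis .
    qed
    finally show ?thesis .
  qed
  have wn: "0 \<le> x / xh * exp (- \<rho> * t + ly t \<omega>)" for t \<omega> using c by (intro mult_nonneg_nonneg) auto
  have v0: "0 \<le> v T \<omega>" "ennreal (v T \<omega>) = (\<integral>\<^sup>+t\<in>{0<..T}. ennreal (x / xh * exp (- \<rho> * t + ly t \<omega>)) \<partial>control_measure (\<lambda>t. exp (\<xi> t \<omega>) - 1))"
    if "0 < T" "\<omega> \<in> space M" for T \<omega>
    unfolding v_def
    by (rule control_path.nn_integral_eq_LINT(2)[OF e_path[OF that(2)] that(1) wc(2)[OF that(2)] wn])
       (rule control_path.nn_integral_eq_LINT(1)[OF e_path[OF that(2)] that(1) wc(2)[OF that(2)] wn, symmetric])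
  have v_mono: "v T \<omega> \<le> v T' \<omega>" if T: "0 < T" "T \<le> T'" and \<omega>: "\<omega> \<in> space M" for T T' \<omega>
  proof -
    have "ennreal (v T \<omega>) \<le> ennreal (v T' \<omega>)"
      using T by (subst (1 2) v0(2)) (auto intro!: nn_integral_mono \<omega> simp: indicator_def)
    then show ?thesis using v0(1)[of T' \<omega>] T \<omega> by (simp add: ennreal_le_iff)
  qed
  have YT_mono: "YT T \<omega> \<le> YT T' \<omega>" if T: "0 < T" "T \<le> T'" and \<omega>: "\<omega> \<in> space M" for T T' \<omega>
    unfolding YT_def using v_mono[OF that] c2_pos by (intro add_left_mono mult_left_mono) auto
  have hc: "c2 \<le> marginal (ln xh)" using a xh by (intro marginal_lower) simp
  have up: "ennreal (x * marginal (ln xh)) + ennreal c2 * (\<integral>\<^sup>+t\<in>{0..}. ennreal (x / xh * exp (- \<rho> * t + ly t \<omega>)) \<partial>control_measure (\<lambda>t. exp (\<xi> t \<omega>) - 1))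
      = (SUP m. ennreal (YT (real (Suc m)) \<omega>))" if \<omega>: "\<omega> \<in> space M" for \<omega>
  proof -
    have \<xi>0: "0 \<le> exp (\<xi> 0 \<omega>) - 1" using control_path.f_nonneg[OF path[OF \<omega>], of 0] by simp
    have w0: "x / xh * exp (- \<rho> * 0 + ly 0 \<omega>) = x" using xh0 by (simp add: ly_0[OF \<omega>])
    have "(\<integral>\<^sup>+t\<in>{0..}. ennreal (x / xh * exp (- \<rho> * t + ly t \<omega>)) \<partial>control_measure (\<lambda>t. exp (\<xi> t \<omega>) - 1))
      = ennreal (x * (exp (\<xi> 0 \<omega>) - 1)) + (SUP m. ennreal (v (real (Suc m)) \<omega>))"
      using control_path.nn_integral_split_zero[OF e_path[OF \<omega>] wc(2)[OF \<omega>] wn] unfolding w0 v_def .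
    also have "\<dots> = (SUP m. ennreal (x * (exp (\<xi> 0 \<omega>) - 1)) + ennreal (v (real (Suc m)) \<omega>))"
      by (rule ennreal_SUP_add_right) simp
    finally have "ennreal (x * marginal (ln xh)) + ennreal c2 * (\<integral>\<^sup>+t\<in>{0..}. ennreal (x / xh * exp (- \<rho> * t + ly t \<omega>)) \<partial>control_measure (\<lambda>t. exp (\<xi> t \<omega>) - 1))
      = ennreal (x * marginal (ln xh)) + (SUP m. ennreal c2 * (ennreal (x * (exp (\<xi> 0 \<omega>) - 1)) + ennreal (v (real (Suc m)) \<omega>)))"
      by (simp only: SUP_mult_left_ennreal)
    also have "\<dots> = (SUP m. ennreal (x * marginal (ln xh)) + ennreal c2 * (ennreal (x * (exp (\<xi> 0 \<omega>) - 1)) + ennreal (v (real (Suc m)) \<omega>)))"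
      by (rule ennreal_SUP_add_right) simp
    also have "\<dots> = (SUP m. ennreal (YT (real (Suc m)) \<omega>))"
    proof (rule SUP_cong[OF refl])
      fix m :: nat
      have "0 \<le> v (real (Suc m)) \<omega>" using v0(1)[of "real (Suc m)" \<omega>] \<omega> by simp
      moreover have "0 \<le> x * (exp (\<xi> 0 \<omega>) - 1)" using x \<xi>0 by (intro mult_nonneg_nonneg) auto
      moreover have "0 \<le> x * marginal (ln xh)" using x hc c2_pos by (intro mult_nonneg_nonneg) auto
      ultimately show "ennreal (x * marginal (ln xh)) + ennreal c2 * (ennreal (x * (exp (\<xi> 0 \<omega>) - 1)) + ennreal (v (real (Suc m)) \<omega>)) = ennreal (YT (real (Suc m)) \<omega>)"
        unfolding YT_def using c2_pos by (simp only: ennreal_plus[symmetric] ennreal_mult[symmetric] add_nonneg_nonneg mult_nonneg_nonneg less_imp_le)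
    qed
    finally show ?thesis .
  qed
  \<comment> \<open>The mean terminal terms, integrated over all horizons, give the right side of
    the claim, which is finite by \<open>fin\<close>.\<close>
  have tonelli: "(\<integral>\<^sup>+t\<in>{0..}. \<Phi> t \<partial>lborel) = BB"
  proof -
    have "(\<lambda>(t, \<omega>). if 0 \<le> t then exp (- \<rho> * t + ly t \<omega> + l t \<omega>) * X t \<omega> else 0) \<in> borel_measurable (borel \<Otimes>\<^sub>M M)"
    proof (rule jointly_measurable_right_continuous)
      fix t :: real assume t: "0 \<le> t"
      have "ly t \<in> borel_measurable M" "l t \<in> borel_measurable M" "\<xi> t \<in> borel_measurable M"
        using t Fl_measurable_M[OF t ly_adapted[of t t]] Fl_measurable_M[OF t l_adapted] Fl_measurable_M[OF t adapted] by auto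
      then show "(\<lambda>\<omega>. exp (- \<rho> * t + ly t \<omega> + l t \<omega>) * X t \<omega>) \<in> borel_measurable M" unfolding X_def by measurable
      fix \<omega> assume \<omega>: "\<omega> \<in> space M"
      interpret P: control_path "\<lambda>t. \<xi> t \<omega>" by (rule path[OF \<omega>])
      interpret R: reflection "ln a" "\<lambda>s. ly s \<omega>" by (rule reflection_ly[OF \<omega>])
      have 1: "((\<lambda>t. ly t \<omega>) \<longlongrightarrow> ly t \<omega>) (at_right t)"
        using R.y_cont t by (auto simp: continuous_on_def intro: tendsto_within_subset)
      have 2: "((\<lambda>t. l t \<omega>) \<longlongrightarrow> l t \<omega>) (at_right t)"
        using R.l_cont t unfolding l_def by (auto simp: continuous_on_def intro: tendsto_within_subset)
      show "((\<lambda>t. exp (- \<rho> * t + ly t \<omega> + l t \<omega>) * X t \<omega>) \<longlongrightarrow> exp (- \<rho> * t + ly t \<omega> + l t \<omega>) * X t \<omega>) (at_right t)"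
        unfolding X_def using xh0 by (intro tendsto_intros 1 2 P.f_right[OF t]) auto
    qed
    then have m: "(\<lambda>p. ennreal (case p of (t, \<omega>) \<Rightarrow> if 0 \<le> t then exp (- \<rho> * t + ly t \<omega> + l t \<omega>) * X t \<omega> else 0)) \<in> borel_measurable (lborel \<Otimes>\<^sub>M M)"
      by (simp add: measurable_cong_sets[OF sets_pair_measure_cong[OF sets_lborel refl] refl])
    interpret pair_sigma_finite lborel M ..
    have "(\<integral>\<^sup>+t\<in>{0..}. \<Phi> t \<partial>lborel) = (\<integral>\<^sup>+t. \<integral>\<^sup>+\<omega>. ennreal (if 0 \<le> t then exp (- \<rho> * t + ly t \<omega> + l t \<omega>) * X t \<omega> else 0) \<partial>M \<partial>lborel)"
      unfolding \<Phi>_def by (intro nn_integral_cong) (auto simp: indicator_def)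
    also have "\<dots> = (\<integral>\<^sup>+\<omega>. \<integral>\<^sup>+t. ennreal (if 0 \<le> t then exp (- \<rho> * t + ly t \<omega> + l t \<omega>) * X t \<omega> else 0) \<partial>lborel \<partial>M)"
      using Fubini[OF m] by simp
    also have "\<dots> = BB"
      unfolding BB_def by (intro nn_integral_cong) (auto simp: indicator_def)
    finally show ?thesis .
  qed
  have BBfin: "BB < \<infinity>" using fin by (simp add: BB_def)
  have final: "(\<integral>\<^sup>+\<omega>. ennreal (YT (real (Suc m)) \<omega>) \<partial>M) \<le> BB" for m
  proof (rule ennreal_le_epsilon)
    fix e :: real assume e: "0 < e"
    have "\<exists>T\<ge>real (Suc m). \<Phi> T \<le> ennreal (e / marginal_slope)"
      using BBfin tonelli e marginal_slope_pos by (intro nn_integral_small_value) auto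
    then obtain T where T: "real (Suc m) \<le> T" "\<Phi> T \<le> ennreal (e / marginal_slope)" by blast
    have T0: "0 < T" using T(1) by (rule less_le_trans[rotated]) simp
    have "(\<integral>\<^sup>+\<omega>. ennreal (YT (real (Suc m)) \<omega>) \<partial>M) \<le> (\<integral>\<^sup>+\<omega>. ennreal (YT T \<omega>) \<partial>M)"
      using T(1) by (intro nn_integral_mono ennreal_leI YT_mono) auto
    also have "\<dots> \<le> BB + ennreal marginal_slope * \<Phi> T" by (rule YT_bd[OF T0])
    also have "\<dots> \<le> BB + ennreal marginal_slope * ennreal (e / marginal_slope)" using T by (intro add_left_mono mult_left_mono) auto
    also have "\<dots> = BB + ennreal e" using marginal_slope_pos e by (simp add: ennreal_mult[symmetric])
    finally show "(\<integral>\<^sup>+\<omega>. ennreal (YT (real (Suc m)) \<omega>) \<partial>M) \<le> BB + ennreal e" .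
  qed
  have "(\<integral>\<^sup>+\<omega>. ennreal (x * marginal (ln xh)) + ennreal c2 *
        (\<integral>\<^sup>+t\<in>{0..}. ennreal (x / xh * exp (- \<rho> * t + ly t \<omega>)) \<partial>control_measure (\<lambda>t. exp (\<xi> t \<omega>) - 1)) \<partial>M)
     = (\<integral>\<^sup>+\<omega>. (SUP m. ennreal (YT (real (Suc m)) \<omega>)) \<partial>M)"
    by (intro nn_integral_cong) (rule up)
  also have "\<dots> = (SUP m. \<integral>\<^sup>+\<omega>. ennreal (YT (real (Suc m)) \<omega>) \<partial>M)"
  proof (rule nn_integral_monotone_convergence_SUP_AE)
    show "AE \<omega> in M. ennreal (YT (real (Suc i)) \<omega>) \<le> ennreal (YT (real (Suc (Suc i))) \<omega>)" for i
      by (intro AE_I2 ennreal_leI YT_mono) auto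
    show "(\<lambda>\<omega>. ennreal (YT (real (Suc i)) \<omega>)) \<in> borel_measurable M" for i
      using YT_meas[of "real (Suc i)"] by simp
  qed
  also have "\<dots> \<le> BB" by (intro SUP_least final)
  finally show ?thesis unfolding BB_def .
qed

end

section \<open>Measurability of running costs and absence of legislative control\<close>

lemma time_integral_measurable:
  fixes f :: "real \<Rightarrow> 'a \<Rightarrow> real"
  assumes f: "\<And>t. 0 \<le> t \<Longrightarrow> f t \<in> borel_measurable M"
    and right: "\<And>t \<omega>. 0 \<le> t \<Longrightarrow> \<omega> \<in> space M \<Longrightarrow> ((\<lambda>t. f t \<omega>) \<longlongrightarrow> f t \<omega>) (at_right t)"
  shows "\<omega> \<in> space M \<Longrightarrow> (\<lambda>t. ennreal (f t \<omega>) * indicator {0..} t) \<in> borel_measurable lborel"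
    "(\<lambda>\<omega>. \<integral>\<^sup>+t\<in>{0..}. ennreal (f t \<omega>) \<partial>lborel) \<in> borel_measurable M"
proof -
  have j: "(\<lambda>(t, \<omega>). if 0 \<le> t then f t \<omega> else 0) \<in> borel_measurable (borel \<Otimes>\<^sub>M M)"
    using f right by (rule jointly_measurable_right_continuous)
  have eq: "(\<lambda>t. ennreal (if 0 \<le> t then f t \<omega> else 0)) = (\<lambda>t. ennreal (f t \<omega>) * indicator {0..} t)" for \<omega>
    by (auto simp: indicator_def)
  {
    assume \<omega>: "\<omega> \<in> space M"
    have "(\<lambda>t. case (t, \<omega>) of (t, \<omega>) \<Rightarrow> if 0 \<le> t then f t \<omega> else 0) \<in> borel_measurable borel"
      by (rule measurable_Pair1[OF j \<omega>])
    then have "(\<lambda>t. ennreal (if 0 \<le> t then f t \<omega> else 0)) \<in> borel_measurable borel" by simp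
    then show "(\<lambda>t. ennreal (f t \<omega>) * indicator {0..} t) \<in> borel_measurable lborel" unfolding eq by simp
  }
  have "(\<lambda>(\<omega>, t). if 0 \<le> t then f t \<omega> else 0) \<in> borel_measurable (M \<Otimes>\<^sub>M borel)"
    using measurable_pair_swap[OF j] by (simp only: case_prod_conv)
  then have "(\<lambda>(\<omega>, t). ennreal (if 0 \<le> t then f t \<omega> else 0)) \<in> borel_measurable (M \<Otimes>\<^sub>M lborel)"
    by (simp add: measurable_cong_sets[OF sets_pair_measure_cong[OF refl sets_lborel] refl] case_prod_beta)
  from lborel.borel_measurable_nn_integral[OF this]
  show "(\<lambda>\<omega>. \<integral>\<^sup>+t\<in>{0..}. ennreal (f t \<omega>) \<partial>lborel) \<in> borel_measurable M" unfolding eq .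
qed

lemma (in complete_measure) borel_measurable_AE_eq:
  fixes X Y :: "'a \<Rightarrow> real"
  assumes X: "X \<in> borel_measurable M" and ae: "AE \<omega> in M. Y \<omega> = X \<omega>"
  shows "Y \<in> borel_measurable M"
proof (rule measurableI)
  fix B :: "real set" assume B: "B \<in> sets borel"
  show "Y -` B \<inter> space M \<in> sets M"
  proof (rule in_sets_AE[OF _ measurable_sets[OF X B]])
    show "AE \<omega> in M. \<omega> \<in> X -` B \<inter> space M \<longleftrightarrow> \<omega> \<in> Y -` B \<inter> space M"
      using ae by eventually_elim auto
  qed auto
qed simp

lemma control_measure_zero: "control_measure (\<lambda>_. 0) = null_measure borel"
proof (rule measure_eq_if_eq_Ioc[where F="\<lambda>_. 0"])
  interpret Z: control_path "\<lambda>_. 0" by (rule control_path_const) simp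
  show "sets (control_measure (\<lambda>_. 0)) = sets borel" by (simp add: Z.control_measure_eq)
  show "emeasure (control_measure (\<lambda>_. 0)) {s<..t} = ennreal (0 - 0)" if "s \<le> t" for s t
    using that by (simp add: Z.control_measure_eq Z.emeasure_Ioc Z.F_def)
qed simp_all

lemma jump_zero: "jump (\<lambda>_. 0) t = 0"
  by (simp add: jump_def left_lim_def tendsto_Lim trivial_limit_at_left_real)

lemma down_integral_zero: "down_integral q x X (\<lambda>t. no_intervention t \<omega>) = 0"
  unfolding down_integral_def no_intervention_def cont_part_def jump_zero
  by (simp add: control_measure_zero nn_integral_null_measure)

lemma no_intervention_controls: "no_intervention \<in> controls M W"
  unfolding controls_def no_intervention_def by (auto simp: mono_on_def cadlag_def)

lemma controls_path: "\<xi> \<in> controls M W \<Longrightarrow> \<omega> \<in> space M \<Longrightarrow> control_path (\<lambda>t. \<xi> t \<omega>)"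
  by unfold_locales (auto simp: controls_def)

lemma controls_add_const:
  assumes \<xi>: "\<xi> \<in> controls M W" and k: "0 \<le> k"
  shows "(\<lambda>t \<omega>. k + \<xi> t \<omega>) \<in> controls M W"
  unfolding controls_def
proof (intro CollectI conjI ballI allI impI)
  fix t :: real assume "0 \<le> t"
  then have "\<xi> t \<in> borel_measurable (augmented_filtration M W t)" using \<xi> by (simp add: controls_def)
  then show "(\<lambda>\<omega>. k + \<xi> t \<omega>) \<in> borel_measurable (augmented_filtration M W t)" by measurable
next
  fix \<omega> assume \<omega>: "\<omega> \<in> space M"
  interpret P: control_path "\<lambda>t. \<xi> t \<omega>" by (rule controls_path[OF \<xi> \<omega>])
  show "0 \<le> k + \<xi> t \<omega>" if "0 \<le> t" for t using P.f_nonneg[OF that] k by simp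
  show "mono_on {0..} (\<lambda>t. k + \<xi> t \<omega>)" using P.f_mono by (auto simp: mono_on_def)
  show "cadlag (\<lambda>t. k + \<xi> t \<omega>)"
    unfolding cadlag_def
  proof (intro conjI allI impI)
    show "continuous (at_right t) (\<lambda>t. k + \<xi> t \<omega>)" if "0 \<le> t" for t
      unfolding continuous_within by (intro tendsto_intros P.f_right that)
    show "\<exists>l. ((\<lambda>t. k + \<xi> t \<omega>) \<longlongrightarrow> l) (at_left t)" if "0 < t" for t
      using tendsto_add[OF tendsto_const P.left_lim_tendsto[OF that]] by (rule exI)
  qed
qed

section \<open>Costs of reflected policies\<close>

context debt_model
begin

lemma xh_pos: "0 < xh" using a xh by simp

lemma ly_right: "0 \<le> t \<Longrightarrow> \<omega> \<in> space M \<Longrightarrow> ((\<lambda>t. ly t \<omega>) \<longlongrightarrow> ly t \<omega>) (at_right t)"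
  using reflection.y_cont[OF reflection_ly, of \<omega>] by (auto simp: continuous_on_def intro: tendsto_within_subset)

lemma l_right: "0 \<le> t \<Longrightarrow> \<omega> \<in> space M \<Longrightarrow> ((\<lambda>t. l t \<omega>) \<longlongrightarrow> l t \<omega>) (at_right t)"
  using reflection.l_cont[OF reflection_ly, of \<omega>] unfolding l_def
  by (auto simp: continuous_on_def intro: tendsto_within_subset)

lemma ly_measurable: "0 \<le> t \<Longrightarrow> ly t \<in> borel_measurable M"
  using Fl_measurable_M ly_adapted by blast

lemma l_measurable: "0 \<le> t \<Longrightarrow> l t \<in> borel_measurable M"
  using Fl_measurable_M l_adapted by blast

text \<open>The integrating measure varies with the scenario. Measurability comes from partition
  sums on bounded horizons and a supremum over the horizons.\<close>

lemma up_measurable: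
  assumes path: "\<And>\<omega>. \<omega> \<in> space M \<Longrightarrow> control_path (\<lambda>t. \<xi> t \<omega>)"
    and meas: "\<And>t. 0 \<le> t \<Longrightarrow> \<xi> t \<in> borel_measurable M" and c: "0 \<le> c"
  shows "(\<lambda>\<omega>. \<integral>\<^sup>+t\<in>{0..}. ennreal (c * exp (- q * t + ly t \<omega>)) \<partial>control_measure (\<lambda>t. exp (\<xi> t \<omega>) - 1)) \<in> borel_measurable M"
proof -
  let ?v = "\<lambda>m \<omega>. LINT t:{0<..real (Suc m)}|control_measure (\<lambda>t. exp (\<xi> t \<omega>) - 1). c * exp (- q * t + ly t \<omega>)"
  have e_path: "control_path (\<lambda>t. exp (\<xi> t \<omega>) - 1)" if "\<omega> \<in> space M" for \<omega>
    using path[OF that] by (rule control_path.exp_path)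
  have wc: "continuous_on {0..} (\<lambda>t. c * exp (- q * t + ly t \<omega>))" if "\<omega> \<in> space M" for \<omega>
    using continuous_on_mult_left[OF weight_continuous[OF that, of q 1 0], of c] by simp
  have v: "?v m \<in> borel_measurable M" for m
  proof (rule borel_measurable_LIMSEQ_real)
    let ?nd = "\<lambda>n i. node (real (Suc m)) (Suc n) i"
    show "(\<lambda>n. \<Sum>i<Suc n. (c * exp (- q * ?nd n (Suc i) + ly (?nd n (Suc i)) \<omega>)) * ((exp (\<xi> (?nd n (Suc i)) \<omega>) - 1) - (exp (\<xi> (?nd n i) \<omega>) - 1))) \<longlonglongrightarrow> ?v m \<omega>"
      if \<omega>: "\<omega> \<in> space M" for \<omega>
      by (rule control_path.continuous_integral(2)[OF e_path[OF \<omega>] _ wc[OF \<omega>]]) simp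
    have nd: "0 \<le> ?nd n i" for n i by (rule node_nonneg) simp
    show "(\<lambda>\<omega>. \<Sum>i<Suc n. (c * exp (- q * ?nd n (Suc i) + ly (?nd n (Suc i)) \<omega>)) * ((exp (\<xi> (?nd n (Suc i)) \<omega>) - 1) - (exp (\<xi> (?nd n i) \<omega>) - 1))) \<in> borel_measurable M" for n
      using ly_measurable[OF nd] meas[OF nd] by measurable
  qed
  have "(\<lambda>\<omega>. ennreal (c * exp (- q * 0 + ly 0 \<omega>) * (exp (\<xi> 0 \<omega>) - 1)) + (SUP m. ennreal (?v m \<omega>))) \<in> borel_measurable M"
    using v ly_measurable[of 0] meas[of 0] by measurable
  then show ?thesis
  proof (subst measurable_cong)
    fix \<omega> assume \<omega>: "\<omega> \<in> space M"
    show "(\<integral>\<^sup>+t\<in>{0..}. ennreal (c * exp (- q * t + ly t \<omega>)) \<partial>control_measure (\<lambda>t. exp (\<xi> t \<omega>) - 1))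
      = ennreal (c * exp (- q * 0 + ly 0 \<omega>) * (exp (\<xi> 0 \<omega>) - 1)) + (SUP m. ennreal (?v m \<omega>))"
      by (rule control_path.nn_integral_split_zero[OF e_path[OF \<omega>] wc[OF \<omega>]]) (use c in simp)
  qed
qed

text \<open>\<open>exp \<xi> - 1\<close> equals \<open>exp k * (exp l - 1) + (exp k - 1)\<close>:
  after time 0 the measure is scaled by \<open>exp k\<close>, and the constant is the jump at time
  0, paid at the starting value \<open>c * xh\<close>.\<close>

lemma up_reflected:
  assumes \<omega>: "\<omega> \<in> space M" and path: "control_path (\<lambda>t. \<xi> t \<omega>)"
    and eq: "\<And>t. 0 \<le> t \<Longrightarrow> \<xi> t \<omega> = k + l t \<omega>" and c: "0 \<le> c" and k: "0 \<le> k"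
  shows "(\<integral>\<^sup>+t\<in>{0..}. ennreal (c * exp (- q * t + ly t \<omega>)) \<partial>control_measure (\<lambda>t. exp (\<xi> t \<omega>) - 1))
    = ennreal (c * (xh * (exp k - 1))) + ennreal (c * exp k) * up_reflection q \<omega>"
proof -
  have e_path: "control_path (\<lambda>t. exp (\<xi> t \<omega>) - 1)" using path by (rule control_path.exp_path)
  have wc: "continuous_on {0..} (\<lambda>t. c * exp (- q * t + ly t \<omega>))"
    using continuous_on_mult_left[OF weight_continuous[OF \<omega>, of q 1 0], of c] by simp
  have "(\<integral>\<^sup>+t\<in>{0..}. ennreal (c * exp (- q * t + ly t \<omega>)) \<partial>control_measure (\<lambda>t. exp (\<xi> t \<omega>) - 1))
    = ennreal (c * exp (- q * 0 + ly 0 \<omega>) * (exp (\<xi> 0 \<omega>) - 1))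
     + (SUP m. ennreal (LINT t:{0<..real (Suc m)}|control_measure (\<lambda>t. exp (\<xi> t \<omega>) - 1). c * exp (- q * t + ly t \<omega>)))"
    by (rule control_path.nn_integral_split_zero[OF e_path wc]) (use c in simp)
  also have "(\<lambda>m::nat. ennreal (LINT t:{0<..real (Suc m)}|control_measure (\<lambda>t. exp (\<xi> t \<omega>) - 1). c * exp (- q * t + ly t \<omega>)))
    = (\<lambda>m. ennreal (c * exp k) * ennreal (up_truncated q (real (Suc m)) \<omega>))"
  proof
    fix m :: nat
    have "(LINT t:{0<..real (Suc m)}|control_measure (\<lambda>t. exp (\<xi> t \<omega>) - 1). c * exp (- q * t + ly t \<omega>))
      = exp k * (LINT t:{0<..real (Suc m)}|control_measure (\<lambda>t. exp (l t \<omega>) - 1). c * exp (- q * t + ly t \<omega>))"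
      by (rule control_path.control_measure_affine[OF exp_l_path[OF \<omega>] _ wc e_path, where k="exp k - 1"])
         (simp_all add: eq exp_add algebra_simps)
    also have "\<dots> = c * exp k * up_truncated q (real (Suc m)) \<omega>" unfolding up_truncated_def by simp
    finally have eq': "(LINT t:{0<..real (Suc m)}|control_measure (\<lambda>t. exp (\<xi> t \<omega>) - 1). c * exp (- q * t + ly t \<omega>)) = c * exp k * up_truncated q (real (Suc m)) \<omega>" .
    show "ennreal (LINT t:{0<..real (Suc m)}|control_measure (\<lambda>t. exp (\<xi> t \<omega>) - 1). c * exp (- q * t + ly t \<omega>))
       = ennreal (c * exp k) * ennreal (up_truncated q (real (Suc m)) \<omega>)"
      unfolding eq' using c up_truncated_nonneg[OF \<omega>, of "real (Suc m)" q] by (intro ennreal_mult) auto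
  qed
  also have "(SUP m. ennreal (c * exp k) * ennreal (up_truncated q (real (Suc m)) \<omega>)) = ennreal (c * exp k) * up_reflection q \<omega>"
    unfolding up_reflection_SUP[OF \<omega>] by (rule SUP_mult_left_ennreal[symmetric])
  also have "c * exp (- q * 0 + ly 0 \<omega>) * (exp (\<xi> 0 \<omega>) - 1) = c * (xh * (exp k - 1))"
  proof -
    have "l 0 \<omega> = 0" unfolding l_def by (rule reflection.l_0[OF reflection_ly[OF \<omega>]])
    then show ?thesis using xh_pos by (simp add: ly_0[OF \<omega>] eq)
  qed
  finally show ?thesis .
qed

lemma up_reflection_measurable: "up_reflection q \<in> borel_measurable M"
proof -
  have "(\<lambda>\<omega>. \<integral>\<^sup>+t\<in>{0..}. ennreal (1 * exp (- q * t + ly t \<omega>)) \<partial>control_measure (\<lambda>t. exp (l t \<omega>) - 1)) \<in> borel_measurable M"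
  proof (rule up_measurable)
    show "control_path (\<lambda>t. l t \<omega>)" if "\<omega> \<in> space M" for \<omega>
      unfolding l_def by (rule reflection.l_path[OF reflection_ly[OF that]])
  qed (auto intro: l_measurable)
  then show ?thesis by (simp add: up_reflection_def[abs_def])
qed

text \<open>The given root belongs to the rate \<open>\<rho>\<close>; finiteness of the excess cost
  under the rate \<open>lam\<close> calls for a root of its own.\<close>

lemma negative_root:
  assumes q: "0 < q"
  obtains e where "e < 0" "\<theta> e = q"
proof -
  \<comment> \<open>Large enough for \<open>\<sigma>\<^sup>2 / 2 * N\<close> to reach
    \<open>\<bar>r - g\<bar> + q\<close>, so that the quadratic term prevails at
    \<open>- N\<close>.\<close>
  define N where "N = 1 + 2 * (\<bar>r - g\<bar> + q) / \<sigma>\<^sup>2"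
  have s2: "0 < \<sigma>\<^sup>2" using \<sigma> by simp
  have N1: "1 \<le> N" unfolding N_def using q s2 by simp
  have "\<sigma>\<^sup>2 / 2 * N = \<sigma>\<^sup>2 / 2 + (\<bar>r - g\<bar> + q)" unfolding N_def using s2 by (simp add: field_simps)
  then have N2: "\<bar>r - g\<bar> + q \<le> \<sigma>\<^sup>2 / 2 * N" using s2 by simp
  have "\<theta> (- N) = \<sigma>\<^sup>2 / 2 * N + N * (\<sigma>\<^sup>2 / 2 * N - (r - g))" unfolding \<theta>_def by (simp add: field_simps power2_eq_square)
  also have "\<dots> \<ge> 0 + 1 * q"
  proof (intro add_mono mult_mono)
    show "q \<le> \<sigma>\<^sup>2 / 2 * N - (r - g)" using N2 by linarith
  qed (use N1 s2 q in auto)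
  finally have hi: "q \<le> \<theta> (- N)" by simp
  have lo: "\<theta> 0 \<le> q" using q by (simp add: \<theta>_def)
  have "continuous_on {- N..0} \<theta>" unfolding \<theta>_def[abs_def] by (intro continuous_intros)
  then obtain e where e: "- N \<le> e" "e \<le> 0" "\<theta> e = q"
    using IVT2'[of \<theta> 0 q "- N"] lo hi N1 by auto
  have "e \<noteq> 0" using e(3) q by (auto simp: \<theta>_def)
  then show ?thesis using e that by force
qed

lemma up_reflection_finite: "0 < q \<Longrightarrow> \<exists>u\<ge>0. (\<integral>\<^sup>+\<omega>. up_reflection q \<omega> \<partial>M) = ennreal u"
proof -
  assume q: "0 < q"
  obtain e where e: "e < 0" "\<theta> e = q" using negative_root[OF q] .
  show ?thesis
    using up_reflection_expectation[OF e q] e by (intro exI[of _ "- exp (e * ln xh + (1 - e) * ln a) / e"]) (auto intro: less_imp_le[OF divide_pos_neg])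
qed

lemma running_finite:
  assumes "0 < p" "\<theta> p < q" "0 < q"
  shows "(\<integral>\<^sup>+\<omega>. (\<integral>\<^sup>+t\<in>{0..}. ennreal (exp (- q * t + p * ly t \<omega> + p * l t \<omega>)) \<partial>lborel) \<partial>M) < \<infinity>"
proof -
  obtain u where "0 \<le> u" "(\<integral>\<^sup>+\<omega>. up_reflection q \<omega> \<partial>M) = ennreal u" using up_reflection_finite[OF assms(3)] by blast
  then have "(\<integral>\<^sup>+\<omega>. (\<integral>\<^sup>+t\<in>{0..}. ennreal (exp (- q * t + p * ly t \<omega> + p * l t \<omega>)) \<partial>lborel) \<partial>M)
    \<le> ennreal ((exp (p * ln xh) + p * exp ((p - 1) * ln a) * u) / (q - \<theta> p))"
    by (intro expectation_square_bound assms(1,2)) auto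
  then show ?thesis by (rule order_le_less_trans) simp
qed

lemma running_reflected_measurable:
  "(\<lambda>\<omega>. \<integral>\<^sup>+t\<in>{0..}. ennreal (exp (- q * t + p * ly t \<omega> + s * l t \<omega>)) \<partial>lborel) \<in> borel_measurable M"
  "\<omega> \<in> space M \<Longrightarrow> (\<lambda>t. ennreal (exp (- q * t + p * ly t \<omega> + s * l t \<omega>)) * indicator {0..} t) \<in> borel_measurable lborel"
proof -
  have m: "(\<lambda>\<omega>. exp (- q * t + p * ly t \<omega> + s * l t \<omega>)) \<in> borel_measurable M" if "0 \<le> t" for t
    using ly_measurable[OF that] l_measurable[OF that] by measurable
  have r: "((\<lambda>t. exp (- q * t + p * ly t \<omega> + s * l t \<omega>)) \<longlongrightarrow> exp (- q * t + p * ly t \<omega> + s * l t \<omega>)) (at_right t)"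
    if "0 \<le> t" "\<omega> \<in> space M" for t \<omega>
    by (intro tendsto_intros ly_right l_right that)
  show "(\<lambda>\<omega>. \<integral>\<^sup>+t\<in>{0..}. ennreal (exp (- q * t + p * ly t \<omega> + s * l t \<omega>)) \<partial>lborel) \<in> borel_measurable M"
    by (rule time_integral_measurable(2)[OF m r])
  show "\<omega> \<in> space M \<Longrightarrow> (\<lambda>t. ennreal (exp (- q * t + p * ly t \<omega> + s * l t \<omega>)) * indicator {0..} t) \<in> borel_measurable lborel"
    by (rule time_integral_measurable(1)[OF m r])
qed

end

text \<open>The algebra behind both forms of the value. \<open>E\<close> stands for
  \<open>exp (d * ln xh + (1 - d) * ln a)\<close>, which is \<open>a\<close> when
  \<open>xh = a\<close>; the decisive identity is the partial fraction
  \<open>1 / d * (1 / (1 - d)) = 1 / d + 1 / (1 - d)\<close>. The disjunction separates a start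
  above the barrier from a jump onto it.\<close>

lemma value_algebra:
  fixes d k xh x a E c :: real
  assumes nz: "1 - d \<noteq> 0" "d \<noteq> 0" "k \<noteq> 0" "xh \<noteq> 0" "a \<noteq> 0" and c: "c = a / k * (1 + 1 / (1 - d))"
    and x: "x = xh \<or> (xh = a \<and> E = a)"
  shows "x * ((xh + a * E / xh / (1 - d)) / k) - (xh\<^sup>2 + 2 * a * (- E / d)) / k / 2
       = xh\<^sup>2 / (2 * k) - a * E / (k * d * (d - 1)) - c * (xh - x) \<and>
      x * ((xh + a * E / xh / (1 - d)) / k) - (xh\<^sup>2 + 2 * a * (- E / d)) / k / 2
     = (xh\<^sup>2 + 2 * a * (- E / d)) / k / 2 - c * (xh - x + - E / d)"
proof -
  define i where "i = 1 / k"
  define p where "p = 1 / d"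
  define e where "e = 1 / (1 - d)"
  have pe: "p * e = p + e" using nz(1,2) unfolding p_def e_def by (simp add: field_simps)
  have pe': "a * E / (k * d * (d - 1)) = - (a * E * i * (p * e))"
  proof -
    have "d - 1 = - (1 - d)" by simp
    then show ?thesis unfolding i_def p_def e_def by (simp only: divide_minus_right mult_minus_right) simp
  qed
  have c': "c = a * i * (1 + e)" unfolding c i_def e_def by simp
  have t: "x * ((xh + a * E / xh / (1 - d)) / k) = i * (x * xh + a * E * e * (x / xh))"
  proof -
    have "x * ((xh + b / xh / f) / k) = 1 / k * (x * xh + b * (1 / f) * (x / xh))" for b f
      by (simp add: divide_inverse algebra_simps)
    then show ?thesis unfolding i_def e_def .
  qed
  have q: "(xh\<^sup>2 + 2 * a * (- E / d)) / k / 2 = i * (xh * xh / 2 - a * E * p)"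
  proof -
    have "2 * a * (- E / d) / k / 2 = - (1 / k * (a * E * (1 / d)))" by simp
    then show ?thesis unfolding i_def p_def add_divide_distrib power2_eq_square right_diff_distrib by simp
  qed
  have s: "xh\<^sup>2 / (2 * k) = i * (xh * xh / 2)" "- E / d = - (E * p)" unfolding i_def p_def by (simp_all add: power2_eq_square)
  have "i * (x * xh + a * E * e * (x / xh)) - i * (xh * xh / 2 - a * E * p) = i * (xh * xh / 2) + a * E * i * (p + e) - a * i * (1 + e) * (xh - x) \<and>
     i * (x * xh + a * E * e * (x / xh)) - i * (xh * xh / 2 - a * E * p) = i * (xh * xh / 2 - a * E * p) - a * i * (1 + e) * (xh - x - E * p)"
    using x
  proof
    assume x: "x = xh"
    have "a * E * i * (p * e) = a * E * i * (p + e)" unfolding pe ..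
    then show ?thesis unfolding x using nz(4) by (simp add: algebra_simps)
  next
    assume x: "xh = a \<and> E = a"
    have "a * E * i * (p * e) = a * E * i * (p + e)" "E = a" "xh = a" unfolding pe using x by auto
    then show ?thesis using nz(5) by (simp add: algebra_simps)
  qed
  then show ?thesis unfolding t q unfolding s c' pe' pe diff_minus_eq_add add_uminus_conv_diff .
qed

section \<open>Value and optimal policy\<close>

text \<open>\<open>W0\<close> is the given Brownian motion, which determines the filtration and the
  costs; \<open>W\<close> is its regular version, for which the pathwise results hold.\<close>

locale control_problem = verification M "augmented_filtration M W0" W r g \<sigma> a xh \<rho> d x c2
  for M :: "'a measure" and W0 W :: "'a process" and r g \<sigma> a xh \<rho> d x c2 :: real +
  fixes lam c1 \<alpha> \<kappa> m :: real
  assumes W0: "AE \<omega> in M. \<forall>t. W t \<omega> = W0 t \<omega>" and M_complete: "complete_measure M"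
    and \<rho>_pos: "0 < \<rho>" and lam: "0 < lam" "\<theta> 1 < lam" and \<alpha>: "0 \<le> \<alpha>" and m: "0 \<le> m"
    and xh_max: "xh = max x a"
begin

section \<open>Costs expressed through the regular path\<close>

definition "running_cost c \<xi> \<omega> = (\<integral>\<^sup>+t\<in>{0..}. ennreal (exp (- \<rho> * t) * (1 / 2 * (c * exp (ly t \<omega> + \<xi> t \<omega>))\<^sup>2)) \<partial>lborel)"
definition "up_cost c \<xi> \<omega> = (\<integral>\<^sup>+t\<in>{0..}. ennreal (c * exp (- \<rho> * t + ly t \<omega>)) \<partial>control_measure (\<lambda>t. exp (\<xi> t \<omega>) - 1))"
definition "excess_cost c \<xi> \<omega> = (\<integral>\<^sup>+t\<in>{0..}. ennreal (exp (- lam * t) * (\<alpha> * max 0 (c * exp (ly t \<omega> + \<xi> t \<omega>) - m))) \<partial>lborel)"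

text \<open>A different starting value merely rescales the path, so one process started at
  \<open>xh\<close> serves all values over which admissibility ranges.\<close>

lemma debt_ratio_eq:
  assumes "\<omega> \<in> space M" "\<forall>t. W t \<omega> = W0 t \<omega>"
  shows "debt_ratio r g \<sigma> W0 y \<xi> no_intervention t \<omega> = y / xh * exp (ly t \<omega> + \<xi> t \<omega>)"
proof -
  have "exp (ly t \<omega> + \<xi> t \<omega>) = xh * exp ((r - g - \<sigma>\<^sup>2 / 2) * t + \<sigma> * W t \<omega> + \<xi> t \<omega>)"
    unfolding ly_def using xh_pos by (simp add: add.assoc exp_add[of "ln xh"])
  then show ?thesis using assms(2) xh_pos by (simp add: debt_ratio_def no_intervention_def)
qed

lemma up_integral_eq_up_cost:
  assumes \<omega>: "\<omega> \<in> space M" "\<forall>t. W t \<omega> = W0 t \<omega>" and path: "control_path (\<lambda>t. \<xi> t \<omega>)" and y: "0 < y"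
  shows "up_integral \<rho> y (\<lambda>t. debt_ratio r g \<sigma> W0 y \<xi> no_intervention t \<omega>) (\<lambda>t. \<xi> t \<omega>) = up_cost (y / xh) \<xi> \<omega>"
proof -
  interpret P: control_path "\<lambda>t. \<xi> t \<omega>" by (rule path)
  have c: "0 \<le> y / xh" using y xh_pos by simp
  have eq: "(\<lambda>t. debt_ratio r g \<sigma> W0 y \<xi> no_intervention t \<omega>) = (\<lambda>t. y / xh * exp (ly t \<omega>) * exp (\<xi> t \<omega>))"
    unfolding debt_ratio_eq[OF \<omega>] by (simp add: exp_add mult.assoc)
  have "up_integral \<rho> y (\<lambda>t. y / xh * exp (ly t \<omega>) * exp (\<xi> t \<omega>)) (\<lambda>t. \<xi> t \<omega>)
    = (\<integral>\<^sup>+t\<in>{0..}. ennreal (exp (- \<rho> * t) * (y / xh * exp (ly t \<omega>))) \<partial>control_measure (\<lambda>t. exp (\<xi> t \<omega>) - 1))"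
  proof (rule P.up_integral_eq)
    show "continuous_on {0..} (\<lambda>t. y / xh * exp (ly t \<omega>))"
      using continuous_on_mult_left[OF weight_continuous[OF \<omega>(1), of 0 1 0], of "y / xh"] by simp
    show "0 \<le> y / xh * exp (ly t \<omega>)" for t using c by (intro mult_nonneg_nonneg) auto
    show "y = y / xh * exp (ly 0 \<omega>)" using xh_pos by (simp add: ly_0[OF \<omega>(1)])
  qed
  also have "(\<lambda>t. exp (- \<rho> * t) * (y / xh * exp (ly t \<omega>))) = (\<lambda>t. y / xh * exp (- \<rho> * t + ly t \<omega>))"
    by (simp only: exp_add mult_ac)
  finally show ?thesis unfolding eq up_cost_def .
qed

lemma running_cost_eq:
  assumes "\<omega> \<in> space M" "\<forall>t. W t \<omega> = W0 t \<omega>"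
  shows "running_integral \<rho> (\<lambda>y. 1 / 2 * y\<^sup>2) (\<lambda>t. debt_ratio r g \<sigma> W0 y \<xi> no_intervention t \<omega>) = running_cost (y / xh) \<xi> \<omega>"
    "running_integral lam (\<lambda>y. \<alpha> * max 0 (y - m)) (\<lambda>t. debt_ratio r g \<sigma> W0 y \<xi> no_intervention t \<omega>) = excess_cost (y / xh) \<xi> \<omega>"
  unfolding running_integral_def running_cost_def excess_cost_def debt_ratio_eq[OF assms] by simp_all

lemma controls_measurable: "\<xi> \<in> controls M W0 \<Longrightarrow> 0 \<le> t \<Longrightarrow> \<xi> t \<in> borel_measurable M"
  using Fl_measurable_M by (auto simp: controls_def)

lemma running_cost_measurable:
  assumes \<xi>: "\<xi> \<in> controls M W0"
  shows "running_cost c \<xi> \<in> borel_measurable M"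
    "\<omega> \<in> space M \<Longrightarrow> (\<lambda>t. ennreal (exp (- \<rho> * t) * (1 / 2 * (c * exp (ly t \<omega> + \<xi> t \<omega>))\<^sup>2)) * indicator {0..} t) \<in> borel_measurable lborel"
proof -
  have mm: "(\<lambda>\<omega>. exp (- \<rho> * t) * (1 / 2 * (c * exp (ly t \<omega> + \<xi> t \<omega>))\<^sup>2)) \<in> borel_measurable M" if "0 \<le> t" for t
    using ly_measurable[OF that] controls_measurable[OF \<xi> that] by measurable
  have r: "((\<lambda>t. exp (- \<rho> * t) * (1 / 2 * (c * exp (ly t \<omega> + \<xi> t \<omega>))\<^sup>2)) \<longlongrightarrow> exp (- \<rho> * t) * (1 / 2 * (c * exp (ly t \<omega> + \<xi> t \<omega>))\<^sup>2)) (at_right t)"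
    if "0 \<le> t" "\<omega> \<in> space M" for t \<omega>
    by (intro tendsto_intros ly_right control_path.f_right[OF controls_path[OF \<xi>]] that)
  show "running_cost c \<xi> \<in> borel_measurable M" unfolding running_cost_def[abs_def] by (rule time_integral_measurable(2)[OF mm r])
  show "\<omega> \<in> space M \<Longrightarrow> (\<lambda>t. ennreal (exp (- \<rho> * t) * (1 / 2 * (c * exp (ly t \<omega> + \<xi> t \<omega>))\<^sup>2)) * indicator {0..} t) \<in> borel_measurable lborel"
    by (rule time_integral_measurable(1)[OF mm r])
qed

lemma up_cost_measurable:
  assumes \<xi>: "\<xi> \<in> controls M W0" and c: "0 \<le> c"
  shows "up_cost c \<xi> \<in> borel_measurable M"
  unfolding up_cost_def[abs_def] by (rule up_measurable[OF controls_path[OF \<xi>] controls_measurable[OF \<xi>] c])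

text \<open>Without intervention the downward integrals vanish and the joint jump condition holds
  trivially; almost sure equality of \<open>W\<close> and \<open>W0\<close> carries the remaining
  costs over to the regular version.\<close>

lemma admissible_iff:
  assumes \<xi>: "\<xi> \<in> controls M W0"
  shows "\<xi> \<in> admissible_for M W0 r g \<sigma> \<rho> lam c1 c2 \<alpha> \<kappa> m no_intervention \<longleftrightarrow>
    (\<forall>y>0. (\<integral>\<^sup>+\<omega>. running_cost (y / xh) \<xi> \<omega> + ennreal c2 * up_cost (y / xh) \<xi> \<omega> \<partial>M) < \<infinity> \<and> (\<integral>\<^sup>+\<omega>. excess_cost (y / xh) \<xi> \<omega> \<partial>M) < \<infinity>)"
proof -
  have 1: "(\<integral>\<^sup>+\<omega>. (let X = (\<lambda>t. debt_ratio r g \<sigma> W0 y \<xi> no_intervention t \<omega>) in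
               running_integral \<rho> (\<lambda>y. 1 / 2 * y\<^sup>2) X
               + ennreal c1 * down_integral \<rho> y X (\<lambda>t. no_intervention t \<omega>)
               + ennreal c2 * up_integral \<rho> y X (\<lambda>t. \<xi> t \<omega>)) \<partial>M)
      = (\<integral>\<^sup>+\<omega>. running_cost (y / xh) \<xi> \<omega> + ennreal c2 * up_cost (y / xh) \<xi> \<omega> \<partial>M)" if y: "0 < y" for y
  proof (rule nn_integral_cong_AE)
    show "AE \<omega> in M. (let X = (\<lambda>t. debt_ratio r g \<sigma> W0 y \<xi> no_intervention t \<omega>) in
               running_integral \<rho> (\<lambda>y. 1 / 2 * y\<^sup>2) X
               + ennreal c1 * down_integral \<rho> y X (\<lambda>t. no_intervention t \<omega>)
               + ennreal c2 * up_integral \<rho> y X (\<lambda>t. \<xi> t \<omega>)) = running_cost (y / xh) \<xi> \<omega> + ennreal c2 * up_cost (y / xh) \<xi> \<omega>"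
      using W0 AE_space
    proof eventually_elim
      case (elim \<omega>)
      show ?case unfolding Let_def down_integral_zero running_cost_eq(1)[OF elim(2,1)] up_integral_eq_up_cost[where \<xi>=\<xi>, OF elim(2,1) controls_path[OF \<xi> elim(2)] y] by simp
    qed
  qed
  have 2: "(\<integral>\<^sup>+\<omega>. (let X = (\<lambda>t. debt_ratio r g \<sigma> W0 y \<xi> no_intervention t \<omega>) in
               running_integral lam (\<lambda>y. \<alpha> * max 0 (y - m)) X
               + ennreal \<kappa> * down_integral lam y X (\<lambda>t. no_intervention t \<omega>)) \<partial>M)
      = (\<integral>\<^sup>+\<omega>. excess_cost (y / xh) \<xi> \<omega> \<partial>M)" for y
  proof (rule nn_integral_cong_AE)
    show "AE \<omega> in M. (let X = (\<lambda>t. debt_ratio r g \<sigma> W0 y \<xi> no_intervention t \<omega>) in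
               running_integral lam (\<lambda>y. \<alpha> * max 0 (y - m)) X
               + ennreal \<kappa> * down_integral lam y X (\<lambda>t. no_intervention t \<omega>)) = excess_cost (y / xh) \<xi> \<omega>"
      using W0 AE_space
    proof eventually_elim
      case (elim \<omega>)
      show ?case unfolding Let_def down_integral_zero running_cost_eq(2)[OF elim(2,1)] by simp
    qed
  qed
  have 3: "jump (\<lambda>s. no_intervention s \<omega>) t = 0" for t and \<omega> :: 'a unfolding no_intervention_def by (rule jump_zero)
  show ?thesis unfolding admissible_for_def admissible_def using \<xi> 1 2 by (simp add: no_intervention_controls 3)
qed

text \<open>The integrand built from \<open>W0\<close> agrees only almost surely with one known to
  be measurable; completeness makes it measurable as well.\<close>

lemma objective_eq:
  assumes \<xi>: "\<xi> \<in> controls M W0"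
    and fin: "(\<integral>\<^sup>+\<omega>. running_cost (x / xh) \<xi> \<omega> \<partial>M) = ennreal R" "(\<integral>\<^sup>+\<omega>. up_cost (x / xh) \<xi> \<omega> \<partial>M) = ennreal U" "0 \<le> R" "0 \<le> U"
  shows "objective1 M W0 r g \<sigma> \<rho> c2 x \<xi> = R - c2 * U"
proof -
  interpret C: complete_measure M by (rule M_complete)
  have c: "0 \<le> x / xh" using x xh_pos by simp
  note meas = running_cost_measurable(1)[OF \<xi>, of "x / xh"] up_cost_measurable[OF \<xi> c]
  let ?f = "\<lambda>\<omega>. enn2real (running_cost (x / xh) \<xi> \<omega>) - c2 * enn2real (up_cost (x / xh) \<xi> \<omega>)"
  let ?h = "\<lambda>\<omega>. let X = (\<lambda>t. debt_ratio r g \<sigma> W0 x \<xi> no_intervention t \<omega>) in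
         enn2real (running_integral \<rho> (\<lambda>y. 1 / 2 * y\<^sup>2) X) - c2 * enn2real (up_integral \<rho> x X (\<lambda>t. \<xi> t \<omega>))"
  have ae: "AE \<omega> in M. ?h \<omega> = ?f \<omega>"
    using W0 AE_space
  proof eventually_elim
    case (elim \<omega>)
    show ?case unfolding Let_def running_cost_eq(1)[OF elim(2,1)] up_integral_eq_up_cost[where \<xi>=\<xi>, OF elim(2,1) controls_path[OF \<xi> elim(2)] x(1)] by simp
  qed
  \<comment> \<open>A finite mean makes the cost finite almost surely, so its real version has the
    same mean.\<close>
  have part: "integrable M (\<lambda>\<omega>. enn2real (F \<omega>)) \<and> expectation (\<lambda>\<omega>. enn2real (F \<omega>)) = b"
    if F: "F \<in> borel_measurable M" "(\<integral>\<^sup>+\<omega>. F \<omega> \<partial>M) = ennreal b" "0 \<le> b" for F b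
  proof -
    have "AE \<omega> in M. F \<omega> \<noteq> \<infinity>" using F by (intro nn_integral_PInf_AE) auto
    then have "(\<integral>\<^sup>+\<omega>. ennreal (enn2real (F \<omega>)) \<partial>M) = (\<integral>\<^sup>+\<omega>. F \<omega> \<partial>M)"
      by (intro nn_integral_cong_AE) (auto elim!: eventually_mono simp: less_top)
    then have e: "(\<integral>\<^sup>+\<omega>. ennreal (enn2real (F \<omega>)) \<partial>M) = ennreal b" using F by simp
    have i: "integrable M (\<lambda>\<omega>. enn2real (F \<omega>))"
      using F e by (intro integrableI_bounded) auto
    have "ennreal (expectation (\<lambda>\<omega>. enn2real (F \<omega>))) = ennreal b"
      using nn_integral_eq_integral[OF i] e by simp
    moreover have "0 \<le> expectation (\<lambda>\<omega>. enn2real (F \<omega>))" by (intro Bochner_Integration.integral_nonneg) simp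
    ultimately show ?thesis using i F(3) by (simp add: ennreal_inj)
  qed
  have f_meas: "?f \<in> borel_measurable M" using meas by measurable
  have "objective1 M W0 r g \<sigma> \<rho> c2 x \<xi> = expectation ?h" unfolding objective1_def ..
  also have "\<dots> = expectation ?f"
    by (rule integral_cong_AE[OF C.borel_measurable_AE_eq[OF f_meas ae] f_meas ae])
  also have "\<dots> = R - c2 * U"
    using part[OF meas(1) fin(1,3)] part[OF meas(2) fin(2,4)] by simp
  finally show ?thesis .
qed

section \<open>The candidate value and the optimality argument\<close>

definition "up_mean = - exp (d * ln xh + (1 - d) * ln a) / d"
text \<open>The bound of \<open>expectation_square_bound\<close> at \<open>p = 2\<close>, with the
  exact mean effort inserted.\<close>

definition "square_mean = (exp (2 * ln xh) + 2 * exp ((2 - 1) * ln a) * up_mean) / (\<rho> - \<theta> 2)"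
text \<open>What is left when Young's inequality meets the lower bound for the cross term.\<close>

definition "val = x * marginal (ln xh) - square_mean / 2"

lemma up_mean_nonneg: "0 \<le> up_mean" unfolding up_mean_def using d by (auto intro: less_imp_le[OF divide_pos_neg])

lemma square_mean_nonneg: "0 \<le> square_mean" unfolding square_mean_def using up_mean_nonneg K_pos by (intro divide_nonneg_pos add_nonneg_nonneg mult_nonneg_nonneg) auto

lemma up_reflection_mean: "(\<integral>\<^sup>+\<omega>. up_reflection \<rho> \<omega> \<partial>M) = ennreal up_mean"
  unfolding up_mean_def by (rule up_reflection_expectation[OF d \<rho>_pos])

lemma square_bound: "(\<integral>\<^sup>+\<omega>. (\<integral>\<^sup>+t\<in>{0..}. ennreal (exp (- \<rho> * t + 2 * ly t \<omega> + 2 * l t \<omega>)) \<partial>lborel) \<partial>M) \<le> ennreal square_mean"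
  unfolding square_mean_def
proof (rule expectation_square_bound)
  show "0 < (2::real)" by simp
  show "\<theta> 2 < \<rho>" by (rule K)
  show "(\<integral>\<^sup>+\<omega>. up_reflection \<rho> \<omega> \<partial>M) \<le> ennreal up_mean" unfolding up_reflection_mean ..
  show "0 \<le> up_mean" by (rule up_mean_nonneg)
qed

text \<open>The first form leads to the closed formula. The second is the objective of the reflected
  policy with its running cost replaced by the upper bound \<open>square_mean / 2\<close>.\<close>

lemma value_forms:
  defines "E \<equiv> exp (d * ln xh + (1 - d) * ln a)"
  shows "val = xh\<^sup>2 / (2 * K) - a * E / (K * d * (d - 1)) - c2 * (xh - x)"
    "val = square_mean / 2 - c2 * (xh - x + up_mean)"
proof -
  have ex: "exp (2 * ln xh) = xh\<^sup>2" "exp ((2 - 1) * ln a) = a" "exp (ln xh) = xh"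
  proof -
    show ex3: "exp (ln xh) = xh" using xh_pos by simp
    show "exp (2 * ln xh) = xh\<^sup>2" unfolding mult_2 exp_add ex3 power2_eq_square ..
    show "exp ((2 - 1) * ln a) = a" using a by simp
  qed
  have e3: "exp ((2 - d) * ln a + (d - 1) * ln xh) = a * E / xh"
  proof -
    have "(2 - d) * ln a + (d - 1) * ln xh = ln a + (d * ln xh + (1 - d) * ln a) - ln xh" by (simp add: algebra_simps)
    then show ?thesis using xh_pos a by (simp only: exp_diff exp_add exp_ln E_def)
  qed
  have alg1: "x * ((xh + a * E / xh / (1 - d)) / k) - (xh\<^sup>2 + 2 * a * (- E / d)) / k / 2
     = xh\<^sup>2 / (2 * k) - a * E / (k * d * (d - 1)) - c2 * (xh - x)"
    and alg2: "x * ((xh + a * E / xh / (1 - d)) / k) - (xh\<^sup>2 + 2 * a * (- E / d)) / k / 2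
     = (xh\<^sup>2 + 2 * a * (- E / d)) / k / 2 - c2 * (xh - x + - E / d)"
    if k: "k \<noteq> 0" "c2 = a / k * (1 + 1 / (1 - d))" for k
  proof -
    have "x = xh \<or> (xh = a \<and> E = a)"
    proof (cases "a \<le> x")
      case True then show ?thesis using xh_max by simp
    next
      case False
      then have "xh = a" using xh_max by simp
      moreover have "E = a" unfolding E_def using a \<open>xh = a\<close> by (simp add: algebra_simps)
      ultimately show ?thesis by simp
    qed
    moreover have "(1 - d) \<noteq> 0" "d \<noteq> 0" "xh \<noteq> 0" "a \<noteq> 0" using d xh_pos a by auto
    ultimately have "x * ((xh + a * E / xh / (1 - d)) / k) - (xh\<^sup>2 + 2 * a * (- E / d)) / k / 2
       = xh\<^sup>2 / (2 * k) - a * E / (k * d * (d - 1)) - c2 * (xh - x) \<and>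
      x * ((xh + a * E / xh / (1 - d)) / k) - (xh\<^sup>2 + 2 * a * (- E / d)) / k / 2
     = (xh\<^sup>2 + 2 * a * (- E / d)) / k / 2 - c2 * (xh - x + - E / d)"
      by (intro value_algebra k)
    then show "x * ((xh + a * E / xh / (1 - d)) / k) - (xh\<^sup>2 + 2 * a * (- E / d)) / k / 2
     = xh\<^sup>2 / (2 * k) - a * E / (k * d * (d - 1)) - c2 * (xh - x)"
     "x * ((xh + a * E / xh / (1 - d)) / k) - (xh\<^sup>2 + 2 * a * (- E / d)) / k / 2
     = (xh\<^sup>2 + 2 * a * (- E / d)) / k / 2 - c2 * (xh - x + - E / d)" by auto
  qed
  have k: "K \<noteq> 0" using K_pos by simp
  show "val = xh\<^sup>2 / (2 * K) - a * E / (K * d * (d - 1)) - c2 * (xh - x)"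
    using alg1[OF k c2] unfolding val_def marginal_def square_mean_def up_mean_def ex e3 E_def .
  show "val = square_mean / 2 - c2 * (xh - x + up_mean)"
    using alg2[OF k c2] unfolding val_def marginal_def square_mean_def up_mean_def ex e3 E_def .
qed

text \<open>Young's inequality is applied to the product of the controlled and the reflected debt
  ratio. Half the square of the former is its running cost, half the square of the latter has mean
  at most \<open>square_mean / 2\<close>, and the cross term is at least
  \<open>x * marginal (ln xh)\<close> plus \<open>c2\<close> times the effort, which is just the
  gain that the objective subtracts.\<close>

lemma objective_lower:
  assumes adm: "\<xi> \<in> admissible_for M W0 r g \<sigma> \<rho> lam c1 c2 \<alpha> \<kappa> m no_intervention"
  shows "val \<le> objective1 M W0 r g \<sigma> \<rho> c2 x \<xi>"
proof -
  have \<xi>: "\<xi> \<in> controls M W0" using adm by (simp add: admissible_for_def)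
  have c: "0 \<le> x / xh" using x xh_pos by simp
  have Um: "up_cost (x / xh) \<xi> \<in> borel_measurable M" by (rule up_cost_measurable[OF \<xi> c])
  have Rm: "running_cost (x / xh) \<xi> \<in> borel_measurable M" by (rule running_cost_measurable(1)[OF \<xi>])
  have fin: "(\<integral>\<^sup>+\<omega>. running_cost (x / xh) \<xi> \<omega> + ennreal c2 * up_cost (x / xh) \<xi> \<omega> \<partial>M) < \<infinity>"
    using adm x(1) unfolding admissible_iff[OF \<xi>] by blast
  then have "(\<integral>\<^sup>+\<omega>. running_cost (x / xh) \<xi> \<omega> \<partial>M) + ennreal c2 * (\<integral>\<^sup>+\<omega>. up_cost (x / xh) \<xi> \<omega> \<partial>M) < \<infinity>"
    using Um Rm by (simp add: nn_integral_add nn_integral_cmult)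
  then have "(\<integral>\<^sup>+\<omega>. running_cost (x / xh) \<xi> \<omega> \<partial>M) < \<infinity>" "ennreal c2 * (\<integral>\<^sup>+\<omega>. up_cost (x / xh) \<xi> \<omega> \<partial>M) < \<infinity>"
    by (simp_all add: less_top[symmetric])
  then have "(\<integral>\<^sup>+\<omega>. running_cost (x / xh) \<xi> \<omega> \<partial>M) < \<infinity>" "(\<integral>\<^sup>+\<omega>. up_cost (x / xh) \<xi> \<omega> \<partial>M) < \<infinity>"
    using c2_pos by (auto simp: ennreal_mult_less_top)
  then obtain R U where R: "(\<integral>\<^sup>+\<omega>. running_cost (x / xh) \<xi> \<omega> \<partial>M) = ennreal R" "0 \<le> R"
    and U: "(\<integral>\<^sup>+\<omega>. up_cost (x / xh) \<xi> \<omega> \<partial>M) = ennreal U" "0 \<le> U"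
    by (cases "\<integral>\<^sup>+\<omega>. running_cost (x / xh) \<xi> \<omega> \<partial>M"; cases "\<integral>\<^sup>+\<omega>. up_cost (x / xh) \<xi> \<omega> \<partial>M") auto
  let ?X = "\<lambda>t \<omega>. x / xh * exp (ly t \<omega> + \<xi> t \<omega>)"
  let ?S = "\<lambda>\<omega>. \<integral>\<^sup>+t\<in>{0..}. ennreal (exp (- \<rho> * t + 2 * ly t \<omega> + 2 * l t \<omega>)) \<partial>lborel"
  have Sm: "?S \<in> borel_measurable M" by (rule running_reflected_measurable(1))
  have young: "exp (- \<rho> * t + ly t \<omega> + l t \<omega>) * ?X t \<omega>
      \<le> 1/2 * exp (- \<rho> * t + 2 * ly t \<omega> + 2 * l t \<omega>) + exp (- \<rho> * t) * (1 / 2 * (?X t \<omega>)\<^sup>2)" for t \<omega>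
  proof -
    let ?p = "exp (ly t \<omega> + l t \<omega>)" let ?q = "?X t \<omega>"
    have "p * q \<le> 1/2 * (p * p) + 1/2 * q\<^sup>2" for p q :: real
      using zero_le_power2[of "p - q"] by (simp add: power2_eq_square algebra_simps)
    from this[of ?p ?q] have "exp (- \<rho> * t) * (?p * ?q) \<le> exp (- \<rho> * t) * (1/2 * (?p * ?p) + 1/2 * ?q\<^sup>2)" by (intro mult_left_mono) auto
    moreover have "exp (- \<rho> * t) * (?p * ?q) = exp (- \<rho> * t + ly t \<omega> + l t \<omega>) * ?q"
      unfolding add.assoc[of "- \<rho> * t"] exp_add[of "- \<rho> * t"] by (simp only: mult.assoc)
    moreover have "exp (- \<rho> * t) * (?p * ?p) = exp (- \<rho> * t + 2 * ly t \<omega> + 2 * l t \<omega>)"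
      unfolding exp_add[symmetric] by (simp add: algebra_simps)
    moreover have "exp (- \<rho> * t) * (1/2 * p + 1/2 * q) = 1/2 * (exp (- \<rho> * t) * p) + exp (- \<rho> * t) * (1/2 * q)" for p q
      by (simp add: algebra_simps)
    ultimately show ?thesis by (simp only:)
  qed
  \<comment> \<open>Besides the estimate itself, this supplies the finiteness of the cross term that
    the lower bound presupposes.\<close>
  have BB: "(\<integral>\<^sup>+\<omega>. (\<integral>\<^sup>+t\<in>{0..}. ennreal (exp (- \<rho> * t + ly t \<omega> + l t \<omega>) * ?X t \<omega>) \<partial>lborel) \<partial>M) \<le> ennreal (square_mean / 2 + R)"
  proof -
    have "(\<integral>\<^sup>+\<omega>. (\<integral>\<^sup>+t\<in>{0..}. ennreal (exp (- \<rho> * t + ly t \<omega> + l t \<omega>) * ?X t \<omega>) \<partial>lborel) \<partial>M)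
      \<le> (\<integral>\<^sup>+\<omega>. ennreal (1/2) * ?S \<omega> + running_cost (x / xh) \<xi> \<omega> \<partial>M)"
    proof (rule nn_integral_mono)
      fix \<omega> assume \<omega>: "\<omega> \<in> space M"
      have "(\<integral>\<^sup>+t\<in>{0..}. ennreal (exp (- \<rho> * t + ly t \<omega> + l t \<omega>) * ?X t \<omega>) \<partial>lborel)
        \<le> (\<integral>\<^sup>+t. ennreal (1/2) * (ennreal (exp (- \<rho> * t + 2 * ly t \<omega> + 2 * l t \<omega>)) * indicator {0..} t)
            + ennreal (exp (- \<rho> * t) * (1 / 2 * (?X t \<omega>)\<^sup>2)) * indicator {0..} t \<partial>lborel)"
      proof (rule nn_integral_mono)
        fix t :: real
        have "ennreal (exp (- \<rho> * t + ly t \<omega> + l t \<omega>) * ?X t \<omega>)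
          \<le> ennreal (1/2 * exp (- \<rho> * t + 2 * ly t \<omega> + 2 * l t \<omega>) + exp (- \<rho> * t) * (1 / 2 * (?X t \<omega>)\<^sup>2))"
          by (rule ennreal_leI[OF young])
        also have "\<dots> = ennreal (1/2 * exp (- \<rho> * t + 2 * ly t \<omega> + 2 * l t \<omega>)) + ennreal (exp (- \<rho> * t) * (1 / 2 * (?X t \<omega>)\<^sup>2))"
          by (rule ennreal_plus) auto
        also have "ennreal (1/2 * exp (- \<rho> * t + 2 * ly t \<omega> + 2 * l t \<omega>)) = ennreal (1/2) * ennreal (exp (- \<rho> * t + 2 * ly t \<omega> + 2 * l t \<omega>))"
          by (rule ennreal_mult) auto
        finally show "ennreal (exp (- \<rho> * t + ly t \<omega> + l t \<omega>) * ?X t \<omega>) * indicator {0..} t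
          \<le> ennreal (1/2) * (ennreal (exp (- \<rho> * t + 2 * ly t \<omega> + 2 * l t \<omega>)) * indicator {0..} t)
            + ennreal (exp (- \<rho> * t) * (1 / 2 * (?X t \<omega>)\<^sup>2)) * indicator {0..} t"
          by (cases "0 \<le> t") (simp_all add: indicator_def)
      qed
      also have "\<dots> = ennreal (1/2) * ?S \<omega> + running_cost (x / xh) \<xi> \<omega>"
        unfolding running_cost_def using running_reflected_measurable(2)[OF \<omega>, of \<rho> 2 2] running_cost_measurable(2)[OF \<xi> \<omega>, of "x / xh"]
        by (subst nn_integral_add) (auto intro!: nn_integral_cmult)
      finally show "(\<integral>\<^sup>+t\<in>{0..}. ennreal (exp (- \<rho> * t + ly t \<omega> + l t \<omega>) * ?X t \<omega>) \<partial>lborel) \<le> ennreal (1/2) * ?S \<omega> + running_cost (x / xh) \<xi> \<omega>" .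
    qed
    also have "\<dots> = ennreal (1/2) * (\<integral>\<^sup>+\<omega>. ?S \<omega> \<partial>M) + ennreal R"
      using Sm Rm R(1) by (subst nn_integral_add) (auto simp: nn_integral_cmult)
    also have "\<dots> \<le> ennreal (1/2) * ennreal square_mean + ennreal R" by (intro add_mono mult_left_mono square_bound) auto
    also have "\<dots> = ennreal (square_mean / 2 + R)" using square_mean_nonneg R(2)
      by (subst ennreal_mult[symmetric], simp, simp, subst ennreal_plus[symmetric]) auto
    finally show ?thesis .
  qed
  have "(\<integral>\<^sup>+\<omega>. ennreal (x * marginal (ln xh)) + ennreal c2 * up_cost (x / xh) \<xi> \<omega> \<partial>M)
    \<le> (\<integral>\<^sup>+\<omega>. (\<integral>\<^sup>+t\<in>{0..}. ennreal (exp (- \<rho> * t + ly t \<omega> + l t \<omega>) * ?X t \<omega>) \<partial>lborel) \<partial>M)"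
    unfolding up_cost_def
  proof (rule expectation_lower_bound)
    show "control_path (\<lambda>t. \<xi> t \<omega>)" if "\<omega> \<in> space M" for \<omega> by (rule controls_path[OF \<xi> that])
    show "\<xi> t \<in> borel_measurable (augmented_filtration M W0 t)" if "0 \<le> t" for t using \<xi> that by (simp add: controls_def)
    show "(\<integral>\<^sup>+\<omega>. (\<integral>\<^sup>+t\<in>{0..}. ennreal (exp (- \<rho> * t + ly t \<omega> + l t \<omega>) * ?X t \<omega>) \<partial>lborel) \<partial>M) < \<infinity>"
      using BB by (rule order_le_less_trans) simp
  qed
  also note BB
  also have "(\<integral>\<^sup>+\<omega>. ennreal (x * marginal (ln xh)) + ennreal c2 * up_cost (x / xh) \<xi> \<omega> \<partial>M) = ennreal (x * marginal (ln xh) + c2 * U)"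
  proof -
    have "0 \<le> x * marginal (ln xh)" using x(1) c2_pos marginal_lower[of "ln xh"] a xh by (intro mult_nonneg_nonneg) auto
    then show ?thesis using Um U c2_pos emeasure_space_1 by (simp add: nn_integral_add nn_integral_cmult ennreal_mult)
  qed
  finally have "x * marginal (ln xh) + c2 * U \<le> square_mean / 2 + R" using square_mean_nonneg R(2) by (simp add: ennreal_le_iff del: ennreal_plus)
  then show ?thesis unfolding objective_eq[OF \<xi> R(1) U(1) R(2) U(2)] val_def by simp
qed

lemma reflected_running_cost:
  assumes \<omega>: "\<omega> \<in> space M" and eq: "\<And>t. 0 \<le> t \<Longrightarrow> \<xi> t \<omega> = k + l t \<omega>"
  shows "running_cost c \<xi> \<omega> = ennreal (1 / 2 * (c * exp k)\<^sup>2) * (\<integral>\<^sup>+t\<in>{0..}. ennreal (exp (- \<rho> * t + 2 * ly t \<omega> + 2 * l t \<omega>)) \<partial>lborel)"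
proof -
  have "running_cost c \<xi> \<omega> = (\<integral>\<^sup>+t. ennreal (1 / 2 * (c * exp k)\<^sup>2) * (ennreal (exp (- \<rho> * t + 2 * ly t \<omega> + 2 * l t \<omega>)) * indicator {0..} t) \<partial>lborel)"
    unfolding running_cost_def
  proof (rule nn_integral_cong)
    fix t :: real
    show "ennreal (exp (- \<rho> * t) * (1 / 2 * (c * exp (ly t \<omega> + \<xi> t \<omega>))\<^sup>2)) * indicator {0..} t
      = ennreal (1 / 2 * (c * exp k)\<^sup>2) * (ennreal (exp (- \<rho> * t + 2 * ly t \<omega> + 2 * l t \<omega>)) * indicator {0..} t)"
    proof (cases "0 \<le> t")
      case True
      have "exp (- \<rho> * t + 2 * ly t \<omega> + 2 * l t \<omega>) = exp (- \<rho> * t) * (exp (ly t \<omega> + l t \<omega>))\<^sup>2"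
        unfolding power2_eq_square exp_add[symmetric] by (simp add: algebra_simps)
      moreover have "exp (ly t \<omega> + \<xi> t \<omega>) = exp k * exp (ly t \<omega> + l t \<omega>)"
        unfolding eq[OF True] exp_add[symmetric] by (simp add: algebra_simps)
      ultimately have "exp (- \<rho> * t) * (1 / 2 * (c * exp (ly t \<omega> + \<xi> t \<omega>))\<^sup>2) = 1 / 2 * (c * exp k)\<^sup>2 * exp (- \<rho> * t + 2 * ly t \<omega> + 2 * l t \<omega>)"
        by (simp add: power_mult_distrib)
      then have "ennreal (exp (- \<rho> * t) * (1 / 2 * (c * exp (ly t \<omega> + \<xi> t \<omega>))\<^sup>2)) = ennreal (1 / 2 * (c * exp k)\<^sup>2 * exp (- \<rho> * t + 2 * ly t \<omega> + 2 * l t \<omega>))"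
        by (rule arg_cong)
      also have "\<dots> = ennreal (1 / 2 * (c * exp k)\<^sup>2) * ennreal (exp (- \<rho> * t + 2 * ly t \<omega> + 2 * l t \<omega>))"
        by (rule ennreal_mult) auto
      finally show ?thesis using True by simp
    qed simp
  qed
  also have "\<dots> = ennreal (1 / 2 * (c * exp k)\<^sup>2) * (\<integral>\<^sup>+t\<in>{0..}. ennreal (exp (- \<rho> * t + 2 * ly t \<omega> + 2 * l t \<omega>)) \<partial>lborel)"
    by (rule nn_integral_cmult[OF running_reflected_measurable(2)[OF \<omega>]])
  finally show ?thesis .
qed

text \<open>The policy belongs to one starting value, but admissibility ranges over all
  \<open>y\<close>; costs from \<open>y\<close> are those of the reflected process up to constants.
  The excess over \<open>m\<close> is bounded by the process itself, whose discounted integral has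
  finite mean by \<open>\<theta> 1 < lam\<close>.\<close>

lemma reflected_admissible:
  assumes \<xi>: "\<xi> \<in> controls M W0" and eq: "AE \<omega> in M. \<forall>t\<ge>0. \<xi> t \<omega> = k + l t \<omega>" and k: "0 \<le> k"
  shows "\<xi> \<in> admissible_for M W0 r g \<sigma> \<rho> lam c1 c2 \<alpha> \<kappa> m no_intervention"
  unfolding admissible_iff[OF \<xi>]
proof (intro allI impI conjI)
  fix y :: real assume y: "0 < y"
  let ?c = "y / xh"
  have c: "0 \<le> ?c" using y xh_pos by simp
  let ?S = "\<lambda>\<omega>. \<integral>\<^sup>+t\<in>{0..}. ennreal (exp (- \<rho> * t + 2 * ly t \<omega> + 2 * l t \<omega>)) \<partial>lborel"
  let ?L = "\<lambda>\<omega>. \<integral>\<^sup>+t\<in>{0..}. ennreal (exp (- lam * t + 1 * ly t \<omega> + 1 * l t \<omega>)) \<partial>lborel"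
  note [measurable] = up_reflection_measurable running_reflected_measurable(1)
  have "(\<integral>\<^sup>+\<omega>. running_cost ?c \<xi> \<omega> + ennreal c2 * up_cost ?c \<xi> \<omega> \<partial>M)
    = (\<integral>\<^sup>+\<omega>. ennreal (1 / 2 * (?c * exp k)\<^sup>2) * ?S \<omega> + ennreal c2 * (ennreal (?c * (xh * (exp k - 1))) + ennreal (?c * exp k) * up_reflection \<rho> \<omega>) \<partial>M)"
  proof (rule nn_integral_cong_AE)
    show "AE \<omega> in M. running_cost ?c \<xi> \<omega> + ennreal c2 * up_cost ?c \<xi> \<omega>
      = ennreal (1 / 2 * (?c * exp k)\<^sup>2) * ?S \<omega> + ennreal c2 * (ennreal (?c * (xh * (exp k - 1))) + ennreal (?c * exp k) * up_reflection \<rho> \<omega>)"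
      using eq AE_space
    proof eventually_elim
      case (elim \<omega>)
      have e: "\<And>t. 0 \<le> t \<Longrightarrow> \<xi> t \<omega> = k + l t \<omega>" using elim(1) by blast
      have "running_cost ?c \<xi> \<omega> = ennreal (1 / 2 * (?c * exp k)\<^sup>2) * ?S \<omega>"
        by (rule reflected_running_cost[OF elim(2)]) (rule e)
      moreover have "up_cost ?c \<xi> \<omega> = ennreal (?c * (xh * (exp k - 1))) + ennreal (?c * exp k) * up_reflection \<rho> \<omega>"
        unfolding up_cost_def by (rule up_reflected[where \<xi>=\<xi>, OF elim(2) controls_path[OF \<xi> elim(2)] _ c k]) (rule e)
      ultimately show ?case by (simp only:)
    qed
  qed
  also have "\<dots> = ennreal (1 / 2 * (?c * exp k)\<^sup>2) * (\<integral>\<^sup>+\<omega>. ?S \<omega> \<partial>M) + ennreal c2 * (ennreal (?c * (xh * (exp k - 1))) + ennreal (?c * exp k) * ennreal up_mean)"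
  proof -
    have "(\<integral>\<^sup>+\<omega>. A * S \<omega> + C * (D + G * up_reflection \<rho> \<omega>) \<partial>M) = A * (\<integral>\<^sup>+\<omega>. S \<omega> \<partial>M) + C * (D + G * ennreal up_mean)"
      if [measurable]: "S \<in> borel_measurable M" for S A C D G
      by (simp add: nn_integral_add nn_integral_cmult up_reflection_mean emeasure_space_1)
    then show ?thesis by this (rule running_reflected_measurable(1))
  qed
  also have "\<dots> < \<infinity>"
  proof -
    have "(\<integral>\<^sup>+\<omega>. ?S \<omega> \<partial>M) < \<infinity>" using square_bound by (rule order_le_less_trans) simp
    then show ?thesis by (auto simp: ennreal_mult_less_top)
  qed
  finally show "(\<integral>\<^sup>+\<omega>. running_cost ?c \<xi> \<omega> + ennreal c2 * up_cost ?c \<xi> \<omega> \<partial>M) < \<infinity>" .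
  have "(\<integral>\<^sup>+\<omega>. excess_cost ?c \<xi> \<omega> \<partial>M) \<le> (\<integral>\<^sup>+\<omega>. ennreal (\<alpha> * (?c * exp k)) * ?L \<omega> \<partial>M)"
  proof (rule nn_integral_mono_AE)
    show "AE \<omega> in M. excess_cost ?c \<xi> \<omega> \<le> ennreal (\<alpha> * (?c * exp k)) * ?L \<omega>"
      using eq AE_space
    proof eventually_elim
      case (elim \<omega>)
      have "excess_cost ?c \<xi> \<omega> \<le> (\<integral>\<^sup>+t. ennreal (\<alpha> * (?c * exp k)) * (ennreal (exp (- lam * t + 1 * ly t \<omega> + 1 * l t \<omega>)) * indicator {0..} t) \<partial>lborel)"
        unfolding excess_cost_def
      proof (rule nn_integral_mono)
        fix t :: real
        show "ennreal (exp (- lam * t) * (\<alpha> * max 0 (?c * exp (ly t \<omega> + \<xi> t \<omega>) - m))) * indicator {0..} t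
          \<le> ennreal (\<alpha> * (?c * exp k)) * (ennreal (exp (- lam * t + 1 * ly t \<omega> + 1 * l t \<omega>)) * indicator {0..} t)"
        proof (cases "0 \<le> t")
          case True
          have "exp (ly t \<omega> + \<xi> t \<omega>) = exp k * exp (ly t \<omega> + l t \<omega>)"
            using elim(1) True unfolding exp_add[symmetric] by (simp add: algebra_simps)
          then have "?c * exp (ly t \<omega> + \<xi> t \<omega>) = ?c * exp k * exp (ly t \<omega> + l t \<omega>)" by (simp only: mult.assoc)
          moreover have "0 \<le> ?c * exp k * exp (ly t \<omega> + l t \<omega>)" using c by (intro mult_nonneg_nonneg) auto
          ultimately have "max 0 (?c * exp (ly t \<omega> + \<xi> t \<omega>) - m) \<le> ?c * exp k * exp (ly t \<omega> + l t \<omega>)"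
            using m by linarith
          then have "exp (- lam * t) * (\<alpha> * max 0 (?c * exp (ly t \<omega> + \<xi> t \<omega>) - m)) \<le> exp (- lam * t) * (\<alpha> * (?c * exp k * exp (ly t \<omega> + l t \<omega>)))"
            using \<alpha> by (intro mult_left_mono) auto
          also have "\<dots> = \<alpha> * (?c * exp k) * exp (- lam * t + 1 * ly t \<omega> + 1 * l t \<omega>)"
            unfolding add.assoc exp_add[of "- lam * t"] by (simp add: mult_ac)
          finally have "ennreal (exp (- lam * t) * (\<alpha> * max 0 (?c * exp (ly t \<omega> + \<xi> t \<omega>) - m)))
            \<le> ennreal (\<alpha> * (?c * exp k) * exp (- lam * t + 1 * ly t \<omega> + 1 * l t \<omega>))" by (rule ennreal_leI)
          also have "\<dots> = ennreal (\<alpha> * (?c * exp k)) * ennreal (exp (- lam * t + 1 * ly t \<omega> + 1 * l t \<omega>))"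
            using \<alpha> c by (intro ennreal_mult mult_nonneg_nonneg) auto
          finally show ?thesis using True by simp
        qed simp
      qed
      also have "\<dots> = ennreal (\<alpha> * (?c * exp k)) * ?L \<omega>"
        by (rule nn_integral_cmult[OF running_reflected_measurable(2)[OF elim(2)]])
      finally show ?case .
    qed
  qed
  also have "\<dots> = ennreal (\<alpha> * (?c * exp k)) * (\<integral>\<^sup>+\<omega>. ?L \<omega> \<partial>M)"
    by (rule nn_integral_cmult) measurable
  also have "\<dots> < \<infinity>"
    using running_finite[of 1 lam] lam by (auto simp: ennreal_mult_less_top)
  finally show "(\<integral>\<^sup>+\<omega>. excess_cost ?c \<xi> \<omega> \<partial>M) < \<infinity>" .
qed

text \<open>One inequality is the general lower bound for this admissible policy. For the other, the
  mean effort is known exactly and the running cost is bounded above; by the second form of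
  \<open>val\<close> this bound already meets the lower one.\<close>

lemma reflected_objective:
  assumes \<xi>: "\<xi> \<in> controls M W0" and eq: "AE \<omega> in M. \<forall>t\<ge>0. \<xi> t \<omega> = ln (xh / x) + l t \<omega>"
  shows "objective1 M W0 r g \<sigma> \<rho> c2 x \<xi> = val"
proof (rule antisym)
  have k: "0 \<le> ln (xh / x)" and ek: "exp (ln (xh / x)) = xh / x" using x xh_pos by simp_all
  show "val \<le> objective1 M W0 r g \<sigma> \<rho> c2 x \<xi>"
    by (rule objective_lower[OF reflected_admissible[OF \<xi> eq k]])
  let ?c = "x / xh"
  have c: "0 \<le> ?c" using x xh_pos by simp
  let ?S = "\<lambda>\<omega>. \<integral>\<^sup>+t\<in>{0..}. ennreal (exp (- \<rho> * t + 2 * ly t \<omega> + 2 * l t \<omega>)) \<partial>lborel"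
  note [measurable] = up_reflection_measurable running_reflected_measurable(1)
  \<comment> \<open>The initial jump carries \<open>x\<close> to \<open>xh\<close>, so the scaling
    factors cancel.\<close>
  have ck: "?c * exp (ln (xh / x)) = 1" using x xh_pos by (simp add: ek)
  have cx: "?c * (xh * (exp (ln (xh / x)) - 1)) = xh - x" using x xh_pos by (simp add: ek field_simps)
  have "(\<integral>\<^sup>+\<omega>. running_cost ?c \<xi> \<omega> \<partial>M) = (\<integral>\<^sup>+\<omega>. ennreal (1/2) * ?S \<omega> \<partial>M)"
  proof (rule nn_integral_cong_AE)
    show "AE \<omega> in M. running_cost ?c \<xi> \<omega> = ennreal (1/2) * ?S \<omega>"
      using eq AE_space
    proof eventually_elim
      case (elim \<omega>)
      have e: "\<And>t. 0 \<le> t \<Longrightarrow> \<xi> t \<omega> = ln (xh / x) + l t \<omega>" using elim(1) by blast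
      have "running_cost ?c \<xi> \<omega> = ennreal (1 / 2 * (?c * exp (ln (xh / x)))\<^sup>2) * ?S \<omega>"
        by (rule reflected_running_cost[OF elim(2)]) (rule e)
      then show ?case unfolding ck by simp
    qed
  qed
  also have "\<dots> = ennreal (1/2) * (\<integral>\<^sup>+\<omega>. ?S \<omega> \<partial>M)" by (rule nn_integral_cmult) measurable
  finally have R1: "(\<integral>\<^sup>+\<omega>. running_cost ?c \<xi> \<omega> \<partial>M) = ennreal (1/2) * (\<integral>\<^sup>+\<omega>. ?S \<omega> \<partial>M)" .
  obtain s where s: "(\<integral>\<^sup>+\<omega>. ?S \<omega> \<partial>M) = ennreal s" "0 \<le> s"
    using square_bound by (cases "\<integral>\<^sup>+\<omega>. ?S \<omega> \<partial>M") (auto simp: top_unique)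
  have sQ: "s \<le> square_mean" using square_bound square_mean_nonneg unfolding s(1) by (simp add: ennreal_le_iff)
  have R: "(\<integral>\<^sup>+\<omega>. running_cost ?c \<xi> \<omega> \<partial>M) = ennreal (1/2 * s)" unfolding R1 s(1) using s(2) by (intro ennreal_mult[symmetric]) auto
  have "(\<integral>\<^sup>+\<omega>. up_cost ?c \<xi> \<omega> \<partial>M) = (\<integral>\<^sup>+\<omega>. ennreal (xh - x) + up_reflection \<rho> \<omega> \<partial>M)"
  proof (rule nn_integral_cong_AE)
    show "AE \<omega> in M. up_cost ?c \<xi> \<omega> = ennreal (xh - x) + up_reflection \<rho> \<omega>"
      using eq AE_space
    proof eventually_elim
      case (elim \<omega>)
      have e: "\<And>t. 0 \<le> t \<Longrightarrow> \<xi> t \<omega> = ln (xh / x) + l t \<omega>" using elim(1) by blast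
      have "up_cost ?c \<xi> \<omega> = ennreal (?c * (xh * (exp (ln (xh / x)) - 1))) + ennreal (?c * exp (ln (xh / x))) * up_reflection \<rho> \<omega>"
        unfolding up_cost_def by (rule up_reflected[where \<xi>=\<xi>, OF elim(2) controls_path[OF \<xi> elim(2)] _ c k]) (rule e)
      then show ?case unfolding ck cx by simp
    qed
  qed
  also have "\<dots> = ennreal (xh - x + up_mean)"
    using x up_mean_nonneg by (simp add: nn_integral_add up_reflection_mean emeasure_space_1)
  finally have U: "(\<integral>\<^sup>+\<omega>. up_cost ?c \<xi> \<omega> \<partial>M) = ennreal (xh - x + up_mean)" .
  have "objective1 M W0 r g \<sigma> \<rho> c2 x \<xi> = 1/2 * s - c2 * (xh - x + up_mean)"
    by (rule objective_eq[OF \<xi> R U]) (use s x up_mean_nonneg in auto)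
  also have "\<dots> \<le> val" unfolding value_forms(2) using sQ by simp
  finally show "objective1 M W0 r g \<sigma> \<rho> c2 x \<xi> \<le> val" .
qed

section \<open>Existence and uniqueness of the reflection\<close>

lemma l_control: "l \<in> controls M W0"
  unfolding controls_def
proof (intro CollectI conjI ballI allI impI)
  show "l t \<in> borel_measurable (augmented_filtration M W0 t)" if "0 \<le> t" for t using that by (rule l_adapted)
  fix \<omega> assume "\<omega> \<in> space M"
  then interpret P: control_path "\<lambda>t. l t \<omega>" unfolding l_def by (rule reflection.l_path[OF reflection_ly])
  show "0 \<le> l t \<omega>" if "0 \<le> t" for t using that by (rule P.f_nonneg)
  show "mono_on {0..} (\<lambda>t. l t \<omega>)" by (rule P.f_mono)
  show "cadlag (\<lambda>t. l t \<omega>)" by (rule P.f_cadlag)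
qed

lemma exp_ly_ge: "a \<le> exp y \<longleftrightarrow> ln a \<le> y" and exp_ly_gt: "a < exp y \<longleftrightarrow> ln a < y"
  using a by (metis exp_le_cancel_iff exp_ln, metis exp_less_cancel_iff exp_ln)

lemma l_reflects: "reflects_at M W0 r g \<sigma> \<rho> lam c1 c2 \<alpha> \<kappa> m a x l"
  unfolding reflects_at_def
proof
  show "l \<in> admissible_for M W0 r g \<sigma> \<rho> lam c1 c2 \<alpha> \<kappa> m no_intervention"
    by (rule reflected_admissible[OF l_control, of 0]) auto
  show "AE \<omega> in M. let X = (\<lambda>t. debt_ratio r g \<sigma> W0 (max x a) l no_intervention t \<omega>) in
        (\<forall>t>0. a \<le> X t) \<and>
        (\<forall>T>0. (\<integral>\<^sup>+t\<in>{0..T}. indicator {s. a < X s} t \<partial>control_measure (\<lambda>t. l t \<omega>)) = 0)"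
    using W0 AE_space
  proof eventually_elim
    case (elim \<omega>)
    interpret R: reflection "ln a" "\<lambda>s. ly s \<omega>" by (rule reflection_ly[OF elim(2)])
    interpret P: control_path "\<lambda>t. l t \<omega>" by (rule controls_path[OF l_control elim(2)])
    have X: "debt_ratio r g \<sigma> W0 (max x a) l no_intervention t \<omega> = exp (ly t \<omega> + l t \<omega>)" for t
      unfolding debt_ratio_eq[OF elim(2,1)] xh_max[symmetric] using xh_pos by simp
    let ?O = "{t \<in> {0..}. ln a < ly t \<omega> + l t \<omega>}"
    have "?O \<in> sets borel"
    proof -
      have "?O = {t. 0 \<le> t \<and> ln a < (if 0 \<le> t then ly t \<omega> else 0) + P.F t}" by (auto simp: P.F_def)
      also have "\<dots> \<in> sets borel" using R.y_measurable P.F_measurable by measurable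
      finally show ?thesis .
    qed
    moreover have "sets (control_measure (\<lambda>t. l t \<omega>)) = sets borel" by (simp add: P.control_measure_eq)
    moreover have "emeasure (control_measure (\<lambda>t. l t \<omega>)) ?O = 0" using R.l_support unfolding l_def .
    ultimately have "?O \<in> null_sets (control_measure (\<lambda>t. l t \<omega>))" by (simp only: null_sets_def mem_Collect_eq)
    then have "AE t in control_measure (\<lambda>t. l t \<omega>). t \<notin> ?O" by (rule AE_not_in)
    then have "(\<integral>\<^sup>+t\<in>{0..T}. indicator {s. a < exp (ly s \<omega> + l s \<omega>)} t \<partial>control_measure (\<lambda>t. l t \<omega>))
      = (\<integral>\<^sup>+t. 0 \<partial>control_measure (\<lambda>t. l t \<omega>))" for T
      by (intro nn_integral_cong_AE) (auto elim!: eventually_mono simp: exp_ly_gt indicator_def)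
    then show ?case unfolding Let_def X using reflected_above[OF _ elim(2)] by (simp add: exp_ly_ge)
  qed
qed

text \<open>Logarithms turn the reflection conditions into the Skorokhod problem, whose solution is
  unique path by path.\<close>

lemma reflects_unique:
  assumes refl: "reflects_at M W0 r g \<sigma> \<rho> lam c1 c2 \<alpha> \<kappa> m a x \<zeta>"
  shows "AE \<omega> in M. \<forall>t\<ge>0. \<zeta> t \<omega> = l t \<omega>"
proof -
  have \<zeta>: "\<zeta> \<in> controls M W0" using refl by (simp add: reflects_at_def admissible_for_def)
  have "AE \<omega> in M. let X = (\<lambda>t. debt_ratio r g \<sigma> W0 (max x a) \<zeta> no_intervention t \<omega>) in
        (\<forall>t>0. a \<le> X t) \<and>
        (\<forall>T>0. (\<integral>\<^sup>+t\<in>{0..T}. indicator {s. a < X s} t \<partial>control_measure (\<lambda>t. \<zeta> t \<omega>)) = 0)"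
    using refl by (simp add: reflects_at_def)
  then show ?thesis using W0 AE_space
  proof eventually_elim
    case (elim \<omega>)
    interpret R: reflection "ln a" "\<lambda>s. ly s \<omega>" by (rule reflection_ly[OF elim(3)])
    have X: "debt_ratio r g \<sigma> W0 (max x a) \<zeta> no_intervention t \<omega> = exp (ly t \<omega> + \<zeta> t \<omega>)" for t
      unfolding debt_ratio_eq[OF elim(3,2)] xh_max[symmetric] using xh_pos by simp
    have 1: "\<And>t. 0 < t \<Longrightarrow> ln a \<le> ly t \<omega> + \<zeta> t \<omega>"
      and 2: "\<And>T. 0 < T \<Longrightarrow> (\<integral>\<^sup>+t\<in>{0..T}. indicator {s. ln a < ly s \<omega> + \<zeta> s \<omega>} t \<partial>control_measure (\<lambda>t. \<zeta> t \<omega>)) = 0"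
      using elim(1) unfolding Let_def X exp_ly_ge exp_ly_gt by blast+
    show ?case unfolding l_def
      using R.skorokhod_unique[OF controls_path[OF \<zeta> elim(3)] 1 2] by blast
  qed
qed

lemma is_reflection_l: "is_reflection M W0 r g \<sigma> \<rho> lam c1 c2 \<alpha> \<kappa> m a x l"
  unfolding is_reflection_def using l_reflects reflects_unique by blast

lemma reflection_policy_optimal:
  assumes refl: "is_reflection M W0 r g \<sigma> \<rho> lam c1 c2 \<alpha> \<kappa> m a x \<zeta>"
  shows "reflection_policy a x \<zeta> \<in> admissible_for M W0 r g \<sigma> \<rho> lam c1 c2 \<alpha> \<kappa> m no_intervention"
    "objective1 M W0 r g \<sigma> \<rho> c2 x (reflection_policy a x \<zeta>) = val"
proof -
  have r: "reflects_at M W0 r g \<sigma> \<rho> lam c1 c2 \<alpha> \<kappa> m a x \<zeta>" using refl by (simp add: is_reflection_def)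
  then have \<zeta>: "\<zeta> \<in> controls M W0" by (simp add: reflects_at_def admissible_for_def)
  have k: "0 \<le> ln (xh / x)" using x xh_pos by simp
  \<comment> \<open>Below the barrier the policy jumps by \<open>ln (a / x)\<close>, otherwise not
    at all; both cases are \<open>ln (xh / x)\<close>.\<close>
  have kk: "max 0 (ln (a / x)) = ln (xh / x)"
    using x(1) a unfolding xh_max by (auto simp: max_def ln_div)
  have p: "reflection_policy a x \<zeta> = (\<lambda>t \<omega>. ln (xh / x) + \<zeta> t \<omega>)"
    by (simp add: reflection_policy_def kk fun_eq_iff)
  have c: "reflection_policy a x \<zeta> \<in> controls M W0" unfolding p by (rule controls_add_const[OF \<zeta> k])
  have eq: "AE \<omega> in M. \<forall>t\<ge>0. reflection_policy a x \<zeta> t \<omega> = ln (xh / x) + l t \<omega>"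
    using reflects_unique[OF r] by eventually_elim (simp add: p)
  show "reflection_policy a x \<zeta> \<in> admissible_for M W0 r g \<sigma> \<rho> lam c1 c2 \<alpha> \<kappa> m no_intervention"
    by (rule reflected_admissible[OF c eq k])
  show "objective1 M W0 r g \<sigma> \<rho> c2 x (reflection_policy a x \<zeta>) = val"
    by (rule reflected_objective[OF c eq])
qed

lemma value1_eq: "value1 M W0 r g \<sigma> \<rho> lam c1 c2 \<alpha> \<kappa> m x = ereal val"
proof (rule antisym)
  note o = reflection_policy_optimal[OF is_reflection_l]
  show "value1 M W0 r g \<sigma> \<rho> lam c1 c2 \<alpha> \<kappa> m x \<le> ereal val"
    unfolding value1_def o(2)[symmetric] by (rule INF_lower[OF o(1)])
  show "ereal val \<le> value1 M W0 r g \<sigma> \<rho> lam c1 c2 \<alpha> \<kappa> m x"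
    unfolding value1_def by (rule INF_greatest) (simp add: objective_lower)
qed

end

theorem theorem3p1:
  fixes M :: "'a measure" and W :: "'a process"
    and r g \<sigma> \<rho> lam c1 c2 \<alpha> \<kappa> m \<delta>2 a :: real
    and U :: "real \<Rightarrow> real"
  assumes "prob_space M" and "complete_measure M" and "brownian_motion M W"
    and "\<sigma> > 0" and "\<rho> > 0" and "lam > 0" and "c1 > 0" and "c2 > 0"
    and "\<alpha> > 0" and "\<kappa> > 0" and "m > 0"
    and "c1 > c2" and "\<rho> > max 0 (2 * (r - g) + \<sigma>\<^sup>2)" and "lam > r - g"
    and "\<delta>2 < 0" and "1 / 2 * \<sigma>\<^sup>2 * \<delta>2 * (\<delta>2 - 1) + (r - g) * \<delta>2 - \<rho> = 0"
  defines "a \<equiv> a_bar r g \<sigma> \<rho> c2 \<delta>2"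
    and "U \<equiv> (\<lambda>x. D1_bar r g \<sigma> \<rho> \<delta>2 a * x powr \<delta>2 + x\<^sup>2 / (2 * (\<rho> - 2 * (r - g) - \<sigma>\<^sup>2)))"
  shows "\<forall>x>0.
     value1 M W r g \<sigma> \<rho> lam c1 c2 \<alpha> \<kappa> m x =
       ereal (if x \<le> a then U a - c2 * (a - x) else U x) \<and>
     (\<exists>\<zeta>. is_reflection M W r g \<sigma> \<rho> lam c1 c2 \<alpha> \<kappa> m a x \<zeta>) \<and>
     (\<forall>\<zeta>. is_reflection M W r g \<sigma> \<rho> lam c1 c2 \<alpha> \<kappa> m a x \<zeta> \<longrightarrow>
        reflection_policy a x \<zeta> \<in> admissible_for M W r g \<sigma> \<rho> lam c1 c2 \<alpha> \<kappa> m no_intervention \<and>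
        ereal (objective1 M W r g \<sigma> \<rho> c2 x (reflection_policy a x \<zeta>)) =
          value1 M W r g \<sigma> \<rho> lam c1 c2 \<alpha> \<kappa> m x)"
proof (intro allI impI)
  fix x :: real assume x: "0 < x"
  interpret B: brownian M W using assms(1-3) by (simp add: brownian_def brownian_axioms_def)
  interpret EM: exp_martingale M "augmented_filtration M W" "regular_version W" by (rule B.exp_martingale_regular)
  define k where "k = \<rho> - 2 * (r - g) - \<sigma>\<^sup>2"
  have k: "0 < k" using assms(13) by (simp add: k_def)
  have a_eq: "a = (1 - \<delta>2) * c2 * k / (2 - \<delta>2)" by (simp add: a_def a_bar_def k_def)
  have a0: "0 < a" unfolding a_eq using \<open>\<delta>2 < 0\<close> \<open>c2 > 0\<close> k by (intro divide_pos_pos mult_pos_pos) auto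
  define xh where "xh = max x a"
  interpret D: debt_model M "augmented_filtration M W" "regular_version W" r g \<sigma> a xh
    by unfold_locales (use assms(4) a0 in \<open>auto simp: xh_def\<close>)
  have th: "D.\<theta> 2 = 2 * (r - g) + \<sigma>\<^sup>2" "D.\<theta> 1 = r - g" "D.\<theta> \<delta>2 = \<rho>"
    using assms(16) by (simp_all add: D.\<theta>_def)
  have kth: "\<rho> - D.\<theta> 2 = k" by (simp add: th k_def)
  \<comment> \<open>The explicit barrier is the equation between marginal value and price, solved
    for \<open>a\<close>.\<close>
  have c2: "c2 = a / k * (1 + 1 / (1 - \<delta>2))"
  proof -
    have "c2 = (1 - e) * c2 * k / (2 - e) / k * (1 + 1 / (1 - e))" if "e < 0" for e
    proof -
      have "1 + 1 / (1 - e) = (2 - e) / (1 - e)" using that by (simp add: field_simps)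
      then show ?thesis using that k by simp
    qed
    then show ?thesis unfolding a_eq using \<open>\<delta>2 < 0\<close> by blast
  qed
  interpret P: control_problem M W "regular_version W" r g \<sigma> a xh \<rho> \<delta>2 x c2 lam c1 \<alpha> \<kappa> m
  proof unfold_locales
    show "D.\<theta> 2 < \<rho>" "\<delta>2 < 0" "D.\<theta> \<delta>2 = \<rho>" "0 < x" "x \<le> xh"
      using th kth k \<open>\<delta>2 < 0\<close> x by (simp_all add: xh_def)
    show "c2 = a / (\<rho> - D.\<theta> 2) * (1 + 1 / (1 - \<delta>2))" unfolding kth by (rule c2)
    show "AE \<omega> in M. \<forall>t. regular_version W t \<omega> = W t \<omega>" by (rule B.AE_regular_version)
    show "0 < \<rho>" "0 < lam" "0 \<le> \<alpha>" "0 \<le> m" using assms(5,6,9,11) by simp_all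
    show "D.\<theta> 1 < lam" unfolding th by (rule assms(14))
    show "xh = max x a" by (rule xh_def)
  qed (use complete_measure.complete[OF assms(2)] in blast)
  have "P.val = U xh - c2 * (xh - x)"
  proof -
    \<comment> \<open>One factor \<open>a\<close> is split off so that the power term takes the
      shape it has in the first form of \<open>P.val\<close>.\<close>
    have e1: "xh powr \<delta>2 / a powr (\<delta>2 - 2) = a * exp (\<delta>2 * ln xh + (1 - \<delta>2) * ln a)"
    proof -
      have "a * exp (\<delta>2 * ln xh + (1 - \<delta>2) * ln a) = exp (ln a + (\<delta>2 * ln xh + (1 - \<delta>2) * ln a))"
        using a0 by (simp only: exp_add exp_ln)
      also have "\<dots> = exp (\<delta>2 * ln xh - (\<delta>2 - 2) * ln a)" by (simp add: algebra_simps)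
      finally show ?thesis using a0 D.xh_pos by (simp add: powr_def exp_diff)
    qed
    then have "D1_bar r g \<sigma> \<rho> \<delta>2 a * xh powr \<delta>2 = - (a * exp (\<delta>2 * ln xh + (1 - \<delta>2) * ln a) / (k * \<delta>2 * (\<delta>2 - 1)))"
    proof -
      have "- (1 / (n * A)) * B = - (B / A / n)" for n A B :: real by simp
      then show ?thesis using e1 unfolding D1_bar_def k_def[symmetric] by (simp only:)
    qed
    then show ?thesis unfolding P.value_forms(1) U_def kth by (simp add: k_def)
  qed
  \<comment> \<open>Both branches are one expression in \<open>xh\<close>: below the barrier
    \<open>xh\<close> is \<open>a\<close>, and above it the linear term vanishes.\<close>
  also have "\<dots> = (if x \<le> a then U a - c2 * (a - x) else U x)" by (auto simp: xh_def max_def)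
  finally have val: "P.val = (if x \<le> a then U a - c2 * (a - x) else U x)" .
  show "value1 M W r g \<sigma> \<rho> lam c1 c2 \<alpha> \<kappa> m x =
       ereal (if x \<le> a then U a - c2 * (a - x) else U x) \<and>
     (\<exists>\<zeta>. is_reflection M W r g \<sigma> \<rho> lam c1 c2 \<alpha> \<kappa> m a x \<zeta>) \<and>
     (\<forall>\<zeta>. is_reflection M W r g \<sigma> \<rho> lam c1 c2 \<alpha> \<kappa> m a x \<zeta> \<longrightarrow>
        reflection_policy a x \<zeta> \<in> admissible_for M W r g \<sigma> \<rho> lam c1 c2 \<alpha> \<kappa> m no_intervention \<and>
        ereal (objective1 M W r g \<sigma> \<rho> c2 x (reflection_policy a x \<zeta>)) =
          value1 M W r g \<sigma> \<rho> lam c1 c2 \<alpha> \<kappa> m x)"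
    unfolding val[symmetric] P.value1_eq
    using P.is_reflection_l P.reflection_policy_optimal by blast
qed

end
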